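(* Let $\alpha\in[0,1)$ and $r_0\le 1$ be fixed. For $\varepsilon>0$ let $S=S^\varepsilon$ be an axisymmetric solid whose surface near its lower tip is $z=\gamma_S(r)$, $r\le r_0$, with $$\gamma_S(r)=1-\sqrt{1-r^2}+\varepsilon r^{1+\alpha},$$ as described in the context, and let $\mathcal F_h$ be the normalized drag at distance $h>0$ from the flat wall $\{z=0\}$, with no-slip conditions on both surfaces. Set $$\tilde{\mathcal F}_h:=6\pi\int_0^{r_0}\frac{r^3\,dr}{(h+\gamma_S(r))^3},\qquad \beta:=\varepsilon h^{\frac{\alpha-1}{2}}.$$ Then, in the limit of small $h$, the following hold. (a) $\tilde{\mathcal F}_h\le\mathcal F_h$, and $$\mathcal F_h=\tilde{\mathcal F}_h+O\big(\min(|\ln\varepsilon|,|\ln h|)\big).$$ (b) For $\beta\ll1$, $$\tilde{\mathcal F}_h=\frac{6\pi}{h+\lambda_\alpha\varepsilon h^{\frac{\alpha+1}{2}}}\,(1+O(\beta))+O(|\ln h|),\qquad \lambda_\alpha:=\frac{2^{\frac{\alpha+1}{2}}\pi(3+\alpha)(1-\alpha^2)}{8\cos(\pi\alpha/2)}.$$ (c) For $\beta\gg1$: - if $\alpha>1/3$, $$\tilde{\mathcal F}_h=\frac{6\pi\mu_\alpha}{\varepsilon^{\frac{4}{1+\alpha}}h^{\frac{3\alpha-1}{\alpha+1}}}\Big(1+O\big(\beta^{\frac{1-3\alpha}{1+\alpha}}\big)\Big)+O(|\ln h|),\qquad \mu_\alpha:=\frac1{1+\alpha}\int_0^\infty\frac{u^{\frac{3-\alpha}{1+\alpha}}\,du}{(1+u)^3};$$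 - if $\alpha=1/3$, $$\tilde{\mathcal F}_h=\frac{9\pi|\ln h|}{2\varepsilon^3}+O\Big(\frac{|\ln\varepsilon|}{\varepsilon^3}\Big);$$ - if $\alpha<1/3$, $$\tilde{\mathcal F}_h=\frac{6\pi\mu_\alpha}{\varepsilon^{\frac{2}{1-\alpha}}}\Big(1+O\big(\beta^{\frac{3\alpha-1}{1+\alpha}}\big)\Big)+O(|\ln\varepsilon|),\qquad \mu_\alpha:=\int_0^\infty\frac{s^3\,ds}{\big(\frac{s^2}{2}+s^{1+\alpha}\big)^3}.$$ (The last expression, for $\alpha<1/3$, only matters when $\varepsilon\ll1$; otherwise one can just retain that $\tilde{\mathcal F}_h=O(1)$.)
   Context: Cylindrical coordinates $(r,\theta,z)$ are used in $\mathbb R^3$, with vertical unit vector $e_z$. The solid $S=S^\varepsilon$ is axisymmetric around the axis $\{r=0\}$, with lower tip at the origin. In the vicinity of its lower tip its surface is $\{z=\gamma_S(r),\ r\le r_0\}$, where $\gamma_S$ is Lipschitz on $[0,r_0]$. Away from a vicinity of $r=0$ the boundary of the solid stays away from the plane $\{z=0\}$, uniformly in $\varepsilon$, so that no singularity is created there as $h\to0$. For $h>0$ put $S_h=S+h e_z$. The wall is $P=\{z=0\}$ and the fluid domain is $F_h=\{z>0\}\setminus\overline{S_h}$. Let $(u_h,p_h)$ be the (finite energy) solution of the Stokes problem $$-\Delta u_h+\nabla p_h=0,\quad \nabla\cdot u_h=0\ \text{ in }F_h,\qquad u_h=e_z\ \text{ on }\partial S_h,\quad u_h=0\ \text{ on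 }P.$$ The normalized drag is $$\mathcal F_h=e_z\cdot\int_{\partial S_h}\big(2D(u_h)n-p_hn\big)\,d\sigma,$$ where $n$ is the unit normal pointing outside the fluid domain and $D(u)$ is the symmetric part of $\nabla u$. Equivalently, $\mathcal F_h=\int_{F_h}|\nabla u_h|^2$ is the minimum of $\int_{F_h}|\nabla u|^2$ over divergence-free $u\in H^1_{loc}(F_h)$ with $u=0$ on $P$ and $u=e_z$ on $\partial S_h$.
   Formalization: Where |ln ε| is an error bound, constants are uniform only for |ln ε| ≥ δ, any δ > 0 (ε = 1 excluded, where the claim fails). In (a), ε ranges up to an arbitrary fixed bound and the solids are uniformly bounded, filling a layer above the graph for r ≤ r_0. *)

theory Defs
  imports "HOL-Analysis.Analysis"
begin

section \<open>Geometry\<close>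

definition e_z :: "real^3" where
  "e_z = axis 3 1"

definition radius :: "real^3 \<Rightarrow> real" where
  "radius x = sqrt ((x$1)\<^sup>2 + (x$2)\<^sup>2)"

definition gamma_S :: "real \<Rightarrow> real \<Rightarrow> real \<Rightarrow> real" where
  "gamma_S \<alpha> \<epsilon> r = 1 - sqrt (1 - r\<^sup>2) + \<epsilon> * r powr (1 + \<alpha>)"

definition axisymmetric :: "(real^3) set \<Rightarrow> bool" where
  "axisymmetric S \<longleftrightarrow> (\<forall>x y. radius x = radius y \<and> x$3 = y$3 \<longrightarrow> (x \<in> S \<longleftrightarrow> y \<in> S))"

text \<open>In a layer of positive thickness around the graph of the profile, over the disc of
  radius \<open>r\<^sub>0\<close>, the solid is exactly the part lying above the graph; everything below the
  graph is outside the solid.\<close>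

definition has_tip :: "real \<Rightarrow> (real \<Rightarrow> real) \<Rightarrow> (real^3) set \<Rightarrow> bool" where
  "has_tip r\<^sub>0 \<gamma> S \<longleftrightarrow>
     (\<exists>d>0. \<forall>x. radius x \<le> r\<^sub>0 \<and> x$3 < \<gamma> (radius x) + d \<longrightarrow>
        (x \<in> S \<longleftrightarrow> \<gamma> (radius x) < x$3))"

text \<open>The solids \<open>S \<epsilon>\<close>, \<open>0 < \<epsilon> \<le> \<epsilon>\<^sub>m\<close>, are open sets.  The size \<open>R\<close> and the distance \<open>c\<close> from the
  wall away from the tip do not depend on \<open>\<epsilon>\<close>.\<close>

definition solid_family ::
    "real \<Rightarrow> real \<Rightarrow> real \<Rightarrow> (real \<Rightarrow> (real^3) set) \<Rightarrow> bool" where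
  "solid_family \<alpha> r\<^sub>0 \<epsilon>\<^sub>m S \<longleftrightarrow>
     (\<forall>\<epsilon>\<in>{0<..\<epsilon>\<^sub>m}. open (S \<epsilon>) \<and> axisymmetric (S \<epsilon>) \<and> has_tip r\<^sub>0 (gamma_S \<alpha> \<epsilon>) (S \<epsilon>)) \<and>
     (\<exists>R. \<forall>\<epsilon>\<in>{0<..\<epsilon>\<^sub>m}. S \<epsilon> \<subseteq> cball 0 R) \<and>
     (\<exists>c>0. \<forall>\<epsilon>\<in>{0<..\<epsilon>\<^sub>m}. \<forall>x\<in>frontier (S \<epsilon>). r\<^sub>0 \<le> radius x \<longrightarrow> c \<le> x$3)"

definition shifted :: "(real^3) set \<Rightarrow> real \<Rightarrow> (real^3) set" where
  "shifted S h = (\<lambda>x. x + h *\<^sub>R e_z) ` S"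

definition fluid_domain :: "(real^3) set \<Rightarrow> real \<Rightarrow> (real^3) set" where
  "fluid_domain S h = {x. 0 < x$3} - closure (shifted S h)"


section \<open>Fields of finite energy\<close>

definition partial_deriv :: "3 \<Rightarrow> (real^3 \<Rightarrow> real) \<Rightarrow> real^3 \<Rightarrow> real" where
  "partial_deriv j \<phi> x = frechet_derivative \<phi> (at x) (axis j 1)"

definition test_function :: "(real^3 \<Rightarrow> real) \<Rightarrow> bool" where
  "test_function \<phi> \<longleftrightarrow>
     (\<forall>x. \<phi> differentiable (at x)) \<and>
     (\<forall>j. continuous_on UNIV (partial_deriv j \<phi>)) \<and>
     bounded {x. \<phi> x \<noteq> 0}"

text \<open>\<open>G\<close> is the weak gradient of \<open>u\<close>, with \<open>G x $ i $ j\<close> the derivative of \<open>u\<^sub>i\<close> in direction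
  \<open>j\<close>; \<open>norm\<close> and \<open>\<bullet>\<close> on \<open>real^3^3\<close> are the Frobenius norm and inner product.  All fields live on
  the whole space: a field on the fluid domain with constant boundary value \<open>a\<close> on the solid and
  \<open>0\<close> on the wall is represented by its extension by these constants (see \<open>boundary_values\<close>).\<close>

definition energy_field :: "(real^3 \<Rightarrow> real^3) \<Rightarrow> (real^3 \<Rightarrow> real^3^3) \<Rightarrow> bool" where
  "energy_field u G \<longleftrightarrow>
     u \<in> borel_measurable lborel \<and> G \<in> borel_measurable lborel \<and>
     (\<forall>K. compact K \<longrightarrow> set_integrable lborel K (\<lambda>x. (norm (u x))\<^sup>2)) \<and>
     integrable lborel (\<lambda>x. (norm (G x))\<^sup>2) \<and>
     (\<forall>\<phi> i j. test_function \<phi> \<longrightarrow>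
        (LINT x|lborel. u x $ i * partial_deriv j \<phi> x) = - (LINT x|lborel. G x $ i $ j * \<phi> x))"

text \<open>\<open>v = a\<close> on the boundary of the shifted solid and \<open>v = 0\<close> on the wall.  A field on the fluid
  domain has these traces iff its extension by \<open>a\<close> to the solid and by \<open>0\<close> below the wall is
  weakly differentiable across the boundary, as \<open>energy_field\<close> demands.\<close>

definition boundary_values ::
    "(real^3) set \<Rightarrow> real \<Rightarrow> real^3 \<Rightarrow> (real^3 \<Rightarrow> real^3) \<Rightarrow> bool" where
  "boundary_values S h a v \<longleftrightarrow>
     (AE x in lborel. x \<in> closure (shifted S h) \<longrightarrow> v x = a) \<and>
     (AE x in lborel. x$3 \<le> 0 \<longrightarrow> v x = 0)"


section \<open>The Stokes problem and the drag\<close>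

text \<open>Finite energy solutions: \<open>- \<Delta> u + \<nabla> p = 0\<close> is tested against all fields of finite energy that
  vanish on both boundaries; square integrability of \<open>p\<close> fixes its additive constant.\<close>

definition stokes_solution ::
    "(real^3) set \<Rightarrow> real \<Rightarrow> (real^3 \<Rightarrow> real^3) \<Rightarrow> (real^3 \<Rightarrow> real^3^3) \<Rightarrow> (real^3 \<Rightarrow> real) \<Rightarrow> bool" where
  "stokes_solution S h u G p \<longleftrightarrow>
     energy_field u G \<and> boundary_values S h e_z u \<and>
     (AE x in lborel. x \<in> fluid_domain S h \<longrightarrow> trace (G x) = 0) \<and>
     p \<in> borel_measurable lborel \<and>
     set_integrable lborel (fluid_domain S h) (\<lambda>x. (p x)\<^sup>2) \<and>
     (\<forall>w W. energy_field w W \<and> boundary_values S h 0 w \<longrightarrow>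
        (LINT x:fluid_domain S h|lborel. G x \<bullet> W x - p x * trace (W x)) = 0)"

definition sym_part :: "real^3^3 \<Rightarrow> real^3^3" where
  "sym_part A = (1/2) *\<^sub>R (A + transpose A)"

definition stress :: "real^3^3 \<Rightarrow> real \<Rightarrow> real^3^3" where
  "stress A q = 2 *\<^sub>R sym_part A - q *\<^sub>R mat 1"

text \<open>The force \<open>e\<^sub>z \<cdot> \<integral> (2 D(u) n - p n) d\<sigma>\<close> over the boundary of the solid, \<open>n\<close> pointing out of
  the fluid.  For solutions of finite energy the normal stress is defined by Green's formula: as
  the stress is divergence free, for any field \<open>\<Phi>\<close> with \<open>\<Phi> = e\<^sub>z\<close> on the solid and \<open>\<Phi> = 0\<close> on
  the wall the force is the integral of \<open>(2 D(u) - p I) : \<nabla>\<Phi>\<close> over the fluid domain.  The value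
  does not depend on the choice of \<open>\<Phi>\<close>.\<close>

definition is_normalized_drag :: "(real^3) set \<Rightarrow> real \<Rightarrow> real \<Rightarrow> bool" where
  "is_normalized_drag S h F \<longleftrightarrow>
     (\<exists>u G p \<Phi> D\<Phi>. stokes_solution S h u G p \<and>
        energy_field \<Phi> D\<Phi> \<and> boundary_values S h e_z \<Phi> \<and>
        F = (LINT x:fluid_domain S h|lborel. stress (G x) (p x) \<bullet> D\<Phi> x))"


section \<open>The lubrication approximation and the constants\<close>

definition approx_drag :: "real \<Rightarrow> real \<Rightarrow> real \<Rightarrow> real \<Rightarrow> real" where
  "approx_drag \<alpha> r\<^sub>0 \<epsilon> h =
     6 * pi * integral {0..r\<^sub>0} (\<lambda>r. r ^ 3 / (h + gamma_S \<alpha> \<epsilon> r) ^ 3)"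

definition beta :: "real \<Rightarrow> real \<Rightarrow> real \<Rightarrow> real" where
  "beta \<alpha> \<epsilon> h = \<epsilon> * h powr ((\<alpha> - 1) / 2)"

definition lambda_coeff :: "real \<Rightarrow> real" where
  "lambda_coeff \<alpha> =
     2 powr ((\<alpha> + 1) / 2) * pi * (3 + \<alpha>) * (1 - \<alpha>\<^sup>2) / (8 * cos (pi * \<alpha> / 2))"

definition mu_above :: "real \<Rightarrow> real" where
  "mu_above \<alpha> =
     1 / (1 + \<alpha>) * integral {0..} (\<lambda>u. u powr ((3 - \<alpha>) / (1 + \<alpha>)) / (1 + u) ^ 3)"

definition mu_below :: "real \<Rightarrow> real" where
  "mu_below \<alpha> = integral {0..} (\<lambda>s. s ^ 3 / (s\<^sup>2 / 2 + s powr (1 + \<alpha>)) ^ 3)"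

text \<open>\<open>F = X (1 + O(e)) + O(l)\<close> with implied constant \<open>C\<close>.\<close>

definition expansion :: "real \<Rightarrow> real \<Rightarrow> real \<Rightarrow> real \<Rightarrow> real \<Rightarrow> bool" where
  "expansion C F X e l \<longleftrightarrow>
     (\<exists>a b. F = X * (1 + a) + b \<and> \<bar>a\<bar> \<le> C * e \<and> \<bar>b\<bar> \<le> C * l)"

end

theory Submission
  imports Defs
begin

text \<open>For fields on the whole space \<open>\<integral> \<partial>\<^sub>ju\<^sub>i \<partial>\<^sub>i\<Phi>\<^sub>j = \<integral> div u div \<Phi>\<close>, and the extended fields have almost
  everywhere zero gradient on the solid and below the wall.  Hence the drag is the Dirichlet energy of
  the velocity, and by the Stokes equations this is the minimum of the energy over all divergence free
  fields with the same boundary values.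

  For the lower bound in (a), the energy is at least \<open>2 \<integral> \<nabla>u : T - \<integral> |T|\<^sup>2\<close> for every matrix field \<open>T\<close>.
  On the gap of height \<open>H = h + \<gamma>\<^sub>S\<close> one takes for \<open>T\<close> the vertical shear
  \<open>6 x\<^sub>i (z - H/2) / H\<^sup>3\<close> of the lubrication flow; the pairing with \<open>\<nabla>u\<close> is then a flux, which the
  boundary values and incompressibility determine.  For the upper bound, the lubrication flow is continued
  to an explicit axisymmetric divergence free field, built from a stream function, whose energy exceeds
  the lubrication integral by a multiple of \<open>1 + \<integral> r / (h + \<gamma>\<^sub>S) dr\<close>, and this integral is at most
  logarithmic in \<open>\<epsilon>\<close> as well as in \<open>h\<close>.

  In (b) and (c), \<open>\<gamma>\<^sub>S\<close> is compared with \<open>r\<^sup>2/2\<close>, with \<open>\<epsilon> r\<^bsup>1+\<alpha>\<^esup>\<close> or with their sum.  The term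
  \<open>\<lambda>\<^sub>\<alpha> \<epsilon> h\<^bsup>(\<alpha>+1)/2\<^esup> = \<lambda>\<^sub>\<alpha> \<beta> h\<close> in (b) is itself of the size of the error, so that only
  \<open>\<lambda>\<^sub>\<alpha> \<ge> 0\<close> matters.\<close>

text \<open>The velocity is known only through an \<open>L^2\<close> weak gradient on the whole
  space, tested against C^1 functions; traces and Green's formula on the fluid domain are not at
  hand. Difference quotients replace them: translations are continuous in \<open>L^1\<close>, so the
  quotients of a field converge to its weak derivative, and a shift of the integration variable
  moves them to the other factor. This yields Lipschitz test functions, vanishing gradients on level
  sets and the symmetry of mixed derivatives. Lipschitz regularity is what the tip permits: its
  second derivative is unbounded at the axis for \<open>0 < \<alpha> < 1\<close>, and for
  \<open>\<alpha> = 0\<close> the tip has a corner. Uniformity in \<epsilon> rests on the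
  homogeneous bounds \<open>r * gamma1 <= 3 * gamma_S\<close> and
  \<open>|r * gamma2| <= 2 * gamma1\<close>, whose constants are free of \<epsilon>. They reduce all
  of the energy density near the tip, except the vertical shear, to multiples of
  \<open>1 / K^2\<close> and \<open>1 / (r * K)\<close>; integrated over a gap of height
  \<open>K\<close>, these leave \<open>r / K\<close> and a constant. The minimum of two logarithms
  in (a) reflects two lower bounds for the height: \<open>h + r^2 / 2\<close> and
  \<open>r^2 / 2\<close> plus the power term.\<close>

abbreviation lint :: "('a::euclidean_space => real) => real" (binder "LI " 10) where
 "lint == integral\<^sup>L lborel"

abbreviation bm :: "('a::topological_space => 'b::topological_space) set" where
 "bm == borel_measurable borel"

section \<open>Test functions\<close>

text \<open>Kept apart from the support condition, so that polynomials and compositions can be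
  treated first and multiplied by a cutoff afterwards.\<close>

definition continuously_diff :: "(real^3 => real) => bool" where
 "continuously_diff pf \<longleftrightarrow>
   (\<forall>x. pf differentiable (at x)) \<and> (\<forall>j. continuous_on UNIV (partial_deriv j pf))"

lemma test_function_iff: "test_function pf \<longleftrightarrow> continuously_diff pf \<and> bounded {x. pf x ~= 0}"
 by (auto simp: test_function_def continuously_diff_def)

lemma partial_deriv_eqI: "(pf has_derivative D) (at x) ==> partial_deriv j pf x = D (axis j 1)"
 unfolding partial_deriv_def using frechet_derivative_at by metis

lemma continuously_diffI:
 assumes "!!x. (pf has_derivative D x) (at x)" "!!j. continuous_on UNIV (%x. D x (axis j 1))"
 shows "continuously_diff pf"
proof -
 have "partial_deriv j pf = (%x. D x (axis j 1))" for j
  using assms(1) partial_deriv_eqI by blast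
 then show ?thesis
  using assms unfolding continuously_diff_def differentiable_def by auto
qed

lemma continuously_diff_has_derivative:
 "continuously_diff pf ==> (pf has_derivative frechet_derivative pf (at x)) (at x)"
 by (simp add: continuously_diff_def frechet_derivative_works)

lemma continuously_diff_continuous: "continuously_diff pf ==> continuous_on S pf"
 unfolding continuously_diff_def
 by (meson continuous_at_imp_continuous_on differentiable_imp_continuous_within)

lemma continuously_diff_mult:
 assumes "continuously_diff f" "continuously_diff g"
 shows "continuously_diff (%x. f x * g x)"
proof (rule continuously_diffI)
 show "((%x. f x * g x) has_derivative
   (%v. f x * frechet_derivative g (at x) v + frechet_derivative f (at x) v * g x)) (at x)" for x
  using assms by (intro has_derivative_mult continuously_diff_has_derivative)
 show "continuous_on UNIV (%x. f x * frechet_derivative g (at x) (axis j 1)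
   + frechet_derivative f (at x) (axis j 1) * g x)" for j
  using assms continuously_diff_continuous[of f] continuously_diff_continuous[of g]
  unfolding continuously_diff_def partial_deriv_def by (intro continuous_intros) auto
qed

lemma continuously_diff_add:
 assumes "continuously_diff f" "continuously_diff g"
 shows "continuously_diff (%x. f x + g x)"
proof (rule continuously_diffI)
 show "((%x. f x + g x) has_derivative
   (%v. frechet_derivative f (at x) v + frechet_derivative g (at x) v)) (at x)" for x
  using assms by (intro has_derivative_add continuously_diff_has_derivative)
 show "continuous_on UNIV (%x. frechet_derivative f (at x) (axis j 1)
   + frechet_derivative g (at x) (axis j 1))" for j
  using assms unfolding continuously_diff_def partial_deriv_def by (intro continuous_intros) auto
qed

lemma continuously_diff_compose_real:
 assumes "continuously_diff f" "!!y. (k has_real_derivative k' y) (at y)" "continuous_on UNIV k'"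
 shows "continuously_diff (%x. k (f x))"
proof (rule continuously_diffI)
 show "((%x. k (f x)) has_derivative (%v. k' (f x) * frechet_derivative f (at x) v)) (at x)" for x
  using has_derivative_compose[OF continuously_diff_has_derivative[OF assms(1)],
    of k "%v. k' (f x) * v"] assms(2) by (simp add: has_field_derivative_def)
 show "continuous_on UNIV (%x. k' (f x) * frechet_derivative f (at x) (axis j 1))" for j
  using assms(1) continuous_on_compose2[OF assms(3) continuously_diff_continuous[OF assms(1)]]
  unfolding continuously_diff_def partial_deriv_def by (intro continuous_intros) auto
qed

lemma continuously_diff_polynomial: "real_polynomial_function p ==> continuously_diff p"
proof (induction rule: real_polynomial_function.induct)
 case (linear f)
 then show ?case
  by (intro continuously_diffI[where D="%_. f"]) (auto intro: bounded_linear_imp_has_derivative)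
next
 case (const c)
 then show ?case by (intro continuously_diffI[where D="%_ _. 0"]) auto
qed (auto intro: continuously_diff_add continuously_diff_mult)

lemma continuously_diff_inner_self: "continuously_diff (%x. x \<bullet> x)"
proof (rule continuously_diffI)
 show "((%x::real^3. x \<bullet> x) has_derivative (%v. x \<bullet> v + v \<bullet> x)) (at x)" for x
  by (auto intro!: derivative_eq_intros)
qed (auto intro!: continuous_intros)

lemma test_function_bounds:
 assumes "test_function pf"
 obtains L where "0 <= L" "!!x. \<bar>pf x\<bar> <= L" "!!x j. \<bar>partial_deriv j pf x\<bar> <= L"
  "!!x y. \<bar>pf x - pf y\<bar> <= L * norm (x - y)"
  "!!x. pf x ~= 0 ==> norm x <= L" "!!x j. partial_deriv j pf x ~= 0 ==> norm x <= L"
proof -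
 obtain b where b: "!!x. pf x ~= 0 ==> norm x <= b"
  using assms unfolding test_function_def bounded_iff by auto
 define B where "B = max b 0"
 have B: "!!x. pf x ~= 0 ==> norm x <= B" "0 <= B" using b by (force simp: B_def)+
 have pd0: "partial_deriv j pf x = 0" if "norm x > B" for x j
 proof -
  have "open {x::real^3. norm x > B}" by (intro open_Collect_less continuous_intros)
  then have "(pf has_derivative (%_. 0)) (at x)"
   by (rule has_derivative_transform_within_open[where f="%_. 0", rotated])
    (use that B(1) in \<open>fastforce+\<close>)
  then show ?thesis by (simp add: partial_deriv_eqI)
 qed
 have c: "continuously_diff pf" using assms by (simp add: test_function_iff)
 have "\<exists>M. \<forall>x\<in>cball 0 B. \<bar>f x\<bar> <= M" if "continuous_on UNIV f" for f :: "real^3 => real"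
 proof -
  have "compact (f ` cball 0 B)"
   by (rule compact_continuous_image[OF continuous_on_subset[OF that subset_UNIV] compact_cball])
  from compact_imp_bounded[OF this] show ?thesis unfolding bounded_iff by auto
 qed
 note ex = this
 obtain M where M: "!!x. x\<in>cball 0 B ==> \<bar>pf x\<bar> <= M"
  using ex[OF continuously_diff_continuous[OF c]] by blast
 have "\<forall>j. \<exists>P. \<forall>x\<in>cball 0 B. \<bar>partial_deriv j pf x\<bar> <= P"
  using c ex unfolding continuously_diff_def by blast
 then obtain P where P: "!!j x. x\<in>cball 0 B ==> \<bar>partial_deriv j pf x\<bar> <= P j" by metis
 define Q where "Q = (\<Sum>j\<in>UNIV. \<bar>P j\<bar>)"
 \<comment> \<open>\<open>M\<close> bounds the values, \<open>Q\<close> the gradient and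
   \<open>B\<close> the radius of the support; their sum serves all purposes, so that later
   majorants need one constant and one ball.\<close>
 define L where "L = \<bar>M\<bar> + Q + B"
 have Q0: "0 <= Q" "\<bar>P j\<bar> <= Q" for j
  by (auto simp: Q_def sum_nonneg intro: member_le_sum[of j UNIV "%j. \<bar>P j\<bar>", simplified])
 have pd: "\<bar>partial_deriv j pf x\<bar> <= \<bar>P j\<bar>" for j x
  using P[of x j] pd0[of x j] by (cases "norm x <= B") (auto)
 have fr: "frechet_derivative pf (at x) v = (\<Sum>j\<in>UNIV. v $ j * partial_deriv j pf x)" for x v
 proof -
  have l: "linear (frechet_derivative pf (at x))"
   using c by (simp add: continuously_diff_def linear_frechet_derivative)
  have "v = (\<Sum>j\<in>UNIV. v $ j *\<^sub>R axis j 1)"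
   using basis_expansion[of v] by (simp add: scalar_mult_eq_scaleR)
  then have "frechet_derivative pf (at x) v = frechet_derivative pf (at x) (\<Sum>j\<in>UNIV. v $ j *\<^sub>R axis j 1)"
   by (rule arg_cong)
  also have "... = (\<Sum>j\<in>UNIV. v $ j * partial_deriv j pf x)"
   unfolding partial_deriv_def using l by (simp add: linear_sum linear_scale)
  finally show ?thesis .
 qed
 have on: "onorm (frechet_derivative pf (at x)) <= Q" for x
 proof (rule onorm_le)
  fix v
  have "\<bar>\<Sum>j\<in>UNIV. v $ j * partial_deriv j pf x\<bar> <= (\<Sum>j\<in>UNIV. norm v * \<bar>P j\<bar>)"
   by (rule order_trans[OF sum_abs sum_mono])
    (auto simp: abs_mult intro!: mult_mono pd component_le_norm_cart)
  then show "norm (frechet_derivative pf (at x) v) <= Q * norm v"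
   by (simp add: fr Q_def sum_distrib_left mult.commute)
 qed
 have lip: "\<bar>pf x - pf y\<bar> <= Q * norm (x - y)" for x y
  using differentiable_bound[of UNIV pf "%x. frechet_derivative pf (at x)" Q x y]
   continuously_diff_has_derivative[OF c] on by simp
 show ?thesis
 proof (rule that[of L])
  show "\<bar>pf x\<bar> <= L" for x
  proof (cases "pf x = 0")
   case False
   then have "\<bar>pf x\<bar> <= M" using M[of x] B by simp
   then show ?thesis using Q0(1) B by (simp add: L_def)
  qed (use Q0 B in \<open>simp add: L_def\<close>)
  show "0 <= L" using Q0 B by (simp add: L_def)
  show "\<bar>partial_deriv j pf x\<bar> <= L" for x j
   using pd[of j x] Q0(2)[of j] B by (simp add: L_def)
  show "\<bar>pf x - pf y\<bar> <= L * norm (x - y)" for x y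
   by (rule order_trans[OF lip mult_right_mono]) (use B in \<open>auto simp: L_def\<close>)
  show "norm x <= L" if "pf x ~= 0" for x using B(1)[OF that] Q0 by (simp add: L_def)
  show "norm x <= L" if "partial_deriv j pf x ~= 0" for x j
   using pd0[of x j] that Q0 by (force simp: L_def)
 qed
qed

section \<open>Smooth cutoffs\<close>

text \<open>The cubic is flat at both ends, so the step is C^1, which is exactly what
  \<open>test_function\<close> asks for. It is piecewise polynomial, hence its first two derivatives
  are explicit and bounded by absolute constants.\<close>

definition smoothstep :: "real => real" where
 "smoothstep s = (let t = max 0 (min 1 s) in t^2 * (3 - 2 * t))"

definition smoothstep' :: "real => real" where
 "smoothstep' s = (let t = max 0 (min 1 s) in 6 * t * (1 - t))"

lemma smoothstep_le_0 [simp]: "s <= 0 ==> smoothstep s = 0" "s <= 0 ==> smoothstep' s = 0"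
 by (auto simp: smoothstep_def smoothstep'_def)

lemma smoothstep_ge_1 [simp]: "1 <= s ==> smoothstep s = 1" "1 <= s ==> smoothstep' s = 0"
 by (auto simp: smoothstep_def smoothstep'_def)

lemma smoothstep_between:
 "0 <= s ==> s <= 1 ==> smoothstep s = s^2 * (3 - 2 * s)"
 "0 <= s ==> s <= 1 ==> smoothstep' s = 6 * s * (1 - s)"
 by (auto simp: smoothstep_def smoothstep'_def)

lemma smoothstep_range: "0 <= smoothstep s" "smoothstep s <= 1"
proof -
 define t where "t = max 0 (min 1 s)"
 have t: "0 <= t" "t <= 1" by (auto simp: t_def)
 have "1 - t^2 * (3 - 2 * t) = (1 - t)^2 * (1 + 2 * t)"
  by (simp add: power2_eq_square algebra_simps)
 moreover have "0 <= (1 - t)^2 * (1 + 2 * t)" "0 <= t^2 * (3 - 2 * t)" using t by auto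
 ultimately show "0 <= smoothstep s" "smoothstep s <= 1"
  unfolding smoothstep_def Let_def t_def[symmetric] by linarith+
qed

lemma continuous_on_smoothstep' [continuous_intros]:
 "continuous_on S f ==> continuous_on S (%x. smoothstep' (f x))"
 unfolding smoothstep'_def Let_def by (intro continuous_intros)

text \<open>Quadratic contact at the junctions \<open>0\<close> and \<open>1\<close> forces a zero
  derivative there, although the formula differs on the two sides.\<close>

lemma smoothstep_quadratic: "\<bar>smoothstep s\<bar> <= 3 * s^2" "\<bar>smoothstep s - 1\<bar> <= 3 * (s - 1)^2"
proof -
 define t where "t = max 0 (min 1 s)"
 have t: "0 <= t" "t <= 1" "\<bar>t\<bar> <= \<bar>s\<bar>" "\<bar>t - 1\<bar> <= \<bar>s - 1\<bar>" by (auto simp: t_def)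
 have q: "t^2 <= s^2" "(t - 1)^2 <= (s - 1)^2" using t abs_le_square_iff by blast+
 have "t^2 * (3 - 2 * t) <= t^2 * 3" using t by (intro mult_left_mono) auto
 then show "\<bar>smoothstep s\<bar> <= 3 * s^2"
  using smoothstep_range(1)[of s] q unfolding smoothstep_def Let_def t_def[symmetric] by linarith
 have "1 - t^2 * (3 - 2 * t) = (t - 1)^2 * (1 + 2 * t)"
  by (simp add: power2_eq_square algebra_simps)
 moreover have "(t - 1)^2 * (1 + 2 * t) <= (t - 1)^2 * 3" using t by (intro mult_left_mono) auto
 ultimately show "\<bar>smoothstep s - 1\<bar> <= 3 * (s - 1)^2"
  using smoothstep_range(2)[of s] q unfolding smoothstep_def Let_def t_def[symmetric] by linarith
qed

lemma has_real_derivative_0_quadratic: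
 assumes "!!y. \<bar>f y - f x\<bar> <= C * (y - x)^2"
 shows "(f has_real_derivative 0) (at x)"
proof -
 have "((%y. C * \<bar>y - x\<bar>) \<longlongrightarrow> C * \<bar>x - x\<bar>) (at x)" by (intro tendsto_intros)
 then have l: "((%y. C * \<bar>y - x\<bar>) \<longlongrightarrow> 0) (at x)" by simp
 have "((%y. (f y - f x) / (y - x)) \<longlongrightarrow> 0) (at x)"
 proof (rule Lim_null_comparison[OF _ l])
  have "norm ((f y - f x) / (y - x)) <= C * \<bar>y - x\<bar>" if "y ~= x" for y
  proof -
   have "\<bar>f y - f x\<bar> <= C * \<bar>y - x\<bar> * \<bar>y - x\<bar>"
    using assms[of y] by (simp add: power2_eq_square mult.assoc)
   then show ?thesis using that by (simp add: divide_le_eq)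
  qed
  then show "\<forall>\<^sub>F y in at x. norm ((f y - f x) / (y - x)) <= C * \<bar>y - x\<bar>"
   by (auto simp: eventually_at_filter)
 qed
 then show ?thesis by (simp add: has_field_derivative_iff)
qed

lemma has_real_derivative_smoothstep: "(smoothstep has_real_derivative smoothstep' s) (at s)"
proof -
 consider "s < 0" | "s = 0" | "0 < s" "s < 1" | "s = 1" | "1 < s" by linarith
 then show ?thesis
 proof cases
  case 1
  show ?thesis
   by (rule has_field_derivative_transform_within_open[of "%_. 0" _ _ "{..<0}"])
    (use 1 in auto)
 next
  case 2
  then show ?thesis using has_real_derivative_0_quadratic[of smoothstep 0 3] smoothstep_quadratic by simp
 next
  case 3
  show ?thesis
   by (rule has_field_derivative_transform_within_open[of "%s. s^2 * (3 - 2 * s)" _ _ "{0<..<1}"])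
    (use 3 in \<open>auto intro!: derivative_eq_intros simp: smoothstep_between power2_eq_square algebra_simps\<close>)
 next
  case 4
  then show ?thesis using has_real_derivative_0_quadratic[of smoothstep 1 3] smoothstep_quadratic by simp
 next
  case 5
  show ?thesis
   by (rule has_field_derivative_transform_within_open[of "%_. 1" _ _ "{1<..}"])
    (use 5 in auto)
 qed
qed

lemma ball_cutoff:
 fixes rh :: real assumes "0 <= rh"
 obtains ze :: "real^3 => real" where "test_function ze" "!!x. 0 <= ze x" "!!x. ze x <= 1"
  "!!x. norm x <= rh ==> ze x = 1" "!!x. ze x ~= 0 ==> norm x <= rh + 1"
proof -
 \<comment> \<open>A cutoff in the squared norm is differentiable at the origin. Since
   \<open>(rh + 1)^2\<close> is at least \<open>rh^2 + 1\<close>, its support stays within radius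
   \<open>rh + 1\<close>.\<close>
 define ze where "ze x = 1 - smoothstep (x \<bullet> x - rh^2)" for x :: "real^3"
 have c: "continuously_diff ze"
  unfolding ze_def
  by (rule continuously_diff_compose_real[of "%x. x \<bullet> x" "%y. 1 - smoothstep (y - rh^2)" "%y. - smoothstep' (y - rh^2)"])
   (auto intro!: continuously_diff_inner_self derivative_eq_intros continuous_intros
    DERIV_chain2[OF has_real_derivative_smoothstep])
 have supp: "norm x <= rh + 1" if "ze x ~= 0" for x
 proof (rule ccontr)
  assume "\<not> norm x <= rh + 1"
  then have "(rh + 1)^2 <= (norm x)^2" using assms by (intro power_mono) auto
  moreover have "(rh + 1)^2 \<ge> rh^2 + 1" using assms by (simp add: power2_eq_square algebra_simps)
  ultimately have "1 <= x \<bullet> x - rh^2" by (simp add: dot_square_norm)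
  then show False using that by (simp add: ze_def)
 qed
 show ?thesis
 proof (rule that[of ze])
  show "test_function ze"
   using c supp by (auto simp: test_function_iff bounded_iff)
  show "ze x = 1" if "norm x <= rh" for x
  proof -
   have "(norm x)^2 <= rh^2" using that by (intro power_mono) auto
   then show ?thesis by (simp add: ze_def dot_square_norm)
  qed
 qed (use smoothstep_range supp in \<open>auto simp: ze_def\<close>)
qed

section \<open>Density of test functions and continuity of translations\<close>

text \<open>Convergence almost everywhere with common bounds on size and support is the form that
  dominated convergence against merely locally integrable functions requires. Measurability supplies
  continuous approximants; polynomials approximate these uniformly on a ball, and a cutoff restores
  bounded support.\<close>

lemma bounded_measurable_limit_of_test_functions:
 fixes g :: "real^3 => real"
 assumes [measurable]: "g \<in> bm"
  and M: "!!x. \<bar>g x\<bar> <= M" and supp: "!!x. g x ~= 0 ==> norm x <= rh" and "0 <= rh"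
 obtains pf :: "nat => real^3 => real"
 where "!!n. test_function (pf n)" "!!n x. \<bar>pf n x\<bar> <= M + 1"
  "!!n x. pf n x ~= 0 ==> norm x <= rh + 1" "AE x in lborel. (%n. pf n x) \<longlonglongrightarrow> g x"
proof -
 have M0: "0 <= M" using M[of 0] by linarith
 have "g measurable_on UNIV"
  by (intro lebesgue_measurable_imp_measurable_on_real measurable_completion) auto
 then obtain N c where N: "negligible N" and c: "!!n::nat. continuous_on UNIV (c n)"
  and lim: "!!x. x \<notin> N ==> (%n. c n x) \<longlonglongrightarrow> g x"
  unfolding measurable_on_def by auto
 \<comment> \<open>Clipping to the range of \<open>g\<close> makes the continuous approximants
   uniformly bounded and leaves the limit as it is.\<close>
 define d where "d n x = max (-M) (min M (c n x))" for n x
 have d: "continuous_on UNIV (d n)" "\<bar>d n x\<bar> <= M" for n x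
  using c M0 unfolding d_def by (auto intro!: continuous_intros)
 have limd: "(%n. d n x) \<longlonglongrightarrow> g x" if "x \<notin> N" for x
 proof -
  have "(%n. max (-M) (min M (c n x))) \<longlonglongrightarrow> max (-M) (min M (g x))"
   by (intro tendsto_intros lim that)
  then show ?thesis using M[of x] by (simp add: d_def abs_le_iff max_def min_def split: if_splits)
 qed
 have "\<exists>p. real_polynomial_function p \<and> (\<forall>x\<in>cball 0 (rh + 1). \<bar>d n x - p x\<bar> < 1 / real (Suc n))" for n
  using Stone_Weierstrass_real_polynomial_function[of "cball 0 (rh + 1)" "d n" "1 / real (Suc n)"]
   continuous_on_subset[OF d(1)] by (metis compact_cball of_nat_0_less_iff subset_UNIV zero_less_Suc zero_less_divide_1_iff)
 then obtain p where p: "!!n. real_polynomial_function (p n)"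
  "!!n x. norm x <= rh + 1 ==> \<bar>d n x - p n x\<bar> < 1 / real (Suc n)" by (auto simp: Ball_def) metis
 obtain ze :: "real^3 => real" where ze: "test_function ze" "!!x. 0 <= ze x" "!!x. ze x <= 1"
  "!!x. norm x <= rh ==> ze x = 1" "!!x. ze x ~= 0 ==> norm x <= rh + 1"
  using ball_cutoff[OF \<open>0 <= rh\<close>] by metis
 show ?thesis
 proof (rule that[of "%n x. p n x * ze x"])
  show "test_function (%x. p n x * ze x)" for n
   using ze(1) continuously_diff_polynomial[OF p(1)]
   by (auto simp: test_function_iff intro!: continuously_diff_mult elim: bounded_subset)
  show "norm x <= rh + 1" if "p n x * ze x ~= 0" for n x using that ze(5)[of x] by auto
  show "\<bar>p n x * ze x\<bar> <= M + 1" for n x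
  proof (cases "ze x = 0")
   case False
   then have "\<bar>d n x - p n x\<bar> < 1 / real (Suc n)" using ze(5) p(2) by blast
   moreover have "1 / real (Suc n) <= 1" by simp
   ultimately have "\<bar>p n x\<bar> <= M + 1" using d(2)[of n x] by linarith
   then have "\<bar>p n x\<bar> * \<bar>ze x\<bar> <= (M + 1) * 1" using ze(2,3)[of x] M0 by (intro mult_mono) auto
   then show ?thesis by (simp add: abs_mult)
  qed (use M0 in simp)
  have "(%n. p n x * ze x) \<longlonglongrightarrow> g x" if "x \<notin> N" for x
  proof (cases "norm x <= rh + 1")
   case True
   have "(%n. d n x - p n x) \<longlonglongrightarrow> 0"
    by (rule Lim_null_comparison[OF _ LIMSEQ_inverse_real_of_nat])
     (use p(2)[OF True] in \<open>auto simp: inverse_eq_divide intro!: always_eventually less_imp_le\<close>)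
   then have "(%n. d n x - (d n x - p n x)) \<longlonglongrightarrow> g x - 0" by (intro tendsto_diff limd that)
   then have "(%n. p n x * ze x) \<longlonglongrightarrow> g x * ze x" by (intro tendsto_intros) simp
   then show ?thesis using ze(4)[of x] supp[of x] by (cases "g x = 0") auto
  next
   case False
   then show ?thesis using ze(5)[of x] supp[of x] by (cases "g x = 0"; cases "ze x = 0") auto
  qed
  then show "AE x in lborel. (%n. p n x * ze x) \<longlonglongrightarrow> g x"
   using N by (auto simp: negligible_iff_null_sets null_sets_completion_iff2 intro: AE_I')
 qed
qed


lemma borel_shift [measurable]: "(%x. x + v) \<in> borel \<rightarrow>\<^sub>M (borel :: 'a::euclidean_space measure)"
 by measurable

lemma integral_shift:
 fixes f :: "'a::euclidean_space => real"
 assumes [measurable]: "f \<in> bm"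
 shows "(LI x. f (x + v)) = (LI x. f x)"
proof -
 have "(LI x. f x) = (LINT x|distr lborel borel ((+) v). f x)"
  by (simp only: lborel_distr_plus)
 also have "... = (LI x. f (v + x))" by (subst integral_distr) auto
 finally show ?thesis by (simp add: add.commute)
qed

lemma integrable_shift:
 fixes f :: "'a::euclidean_space => real"
 assumes "integrable lborel f"
 shows "integrable lborel (%x. f (x + v))"
proof -
 have "integrable (distr lborel borel ((+) v)) f" using assms by (simp only: lborel_distr_plus)
 then have "integrable lborel (%x. f (v + x))"
  using borel_measurable_integrable[OF assms] by (subst (asm) integrable_distr_eq) auto
 then show ?thesis by (simp add: add.commute)
qed

lemma integrable_indicator_cball [simp]:
 "integrable lborel (indicator (cball (a::'a::euclidean_space) rh) :: 'a => real)"
 using emeasure_lborel_cball_finite[of a rh] by (intro integrable_real_indicator) auto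

lemma integrable_bounded_support:
 fixes f :: "real^3 => real"
 assumes [measurable]: "f \<in> bm"
  and "!!x. \<bar>f x\<bar> <= M" "!!x. f x ~= 0 ==> norm x <= rh"
 shows "integrable lborel f"
proof (rule Bochner_Integration.integrable_bound[of _ "%x. M * indicator (cball 0 rh) x"])
 show "integrable lborel (%x. M * indicator (cball (0::real^3) rh) x)"
  by (intro integrable_mult_right integrable_indicator_cball)
 have "\<bar>f x\<bar> <= \<bar>M * indicator (cball 0 rh) x\<bar>" for x
  using assms(2)[of x] assms(3)[of x] by (cases "f x = 0") (auto simp: indicator_def)
 then show "AE x in lborel. norm (f x) <= norm (M * indicator (cball 0 rh) x)" by simp
qed auto

lemma test_function_borel [measurable_dest]: "test_function pf ==> pf \<in> bm"
 by (simp add: borel_measurable_continuous_onI continuously_diff_continuous test_function_iff)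

text \<open>The function is first truncated in size and in space, because approximation with uniform
  bounds is available for bounded functions of bounded support.\<close>

lemma integrable_test_approx:
 fixes F :: "real^3 => real"
 assumes F: "integrable lborel F" and e: "0 < e"
 obtains pf where "test_function pf" "integrable lborel pf" "(LI x. \<bar>F x - pf x\<bar>) < e"
proof -
 have [measurable]: "F \<in> bm" using borel_measurable_integrable[OF F] by simp
 define G where "G n x = (if norm x <= real n then max (- real n) (min (real n) (F x)) else 0)" for n x
 have [measurable]: "G n \<in> bm" for n unfolding G_def by measurable
 have "(%n. LINT x|lborel. \<bar>F x - G n x\<bar>) \<longlonglongrightarrow> (LINT x|(lborel::(real^3) measure). 0)"
 proof (rule integral_dominated_convergence[where w="%x. \<bar>F x\<bar>"])
  show "AE x in lborel. (%n. \<bar>F x - G n x\<bar>) \<longlonglongrightarrow> 0"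
  proof (rule AE_I2)
   fix x
   obtain N :: nat where N: "\<bar>F x\<bar> + norm x <= real N" using real_arch_simple by blast
   have "\<bar>F x - G n x\<bar> = 0" if "n \<ge> N" for n
   proof -
    have "\<bar>F x\<bar> + norm x <= real n" using N that by linarith
    then have "\<bar>F x\<bar> <= real n" "norm x <= real n" using norm_ge_zero[of x] by linarith+
    then show ?thesis by (auto simp: G_def max_def min_def abs_le_iff)
   qed
   then show "(%n. \<bar>F x - G n x\<bar>) \<longlonglongrightarrow> 0"
    by (intro tendsto_eventually) (auto simp: eventually_sequentially)
  qed
 qed (use F in \<open>auto simp: G_def\<close>)
 then have "eventually (%n. (LI x. \<bar>F x - G n x\<bar>) < e / 2) sequentially"
  using e by (intro order_tendstoD) auto
 then obtain n where n: "(LI x. \<bar>F x - G n x\<bar>) < e / 2" using eventually_happens by force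
 have bd: "\<bar>G n x\<bar> <= real n" "G n x ~= 0 ==> norm x <= real n" for x by (auto simp: G_def split: if_splits)
 obtain pf where pf: "!!k. test_function (pf k)" "!!k x. \<bar>pf k x\<bar> <= real n + 1"
  "!!k x. pf k x ~= 0 ==> norm x <= real n + 1" "AE x in lborel. (%k. pf k x) \<longlonglongrightarrow> G n x"
  using bounded_measurable_limit_of_test_functions[of "G n" "real n" "real n"] bd by auto
 note [measurable] = test_function_borel[OF pf(1)]
 have ipf: "integrable lborel (pf k)" for k using pf by (intro integrable_bounded_support) auto
 have iG: "integrable lborel (G n)" using bd by (intro integrable_bounded_support) auto
 have "(%k. LINT x|lborel. \<bar>G n x - pf k x\<bar>) \<longlonglongrightarrow> (LINT x|(lborel::(real^3) measure). 0)"
 proof (rule integral_dominated_convergence[where w="%x. \<bar>G n x\<bar> + (real n + 1) * indicator (cball 0 (real n + 1)) x"])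
  show "AE x in lborel. (%k. \<bar>G n x - pf k x\<bar>) \<longlonglongrightarrow> 0"
   using pf(4) by eventually_elim (auto intro!: tendsto_eq_intros)
  show "integrable lborel (%x. \<bar>G n x\<bar> + (real n + 1) * indicator (cball 0 (real n + 1)) x)"
   using iG by (intro Bochner_Integration.integrable_add integrable_mult_right integrable_indicator_cball) auto
  have "\<bar>G n x - pf k x\<bar> <= \<bar>G n x\<bar> + (real n + 1) * indicator (cball 0 (real n + 1)) x" for k x
   using pf(2,3)[of k x] by (cases "pf k x = 0") (auto simp: indicator_def)
  then show "AE x in lborel. norm \<bar>G n x - pf k x\<bar> <= \<bar>G n x\<bar> + (real n + 1) * indicator (cball 0 (real n + 1)) x" for k
   by simp
 qed auto
 then have "eventually (%k. (LI x. \<bar>G n x - pf k x\<bar>) < e / 2) sequentially"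
  using e by (intro order_tendstoD) auto
 then obtain k where k: "(LI x. \<bar>G n x - pf k x\<bar>) < e / 2" using eventually_happens by force
 have "(LI x. \<bar>F x - pf k x\<bar>) <= (LI x. \<bar>F x - G n x\<bar> + \<bar>G n x - pf k x\<bar>)"
  using F iG ipf by (intro integral_mono) auto
 also have "... = (LI x. \<bar>F x - G n x\<bar>) + (LI x. \<bar>G n x - pf k x\<bar>)"
  using F iG ipf by (intro Bochner_Integration.integral_add) auto
 finally have "(LI x. \<bar>F x - pf k x\<bar>) < e" using n k by linarith
 then show ?thesis by (rule that[OF pf(1) ipf])
qed

text \<open>A three-term estimate: a test function near \<open>F\<close> moves little because it is
  Lipschitz with bounded support, and the two approximation errors coincide by translation
  invariance.\<close>

lemma translation_continuous_L1:
 fixes F :: "real^3 => real"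
 assumes F: "integrable lborel F" and e: "0 < e"
 obtains de where "0 < de" "!!v. norm v <= de ==> (LI x. \<bar>F (x + v) - F x\<bar>) <= e"
proof -
 obtain pf where pf: "test_function pf" "integrable lborel pf" "(LI x. \<bar>F x - pf x\<bar>) < e / 3"
  using integrable_test_approx[OF F, of "e / 3"] e by auto
 have [measurable]: "F \<in> bm" using borel_measurable_integrable[OF F] by simp
 note [measurable] = test_function_borel[OF pf(1)]
 obtain L where L: "0 <= L" "!!x y. \<bar>pf x - pf y\<bar> <= L * norm (x - y)" "!!x. pf x ~= 0 ==> norm x <= L"
  using test_function_bounds[OF pf(1)] by metis
 define V where "V = measure lborel (cball (0::real^3) (L + 1))"
 \<comment> \<open>On the ball of radius \<open>L + 1\<close>, of volume \<open>V\<close>, the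
   translates of \<open>pf\<close> differ by at most \<open>L * de\<close>. The bound
   \<open>de <= 1\<close> keeps the shifted support inside this ball; the \<open>+ 1\<close> in the
   denominator guards against \<open>L * V = 0\<close>.\<close>
 define de where "de = min 1 (e / (3 * (L * V + 1)))"
 have V: "0 <= V" by (simp add: V_def)
 have de: "0 < de" using e V L by (auto simp: de_def intro!: divide_pos_pos add_nonneg_pos)
 show ?thesis
 proof (rule that[OF de])
  fix v :: "real^3" assume v: "norm v <= de"
  have "\<bar>pf (x + v) - pf x\<bar> <= L * de * indicator (cball 0 (L + 1)) x" for x
  proof (cases "norm x <= L + 1")
   case True
   then show ?thesis using L(2)[of "x + v" x] mult_left_mono[OF v L(1)] by simp
  next
   case False
   have "norm v <= 1" using v by (simp add: de_def)
   then have "norm (x + v) > L" using False norm_triangle_ineq4[of "x + v" v] by simp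
   then show ?thesis using False L(1) L(3)[of "x + v"] L(3)[of x] de by force
  qed
  then have "(LI x. \<bar>pf (x + v) - pf x\<bar>) <= (LI x. L * de * indicator (cball (0::real^3) (L + 1)) x)"
   using pf(2)
   by (intro integral_mono integrable_mult_right integrable_indicator_cball integrable_abs
      Bochner_Integration.integrable_diff integrable_shift) auto
  also have "... = L * V * de" by (simp add: V_def)
  also have "... <= (L * V + 1) * (e / (3 * (L * V + 1)))"
   using L V de by (intro mult_mono) (auto simp: de_def)
  also have "... = e / 3"
  proof -
   have "L * V + 1 > 0" using L V by (simp add: add_nonneg_pos)
   then show ?thesis by (simp add: field_simps)
  qed
  finally have 1: "(LI x. \<bar>pf (x + v) - pf x\<bar>) <= e / 3" .
  have 2: "(LI x. \<bar>F (x + v) - pf (x + v)\<bar>) = (LI x. \<bar>F x - pf x\<bar>)"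
   by (rule integral_shift[of "%x. \<bar>F x - pf x\<bar>"]) measurable
  have i: "integrable lborel (%x. \<bar>F (x + v) - pf (x + v)\<bar>)" "integrable lborel (%x. \<bar>pf (x + v) - pf x\<bar>)"
   "integrable lborel (%x. \<bar>F x - pf x\<bar>)" "integrable lborel (%x. \<bar>F (x + v) - F x\<bar>)"
   using F pf(2) by (auto intro!: integrable_abs Bochner_Integration.integrable_diff integrable_shift)
  have "(LI x. \<bar>F (x + v) - F x\<bar>)
   <= (LI x. (\<bar>F (x + v) - pf (x + v)\<bar> + \<bar>pf (x + v) - pf x\<bar>) + \<bar>F x - pf x\<bar>)"
   using i by (intro integral_mono Bochner_Integration.integrable_add) auto
  also have "... = (LI x. \<bar>F (x + v) - pf (x + v)\<bar>) + (LI x. \<bar>pf (x + v) - pf x\<bar>)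
    + (LI x. \<bar>F x - pf x\<bar>)"
   using i by (simp add: Bochner_Integration.integral_add)
  also have "... <= e" using 1 2 pf(3) by linarith
  finally show "(LI x. \<bar>F (x + v) - F x\<bar>) <= e" .
 qed
qed

section \<open>Weak partial derivatives\<close>

definition loc_int :: "(real^3 => real) => bool" where
 "loc_int f \<longleftrightarrow> f \<in> bm \<and> (\<forall>rh. integrable lborel (%x. indicator (cball 0 rh) x * f x))"

definition loc_sq_int :: "(real^3 => real) => bool" where
 "loc_sq_int f \<longleftrightarrow> f \<in> bm \<and>
   (\<forall>rh. integrable lborel (%x. indicator (cball 0 rh) x * (f x)^2))"

definition sq_int :: "(real^3 => real) => bool" where
 "sq_int f \<longleftrightarrow> f \<in> bm \<and> integrable lborel (%x. (f x)^2)"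

text \<open>One component and one direction of the identity in \<open>energy_field\<close>. Only the
  derivative is globally square integrable: a field of finite energy need not be.\<close>

definition weak_deriv :: "3 => (real^3 => real) => (real^3 => real) => bool" where
 "weak_deriv j f F \<longleftrightarrow> loc_sq_int f \<and> sq_int F \<and>
   (\<forall>pf. test_function pf -->
    (LI x. f x * partial_deriv j pf x) = - (LI x. F x * pf x))"

lemma loc_int_borel: "loc_int f ==> f \<in> bm"
 and loc_sq_int_borel: "loc_sq_int f ==> f \<in> bm"
 and sq_int_borel: "sq_int f ==> f \<in> bm"
 by (auto simp: loc_int_def loc_sq_int_def sq_int_def)

lemma indicator_cball_borel [simp, measurable]:
 "indicator (cball a rh) \<in> borel_measurable (borel :: (real^3) measure)"
 by (intro borel_measurable_indicator) simp

lemma abs_mult_le_bound: "\<bar>g\<bar> <= M ==> \<bar>f\<bar> * \<bar>g\<bar> <= M * \<bar>f::real\<bar>"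
 using mult_right_mono[of "\<bar>g\<bar>" M "\<bar>f\<bar>"] by (simp add: mult.commute)

lemma two_mult_abs_le: "2 * \<bar>a * b\<bar> <= a^2 + (b::real)^2"
proof -
 have "0 <= (\<bar>a\<bar> - \<bar>b\<bar>)^2" by simp
 then show ?thesis by (simp add: power2_diff abs_mult)
qed

text \<open>Young's inequality. The weight makes a product small when one factor is merely bounded
  in \<open>L^2\<close> and the other is small in \<open>L^2\<close>.\<close>

lemma weighted_mult_abs_le:
 assumes "0 < (k::real)" shows "\<bar>a * b\<bar> <= k / 2 * a^2 + 1 / (2 * k) * b^2"
proof -
 have "2 * \<bar>(sqrt k * a) * (b / sqrt k)\<bar> <= (sqrt k * a)^2 + (b / sqrt k)^2"
  by (rule two_mult_abs_le)
 then show ?thesis using assms by (simp add: power_mult_distrib power_divide field_simps)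
qed

lemma sq_int_mult_integrable:
 assumes "sq_int f" "sq_int g" shows "integrable lborel (%x. f x * g x)"
proof (rule Bochner_Integration.integrable_bound[of _ "%x. (f x)^2 + (g x)^2"])
 note [measurable] = sq_int_borel[OF assms(1)] sq_int_borel[OF assms(2)]
 show "integrable lborel (%x. (f x)^2 + (g x)^2)" using assms by (simp add: sq_int_def)
 have "\<bar>f x * g x\<bar> <= (f x)^2 + (g x)^2" for x
  using two_mult_abs_le[of "f x" "g x"] abs_ge_zero[of "f x * g x"] by linarith
 then show "AE x in lborel. norm (f x * g x) <= norm ((f x)^2 + (g x)^2)" by simp
qed (use assms sq_int_borel in \<open>auto intro!: borel_measurable_times\<close>)

lemma sq_int_bound:
 assumes "sq_int g" "f \<in> bm" "!!x. \<bar>f x\<bar> <= \<bar>g x\<bar>"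
 shows "sq_int f"
 unfolding sq_int_def
proof
 show "integrable lborel (%x. (f x)^2)"
  by (rule Bochner_Integration.integrable_bound[of _ "%x. (g x)^2"])
   (use assms in \<open>auto simp: sq_int_def abs_le_square_iff\<close>)
qed (rule assms)

lemma sq_int_shift: "sq_int f ==> sq_int (%x. f (x + v))"
 using integrable_shift[of "%x. (f x)^2" v] by (auto simp: sq_int_def)

lemma sq_int_add:
 assumes "sq_int f" "sq_int g" shows "sq_int (%x. f x + g x)"
 unfolding sq_int_def
proof
 note [measurable] = sq_int_borel[OF assms(1)] sq_int_borel[OF assms(2)]
 show "(%x. f x + g x) \<in> bm" by measurable
 have "(%x. (f x + g x)^2) = (%x. (f x)^2 + (g x)^2 + 2 * (f x * g x))"
  by (auto simp: power2_eq_square algebra_simps)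
 then show "integrable lborel (%x. (f x + g x)^2)"
  using assms sq_int_mult_integrable[OF assms] by (simp add: sq_int_def)
qed

lemma sq_int_cmult: "sq_int f ==> sq_int (%x. c * f x)"
 by (auto simp: sq_int_def power_mult_distrib)

lemma sq_int_diff: "sq_int f ==> sq_int g ==> sq_int (%x. f x - g x)"
proof -
 assume "sq_int f" "sq_int g"
 then have "sq_int (%x. f x + (- 1) * g x)" by (intro sq_int_add sq_int_cmult)
 then show "sq_int (%x. f x - g x)" by simp
qed

lemma loc_sq_int_iff: "loc_sq_int f \<longleftrightarrow> f \<in> bm \<and> (\<forall>rh. sq_int (%x. indicator (cball 0 rh) x * f x))"
proof -
 have "(indicator (cball 0 rh) x * f x)^2 = indicator (cball 0 rh) x * (f x)^2" for rh x
  by (auto simp: indicator_def)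
 then show ?thesis by (auto simp: loc_sq_int_def sq_int_def intro: borel_measurable_times)
qed

lemma sq_int_imp_loc:
 assumes "sq_int f" shows "loc_sq_int f"
 unfolding loc_sq_int_iff
proof (intro conjI allI)
 show f: "f \<in> bm" by (rule sq_int_borel[OF assms])
 show "sq_int (%x. indicator (cball 0 rh) x * f x)" for rh
  by (rule sq_int_bound[OF assms]) (use f in \<open>auto intro!: borel_measurable_times simp: indicator_def\<close>)
qed

lemma sq_int_indicator: "sq_int (indicator (cball 0 rh))"
proof -
 have "(%x. (indicator (cball 0 rh) x)^2) = (indicator (cball (0::real^3) rh) :: _ => real)"
  by (auto simp: indicator_def)
 then show ?thesis by (simp add: sq_int_def)
qed

lemma loc_sq_int_imp_loc_int: assumes "loc_sq_int f" shows "loc_int f"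
 unfolding loc_int_def
proof (intro conjI allI)
 fix rh
 have "integrable lborel (%x. indicator (cball 0 rh) x * (indicator (cball 0 rh) x * f x))"
  using assms sq_int_indicator by (intro sq_int_mult_integrable) (auto simp: loc_sq_int_iff)
 moreover have "indicator (cball 0 rh) x * (indicator (cball 0 rh) x * f x) = indicator (cball 0 rh) x * f x" for x
  by (auto simp: indicator_def)
 ultimately show "integrable lborel (%x. indicator (cball 0 rh) x * f x)" by simp
qed (use assms loc_sq_int_borel in \<open>auto intro!: borel_measurable_times\<close>)

lemma loc_sq_int_mult_integrable:
 assumes "loc_sq_int f" "sq_int g" "!!x. g x ~= 0 ==> norm x <= rh"
 shows "integrable lborel (%x. f x * g x)"
proof -
 have "integrable lborel (%x. (indicator (cball 0 rh) x * f x) * g x)"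
  using assms by (intro sq_int_mult_integrable) (auto simp: loc_sq_int_iff)
 moreover have "(indicator (cball 0 rh) x * f x) * g x = f x * g x" for x
  using assms(3)[of x] by (auto simp: indicator_def)
 ultimately show ?thesis by simp
qed

lemma loc_sq_int_shift:
 assumes "loc_sq_int f" shows "loc_sq_int (%x. f (x + v))"
 unfolding loc_sq_int_iff
proof (intro conjI allI)
 note [measurable] = loc_sq_int_borel[OF assms]
 show "(%x. f (x + v)) \<in> bm" by measurable
 fix rh
 have 1: "sq_int (%x. indicator (cball 0 (rh + norm v)) (x + v) * f (x + v))"
  using assms by (intro sq_int_shift) (simp add: loc_sq_int_iff)
 have "\<bar>indicator (cball 0 rh) x * f (x + v)\<bar> <= \<bar>indicator (cball 0 (rh + norm v)) (x + v) * f (x + v)\<bar>" for x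
  using norm_triangle_ineq[of x v] by (auto simp: indicator_def)
 then show "sq_int (%x. indicator (cball 0 rh) x * f (x + v))"
  by (intro sq_int_bound[OF 1] borel_measurable_times) auto
qed

lemma loc_sq_int_diff:
 assumes "loc_sq_int f" "loc_sq_int g" shows "loc_sq_int (%x. f x - g x)"
 unfolding loc_sq_int_iff
proof (intro conjI allI)
 show "(%x. f x - g x) \<in> bm"
  using assms loc_sq_int_borel by (intro borel_measurable_diff) auto
 fix rh
 show "sq_int (%x. indicator (cball 0 rh) x * (f x - g x))"
  using assms unfolding loc_sq_int_iff right_diff_distrib by (intro sq_int_diff) auto
qed

lemma loc_sq_int_cmult:
 assumes "loc_sq_int f" shows "loc_sq_int (%x. c * f x)"
 unfolding loc_sq_int_iff
proof (intro conjI allI)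
 show "(%x. c * f x) \<in> bm"
  using loc_sq_int_borel[OF assms] by (intro borel_measurable_times) auto
 fix rh
 have "sq_int (%x. c * (indicator (cball 0 rh) x * f x))"
  using assms by (intro sq_int_cmult) (simp add: loc_sq_int_iff)
 moreover have "(%x. c * (indicator (cball 0 rh) x * f x)) = (%x. indicator (cball 0 rh) x * (c * f x))"
  by auto
 ultimately show "sq_int (%x. indicator (cball 0 rh) x * (c * f x))" by simp
qed

lemma loc_int_mult_integrable:
 assumes "loc_int f" and [measurable]: "g \<in> bm"
  and "!!x. \<bar>g x\<bar> <= M" "!!x. g x ~= 0 ==> norm x <= rh"
 shows "integrable lborel (%x. f x * g x)"
proof (rule Bochner_Integration.integrable_bound[of _ "%x. M * (indicator (cball 0 rh) x * f x)"])
 note [measurable] = loc_int_borel[OF assms(1)]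
 have M: "0 <= M" using assms(3)[of 0] by linarith
 show "integrable lborel (%x. M * (indicator (cball 0 rh) x * f x))" using assms by (simp add: loc_int_def)
 have "\<bar>f x * g x\<bar> <= \<bar>M * (indicator (cball 0 rh) x * f x)\<bar>" for x
  using assms(3)[of x] assms(4)[of x] M
  by (cases "g x = 0") (auto simp: indicator_def abs_mult intro!: abs_mult_le_bound)
 then show "AE x in lborel. norm (f x * g x) <= norm (M * (indicator (cball 0 rh) x * f x))" by simp
 show "(%x. f x * g x) \<in> borel_measurable lborel" by measurable
qed

lemma AE_shift:
 fixes v :: "'a::euclidean_space"
 assumes "AE x in lborel. P x" shows "AE x in lborel. P (x + v)"
proof -
 have "AE x in distr lborel borel ((+) v). P x" using assms by (simp only: lborel_distr_plus)
 then obtain N where N: "N \<in> null_sets (distr lborel borel ((+) v))" "{x. \<not> P x} \<subseteq> N"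
  by (auto simp: eventually_ae_filter)
 then have "((+) v) -` N \<in> null_sets lborel"
  using measurable_sets[of "(+) v" borel borel N] by (auto simp: null_sets_def emeasure_distr)
 then show ?thesis by (rule AE_I') (use N(2) in \<open>auto simp: add.commute\<close>)
qed

lemma test_function_shift:
 assumes "test_function pf"
 shows "test_function (%x. pf (x - v))" "partial_deriv j (%x. pf (x - v)) x = partial_deriv j pf (x - v)"
proof -
 have c: "continuously_diff pf" and b: "bounded {x. pf x ~= 0}" using assms by (auto simp: test_function_iff)
 have d: "((%x. pf (x - v)) has_derivative frechet_derivative pf (at (x - v))) (at x)" for x
 proof -
  have "((%x. x - v) has_derivative (%h. h)) (at x)" by (auto intro!: derivative_eq_intros)
  from has_derivative_compose[OF this continuously_diff_has_derivative[OF c]]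
  show ?thesis by simp
 qed
 show "partial_deriv j (%x. pf (x - v)) x = partial_deriv j pf (x - v)"
  using partial_deriv_eqI[OF d] by (simp add: partial_deriv_def)
 have "continuously_diff (%x. pf (x - v))"
 proof (rule continuously_diffI[OF d])
  fix j
  have "continuous_on UNIV (partial_deriv j pf)" using c by (simp add: continuously_diff_def)
  then have "continuous_on UNIV (%x. partial_deriv j pf (x - v))"
   by (rule continuous_on_compose2) (auto intro!: continuous_intros)
  then show "continuous_on UNIV (%x. frechet_derivative pf (at (x - v)) (axis j 1))"
   by (simp add: partial_deriv_def)
 qed
 moreover have "bounded {x. pf (x - v) ~= 0}"
 proof -
  have "{x. pf (x - v) ~= 0} = (%x. x + v) ` {x. pf x ~= 0}"
   by (auto simp: image_iff) (metis diff_add_cancel)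
  then show ?thesis using bounded_translation[OF b, of v] by (simp add: add.commute)
 qed
 ultimately show "test_function (%x. pf (x - v))" by (simp add: test_function_iff)
qed

section \<open>Increments and difference quotients of weakly differentiable functions\<close>

lemma partial_deriv_borel:
 "test_function pf ==> partial_deriv j pf \<in> bm"
 by (auto simp: test_function_def intro: borel_measurable_continuous_onI)

lemma test_function_line_derivative:
 assumes "test_function pf"
 shows "((%t. pf (x - t *\<^sub>R axis j 1)) has_real_derivative - partial_deriv j pf (x - t *\<^sub>R axis j 1)) (at t)"
proof -
 have c: "continuously_diff pf" using assms by (simp add: test_function_iff)
 have "((%t. x - t *\<^sub>R axis j 1) has_derivative (%h. - (h *\<^sub>R axis j 1))) (at t)"
  by (auto intro!: derivative_eq_intros)
 from has_derivative_compose[OF this continuously_diff_has_derivative[OF c]]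
 have d: "((%t. pf (x - t *\<^sub>R axis j 1)) has_derivative
   (%h. frechet_derivative pf (at (x - t *\<^sub>R axis j 1)) (- (h *\<^sub>R axis j 1)))) (at t)" .
 have l: "linear (frechet_derivative pf (at (x - t *\<^sub>R axis j 1)))"
  using c by (simp add: continuously_diff_def linear_frechet_derivative)
 have "(%h. frechet_derivative pf (at (x - t *\<^sub>R axis j 1)) (- (h *\<^sub>R axis j 1)))
   = times (- partial_deriv j pf (x - t *\<^sub>R axis j 1))"
  using linear_scale[OF l] linear_neg[OF l] by (auto simp: partial_deriv_def fun_eq_iff)
 then show ?thesis using d by (simp add: has_field_derivative_def)
qed

text \<open>A change of variables puts the translation on the test function, whose quotients
  converge boundedly; the weak derivative, applied to the translated test function, then carries the
  result back to \<open>F\<close>.\<close>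

lemma weak_deriv_line_derivative:
 assumes wd: "weak_deriv j f F" and pf: "test_function pf"
 shows "((%t. LINT x|lborel. f (x + t *\<^sub>R axis j 1) * pf x) has_real_derivative
   (LI x. F (x + t *\<^sub>R axis j 1) * pf x)) (at t)"
proof -
 define e :: "real^3" where "e = axis j 1"
 have ne: "norm e = 1" by (simp add: e_def)
 have lf: "loc_int f" and F: "sq_int F" using wd loc_sq_int_imp_loc_int by (auto simp: weak_deriv_def)
 note [measurable] = loc_int_borel[OF lf] sq_int_borel[OF F] test_function_borel[OF pf] partial_deriv_borel[OF pf]
 obtain L where L: "0 <= L" "!!x. \<bar>pf x\<bar> <= L" "!!x y. \<bar>pf x - pf y\<bar> <= L * norm (x - y)"
  "!!x. pf x ~= 0 ==> norm x <= L" using test_function_bounds[OF pf] by metis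
 have sh: "(LI x. g (x + s *\<^sub>R e) * pf x) = (LI x. g x * pf (x - s *\<^sub>R e))"
  if [measurable]: "g \<in> bm" for g s
  using integral_shift[of "%x. g x * pf (x - s *\<^sub>R e)" "s *\<^sub>R e"] by simp
 have supp: "norm x <= L + \<bar>s\<bar>" if "pf (x - s *\<^sub>R e) ~= 0" for x s
  using L(4)[OF that] norm_triangle_ineq[of "x - s *\<^sub>R e" "s *\<^sub>R e"] ne by simp
 have i: "integrable lborel (%x. f x * pf (x - s *\<^sub>R e))" for s
  by (rule loc_int_mult_integrable[OF lf, where M=L and rh="L + \<bar>s\<bar>"]) (use L supp in auto)
 have "((%y. ((LI x. f x * pf (x - y *\<^sub>R e)) - (LI x. f x * pf (x - t *\<^sub>R e))) / (y - t))
   \<longlongrightarrow> (LI x. f x * - partial_deriv j pf (x - t *\<^sub>R e))) (at t)"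
  unfolding tendsto_at_iff_sequentially
 proof (intro allI impI)
  fix X :: "nat => real" assume X: "\<forall>i. X i \<in> UNIV - {t}" and Xt: "X \<longlonglongrightarrow> t"
  obtain B where B: "!!i. \<bar>X i\<bar> <= B"
   using Xt convergent_imp_Bseq[of X] by (auto simp: convergent_def Bseq_def)
  have tB: "\<bar>t\<bar> <= B" using B Xt by (intro Lim_bounded[of "%i. \<bar>X i\<bar>"]) (auto intro!: tendsto_intros)
  have eq: "((LI x. f x * pf (x - X n *\<^sub>R e)) - (LI x. f x * pf (x - t *\<^sub>R e))) / (X n - t)
    = (LI x. f x * ((pf (x - X n *\<^sub>R e) - pf (x - t *\<^sub>R e)) / (X n - t)))" for n
  proof -
   have "(LI x. f x * ((pf (x - X n *\<^sub>R e) - pf (x - t *\<^sub>R e)) / (X n - t)))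
     = (LI x. (f x * pf (x - X n *\<^sub>R e) - f x * pf (x - t *\<^sub>R e)) / (X n - t))"
    by (simp add: right_diff_distrib)
   also have "... = (LI x. f x * pf (x - X n *\<^sub>R e) - f x * pf (x - t *\<^sub>R e)) / (X n - t)"
    by (rule integral_divide_zero)
   finally show ?thesis by (simp only: Bochner_Integration.integral_diff[OF i i])
  qed
  have "(%n. LINT x|lborel. f x * ((pf (x - X n *\<^sub>R e) - pf (x - t *\<^sub>R e)) / (X n - t)))
    \<longlonglongrightarrow> (LI x. f x * - partial_deriv j pf (x - t *\<^sub>R e))"
  proof (rule integral_dominated_convergence[where w="%x. L * \<bar>indicator (cball 0 (L + B)) x * f x\<bar>"])
   show "integrable lborel (%x. L * \<bar>indicator (cball 0 (L + B)) x * f x\<bar>)"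
    using lf by (simp add: loc_int_def)
   have "(%n. (pf (x - X n *\<^sub>R e) - pf (x - t *\<^sub>R e)) / (X n - t)) \<longlonglongrightarrow> - partial_deriv j pf (x - t *\<^sub>R e)" for x
    using test_function_line_derivative[OF pf, of x j t] X Xt
    unfolding has_field_derivative_iff tendsto_at_iff_sequentially e_def[symmetric] by (auto simp: o_def)
   then show "AE x in lborel. (%n. f x * ((pf (x - X n *\<^sub>R e) - pf (x - t *\<^sub>R e)) / (X n - t)))
     \<longlonglongrightarrow> f x * - partial_deriv j pf (x - t *\<^sub>R e)"
    by (intro AE_I2 tendsto_mult_left)
   have "\<bar>f x * ((pf (x - X n *\<^sub>R e) - pf (x - t *\<^sub>R e)) / (X n - t))\<bar>
     <= L * \<bar>indicator (cball 0 (L + B)) x * f x\<bar>" for n x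
   proof (cases "norm x <= L + B")
    case True
    have "x - X n *\<^sub>R e - (x - t *\<^sub>R e) = (t - X n) *\<^sub>R e" by (simp add: algebra_simps)
    then have "\<bar>pf (x - X n *\<^sub>R e) - pf (x - t *\<^sub>R e)\<bar> <= L * \<bar>X n - t\<bar>"
     using L(3)[of "x - X n *\<^sub>R e" "x - t *\<^sub>R e"] ne by (simp add: abs_minus_commute)
    moreover have "X n - t ~= 0" using X by auto
    ultimately have "\<bar>(pf (x - X n *\<^sub>R e) - pf (x - t *\<^sub>R e)) / (X n - t)\<bar> <= L"
     by (simp add: divide_le_eq)
    then have "\<bar>f x\<bar> * \<bar>(pf (x - X n *\<^sub>R e) - pf (x - t *\<^sub>R e)) / (X n - t)\<bar> <= \<bar>f x\<bar> * L"
     by (rule mult_left_mono) simp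
    then show ?thesis using True by (simp add: abs_mult mult.commute)
   next
    case False
    then have "pf (x - X n *\<^sub>R e) = 0" "pf (x - t *\<^sub>R e) = 0"
     using supp[of x "X n"] supp[of x t] B[of n] tB by force+
    then show ?thesis using L(1) by simp
   qed
   then show "AE x in lborel. norm (f x * ((pf (x - X n *\<^sub>R e) - pf (x - t *\<^sub>R e)) / (X n - t)))
     <= L * \<bar>indicator (cball 0 (L + B)) x * f x\<bar>" for n by simp
  qed measurable
  then show "((%y. ((LI x. f x * pf (x - y *\<^sub>R e)) - (LI x. f x * pf (x - t *\<^sub>R e))) / (y - t)) \<circ> X)
    \<longlonglongrightarrow> (LI x. f x * - partial_deriv j pf (x - t *\<^sub>R e))"
   by (simp add: o_def eq)
 qed
 moreover have "(LI x. f x * - partial_deriv j pf (x - t *\<^sub>R e)) = (LI x. F x * pf (x - t *\<^sub>R e))"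
 proof -
  have "(LI x. f x * partial_deriv j (%x. pf (x - t *\<^sub>R e)) x) = - (LI x. F x * pf (x - t *\<^sub>R e))"
   using wd test_function_shift(1)[OF pf, where v="t *\<^sub>R e"] unfolding weak_deriv_def by blast
  then show ?thesis by (simp add: test_function_shift(2)[OF pf])
 qed
 ultimately show ?thesis
  unfolding has_field_derivative_iff e_def[symmetric] by (simp add: sh)
qed

lemma integral_limit_of_test_functions:
 assumes h: "loc_int h" and [measurable]: "!!n. pf n \<in> bm" "g \<in> bm"
  and "!!n x. \<bar>pf n x\<bar> <= M" "!!n x. pf n x ~= 0 ==> norm x <= rh"
  and "AE x in lborel. (%n. pf n x) \<longlonglongrightarrow> g x"
 shows "(%n. LINT x|lborel. h x * pf n x) \<longlonglongrightarrow> (LI x. h x * g x)"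
proof (rule integral_dominated_convergence[where w="%x. M * \<bar>indicator (cball 0 rh) x * h x\<bar>"])
 note [measurable] = loc_int_borel[OF h]
 have M: "0 <= M" using assms(4)[of 0 0] by linarith
 show "integrable lborel (%x. M * \<bar>indicator (cball 0 rh) x * h x\<bar>)" using h by (simp add: loc_int_def)
 show "AE x in lborel. (%n. h x * pf n x) \<longlonglongrightarrow> h x * g x"
  using assms(6) by eventually_elim (rule tendsto_mult_left)
 have "\<bar>h x * pf n x\<bar> <= M * \<bar>indicator (cball 0 rh) x * h x\<bar>" for n x
  using assms(4)[of n x] assms(5)[of n x] M
  by (cases "pf n x = 0") (auto simp: abs_mult intro!: abs_mult_le_bound)
 then show "AE x in lborel. norm (h x * pf n x) <= M * \<bar>indicator (cball 0 rh) x * h x\<bar>" for n by simp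
qed (use loc_int_borel[OF h] assms(2,3) in \<open>auto intro!: borel_measurable_times\<close>)

text \<open>The mean value inequality in the shift. With \<open>c\<close> the pairing of
  \<open>F\<close> itself it controls a first order Taylor remainder, with \<open>c = 0\<close> a
  plain increment; both uses occur.\<close>

lemma weak_deriv_increment_test:
 assumes wd: "weak_deriv j f F" and pf: "test_function pf"
  and b: "!!s. \<bar>s\<bar> <= \<bar>t\<bar> ==> \<bar>(LI x. F (x + s *\<^sub>R axis j 1) * pf x) - c\<bar> <= B"
 shows "\<bar>(LI x. f (x + t *\<^sub>R axis j 1) * pf x) - (LI x. f x * pf x) - t * c\<bar> <= B * \<bar>t\<bar>"
proof -
 define Ps where "Ps s = (LI x. f (x + s *\<^sub>R axis j 1) * pf x) - s * c" for s
 have "norm (Ps t - Ps 0) <= B * norm (t - 0)"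
 proof (rule field_differentiable_bound[of "{-\<bar>t\<bar>..\<bar>t\<bar>}" Ps "%s. (LI x. F (x + s *\<^sub>R axis j 1) * pf x) - c"])
  show "(Ps has_real_derivative (LI x. F (x + s *\<^sub>R axis j 1) * pf x) - c) (at s within {- \<bar>t\<bar>..\<bar>t\<bar>})" for s
   unfolding Ps_def
   by (rule has_field_derivative_at_within)
    (auto intro!: derivative_eq_intros weak_deriv_line_derivative[OF wd pf])
 qed (use b in auto)
 then show ?thesis by (simp add: Ps_def algebra_simps)
qed

text \<open>Duality: the \<open>L^1\<close> norm of the remainder on a ball is its pairing with its
  own sign. The sign is a limit of test functions bounded by \<open>1 + 1\<close>, supported within
  \<open>rh + 1\<close>; hence the factor 2 and the larger ball in the hypothesis.\<close>

lemma weak_deriv_increment_L1_bound: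
 assumes wd: "weak_deriv j f F" and "0 <= rh"
  and om: "!!s. \<bar>s\<bar> <= \<bar>t\<bar> ==> (LI x. indicator (cball 0 (rh + 1)) x * \<bar>F (x + s *\<^sub>R axis j 1) - F x\<bar>) <= om"
 shows "(LI x. indicator (cball 0 rh) x * \<bar>f (x + t *\<^sub>R axis j 1) - f x - t * F x\<bar>) <= 2 * om * \<bar>t\<bar>"
proof -
 define e :: "real^3" where "e = axis j 1"
 have f: "loc_sq_int f" and F: "sq_int F" using wd by (auto simp: weak_deriv_def)
 note [measurable] = loc_sq_int_borel[OF f] sq_int_borel[OF F]
 define h where "h x = f (x + t *\<^sub>R e) - f x - t * F x" for x
 have lh: "loc_int h" unfolding h_def[abs_def]
  by (rule loc_sq_int_imp_loc_int, rule loc_sq_int_diff, rule loc_sq_int_diff,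
    rule loc_sq_int_shift[OF f], rule f, rule loc_sq_int_cmult, rule sq_int_imp_loc[OF F])
 note [measurable] = loc_int_borel[OF lh]
 define g where "g x = indicator (cball 0 rh) x * sgn (h x)" for x
 have [measurable]: "g \<in> bm" unfolding g_def by measurable
 have g: "\<bar>g x\<bar> <= 1" "g x ~= 0 ==> norm x <= rh" for x by (auto simp: g_def indicator_def sgn_if)
 obtain pf where pf: "!!n. test_function (pf n)" "!!n x. \<bar>pf n x\<bar> <= 1 + 1"
  "!!n x. pf n x ~= 0 ==> norm x <= rh + 1" "AE x in lborel. (%n. pf n x) \<longlonglongrightarrow> g x"
  using bounded_measurable_limit_of_test_functions[of g 1 rh] g \<open>0 <= rh\<close> by auto
 note [measurable] = test_function_borel[OF pf(1)]
 have i: "integrable lborel (%x. k x * pf n x)" if "loc_int k" for k n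
  by (rule loc_int_mult_integrable[OF that, where M="1 + 1" and rh="rh + 1"]) (use pf in auto)
 have lF: "loc_int (%x. F (x + s *\<^sub>R e))" "loc_int F" "loc_int f" "loc_int (%x. f (x + s *\<^sub>R e))" for s
  by (rule loc_sq_int_imp_loc_int, rule loc_sq_int_shift, rule sq_int_imp_loc[OF F])
   (rule loc_sq_int_imp_loc_int, rule sq_int_imp_loc[OF F] f loc_sq_int_shift[OF f])+
 have "\<bar>LINT x|lborel. h x * pf n x\<bar> <= 2 * om * \<bar>t\<bar>" for n
 proof -
  have "\<bar>(LI x. f (x + t *\<^sub>R axis j 1) * pf n x) - (LI x. f x * pf n x)
    - t * (LI x. F x * pf n x)\<bar> <= 2 * om * \<bar>t\<bar>"
  proof (rule weak_deriv_increment_test[OF wd pf(1)])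
   fix s assume s: "\<bar>s\<bar> <= \<bar>t\<bar>"
   have lFd: "loc_int (%x. F (x + s *\<^sub>R e) - F x)"
    by (rule loc_sq_int_imp_loc_int, rule loc_sq_int_diff, rule loc_sq_int_shift) (rule sq_int_imp_loc[OF F])+
   have "(LI x. F (x + s *\<^sub>R e) * pf n x) - (LI x. F x * pf n x)
     = (LI x. (F (x + s *\<^sub>R e) - F x) * pf n x)"
    using i[OF lF(1)] i[OF lF(2)] by (simp add: left_diff_distrib)
   also have "\<bar>...\<bar> <= (LI x. \<bar>(F (x + s *\<^sub>R e) - F x) * pf n x\<bar>)"
    by (rule integral_abs_bound)
   also have "... <= (LI x. 2 * (indicator (cball 0 (rh + 1)) x * \<bar>F (x + s *\<^sub>R e) - F x\<bar>))"
   proof (rule integral_mono)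
    show "integrable lborel (%x. \<bar>(F (x + s *\<^sub>R e) - F x) * pf n x\<bar>)" using i[OF lFd] by simp
    have "integrable lborel (%x. \<bar>indicator (cball 0 (rh + 1)) x * (F (x + s *\<^sub>R e) - F x)\<bar>)"
     using lFd by (intro integrable_abs) (simp add: loc_int_def)
    then show "integrable lborel (%x. 2 * (indicator (cball 0 (rh + 1)) x * \<bar>F (x + s *\<^sub>R e) - F x\<bar>))"
     by (simp add: abs_mult)
    show "\<bar>(F (x + s *\<^sub>R e) - F x) * pf n x\<bar> <= 2 * (indicator (cball 0 (rh + 1)) x * \<bar>F (x + s *\<^sub>R e) - F x\<bar>)" for x
     using pf(2)[of n x] pf(3)[of n x]
     by (cases "pf n x = 0") (auto simp: abs_mult mult.commute indicator_def intro!: mult_right_mono)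
   qed
   also have "... <= 2 * om" using om[OF s] by (simp add: e_def)
   finally show "\<bar>(LI x. F (x + s *\<^sub>R axis j 1) * pf n x) - (LI x. F x * pf n x)\<bar> <= 2 * om"
    by (simp add: e_def)
  qed
  moreover have "(LI x. h x * pf n x) = (LI x. f (x + t *\<^sub>R e) * pf n x)
    - (LI x. f x * pf n x) - t * (LI x. F x * pf n x)"
   using i[OF lF(4)] i[OF lF(3)] i[OF lF(2)] unfolding h_def
   by (simp add: left_diff_distrib mult.assoc)
  ultimately show ?thesis by (simp add: e_def)
 qed
 moreover have "(%n. LINT x|lborel. h x * pf n x) \<longlonglongrightarrow> (LI x. h x * g x)"
  using pf by (intro integral_limit_of_test_functions[OF lh]) auto
 ultimately have "\<bar>LINT x|lborel. h x * g x\<bar> <= 2 * om * \<bar>t\<bar>"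
  by (intro Lim_bounded[OF tendsto_rabs]) auto
 moreover have "h x * g x = indicator (cball 0 rh) x * \<bar>h x\<bar>" for x
  by (auto simp: g_def indicator_def abs_sgn)
 ultimately show ?thesis by (simp add: h_def e_def)
qed

text \<open>Differentiability in the mean: the modulus of continuity of \<open>F\<close> under
  translation, measured in \<open>L^1\<close>, is exactly what bounds the Taylor remainder relative
  to \<open>t\<close>.\<close>

lemma weak_deriv_L1:
 assumes wd: "weak_deriv j f F" and "0 <= rh" "0 < et"
 obtains de where "0 < de" "!!t. \<bar>t\<bar> <= de ==>
  (LI x. indicator (cball 0 rh) x * \<bar>f (x + t *\<^sub>R axis j 1) - f x - t * F x\<bar>) <= et * \<bar>t\<bar>"
proof -
 define e :: "real^3" where "e = axis j 1"
 have ne: "norm e = 1" by (simp add: e_def)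
 have F: "sq_int F" using wd by (auto simp: weak_deriv_def)
 note [measurable] = sq_int_borel[OF F]
 have lF: "loc_int F" using F by (intro loc_sq_int_imp_loc_int sq_int_imp_loc)
 \<comment> \<open>The bound on the remainder looks at radius \<open>rh + 1\<close>, and shifts of
   length at most 1 enlarge the ball once more.\<close>
 define F1 where "F1 x = indicator (cball 0 (rh + 2)) x * F x" for x
 have F1: "integrable lborel F1" using lF by (simp add: F1_def[abs_def] loc_int_def)
 obtain de where de: "0 < de" "!!v. norm v <= de ==> (LI x. \<bar>F1 (x + v) - F1 x\<bar>) <= et / 2"
  using translation_continuous_L1[OF F1, of "et / 2"] \<open>0 < et\<close> by auto
 show ?thesis
 proof (rule that[of "min 1 de"])
  fix t :: real assume t: "\<bar>t\<bar> <= min 1 de"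
  have "(LI x. indicator (cball 0 rh) x * \<bar>f (x + t *\<^sub>R axis j 1) - f x - t * F x\<bar>) <= 2 * (et / 2) * \<bar>t\<bar>"
  proof (rule weak_deriv_increment_L1_bound[OF wd \<open>0 <= rh\<close>])
   fix s assume s: "\<bar>s\<bar> <= \<bar>t\<bar>"
   have "(LI x. indicator (cball 0 (rh + 1)) x * \<bar>F (x + s *\<^sub>R e) - F x\<bar>) <= (LI x. \<bar>F1 (x + s *\<^sub>R e) - F1 x\<bar>)"
   proof (rule integral_mono')
    show "integrable lborel (%x. \<bar>F1 (x + s *\<^sub>R e) - F1 x\<bar>)"
     using F1 by (intro integrable_abs Bochner_Integration.integrable_diff integrable_shift)
    show "indicator (cball 0 (rh + 1)) x * \<bar>F (x + s *\<^sub>R e) - F x\<bar> <= \<bar>F1 (x + s *\<^sub>R e) - F1 x\<bar>" for x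
     using norm_triangle_ineq[of x "s *\<^sub>R e"] ne s t by (auto simp: F1_def indicator_def)
   qed simp
   also have "... <= et / 2" using s t ne by (intro de) auto
   finally show "(LI x. indicator (cball 0 (rh + 1)) x * \<bar>F (x + s *\<^sub>R axis j 1) - F x\<bar>) <= et / 2"
    by (simp add: e_def)
  qed
  then show "(LI x. indicator (cball 0 rh) x * \<bar>f (x + t *\<^sub>R axis j 1) - f x - t * F x\<bar>) <= et * \<bar>t\<bar>" by simp
 qed (use de in auto)
qed

lemma loc_int_abs: "loc_int f ==> integrable lborel (%x. indicator (cball 0 rh) x * \<bar>f x\<bar>)"
proof -
 assume "loc_int f"
 then have "integrable lborel (%x. \<bar>indicator (cball 0 rh) x * f x\<bar>)"
  by (intro integrable_abs) (simp add: loc_int_def)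
 then show ?thesis by (simp add: abs_mult)
qed

lemma loc_sq_int_diffquot:
 assumes "loc_sq_int f" shows "loc_sq_int (%x. (f (x + v) - f x) / t)"
proof -
 have "loc_sq_int (%x. (1 / t) * (f (x + v) - f x))"
  by (rule loc_sq_int_cmult, rule loc_sq_int_diff, rule loc_sq_int_shift) (rule assms)+
 then show ?thesis by simp
qed

lemma weak_derivD: assumes "weak_deriv j f F"
 shows "loc_sq_int f" "sq_int F" "loc_int f" "loc_int F" "f \<in> bm" "F \<in> bm"
proof -
 show f: "loc_sq_int f" and F: "sq_int F" using assms by (auto simp: weak_deriv_def)
 show "loc_int f" "loc_int F"
  by (rule loc_sq_int_imp_loc_int[OF f], rule loc_sq_int_imp_loc_int[OF sq_int_imp_loc[OF F]])
 show "f \<in> bm" "F \<in> bm"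
  by (rule loc_sq_int_borel[OF f], rule sq_int_borel[OF F])
qed

text \<open>The \<open>L^1\<close> expansion pairs with bounded functions. Square integrable
  \<open>g\<close> are reached afterwards, once the quotients are known to be bounded in
  \<open>L^2\<close>.\<close>

lemma weak_deriv_diffquot_bounded:
 fixes X :: "nat => real"
 assumes wd: "weak_deriv j f F" and [measurable]: "g \<in> bm"
  and g: "!!x. \<bar>g x\<bar> <= M" "!!x. g x ~= 0 ==> norm x <= rh" and "0 <= rh"
  and X: "X \<longlonglongrightarrow> 0" "!!n. X n ~= 0"
 shows "(%n. LINT x|lborel. (f (x + X n *\<^sub>R axis j 1) - f x) / X n * g x) \<longlonglongrightarrow> (LI x. F x * g x)"
proof (rule LIMSEQ_I)
 fix r :: real assume "0 < r"
 note [measurable] = weak_derivD(5,6)[OF wd]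
 have M: "0 <= M" using g(1)[of 0] by linarith
 define et where "et = r / (2 * (M + 1))"
 have "0 < et" using \<open>0 < r\<close> M by (simp add: et_def)
 obtain de where de: "0 < de" "!!t. \<bar>t\<bar> <= de ==>
  (LI x. indicator (cball 0 rh) x * \<bar>f (x + t *\<^sub>R axis j 1) - f x - t * F x\<bar>) <= et * \<bar>t\<bar>"
  using weak_deriv_L1[OF wd \<open>0 <= rh\<close> \<open>0 < et\<close>] by blast
 have "\<forall>\<^sub>F n in sequentially. \<bar>X n\<bar> < de"
  using X(1) de(1) by (auto dest!: tendstoD[of _ _ _ de] simp: dist_real_def)
 then obtain N where N: "!!n. n \<ge> N ==> \<bar>X n\<bar> < de" by (auto simp: eventually_sequentially)
 have "norm ((LI x. (f (x + X n *\<^sub>R axis j 1) - f x) / X n * g x) - (LI x. F x * g x)) < r"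
  if n: "n \<ge> N" for n
 proof -
  define t where "t = X n"
  have t: "t ~= 0" "\<bar>t\<bar> <= de" using X N[OF n] by (auto simp: t_def)
  define h where "h = (%x. f (x + t *\<^sub>R axis j 1) - f x - t * F x)"
  have lh: "loc_int h"
   unfolding h_def
   by (rule loc_sq_int_imp_loc_int, rule loc_sq_int_diff, rule loc_sq_int_diff,
    rule loc_sq_int_shift[OF weak_derivD(1)[OF wd]], rule weak_derivD(1)[OF wd], rule loc_sq_int_cmult,
    rule sq_int_imp_loc[OF weak_derivD(2)[OF wd]])
  have ldq: "loc_int (%x. (f (x + t *\<^sub>R axis j 1) - f x) / t)"
   by (rule loc_sq_int_imp_loc_int, rule loc_sq_int_diffquot, rule weak_derivD(1)[OF wd])
  note i = loc_int_mult_integrable[where g=g and M=M and rh=rh, OF _ _ g(1) g(2)]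
  have "(LI x. (f (x + t *\<^sub>R axis j 1) - f x) / t * g x) - (LI x. F x * g x)
    = (LI x. (f (x + t *\<^sub>R axis j 1) - f x) / t * g x - F x * g x)"
   using Bochner_Integration.integral_diff[OF i[OF ldq] i[OF weak_derivD(4)[OF wd]]] by simp
  also have "... = (LI x. (1 / t) * (h x * g x))"
   using t by (intro Bochner_Integration.integral_cong) (auto simp: h_def field_simps)
  also have "... = (1 / t) * (LI x. h x * g x)" by simp
  also have "\<bar>...\<bar> <= (1 / \<bar>t\<bar>) * (M * (et * \<bar>t\<bar>))"
  proof -
   have "\<bar>LINT x|lborel. h x * g x\<bar> <= (LI x. \<bar>h x * g x\<bar>)" by (rule integral_abs_bound)
   also have "... <= (LI x. M * (indicator (cball 0 rh) x * \<bar>h x\<bar>))"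
   proof (rule integral_mono)
    show "integrable lborel (%x. \<bar>h x * g x\<bar>)" using i[OF lh] by simp
    show "integrable lborel (%x. M * (indicator (cball 0 rh) x * \<bar>h x\<bar>))" using loc_int_abs[OF lh] by simp
    show "\<bar>h x * g x\<bar> <= M * (indicator (cball 0 rh) x * \<bar>h x\<bar>)" for x
     using g(1)[of x] g(2)[of x] M by (cases "g x = 0") (auto simp: abs_mult intro!: abs_mult_le_bound)
   qed
   also have "... <= M * (et * \<bar>t\<bar>)" using de(2)[OF t(2)] M by (auto simp: h_def intro!: mult_left_mono)
   finally have "(1 / \<bar>t\<bar>) * \<bar>LINT x|lborel. h x * g x\<bar> <= (1 / \<bar>t\<bar>) * (M * (et * \<bar>t\<bar>))"
    by (rule mult_left_mono) simp
   then show ?thesis by (simp only: abs_mult abs_divide abs_one)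
  qed
  also have "... = M * et" using t by simp
  also have "... < r"
  proof -
   have "M * et <= (M + 1) * et" using \<open>0 < et\<close> by (intro mult_right_mono) auto
   also have "... = r / 2" using M by (simp add: et_def field_simps)
   finally show ?thesis using \<open>0 < r\<close> by linarith
  qed
  finally show ?thesis by (simp add: t_def)
 qed
 then show "\<exists>N. \<forall>n\<ge>N. norm ((LI x. (f (x + X n *\<^sub>R axis j 1) - f x) / X n * g x) - (LI x. F x * g x)) < r"
  by blast
qed

text \<open>Integration by parts against Lipschitz functions, of which only one directional
  derivative almost everywhere is required. The quotient is moved from \<open>f\<close> to
  \<open>pf\<close>, and the Lipschitz constant provides the majorant. A jump of \<open>pf\<close>
  across other directions is harmless.\<close>

lemma weak_deriv_lipschitz_test:
 assumes wd: "weak_deriv j f F" and [measurable]: "pf \<in> bm" "ps \<in> bm"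
  and pf: "!!x. \<bar>pf x\<bar> <= M" "!!x. pf x ~= 0 ==> norm x <= rh" and "0 <= rh"
  and lip: "!!x t. \<bar>pf (x + t *\<^sub>R axis j 1) - pf x\<bar> <= L * \<bar>t\<bar>"
  and der: "AE x in lborel. ((%t. pf (x + t *\<^sub>R axis j 1)) has_real_derivative ps x) (at 0)"
 shows "(LI x. f x * ps x) = - (LI x. F x * pf x)"
proof -
 define e :: "real^3" where "e = axis j 1"
 have ne: "norm e = 1" by (simp add: e_def)
 define X where "X n = inverse (real (Suc n))" for n
 have X: "X \<longlonglongrightarrow> 0" "!!n. X n ~= 0" "!!n. 0 < X n" "!!n. X n <= 1"
  unfolding X_def using LIMSEQ_inverse_real_of_nat by (auto simp: inverse_le_1_iff)
 note [measurable] = weak_derivD(5,6)[OF wd]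
 have L: "0 <= L" using lip[of 0 1] by linarith
 have supp: "norm x <= rh + 1" if "pf (x - X n *\<^sub>R e) ~= 0 \<or> pf x ~= 0" for x n
  using that pf(2)[of x] pf(2)[of "x - X n *\<^sub>R e"] norm_triangle_ineq[of "x - X n *\<^sub>R e" "X n *\<^sub>R e"] ne X(3,4)[of n] by auto
 have a1: "(%n. LINT x|lborel. (f (x + X n *\<^sub>R e) - f x) / X n * pf x) \<longlonglongrightarrow> (LI x. F x * pf x)"
  unfolding e_def by (rule weak_deriv_diffquot_bounded[OF wd _ pf \<open>0 <= rh\<close> X(1,2)]) auto
 have a2: "(LI x. (f (x + X n *\<^sub>R e) - f x) / X n * pf x)
   = (LI x. f x * ((pf (x - X n *\<^sub>R e) - pf x) / X n))" for n
 proof -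
  have i1: "integrable lborel (%x. f (x + X n *\<^sub>R e) * pf x)"
   by (rule loc_int_mult_integrable[where M=M and rh=rh], rule loc_sq_int_imp_loc_int, rule loc_sq_int_shift, rule weak_derivD(1)[OF wd])
    (use pf in auto)
  have i2: "integrable lborel (%x. f x * pf x)"
   by (rule loc_int_mult_integrable[where M=M and rh=rh, OF weak_derivD(3)[OF wd]]) (use pf in auto)
  have i3: "integrable lborel (%x. f x * pf (x - X n *\<^sub>R e))"
   by (rule loc_int_mult_integrable[where M=M and rh="rh + 1", OF weak_derivD(3)[OF wd]]) (use pf supp in auto)
  have sh: "(LI x. f (x + X n *\<^sub>R e) * pf x) = (LI x. f x * pf (x - X n *\<^sub>R e))"
   using integral_shift[of "%x. f x * pf (x - X n *\<^sub>R e)" "X n *\<^sub>R e"] by simp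
  have "(LI x. (f (x + X n *\<^sub>R e) - f x) / X n * pf x)
    = (LI x. (f (x + X n *\<^sub>R e) * pf x - f x * pf x) / X n)"
   by (intro Bochner_Integration.integral_cong) (auto simp: field_simps)
  also have "... = (LI x. f (x + X n *\<^sub>R e) * pf x - f x * pf x) / X n"
   by (rule integral_divide_zero)
  also have "... = (LI x. f x * pf (x - X n *\<^sub>R e) - f x * pf x) / X n"
   by (simp only: Bochner_Integration.integral_diff[OF i1 i2] Bochner_Integration.integral_diff[OF i3 i2] sh)
  also have "... = (LI x. (f x * pf (x - X n *\<^sub>R e) - f x * pf x) / X n)"
   by (rule integral_divide_zero[symmetric])
  also have "... = (LI x. f x * ((pf (x - X n *\<^sub>R e) - pf x) / X n))"
   by (intro Bochner_Integration.integral_cong) (auto simp: field_simps)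
  finally show ?thesis .
 qed
 have "(%n. LINT x|lborel. f x * ((pf (x - X n *\<^sub>R e) - pf x) / X n)) \<longlonglongrightarrow> (LI x. f x * - ps x)"
 proof (rule integral_dominated_convergence[where w="%x. L * (indicator (cball 0 (rh + 1)) x * \<bar>f x\<bar>)"])
  show "integrable lborel (%x. L * (indicator (cball 0 (rh + 1)) x * \<bar>f x\<bar>))"
   using loc_int_abs[OF weak_derivD(3)[OF wd]] by simp
  show "AE x in lborel. (%n. f x * ((pf (x - X n *\<^sub>R e) - pf x) / X n)) \<longlonglongrightarrow> f x * - ps x"
   using der
  proof eventually_elim
   case (elim x)
   \<comment> \<open>Moving the quotient to the other factor reverses the shift, so the derivative
     is taken along the negative sequence.\<close>
   have "(%n. - X n) \<longlonglongrightarrow> 0" using tendsto_minus[OF X(1)] by simp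
   then have "(%n. (pf (x + (- X n) *\<^sub>R e) - pf x) / (- X n)) \<longlonglongrightarrow> ps x"
    using elim X(2) unfolding has_field_derivative_iff tendsto_at_iff_sequentially e_def[symmetric]
    by (auto simp: o_def dest!: spec[of _ "%n. - X n"])
   then have "(%n. - ((pf (x + (- X n) *\<^sub>R e) - pf x) / (- X n))) \<longlonglongrightarrow> - ps x" by (rule tendsto_minus)
   then have "(%n. (pf (x - X n *\<^sub>R e) - pf x) / X n) \<longlonglongrightarrow> - ps x" by simp
   then show ?case by (rule tendsto_mult_left)
  qed
  have "\<bar>f x * ((pf (x - X n *\<^sub>R e) - pf x) / X n)\<bar> <= L * (indicator (cball 0 (rh + 1)) x * \<bar>f x\<bar>)" for n x
  proof (cases "norm x <= rh + 1")
   case True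
   have "\<bar>(pf (x - X n *\<^sub>R e) - pf x) / X n\<bar> <= L"
    using lip[of x "- X n"] X(3)[of n] by (simp add: divide_le_eq e_def)
   from abs_mult_le_bound[OF this, of "f x"] show ?thesis using True by (simp add: abs_mult)
  next
   case False
   then have "pf (x - X n *\<^sub>R e) = 0" "pf x = 0" using supp by blast+
   then show ?thesis using L by simp
  qed
  then show "AE x in lborel. norm (f x * ((pf (x - X n *\<^sub>R e) - pf x) / X n)) <= L * (indicator (cball 0 (rh + 1)) x * \<bar>f x\<bar>)" for n
   by simp
 qed measurable
 then have "(%n. LINT x|lborel. (f (x + X n *\<^sub>R e) - f x) / X n * pf x) \<longlonglongrightarrow> (LI x. f x * - ps x)"
  by (simp only: a2)
 from LIMSEQ_unique[OF a1 this] have "(LI x. F x * pf x) = (LI x. f x * - ps x)" .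
 then show ?thesis by simp
qed

text \<open>Duality once more, with Cauchy-Schwarz in additive form, which passes to limits of test
  functions. Inserting truncations of the increment itself produces half of their square on the
  right, which is absorbed on the left.\<close>

lemma weak_deriv_L2:
 assumes wd: "weak_deriv j f F" and "0 <= rh"
 shows "(LI x. indicator (cball 0 rh) x * (f (x + t *\<^sub>R axis j 1) - f x)^2) <= t^2 * (LI x. (F x)^2)"
proof (cases "t = 0")
 case False
 define e :: "real^3" where "e = axis j 1"
 note [measurable] = weak_derivD(5,6)[OF wd]
 define A where "A = (LI x. (F x)^2)"
 define D where "D = (%x. f (x + t *\<^sub>R e) - f x)"
 have lsD: "loc_sq_int D" unfolding D_def
  by (rule loc_sq_int_diff, rule loc_sq_int_shift) (rule weak_derivD(1)[OF wd])+
 have lD: "loc_int D" by (rule loc_sq_int_imp_loc_int[OF lsD])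
 have [measurable]: "D \<in> bm" by (rule loc_int_borel[OF lD])
 have l1: "loc_int (%x. 1)" by (simp add: loc_int_def)
 have test: "(LI x. D x * pf x) <= t^2 / 2 * A + 1 / 2 * (LI x. 1 * (pf x)^2)"
  if pf: "test_function pf" "!!x. \<bar>pf x\<bar> <= M" "!!x. pf x ~= 0 ==> norm x <= rh'" for pf M rh'
 proof -
  note [measurable] = test_function_borel[OF pf(1)]
  have M: "0 <= M" using pf(2)[of 0] by linarith
  have spf: "integrable lborel (%x. (pf x)^2)"
   by (rule integrable_bounded_support[where M="M^2" and rh=rh'])
    (use pf M in \<open>auto simp: abs_le_square_iff[symmetric]\<close>)
  have "\<bar>(LI x. f (x + t *\<^sub>R axis j 1) * pf x) - (LI x. f x * pf x) - t * 0\<bar>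
    <= (\<bar>t\<bar> / 2 * A + 1 / (2 * \<bar>t\<bar>) * (LI x. (pf x)^2)) * \<bar>t\<bar>"
  proof (rule weak_deriv_increment_test[OF wd pf(1)])
   fix s :: real
   have sF: "sq_int (%x. F (x + s *\<^sub>R e))" by (rule sq_int_shift[OF weak_derivD(2)[OF wd]])
   have "\<bar>LINT x|lborel. F (x + s *\<^sub>R e) * pf x\<bar> <= (LI x. \<bar>F (x + s *\<^sub>R e) * pf x\<bar>)"
    by (rule integral_abs_bound)
   also have "... <= (LI x. \<bar>t\<bar> / 2 * (F (x + s *\<^sub>R e))^2 + 1 / (2 * \<bar>t\<bar>) * (pf x)^2)"
   proof (rule integral_mono)
    show "integrable lborel (%x. \<bar>F (x + s *\<^sub>R e) * pf x\<bar>)"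
     by (intro integrable_abs sq_int_mult_integrable sF) (use spf in \<open>auto simp: sq_int_def\<close>)
    show "integrable lborel (%x. \<bar>t\<bar> / 2 * (F (x + s *\<^sub>R e))^2 + 1 / (2 * \<bar>t\<bar>) * (pf x)^2)"
     using spf sF by (intro Bochner_Integration.integrable_add integrable_mult_right) (auto simp: sq_int_def)
    show "\<bar>F (x + s *\<^sub>R e) * pf x\<bar> <= \<bar>t\<bar> / 2 * (F (x + s *\<^sub>R e))^2 + 1 / (2 * \<bar>t\<bar>) * (pf x)^2" for x
     using False by (intro weighted_mult_abs_le) auto
   qed
   also have "... = (LI x. \<bar>t\<bar> / 2 * (F (x + s *\<^sub>R e))^2) + (LI x. 1 / (2 * \<bar>t\<bar>) * (pf x)^2)"
    using spf sF by (intro Bochner_Integration.integral_add integrable_mult_right) (auto simp: sq_int_def)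
   also have "... = \<bar>t\<bar> / 2 * (LI x. (F (x + s *\<^sub>R e))^2) + 1 / (2 * \<bar>t\<bar>) * (LI x. (pf x)^2)"
    by (simp only: integral_mult_right_zero)
   also have "(LI x. (F (x + s *\<^sub>R e))^2) = A"
    unfolding A_def by (rule integral_shift[of "%x. (F x)^2"]) measurable
   finally show "\<bar>(LI x. F (x + s *\<^sub>R axis j 1) * pf x) - 0\<bar>
     <= \<bar>t\<bar> / 2 * A + 1 / (2 * \<bar>t\<bar>) * (LI x. (pf x)^2)" by (simp add: e_def)
  qed
  moreover have "(LI x. D x * pf x) = (LI x. f (x + t *\<^sub>R e) * pf x) - (LI x. f x * pf x)"
  proof -
   have "integrable lborel (%x. f (x + t *\<^sub>R e) * pf x)"
    by (rule loc_int_mult_integrable[where M=M and rh=rh'], rule loc_sq_int_imp_loc_int, rule loc_sq_int_shift, rule weak_derivD(1)[OF wd])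
     (use pf in auto)
   moreover have "integrable lborel (%x. f x * pf x)"
    by (rule loc_int_mult_integrable[where M=M and rh=rh', OF weak_derivD(3)[OF wd]]) (use pf in auto)
   ultimately show ?thesis by (simp only: D_def left_diff_distrib Bochner_Integration.integral_diff)
  qed
  moreover have "(\<bar>t\<bar> / 2 * A + 1 / (2 * \<bar>t\<bar>) * (LI x. (pf x)^2)) * \<bar>t\<bar>
    = t^2 / 2 * A + 1 / 2 * (LI x. 1 * (pf x)^2)"
  proof -
   have "(s / 2 * A + 1 / (2 * s) * B) * s = s^2 / 2 * A + 1 / 2 * (1 * B)" if "s > 0" for s B
    using that by (simp add: field_simps power2_eq_square)
   from this[of "\<bar>t\<bar>" "LINT x|lborel. (pf x)^2"] False show ?thesis by (simp only: power2_abs) simp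
  qed
  ultimately show ?thesis by (simp add: e_def)
 qed
 have bd: "(LI x. D x * g x) <= t^2 / 2 * A + 1 / 2 * (LI x. (g x)^2)"
  if [measurable]: "g \<in> bm" and g: "!!x. \<bar>g x\<bar> <= M" "!!x. g x ~= 0 ==> norm x <= rh" for g M
 proof -
  obtain pf where pf: "!!n. test_function (pf n)" "!!n x. \<bar>pf n x\<bar> <= M + 1"
   "!!n x. pf n x ~= 0 ==> norm x <= rh + 1" "AE x in lborel. (%n. pf n x) \<longlonglongrightarrow> g x"
   using bounded_measurable_limit_of_test_functions[of g M rh] g \<open>0 <= rh\<close> by auto
  note [measurable] = test_function_borel[OF pf(1)]
  have M: "0 <= M" using g(1)[of 0] by linarith
  have "(%n. LINT x|lborel. D x * pf n x) \<longlonglongrightarrow> (LI x. D x * g x)"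
   using pf by (intro integral_limit_of_test_functions[OF lD]) auto
  moreover have "(%n. LINT x|lborel. 1 * (pf n x)^2) \<longlonglongrightarrow> (LI x. 1 * (g x)^2)"
  proof (rule integral_limit_of_test_functions[OF l1, where M="(M + 1)^2" and rh="rh + 1"])
   show "\<bar>(pf n x)^2\<bar> <= (M + 1)^2" for n x using pf(2)[of n x] M by (simp add: abs_le_square_iff[symmetric])
   show "AE x in lborel. (%n. (pf n x)^2) \<longlonglongrightarrow> (g x)^2"
    using pf(4) by eventually_elim (rule tendsto_power)
  qed (use pf(3) in auto)
  ultimately have "(LI x. D x * g x) <= t^2 / 2 * A + 1 / 2 * (LI x. 1 * (g x)^2)"
   by (intro LIMSEQ_le[OF _ tendsto_add[OF tendsto_const tendsto_mult[OF tendsto_const]]])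
    (auto intro!: exI[of _ 0] test[OF pf(1) pf(2) pf(3), simplified])
  then show ?thesis by simp
 qed
 \<comment> \<open>Truncation makes the increment an admissible bounded function. It shrinks values
   towards zero without changing sign, so its square is at most its product with
   \<open>D\<close>.\<close>
 define g where "g n x = indicator (cball 0 rh) x * max (- real n) (min (real n) (D x))" for n x
 have [measurable]: "g n \<in> bm" for n unfolding g_def by measurable
 have gb: "\<bar>g n x\<bar> <= real n" "g n x ~= 0 ==> norm x <= rh" for n x by (auto simp: g_def indicator_def)
 have gD: "(g n x)^2 <= D x * g n x" "(g n x)^2 <= indicator (cball 0 rh) x * (D x)^2" for n x
 proof -
  have c: "y^2 <= d * y" "y^2 <= d^2" if "y = max (- real n) (min (real n) d)" for y d :: real
  proof -
   have y: "0 <= y \<and> y <= d \<or> y <= 0 \<and> d <= y" using that by (auto simp: max_def min_def)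
   then show "y^2 <= d * y" by (auto simp: power2_eq_square intro: mult_right_mono mult_right_mono_neg)
   show "y^2 <= d^2" using y by (auto simp: abs_le_square_iff[symmetric])
  qed
  show "(g n x)^2 <= D x * g n x" "(g n x)^2 <= indicator (cball 0 rh) x * (D x)^2"
   using c[OF refl, of "D x"] by (auto simp: g_def indicator_def)
 qed
 have iD: "integrable lborel (%x. indicator (cball 0 rh) x * (D x)^2)" using lsD by (simp add: loc_sq_int_def)
 have "(LI x. (g n x)^2) <= t^2 * A" for n
 proof -
  have "(LI x. (g n x)^2) <= (LI x. D x * g n x)"
  proof (rule integral_mono)
   show "integrable lborel (%x. (g n x)^2)"
    by (rule Bochner_Integration.integrable_bound[OF iD]) (use gD in auto)
   show "integrable lborel (%x. D x * g n x)"
    by (rule loc_int_mult_integrable[OF lD _ gb]) auto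
  qed (rule gD)
  also have "... <= t^2 / 2 * A + 1 / 2 * (LI x. (g n x)^2)" by (rule bd[OF _ gb]) auto
  finally show ?thesis by simp
 qed
 moreover have "(%n. LINT x|lborel. (g n x)^2) \<longlonglongrightarrow> (LI x. indicator (cball 0 rh) x * (D x)^2)"
 proof (rule integral_dominated_convergence[OF _ _ iD])
  show "AE x in lborel. (%n. (g n x)^2) \<longlonglongrightarrow> indicator (cball 0 rh) x * (D x)^2"
  proof (rule AE_I2)
   fix x
   obtain N :: nat where N: "\<bar>D x\<bar> <= real N" using real_arch_simple by blast
   have "(g n x)^2 = indicator (cball 0 rh) x * (D x)^2" if "n \<ge> N" for n
   proof -
    have "\<bar>D x\<bar> <= real n" using N that by linarith
    then have "max (- real n) (min (real n) (D x)) = D x" by (auto simp: max_def min_def abs_le_iff)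
    then show ?thesis by (simp add: g_def indicator_def)
   qed
   then show "(%n. (g n x)^2) \<longlonglongrightarrow> indicator (cball 0 rh) x * (D x)^2"
    by (intro tendsto_eventually) (auto simp: eventually_sequentially)
  qed
 qed (use gD in auto)
 ultimately show ?thesis
  unfolding A_def D_def e_def by (intro Lim_bounded) auto
qed simp

text \<open>\<open>g\<close> is split into a bounded part, for which convergence is known, and a
  rest small in \<open>L^2\<close>, against which the quotients stay bounded uniformly in
  \<open>n\<close>.\<close>

lemma weak_deriv_diffquot_L2:
 fixes X :: "nat => real"
 assumes wd: "weak_deriv j f F" and g: "sq_int g" "!!x. g x ~= 0 ==> norm x <= rh" and "0 <= rh"
  and X: "X \<longlonglongrightarrow> 0" "!!n. X n ~= 0"
 shows "(%n. LINT x|lborel. (f (x + X n *\<^sub>R axis j 1) - f x) / X n * g x) \<longlonglongrightarrow> (LI x. F x * g x)"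
proof (rule LIMSEQ_I)
 fix r :: real assume "0 < r"
 define e :: "real^3" where "e = axis j 1"
 note [measurable] = weak_derivD(5,6)[OF wd] sq_int_borel[OF g(1)]
 define A where "A = (LI x. (F x)^2) + 1"
 have A: "0 < A" unfolding A_def by (intro add_nonneg_pos) auto
 \<comment> \<open>Weight for Young's inequality: the two resulting terms,
   \<open>kp / 2 * (4 * A)\<close> and \<open>1 / (2 * kp) * (kp * r / 2)\<close>, are
   \<open>r / 4\<close> each.\<close>
 define kp where "kp = r / (8 * A)"
 have kp: "0 < kp" using A \<open>0 < r\<close> by (simp add: kp_def)
 define c where "c k x = max (- real k) (min (real k) (g x))" for k x
 have [measurable]: "c k \<in> bm" for k unfolding c_def by measurable
 have cb: "\<bar>c k x\<bar> <= real k" "\<bar>c k x\<bar> <= \<bar>g x\<bar>" "\<bar>g x - c k x\<bar> <= \<bar>g x\<bar>" for k x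
  by (auto simp: c_def max_def min_def)
 have cs: "c k x ~= 0 ==> norm x <= rh" for k x using cb(2)[of k x] g(2)[of x] by auto
 have "(%k. LINT x|lborel. (g x - c k x)^2) \<longlonglongrightarrow> (LINT x|(lborel :: (real^3) measure). 0)"
 proof (rule integral_dominated_convergence[where w="%x. (g x)^2"])
  show "AE x in lborel. (%k. (g x - c k x)^2) \<longlonglongrightarrow> 0"
  proof (rule AE_I2)
   fix x
   obtain N :: nat where N: "\<bar>g x\<bar> <= real N" using real_arch_simple by blast
   have "(g x - c n x)^2 = 0" if "n \<ge> N" for n
   proof -
    have "\<bar>g x\<bar> <= real n" using N that by linarith
    then show ?thesis by (auto simp: c_def max_def min_def abs_le_iff)
   qed
   then show "(%n. (g x - c n x)^2) \<longlonglongrightarrow> 0"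
    by (intro tendsto_eventually) (auto simp: eventually_sequentially)
  qed
  show "AE x in lborel. norm ((g x - c k x)^2) <= (g x)^2" for k
   using cb(3)[of _ k] by (auto simp: abs_le_square_iff)
 qed (use g(1) in \<open>auto simp: sq_int_def\<close>)
 moreover have "0 < kp * r / 2" using kp \<open>0 < r\<close> by simp
 ultimately have "\<forall>\<^sub>F k in sequentially. (LI x. (g x - c k x)^2) < kp * r / 2"
  by (intro order_tendstoD) auto
 then obtain k where k: "(LI x. (g x - c k x)^2) < kp * r / 2"
  using eventually_happens by force
 have sc: "sq_int (c k)" by (rule sq_int_bound[OF g(1) _ cb(2)]) measurable
 have sgc: "sq_int (%x. g x - c k x)" by (rule sq_int_diff[OF g(1) sc])
 have gcs: "g x - c k x ~= 0 ==> norm x <= rh" for x using g(2)[of x] cs[of k x] by (cases "g x = 0"; cases "c k x = 0") auto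
 have "(%n. LINT x|lborel. (f (x + X n *\<^sub>R axis j 1) - f x) / X n * c k x) \<longlonglongrightarrow> (LI x. F x * c k x)"
  by (rule weak_deriv_diffquot_bounded[OF wd _ cb(1) cs \<open>0 <= rh\<close> X]) auto
 from LIMSEQ_D[OF this, of "r / 2"] \<open>0 < r\<close> obtain N where
  N: "!!n. n \<ge> N ==> \<bar>(LI x. (f (x + X n *\<^sub>R e) - f x) / X n * c k x) - (LI x. F x * c k x)\<bar> < r / 2"
  by (auto simp: e_def)
 have "norm ((LI x. (f (x + X n *\<^sub>R e) - f x) / X n * g x) - (LI x. F x * g x)) < r"
  if n: "n \<ge> N" for n
 proof -
  define q where "q = (%x. (f (x + X n *\<^sub>R e) - f x) / X n)"
  have lq: "loc_sq_int q" unfolding q_def by (rule loc_sq_int_diffquot[OF weak_derivD(1)[OF wd]])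
  have [measurable]: "q \<in> bm" by (rule loc_sq_int_borel[OF lq])
  define h where "h = (%x. q x - F x)"
  have lh: "loc_sq_int h" unfolding h_def by (rule loc_sq_int_diff[OF lq sq_int_imp_loc[OF weak_derivD(2)[OF wd]]])
  have iq: "integrable lborel (%x. indicator (cball 0 rh) x * (q x)^2)"
   and ih: "integrable lborel (%x. indicator (cball 0 rh) x * (h x)^2)" using lq lh by (auto simp: loc_sq_int_def)
  have iF: "integrable lborel (%x. (F x)^2)" using weak_derivD(2)[OF wd] by (simp add: sq_int_def)
  have "(LI x. indicator (cball 0 rh) x * (q x)^2)
    = (LI x. indicator (cball 0 rh) x * (f (x + X n *\<^sub>R e) - f x)^2) / (X n)^2"
   by (simp add: q_def power_divide flip: integral_divide_zero)
  also have "... <= A"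
   using weak_deriv_L2[OF wd \<open>0 <= rh\<close>, of "X n"] X(2)[of n] by (auto simp: A_def e_def divide_le_eq algebra_simps intro: add_increasing)
  finally have q2: "(LI x. indicator (cball 0 rh) x * (q x)^2) <= A" .
  have "(LI x. indicator (cball 0 rh) x * (h x)^2)
    <= (LI x. 2 * (indicator (cball 0 rh) x * (q x)^2) + 2 * (F x)^2)"
  proof (rule integral_mono[OF ih])
   show "integrable lborel (%x. 2 * (indicator (cball 0 rh) x * (q x)^2) + 2 * (F x)^2)"
    using iq iF by (intro Bochner_Integration.integrable_add integrable_mult_right)
   have "(a - b)^2 <= 2 * a^2 + 2 * b^2" for a b :: real
    using zero_le_power2[of "a + b"] by (simp add: power2_diff power2_sum)
   then show "indicator (cball 0 rh) x * (h x)^2 <= 2 * (indicator (cball 0 rh) x * (q x)^2) + 2 * (F x)^2" for x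
    by (auto simp: h_def indicator_def)
  qed
  also have "... = 2 * (LI x. indicator (cball 0 rh) x * (q x)^2) + 2 * (LI x. (F x)^2)"
   using iq iF by (subst Bochner_Integration.integral_add) auto
  also have "... <= 4 * A" using q2 by (simp add: A_def)
  finally have h2: "(LI x. indicator (cball 0 rh) x * (h x)^2) <= 4 * A" .
  have "\<bar>LINT x|lborel. h x * (g x - c k x)\<bar> <= (LI x. \<bar>h x * (g x - c k x)\<bar>)" by (rule integral_abs_bound)
  also have "... <= (LI x. kp / 2 * (indicator (cball 0 rh) x * (h x)^2) + 1 / (2 * kp) * (g x - c k x)^2)"
  proof (rule integral_mono)
   show "integrable lborel (%x. \<bar>h x * (g x - c k x)\<bar>)"
    by (intro integrable_abs loc_sq_int_mult_integrable[OF lh sgc gcs])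
   show "integrable lborel (%x. kp / 2 * (indicator (cball 0 rh) x * (h x)^2) + 1 / (2 * kp) * (g x - c k x)^2)"
    using ih sgc by (intro Bochner_Integration.integrable_add integrable_mult_right) (auto simp: sq_int_def)
   show "\<bar>h x * (g x - c k x)\<bar> <= kp / 2 * (indicator (cball 0 rh) x * (h x)^2) + 1 / (2 * kp) * (g x - c k x)^2" for x
    using weighted_mult_abs_le[OF kp, of "h x" "g x - c k x"] gcs[of x] by (cases "g x - c k x = 0") (auto simp: indicator_def kp less_imp_le)
  qed
  also have "... = kp / 2 * (LI x. indicator (cball 0 rh) x * (h x)^2) + 1 / (2 * kp) * (LI x. (g x - c k x)^2)"
   using ih sgc by (subst Bochner_Integration.integral_add) (auto simp: sq_int_def)
  also have "... <= kp / 2 * (4 * A) + 1 / (2 * kp) * (kp * r / 2)"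
   using h2 k kp by (intro add_mono mult_left_mono) auto
  also have "... = r / 2" using A kp by (simp add: kp_def)
  finally have 1: "\<bar>LINT x|lborel. h x * (g x - c k x)\<bar> <= r / 2" .
  have iqc: "integrable lborel (%x. q x * c k x)"
   by (rule loc_sq_int_mult_integrable[where rh=rh, OF lq sc]) (rule cs)
  have iqg: "integrable lborel (%x. q x * g x)"
   by (rule loc_sq_int_mult_integrable[where rh=rh, OF lq g(1)]) (rule g(2))
  have iFc: "integrable lborel (%x. F x * c k x)" and iFg: "integrable lborel (%x. F x * g x)"
   using sq_int_mult_integrable[OF weak_derivD(2)[OF wd] sc] sq_int_mult_integrable[OF weak_derivD(2)[OF wd] g(1)] by blast+
  have "(LI x. h x * (g x - c k x)) = (LI x. (q x * g x - F x * g x) - (q x * c k x - F x * c k x))"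
   by (intro Bochner_Integration.integral_cong) (auto simp: h_def algebra_simps)
  also have "... = ((LI x. q x * g x) - (LI x. F x * g x)) - ((LI x. q x * c k x) - (LI x. F x * c k x))"
   using iqc iqg iFc iFg by (simp add: Bochner_Integration.integral_diff)
  finally have 2: "(LI x. h x * (g x - c k x)) = ((LI x. q x * g x) - (LI x. F x * g x)) - ((LI x. q x * c k x) - (LI x. F x * c k x))" .
  have "\<bar>(LI x. q x * g x) - (LI x. F x * g x)\<bar> < r"
  proof -
   have "\<bar>(LI x. q x * c k x) - (LI x. F x * c k x)\<bar> < r / 2"
    using N[OF n] by (simp add: q_def)
   then show ?thesis using 1 2 by linarith
  qed
  then show ?thesis by (simp add: q_def)
 qed
 then show "\<exists>N. \<forall>n\<ge>N. norm ((LI x. (f (x + X n *\<^sub>R axis j 1) - f x) / X n * g x) - (LI x. F x * g x)) < r"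
  unfolding e_def by blast
qed

text \<open>If a point and its shift by \<open>t\<close> both lie in \<open>A\<close>, the increment
  of \<open>f\<close> vanishes and \<open>t * F\<close> equals the Taylor remainder up to sign,
  which is small compared with \<open>t\<close> in the mean. The points of \<open>A\<close> that are
  shifted out of \<open>A\<close> carry little of \<open>F\<close>, because translations are
  continuous in \<open>L^1\<close>.\<close>

lemma weak_deriv_zero_on_level_set:
 assumes wd: "weak_deriv j f F" and [measurable]: "A \<in> sets borel"
  and const: "AE x in lborel. x \<in> A --> f x = c"
 shows "AE x in lborel. x \<in> A --> F x = 0"
proof -
 define e :: "real^3" where "e = axis j 1"
 have ne: "norm e = 1" by (simp add: e_def)
 note [measurable] = weak_derivD(5,6)[OF wd]
 have "AE x in lborel. x \<in> A \<and> norm x <= real n --> F x = 0" for n :: nat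
 proof -
  define F1 where "F1 x = indicator (cball 0 (real n)) x * (indicator A x * \<bar>F x\<bar>)" for x
  have [measurable]: "F1 \<in> bm" unfolding F1_def by measurable
  have iF: "integrable lborel (%x. indicator (cball 0 (real n)) x * \<bar>F x\<bar>)"
   by (rule loc_int_abs[OF weak_derivD(4)[OF wd]])
  have iF1: "integrable lborel F1"
   by (rule Bochner_Integration.integrable_bound[OF iF]) (auto simp: F1_def indicator_def)
  have F1nn: "0 <= F1 x" for x by (simp add: F1_def)
  have "(LI x. F1 x) <= 0 + r" if r: "0 < r" for r
  proof -
   obtain de1 where de1: "0 < de1" "!!t. \<bar>t\<bar> <= de1 ==>
    (LI x. indicator (cball 0 (real n)) x * \<bar>f (x + t *\<^sub>R axis j 1) - f x - t * F x\<bar>) <= r / 2 * \<bar>t\<bar>"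
    using weak_deriv_L1[OF wd, of "real n" "r / 2"] r by auto
   obtain de2 where de2: "0 < de2" "!!v. norm v <= de2 ==> (LI x. \<bar>F1 (x + v) - F1 x\<bar>) <= r / 2"
    using translation_continuous_L1[OF iF1, of "r / 2"] r by auto
   define t where "t = min de1 de2"
   have t: "0 < t" "\<bar>t\<bar> <= de1" "norm (t *\<^sub>R e) <= de2" using de1(1) de2(1) ne by (auto simp: t_def)
   define h where "h = (%x. f (x + t *\<^sub>R axis j 1) - f x - t * F x)"
   have lh: "loc_int h"
    unfolding h_def
    by (rule loc_sq_int_imp_loc_int, rule loc_sq_int_diff, rule loc_sq_int_diff,
     rule loc_sq_int_shift[OF weak_derivD(1)[OF wd]], rule weak_derivD(1)[OF wd], rule loc_sq_int_cmult,
     rule sq_int_imp_loc[OF weak_derivD(2)[OF wd]])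
   have i1: "integrable lborel (%x. F1 x * indicator A (x + t *\<^sub>R e))"
    by (rule Bochner_Integration.integrable_bound[OF iF1]) (auto simp: indicator_def F1nn)
   have i2: "integrable lborel (%x. F1 x * (1 - indicator A (x + t *\<^sub>R e)))"
    by (rule Bochner_Integration.integrable_bound[OF iF1]) (auto simp: indicator_def F1nn)
   have "t * (LI x. F1 x * indicator A (x + t *\<^sub>R e)) = (LI x. t * (F1 x * indicator A (x + t *\<^sub>R e)))"
    by simp
   also have "... <= (LI x. indicator (cball 0 (real n)) x * \<bar>h x\<bar>)"
   proof (rule integral_mono_AE)
    show "integrable lborel (%x. t * (F1 x * indicator A (x + t *\<^sub>R e)))" using i1 by simp
    show "integrable lborel (%x. indicator (cball 0 (real n)) x * \<bar>h x\<bar>)" by (rule loc_int_abs[OF lh])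
    show "AE x in lborel. t * (F1 x * indicator A (x + t *\<^sub>R e)) <= indicator (cball 0 (real n)) x * \<bar>h x\<bar>"
     using const AE_shift[OF const, of "t *\<^sub>R e"]
    proof eventually_elim
     case (elim x)
     then show ?case using t(1) by (auto simp: F1_def h_def e_def indicator_def abs_mult)
    qed
   qed
   also have "... <= r / 2 * t" using de1(2)[OF t(2)] t(1) by (simp add: h_def)
   finally have "t * (LI x. F1 x * indicator A (x + t *\<^sub>R e)) <= t * (r / 2)" by (simp only: mult.commute)
   then have 1: "(LI x. F1 x * indicator A (x + t *\<^sub>R e)) <= r / 2" using t(1) mult_le_cancel_left_pos by blast
   \<comment> \<open>Where the shifted point leaves \<open>A\<close>, \<open>F1\<close> is zero
     there, so the mass lost is part of the translation difference of \<open>F1\<close>.\<close>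
   have "(LI x. F1 x * (1 - indicator A (x + t *\<^sub>R e))) <= (LI x. \<bar>F1 (x + t *\<^sub>R e) - F1 x\<bar>)"
   proof (rule integral_mono[OF i2])
    show "integrable lborel (%x. \<bar>F1 (x + t *\<^sub>R e) - F1 x\<bar>)"
     by (rule integrable_abs, rule Bochner_Integration.integrable_diff, rule integrable_shift) (rule iF1)+
    show "F1 x * (1 - indicator A (x + t *\<^sub>R e)) <= \<bar>F1 (x + t *\<^sub>R e) - F1 x\<bar>" for x
     using F1nn[of x] by (cases "x + t *\<^sub>R e \<in> A") (auto simp: F1_def)
   qed
   also have "... <= r / 2" by (rule de2(2)[OF t(3)])
   finally have 2: "(LI x. F1 x * (1 - indicator A (x + t *\<^sub>R e))) <= r / 2" .
   have "(LI x. F1 x) = (LI x. F1 x * indicator A (x + t *\<^sub>R e) + F1 x * (1 - indicator A (x + t *\<^sub>R e)))"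
    by (simp add: algebra_simps)
   also have "... = (LI x. F1 x * indicator A (x + t *\<^sub>R e)) + (LI x. F1 x * (1 - indicator A (x + t *\<^sub>R e)))"
    by (rule Bochner_Integration.integral_add[OF i1 i2])
   finally show ?thesis using 1 2 by linarith
  qed
  then have "(LI x. F1 x) <= 0" using field_le_epsilon by blast
  moreover have "0 <= (LI x. F1 x)" using F1nn by simp
  ultimately have "(LI x. F1 x) = 0" by linarith
  then have "AE x in lborel. F1 x = 0"
   using integral_nonneg_eq_0_iff_AE[OF iF1] F1nn by auto
  then show ?thesis by eventually_elim (auto simp: F1_def indicator_def split: if_splits)
 qed
 then have "AE x in lborel. \<forall>n::nat. x \<in> A \<and> norm x <= real n --> F x = 0"
  unfolding AE_all_countable by blast
 then show ?thesis by eventually_elim (use real_arch_simple in blast)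
qed

text \<open>Difference quotients in two directions can be exchanged exactly by shifting the
  integration variable. The two step sizes then tend to zero one after the other, and no second
  derivative ever appears.\<close>

lemma mixed_weak_derivs_bounded_support:
 assumes wd: "weak_deriv i a Ai" "weak_deriv j a Aj" "weak_deriv i b Bi" "weak_deriv j b Bj"
  and supp: "!!x. b x ~= 0 ==> norm x <= rh" "!!x. Bi x ~= 0 ==> norm x <= rh" "!!x. Bj x ~= 0 ==> norm x <= rh"
  and "0 <= rh"
 shows "(LI x. Ai x * Bj x) = (LI x. Aj x * Bi x)"
proof -
 define p :: "real^3" where "p = axis i 1"
 define q :: "real^3" where "q = axis j 1"
 have np: "norm p = 1" "norm q = 1" by (simp_all add: p_def q_def)
 define X where "X n = inverse (real (Suc n))" for n
 have X: "X \<longlonglongrightarrow> 0" "!!n. X n ~= 0" "!!n. \<bar>X n\<bar> <= 1"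
  unfolding X_def using LIMSEQ_inverse_real_of_nat by (auto simp: inverse_le_1_iff)
 have mX: "(%n. - X n) \<longlonglongrightarrow> 0" "!!n. - X n ~= 0" using tendsto_minus[OF X(1)] X(2) by auto
 note [measurable] = weak_derivD(5,6)[OF wd(1)] weak_derivD(5,6)[OF wd(2)] weak_derivD(5,6)[OF wd(3)] weak_derivD(5,6)[OF wd(4)]
 note la = weak_derivD(1)[OF wd(1)] and lb = weak_derivD(1)[OF wd(3)]
 have sb: "sq_int b"
 proof -
  have "sq_int (%x. indicator (cball 0 rh) x * b x)" using lb by (simp add: loc_sq_int_iff)
  moreover have "(%x. indicator (cball 0 rh) x * b x) = b" using supp(1) by (auto simp: fun_eq_iff indicator_def)
  ultimately show ?thesis by simp
 qed
 have supb: "norm x <= rh + 1" if "b (x + v) ~= 0" "norm v <= 1" for x v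
  using supp(1)[OF that(1)] that(2) norm_triangle_ineq4[of "x + v" v] by simp
 have sdq: "sq_int (%x. (b (x + v) - b x) / t)" for v t
  using sq_int_cmult[OF sq_int_diff[OF sq_int_shift[OF sb, of v] sb], of "1 / t"] by simp
 have sdqs: "norm x <= rh + 1" if "(b (x + v) - b x) / t ~= 0" "norm v <= 1" for x v t
 proof (cases "b x = 0")
  case True
  then show ?thesis using that supb[of x v] by auto
 qed (use supp(1)[of x] in auto)
 have inta: "integrable lborel (%x. a (x + v) * b (x + w))" for v w
 proof (rule loc_sq_int_mult_integrable[OF loc_sq_int_shift[OF la] sq_int_shift[OF sb]])
  show "norm x <= rh + norm w" if "b (x + w) ~= 0" for x
   using supp(1)[OF that] norm_triangle_ineq4[of "x + w" w] by simp
 qed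
 \<comment> \<open>Both sides expand into four products of translates, and the integral of such a
   product depends on the difference of the two shifts alone.\<close>
 have shift_id: "(LI x. (a (x + s *\<^sub>R p) - a x) / s * ((b (x + t *\<^sub>R q) - b x) / t))
   = (LI x. (a (x + (-t) *\<^sub>R q) - a x) / (-t) * ((b (x + (-s) *\<^sub>R p) - b x) / (-s)))"
  if "s ~= 0" "t ~= 0" for s t
 proof -
  have ab: "(LI x. a (x + v) * b (x + w)) = (LI x. a (x + v') * b (x + w'))" if "v - w = v' - w'" for v w v' w'
  proof -
   have "(LI x. a (x + v' + (v - v')) * b (x + w' + (v - v'))) = (LI x. a (x + v') * b (x + w'))"
    using integral_shift[of "%x. a (x + v') * b (x + w')" "v - v'"] by (simp add: algebra_simps)
   moreover have "x + v' + (v - v') = x + v" "x + w' + (v - v') = x + w" for x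
    using that by (auto simp: algebra_simps)
   ultimately show ?thesis by simp
  qed
  have ex: "(LI x. (a (x + v) - a x) / s * ((b (x + w) - b x) / t))
    = ((LI x. a (x + v) * b (x + w)) - (LI x. a (x + v) * b (x + 0))
     - (LI x. a (x + 0) * b (x + w)) + (LI x. a (x + 0) * b (x + 0))) / (s * t)" for v w s t
  proof -
   have "(LI x. (a (x + v) - a x) / s * ((b (x + w) - b x) / t))
    = (LI x. (a (x + v) * b (x + w) - a (x + v) * b (x + 0) - a (x + 0) * b (x + w) + a (x + 0) * b (x + 0)) / (s * t))"
    by (intro Bochner_Integration.integral_cong) (auto simp: algebra_simps add_divide_distrib diff_divide_distrib)
   also have "... = (LI x. a (x + v) * b (x + w) - a (x + v) * b (x + 0) - a (x + 0) * b (x + w) + a (x + 0) * b (x + 0)) / (s * t)"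
    by (rule integral_divide_zero)
   also have "(LI x. a (x + v) * b (x + w) - a (x + v) * b (x + 0) - a (x + 0) * b (x + w) + a (x + 0) * b (x + 0))
     = (LI x. a (x + v) * b (x + w)) - (LI x. a (x + v) * b (x + 0))
     - (LI x. a (x + 0) * b (x + w)) + (LI x. a (x + 0) * b (x + 0))"
    using Bochner_Integration.integral_add[OF Bochner_Integration.integrable_diff[OF Bochner_Integration.integrable_diff[OF inta[of v w] inta[of v 0]] inta[of 0 w]] inta[of 0 0]]
     Bochner_Integration.integral_diff[OF Bochner_Integration.integrable_diff[OF inta[of v w] inta[of v 0]] inta[of 0 w]]
     Bochner_Integration.integral_diff[OF inta[of v w] inta[of v 0]] by linarith
   finally show ?thesis .
  qed
  have e1: "(LI x. a (x + s *\<^sub>R p) * b (x + t *\<^sub>R q)) = (LI x. a (x + (-t) *\<^sub>R q) * b (x + (-s) *\<^sub>R p))"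
   by (rule ab) simp
  have e2: "(LI x. a (x + s *\<^sub>R p) * b (x + 0)) = (LI x. a (x + 0) * b (x + (-s) *\<^sub>R p))"
   by (rule ab) simp
  have e3: "(LI x. a (x + 0) * b (x + t *\<^sub>R q)) = (LI x. a (x + (-t) *\<^sub>R q) * b (x + 0))"
   by (rule ab) simp
  show ?thesis unfolding ex e1 e2 e3 by (simp add: mult.commute)
 qed
 \<comment> \<open>Limit in direction \<open>j\<close> while the step \<open>X m\<close> in
   direction \<open>i\<close> is frozen. The quotient of \<open>a\<close> is not square integrable
   globally, so it is cut off to a ball that contains the support of the quotients of
   \<open>b\<close>.\<close>
 have step1: "(LI x. (a (x + X m *\<^sub>R p) - a x) / X m * Bj x) = (LI x. Aj x * ((b (x + (- X m) *\<^sub>R p) - b x) / (- X m)))" for m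
 proof -
  define g where "g x = indicator (cball 0 (rh + 1)) x * ((a (x + X m *\<^sub>R p) - a x) / X m)" for x
  have sg: "sq_int g" unfolding g_def[abs_def]
   using loc_sq_int_diffquot[OF la] by (simp only: loc_sq_int_iff)
  have gs: "norm x <= rh + 1" if "g x ~= 0" for x using that by (auto simp: g_def indicator_def split: if_splits)
  have l1: "(%n. LINT x|lborel. (b (x + X n *\<^sub>R q) - b x) / X n * g x) \<longlonglongrightarrow> (LI x. Bj x * g x)"
   unfolding q_def by (rule weak_deriv_diffquot_L2[OF wd(4) sg gs _ X(1,2)]) (use \<open>0 <= rh\<close> in auto)
  have l2: "(%n. LINT x|lborel. (a (x + (- X n) *\<^sub>R q) - a x) / (- X n) * ((b (x + (- X m) *\<^sub>R p) - b x) / (- X m)))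
    \<longlonglongrightarrow> (LI x. Aj x * ((b (x + (- X m) *\<^sub>R p) - b x) / (- X m)))"
  proof -
   have sd2: "norm x <= rh + 1" if "(b (x + (- X m) *\<^sub>R p) - b x) / (- X m) ~= 0" for x
    using sdqs[OF that] X(3)[of m] np by simp
   show ?thesis
    unfolding q_def
    by (rule weak_deriv_diffquot_L2[where rh="rh + 1", OF wd(2) sdq _ _ mX], erule sd2)
     (simp add: \<open>0 <= rh\<close>)
  qed
  have "(LI x. (b (x + X n *\<^sub>R q) - b x) / X n * g x)
    = (LI x. (a (x + (- X n) *\<^sub>R q) - a x) / (- X n) * ((b (x + (- X m) *\<^sub>R p) - b x) / (- X m)))" for n
  proof -
   have "(b (x + X n *\<^sub>R q) - b x) / X n * g x = (a (x + X m *\<^sub>R p) - a x) / X m * ((b (x + X n *\<^sub>R q) - b x) / X n)" for x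
   proof (cases "(b (x + X n *\<^sub>R q) - b x) / X n = 0")
    case False
    then have "norm x <= rh + 1" using sdqs[of x "X n *\<^sub>R q" "X n"] X(3)[of n] np by simp
    then have gx: "g x = (a (x + X m *\<^sub>R p) - a x) / X m" by (simp add: g_def)
    show ?thesis by (simp only: gx mult.commute)
   qed (simp only: mult_zero_left mult_zero_right)
   then show ?thesis using shift_id[OF X(2)[of m] X(2)[of n]] by simp
  qed
  then have "(LI x. Bj x * g x) = (LI x. Aj x * ((b (x + (- X m) *\<^sub>R p) - b x) / (- X m)))"
   using LIMSEQ_unique[OF l1] l2 by simp
  moreover have "Bj x * g x = (a (x + X m *\<^sub>R p) - a x) / X m * Bj x" for x
   using supp(3)[of x] by (cases "Bj x = 0") (auto simp: g_def)
  ultimately show ?thesis by simp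
 qed
 define h where "h x = indicator (cball 0 (rh + 1)) x * Aj x" for x
 have sh: "sq_int h" unfolding h_def[abs_def]
  using sq_int_imp_loc[OF weak_derivD(2)[OF wd(2)]] by (simp only: loc_sq_int_iff)
 have hs: "norm x <= rh + 1" if "h x ~= 0" for x using that by (auto simp: h_def indicator_def split: if_splits)
 have l1: "(%m. LINT x|lborel. (a (x + X m *\<^sub>R p) - a x) / X m * Bj x) \<longlonglongrightarrow> (LI x. Ai x * Bj x)"
  unfolding p_def by (rule weak_deriv_diffquot_L2[OF wd(1) weak_derivD(2)[OF wd(4)] supp(3) \<open>0 <= rh\<close> X(1,2)])
 have l2: "(%m. LINT x|lborel. (b (x + (- X m) *\<^sub>R p) - b x) / (- X m) * h x) \<longlonglongrightarrow> (LI x. Bi x * h x)"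
  unfolding p_def by (rule weak_deriv_diffquot_L2[OF wd(3) sh hs _ mX]) (use \<open>0 <= rh\<close> in auto)
 have "(LI x. (b (x + (- X m) *\<^sub>R p) - b x) / (- X m) * h x) = (LI x. (a (x + X m *\<^sub>R p) - a x) / X m * Bj x)" for m
 proof -
  have "(b (x + (- X m) *\<^sub>R p) - b x) / (- X m) * h x = Aj x * ((b (x + (- X m) *\<^sub>R p) - b x) / (- X m))" for x
  proof (cases "(b (x + (- X m) *\<^sub>R p) - b x) / (- X m) = 0")
   case False
   then have "norm x <= rh + 1" using sdqs[of x "(- X m) *\<^sub>R p" "- X m"] X(3)[of m] np by simp
   then have hx: "h x = Aj x" by (simp add: h_def)
   show ?thesis by (simp only: hx mult.commute)
  qed (simp only: mult_zero_left mult_zero_right)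
  then show ?thesis by (simp only: step1)
 qed
 then have "(LI x. Ai x * Bj x) = (LI x. Bi x * h x)"
  using LIMSEQ_unique[OF l1] l2 by simp
 moreover have "Bi x * h x = Aj x * Bi x" for x using supp(2)[of x] by (cases "Bi x = 0") (auto simp: h_def)
 ultimately show ?thesis by simp
qed

lemma test_function_mult: "test_function pf ==> test_function ps ==> test_function (%x. pf x * ps x)"
 by (auto simp: test_function_iff intro: continuously_diff_mult bounded_subset)

lemma partial_deriv_mult:
 assumes "continuously_diff pf" "continuously_diff ps"
 shows "partial_deriv j (%x. pf x * ps x) x = pf x * partial_deriv j ps x + partial_deriv j pf x * ps x"
proof -
 have "((%x. pf x * ps x) has_derivative
   (%v. pf x * frechet_derivative ps (at x) v + frechet_derivative pf (at x) v * ps x)) (at x)"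
  using assms by (intro has_derivative_mult continuously_diff_has_derivative)
 from partial_deriv_eqI[OF this] show ?thesis by (simp add: partial_deriv_def)
qed

lemma weak_deriv_mult_test:
 assumes wd: "weak_deriv j b B" and ze: "test_function ze"
 shows "weak_deriv j (%x. ze x * b x) (%x. ze x * B x + partial_deriv j ze x * b x)"
proof -
 obtain L where L: "0 <= L" "!!x. \<bar>ze x\<bar> <= L" "!!x j. \<bar>partial_deriv j ze x\<bar> <= L"
  "!!x. ze x ~= 0 ==> norm x <= L" "!!x j. partial_deriv j ze x ~= 0 ==> norm x <= L"
  using test_function_bounds[OF ze] by metis
 note [measurable] = weak_derivD(5,6)[OF wd] test_function_borel[OF ze] partial_deriv_borel[OF ze]
 have c: "continuously_diff ze" using ze by (simp add: test_function_iff)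
 have sb: "sq_int (%x. k x * b x)" if [measurable]: "k \<in> bm"
  and k: "!!x. \<bar>k x\<bar> <= L" "!!x. k x ~= 0 ==> norm x <= L" for k
 proof (rule sq_int_bound)
  show "sq_int (%x. L * (indicator (cball 0 L) x * b x))"
   using weak_derivD(1)[OF wd] by (intro sq_int_cmult) (simp add: loc_sq_int_iff)
  show "\<bar>k x * b x\<bar> <= \<bar>L * (indicator (cball 0 L) x * b x)\<bar>" for x
   using k[of x] L(1) by (cases "k x = 0") (auto simp: abs_mult intro!: mult_right_mono)
 qed measurable
 have s1: "sq_int (%x. ze x * b x)" "sq_int (%x. partial_deriv j ze x * b x)"
  using L by (auto intro!: sb)
 have "sq_int (%x. ze x * B x)"
 proof (rule sq_int_bound[OF sq_int_cmult[OF weak_derivD(2)[OF wd], of L]])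
  show "\<bar>ze x * B x\<bar> <= \<bar>L * B x\<bar>" for x using L(1,2) by (auto simp: abs_mult intro!: mult_right_mono)
 qed measurable
 then have s2: "sq_int (%x. ze x * B x + partial_deriv j ze x * b x)" by (intro sq_int_add s1)
 have "(LI x. ze x * b x * partial_deriv j pf x) = - (LI x. (ze x * B x + partial_deriv j ze x * b x) * pf x)"
  if pf: "test_function pf" for pf
 proof -
  note [measurable] = test_function_borel[OF pf] partial_deriv_borel[OF pf]
  obtain K where K: "0 <= K" "!!x. \<bar>pf x\<bar> <= K" "!!x j. \<bar>partial_deriv j pf x\<bar> <= K"
  "!!x. pf x ~= 0 ==> norm x <= K" "!!x j. partial_deriv j pf x ~= 0 ==> norm x <= K"
   using test_function_bounds[OF pf] by metis
  have cpf: "continuously_diff pf" using pf by (simp add: test_function_iff)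
  have li: "loc_int (%x. ze x * b x)" "loc_int (%x. partial_deriv j ze x * b x)" "loc_int (%x. ze x * B x)"
   by (rule loc_sq_int_imp_loc_int, rule sq_int_imp_loc, fact)+
  have i: "integrable lborel (%x. ze x * b x * partial_deriv j pf x)" "integrable lborel (%x. partial_deriv j ze x * b x * pf x)"
   "integrable lborel (%x. ze x * B x * pf x)"
   using K by (auto intro!: loc_int_mult_integrable[OF li(1)] loc_int_mult_integrable[OF li(2)] loc_int_mult_integrable[OF li(3)])
  have "(LI x. b x * partial_deriv j (%x. ze x * pf x) x) = - (LI x. B x * (ze x * pf x))"
   using wd test_function_mult[OF ze pf] unfolding weak_deriv_def by blast
  moreover have "b x * partial_deriv j (%x. ze x * pf x) x = ze x * b x * partial_deriv j pf x + partial_deriv j ze x * b x * pf x" for x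
   by (simp only: partial_deriv_mult[OF c cpf]) (simp add: algebra_simps)
  moreover have "B x * (ze x * pf x) = ze x * B x * pf x" for x by simp
  moreover have "(ze x * B x + partial_deriv j ze x * b x) * pf x = ze x * B x * pf x + partial_deriv j ze x * b x * pf x" for x
   by (simp add: algebra_simps)
  ultimately show ?thesis
   by (simp only: Bochner_Integration.integral_add[OF i(1,2)] Bochner_Integration.integral_add[OF i(3,2)])
 qed
 then show ?thesis unfolding weak_deriv_def using sq_int_imp_loc[OF s1(1)] s2 by auto
qed

lemma test_function_scale:
 assumes pf: "test_function pf" and "c ~= 0"
 shows "test_function (%x. pf (c *\<^sub>R x))" "partial_deriv j (%x. pf (c *\<^sub>R x)) x = c * partial_deriv j pf (c *\<^sub>R x)"
proof -
 have cd: "continuously_diff pf" and b: "bounded {x. pf x ~= 0}" using pf by (auto simp: test_function_iff)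
 have d: "((%x. pf (c *\<^sub>R x)) has_derivative (%h. frechet_derivative pf (at (c *\<^sub>R x)) (c *\<^sub>R h))) (at x)" for x
 proof -
  have "((%x. c *\<^sub>R x) has_derivative (%h. c *\<^sub>R h)) (at x)" by (auto intro!: derivative_eq_intros)
  from has_derivative_compose[OF this continuously_diff_has_derivative[OF cd]] show ?thesis .
 qed
 have l: "linear (frechet_derivative pf (at x))" for x
  using cd by (simp add: continuously_diff_def linear_frechet_derivative)
 show "partial_deriv j (%x. pf (c *\<^sub>R x)) x = c * partial_deriv j pf (c *\<^sub>R x)"
  using partial_deriv_eqI[OF d] linear_scale[OF l] by (simp add: partial_deriv_def)
 have "continuously_diff (%x. pf (c *\<^sub>R x))"
 proof (rule continuously_diffI[OF d])
  fix j
  have "continuous_on UNIV (partial_deriv j pf)" using cd by (simp add: continuously_diff_def)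
  then have "continuous_on UNIV (%x. partial_deriv j pf (c *\<^sub>R x))"
   by (rule continuous_on_compose2) (auto intro!: continuous_intros)
  then have "continuous_on UNIV (%x. c * partial_deriv j pf (c *\<^sub>R x))" by (intro continuous_intros)
  then show "continuous_on UNIV (%x. frechet_derivative pf (at (c *\<^sub>R x)) (c *\<^sub>R axis j 1))"
   using linear_scale[OF l] by (simp add: partial_deriv_def)
 qed
 moreover have "bounded {x. pf (c *\<^sub>R x) ~= 0}"
 proof -
  obtain B where "!!x. pf x ~= 0 ==> norm x <= B" using b by (auto simp: bounded_iff)
  then have "norm x <= B / \<bar>c\<bar>" if "pf (c *\<^sub>R x) ~= 0" for x
   using that \<open>c ~= 0\<close> by (fastforce simp: pos_le_divide_eq mult.commute)
  then show ?thesis by (auto simp: bounded_iff)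
 qed
 ultimately show "test_function (%x. pf (c *\<^sub>R x))" by (simp add: test_function_iff)
qed

text \<open>A downward shift by \<open>2 * rh\<close> takes the ball into the half-space where
  \<open>b\<close> vanishes. There \<open>b\<close> equals minus its own increment up to this shift,
  and \<open>weak_deriv_L2\<close> applies.\<close>

lemma half_space_poincare:
 assumes wd: "weak_deriv 3 b B" and b0: "AE x in lborel. x $ 3 <= 0 --> b x = 0" and "0 <= rh"
 shows "(LI x. indicator (cball 0 rh) x * (b x)^2) <= 4 * rh^2 * (LI x. (B x)^2)"
proof -
 note [measurable] = weak_derivD(5,6)[OF wd]
 have "(LI x. indicator (cball 0 rh) x * (b x)^2)
   = (LI x. indicator (cball 0 rh) x * (b (x + (- 2 * rh) *\<^sub>R axis 3 1) - b x)^2)"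
 proof (rule integral_cong_AE)
  show "AE x in lborel. indicator (cball 0 rh) x * (b x)^2
    = indicator (cball 0 rh) x * (b (x + (- 2 * rh) *\<^sub>R axis 3 1) - b x)^2"
   using AE_shift[OF b0, of "(- 2 * rh) *\<^sub>R axis 3 1"]
  proof eventually_elim
   case (elim x)
   show ?case
   proof (cases "norm x <= rh")
    case True
    have "\<bar>x $ 3\<bar> <= norm x" by (rule component_le_norm_cart)
    then have "(x + (- 2 * rh) *\<^sub>R axis 3 1) $ 3 <= 0"
     using True \<open>0 <= rh\<close> by (auto simp: axis_def)
    then show ?thesis using elim by simp
   qed simp
  qed
 qed measurable
 also have "... <= (- 2 * rh)^2 * (LI x. (B x)^2)"
  by (rule weak_deriv_L2[OF wd \<open>0 <= rh\<close>])
 finally show ?thesis by (simp add: power_mult_distrib)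
qed

text \<open>Bounded support of \<open>b\<close> is removed by cutoffs at radius \<open>R n\<close>.
  Their gradient is of size \<open>1 / R n\<close>, while \<open>b\<close> grows at most like
  \<open>R n\<close> in \<open>L^2\<close> thanks to its zero values below the wall. The extra term
  is therefore bounded in \<open>L^2\<close> and escapes to infinity, so it vanishes against any
  square integrable function.\<close>

lemma mixed_weak_derivs:
 assumes wd: "weak_deriv i a Ai" "weak_deriv j a Aj" "!!k. weak_deriv k b (B k)"
  and b0: "AE x in lborel. x $ 3 <= 0 --> b x = 0"
 shows "(LI x. Ai x * B j x) = (LI x. Aj x * B i x)"
proof -
 obtain ze :: "real^3 => real" where ze: "test_function ze" "!!x. 0 <= ze x" "!!x. ze x <= 1"
  "!!x. norm x <= 1 ==> ze x = 1" "!!x. ze x ~= 0 ==> norm x <= 1 + 1"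
  using ball_cutoff[of 1] by auto
 obtain L where L: "0 <= L" "!!x j. \<bar>partial_deriv j ze x\<bar> <= L"
  using test_function_bounds[OF ze(1)] by metis
 have locconst: "partial_deriv k ze x = 0" if "open S" "x \<in> S" "!!y. y \<in> S ==> ze y = c" for k x S c
 proof -
  have "(ze has_derivative (%_. 0)) (at x)"
   by (rule has_derivative_transform_within_open[where f="%_. c", OF _ that(1,2)]) (use that in auto)
  then show ?thesis by (simp add: partial_deriv_eqI)
 qed
 have pd0: "partial_deriv k ze x = 0" if "norm x < 1 \<or> 2 < norm x" for k x
  using that
 proof
  assume "norm x < 1"
  then show ?thesis using ze(4) by (intro locconst[of "ball 0 1" x 1]) auto
 next
  assume "2 < norm x"
  moreover have "open {x::real^3. 2 < norm x}" by (intro open_Collect_less continuous_intros)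
  ultimately show ?thesis using ze(5) by (intro locconst[of "{x. 2 < norm x}" x 0]) force+
 qed
 note [measurable] = weak_derivD(5,6)[OF wd(1)] weak_derivD(5,6)[OF wd(2)] weak_derivD(5,6)[OF wd(3)]
  test_function_borel[OF ze(1)] partial_deriv_borel[OF ze(1)]
 define R where "R n = real (Suc n)" for n
 have R: "0 < R n" "1 <= R n" "R n ~= 0" for n by (auto simp: R_def)
 define z where "z n x = ze ((1 / R n) *\<^sub>R x)" for n x
 define dz where "dz n k x = 1 / R n * partial_deriv k ze ((1 / R n) *\<^sub>R x)" for n k x
 have zt: "test_function (z n)" "partial_deriv k (z n) x = dz n k x" for n k x
  using test_function_scale[OF ze(1), of "1 / R n"] R[of n] by (auto simp: z_def[abs_def] dz_def)
 have [measurable]: "z n \<in> bm" for n by (rule test_function_borel[OF zt(1)])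
 have [measurable]: "dz n k \<in> bm" for n k unfolding dz_def by measurable
 have zs: "norm x <= 2 * R n" if "z n x ~= 0" for n x
  using ze(5)[of "(1 / R n) *\<^sub>R x"] that R[of n] by (simp add: z_def divide_le_eq)
 have dzs: "R n <= norm x" "norm x <= 2 * R n" if "dz n k x ~= 0" for n k x
 proof -
  have "\<not> (norm ((1 / R n) *\<^sub>R x) < 1 \<or> 2 < norm ((1 / R n) *\<^sub>R x))" using that pd0 by (auto simp: dz_def)
  then have "1 <= norm x / R n" "norm x / R n <= 2" using R[of n] by auto
  then show "R n <= norm x" "norm x <= 2 * R n" using R[of n] by (auto simp: le_divide_eq divide_le_eq)
 qed
 have dzb: "\<bar>dz n k x\<bar> <= L / R n" for n k x
  using L(2)[of k "(1 / R n) *\<^sub>R x"] R[of n] by (simp add: dz_def abs_mult divide_right_mono)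
 have wdn: "weak_deriv k (%x. z n x * b x) (%x. z n x * B k x + dz n k x * b x)" for n k
  using weak_deriv_mult_test[OF wd(3) zt(1), of k n] by (simp add: zt(2))
 \<comment> \<open>The factor \<open>(L / R n)^2\<close> of the cutoff times
   \<open>4 * (2 * R n)^2\<close> from the Poincare inequality: the radius cancels.\<close>
 define K where "K = 16 * L^2 * (LI x. (B 3 x)^2)"
 have K0: "0 <= K" by (simp add: K_def)
 have lb: "loc_sq_int b" by (rule weak_derivD(1)[OF wd(3)])
 have sdb: "sq_int (%x. dz n k x * b x)" for n k
 proof (rule sq_int_bound)
  show "sq_int (%x. (L / R n) * (indicator (cball 0 (2 * R n)) x * b x))"
   using lb by (intro sq_int_cmult) (simp add: loc_sq_int_iff)
  show "\<bar>dz n k x * b x\<bar> <= \<bar>(L / R n) * (indicator (cball 0 (2 * R n)) x * b x)\<bar>" for x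
  proof (cases "dz n k x = 0")
   case False
   have "\<bar>dz n k x\<bar> * \<bar>b x\<bar> <= (L / R n) * \<bar>b x\<bar>" by (rule mult_right_mono[OF dzb]) simp
   then show ?thesis using dzs(2)[OF False] L(1) R[of n] by (simp add: abs_mult)
  qed simp
 qed measurable
 have dbK: "(LI x. (dz n k x * b x)^2) <= K" for n k
 proof -
  have "(LI x. (dz n k x * b x)^2) <= (LI x. (L / R n)^2 * (indicator (cball 0 (2 * R n)) x * (b x)^2))"
  proof (rule integral_mono)
   show "integrable lborel (%x. (L / R n)^2 * (indicator (cball 0 (2 * R n)) x * (b x)^2))"
    using lb by (intro integrable_mult_right) (simp add: loc_sq_int_def)
   show "(dz n k x * b x)^2 <= (L / R n)^2 * (indicator (cball 0 (2 * R n)) x * (b x)^2)" for x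
   proof (cases "dz n k x = 0")
    case False
    have "(dz n k x)^2 <= (L / R n)^2" using power_mono[OF dzb[of n k x], of 2] by simp
    then show ?thesis using dzs(2)[OF False] by (simp add: power_mult_distrib mult_right_mono)
   qed simp
  qed (use sdb in \<open>simp add: sq_int_def\<close>)
  also have "... = (L / R n)^2 * (LI x. indicator (cball 0 (2 * R n)) x * (b x)^2)" by (rule integral_mult_right_zero)
  also have "... <= (L / R n)^2 * (4 * (2 * R n)^2 * (LI x. (B 3 x)^2))"
   using R[of n] by (intro mult_left_mono half_space_poincare[OF wd(3) b0]) auto
  also have "... = K" using R[of n] by (simp add: K_def power_divide power_mult_distrib)
  finally show ?thesis .
 qed
 have lim0: "(%n. LINT x|lborel. A x * (dz n k x * b x)) \<longlonglongrightarrow> 0" if A: "sq_int A" for A k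
 proof (rule LIMSEQ_I)
  fix r :: real assume r: "0 < r"
  note [measurable] = sq_int_borel[OF A]
  define kp where "kp = r / (2 * (K + 1))"
  have kp: "0 < kp" using r K0 by (simp add: kp_def)
  \<comment> \<open>The gradient of the cutoff lives beyond \<open>R n\<close>, so only this tail of
    \<open>A\<close> is paired, and the tail tends to zero in \<open>L^2\<close>.\<close>
  define T where "T n x = (if R n <= norm x then A x else 0)" for n x
  have [measurable]: "T n \<in> bm" for n unfolding T_def by measurable
  have sT: "sq_int (T n)" for n by (rule sq_int_bound[OF A]) (auto simp: T_def)
  have "(%n. LINT x|lborel. (T n x)^2) \<longlonglongrightarrow> (LINT x|(lborel :: (real^3) measure). 0)"
  proof (rule integral_dominated_convergence[where w="%x. (A x)^2"])
   show "AE x in lborel. (%n. (T n x)^2) \<longlonglongrightarrow> 0"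
   proof (rule AE_I2)
    fix x :: "real^3"
    obtain N :: nat where N: "norm x <= real N" using real_arch_simple by blast
    have "(T n x)^2 = 0" if "n \<ge> N" for n
     using N that by (auto simp: T_def R_def)
    then show "(%n. (T n x)^2) \<longlonglongrightarrow> 0"
     by (intro tendsto_eventually) (auto simp: eventually_sequentially)
   qed
  qed (use A in \<open>auto simp: sq_int_def T_def\<close>)
  then have "\<forall>\<^sub>F n in sequentially. (LI x. (T n x)^2) < kp * r"
   using kp r by (intro order_tendstoD) auto
  then obtain N where N: "!!n. n \<ge> N ==> (LI x. (T n x)^2) < kp * r" by (auto simp: eventually_sequentially)
  have "\<bar>LINT x|lborel. A x * (dz n k x * b x)\<bar> < r" if n: "n \<ge> N" for n
  proof -
   have sd: "integrable lborel (%x. (dz n k x * b x)^2)" and iT: "integrable lborel (%x. (T n x)^2)"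
    using sdb[of n k] sT[of n] by (auto simp: sq_int_def)
   have "\<bar>LINT x|lborel. A x * (dz n k x * b x)\<bar> <= (LI x. \<bar>A x * (dz n k x * b x)\<bar>)" by (rule integral_abs_bound)
   also have "... <= (LI x. kp / 2 * (dz n k x * b x)^2 + 1 / (2 * kp) * (T n x)^2)"
   proof (rule integral_mono)
    show "integrable lborel (%x. \<bar>A x * (dz n k x * b x)\<bar>)"
     by (rule integrable_abs, rule sq_int_mult_integrable[OF A sdb])
    show "integrable lborel (%x. kp / 2 * (dz n k x * b x)^2 + 1 / (2 * kp) * (T n x)^2)"
     using sd iT by (intro Bochner_Integration.integrable_add integrable_mult_right)
    show "\<bar>A x * (dz n k x * b x)\<bar> <= kp / 2 * (dz n k x * b x)^2 + 1 / (2 * kp) * (T n x)^2" for x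
     using weighted_mult_abs_le[OF kp, of "dz n k x * b x" "A x"] dzs(1)[of n k x]
     by (cases "dz n k x = 0") (auto simp: T_def kp less_imp_le mult.commute)
   qed
   also have "... = kp / 2 * (LI x. (dz n k x * b x)^2) + 1 / (2 * kp) * (LI x. (T n x)^2)"
    using sd iT by (subst Bochner_Integration.integral_add) auto
   also have "... < kp / 2 * (K + 1) + 1 / (2 * kp) * (kp * r)"
    using N[OF n] dbK[of n k] kp by (intro add_strict_mono mult_strict_left_mono) auto
   also have "... <= r"
   proof -
    have "kp / 2 * (K + 1) = r / 4" using K0 by (simp add: kp_def field_simps)
    moreover have "1 / (2 * kp) * (kp * r) = r / 2" using kp by simp
    ultimately show ?thesis using r by linarith
   qed
   finally show ?thesis .
  qed
  then show "\<exists>N. \<forall>n\<ge>N. norm ((LI x. A x * (dz n k x * b x)) - 0) < r" by auto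
 qed
 have limz: "(%n. LINT x|lborel. A x * (z n x * C x)) \<longlonglongrightarrow> (LI x. A x * C x)" if A: "sq_int A" and C: "sq_int C" for A C
 proof (rule integral_dominated_convergence[where w="%x. \<bar>A x * C x\<bar>"])
  note [measurable] = sq_int_borel[OF A] sq_int_borel[OF C]
  show "integrable lborel (%x. \<bar>A x * C x\<bar>)" by (rule integrable_abs, rule sq_int_mult_integrable[OF A C])
  show "AE x in lborel. (%n. A x * (z n x * C x)) \<longlonglongrightarrow> A x * C x"
  proof (rule AE_I2)
   fix x :: "real^3"
   obtain N :: nat where N: "norm x <= real N" using real_arch_simple by blast
   have "A x * (z n x * C x) = A x * C x" if "n \<ge> N" for n
   proof -
    have "norm x <= R n" using N that by (simp add: R_def)
    then have "z n x = 1" unfolding z_def using R[of n] by (intro ze(4)) (simp add: divide_le_eq)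
    then show ?thesis by simp
   qed
   then show "(%n. A x * (z n x * C x)) \<longlonglongrightarrow> A x * C x"
    by (intro tendsto_eventually) (auto simp: eventually_sequentially)
  qed
  show "AE x in lborel. norm (A x * (z n x * C x)) <= \<bar>A x * C x\<bar>" for n
  proof (rule AE_I2)
   fix x
   have "\<bar>z n x\<bar> <= 1" using ze(2,3) by (simp add: z_def)
   then have "\<bar>z n x\<bar> * \<bar>A x * C x\<bar> <= 1 * \<bar>A x * C x\<bar>" by (rule mult_right_mono) simp
   then show "norm (A x * (z n x * C x)) <= \<bar>A x * C x\<bar>" by (simp add: abs_mult mult.left_commute)
  qed
  show "(%x. A x * (z n x * C x)) \<in> borel_measurable lborel" for n by measurable
  show "(%x. A x * C x) \<in> borel_measurable lborel" by measurable
 qed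
 have szC: "sq_int (%x. z n x * B k x)" for n k
 proof (rule sq_int_bound[OF weak_derivD(2)[OF wd(3)[of k]]])
  show "\<bar>z n x * B k x\<bar> <= \<bar>B k x\<bar>" for x
   using mult_right_mono[of "\<bar>z n x\<bar>" 1 "\<bar>B k x\<bar>"] ze(2,3) by (simp add: z_def abs_mult)
 qed measurable
 have lim: "(%n. LINT x|lborel. A x * (z n x * B k x + dz n k x * b x)) \<longlonglongrightarrow> (LI x. A x * B k x)"
  if A: "sq_int A" for A k
 proof -
  have "(LI x. A x * (z n x * B k x + dz n k x * b x))
    = (LI x. A x * (z n x * B k x)) + (LI x. A x * (dz n k x * b x))" for n
   by (simp only: distrib_left Bochner_Integration.integral_add[OF sq_int_mult_integrable[OF A szC] sq_int_mult_integrable[OF A sdb]])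
  then show ?thesis
   using tendsto_add[OF limz[OF A weak_derivD(2)[OF wd(3)[of k]]] lim0[OF A, of k]] by simp
 qed
 have "(LI x. Ai x * (z n x * B j x + dz n j x * b x)) = (LI x. Aj x * (z n x * B i x + dz n i x * b x))" for n
 proof (rule mixed_weak_derivs_bounded_support[OF wd(1,2) wdn wdn, where rh="2 * R n"])
  show "norm x <= 2 * R n" if "z n x * b x ~= 0" for x using zs[of n x] that by auto
  have "norm x <= 2 * R n" if "z n x * B k x + dz n k x * b x ~= 0" for x k
   using zs[of n x] dzs(2)[of n k x] that by (cases "z n x = 0"; cases "dz n k x = 0") auto
  then show "!!x. z n x * B i x + dz n i x * b x ~= 0 ==> norm x <= 2 * R n"
   "!!x. z n x * B j x + dz n j x * b x ~= 0 ==> norm x <= 2 * R n" by blast+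
 qed (use R in \<open>simp add: less_imp_le\<close>)
 then show ?thesis
  using LIMSEQ_unique[OF lim[OF weak_derivD(2)[OF wd(1)], of j]] lim[OF weak_derivD(2)[OF wd(2)], of i] by simp
qed

section \<open>The drag as a minimal energy\<close>

lemma vec_nth_borel [measurable]:
 "(%x::('a::real_normed_vector)^3. x $ i) \<in> borel \<rightarrow>\<^sub>M borel"
 by (intro borel_measurable_continuous_onI continuous_intros)

lemma energy_field_weak_deriv:
 assumes "energy_field u G" shows "weak_deriv j (%x. u x $ i) (%x. G x $ i $ j)"
proof -
 have [measurable]: "u \<in> bm" "G \<in> bm" using assms by (auto simp: energy_field_def)
 have m: "(%x. u x $ i) \<in> bm" "(%x. G x $ i $ j) \<in> bm"
  by measurable
 have "integrable lborel (%x. indicator (cball 0 rh) x * (u x $ i)^2)" for rh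
 proof (rule Bochner_Integration.integrable_bound)
  show "integrable lborel (%x. indicator (cball 0 rh) x *\<^sub>R (norm (u x))^2)"
   using assms by (simp add: energy_field_def set_integrable_def)
  have "(u x $ i)^2 <= (norm (u x))^2" for x
   using component_le_norm_cart[of "u x" i] by (simp add: abs_le_square_iff[symmetric])
  then show "AE x in lborel. norm (indicator (cball 0 rh) x * (u x $ i)^2) <= norm (indicator (cball 0 rh) x *\<^sub>R (norm (u x))^2)"
   by (auto simp: indicator_def)
  show "(%x. indicator (cball 0 rh) x * (u x $ i)^2) \<in> borel_measurable lborel" using m by measurable
 qed
 then have 1: "loc_sq_int (%x. u x $ i)" using m by (simp add: loc_sq_int_def)
 have "integrable lborel (%x. (G x $ i $ j)^2)"
 proof (rule Bochner_Integration.integrable_bound)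
  show "integrable lborel (%x. (norm (G x))^2)" using assms by (simp add: energy_field_def)
  have "(G x $ i $ j)^2 <= (norm (G x))^2" for x
   using order_trans[OF component_le_norm_cart[of "G x $ i" j]] Finite_Cartesian_Product.norm_nth_le[of "G x" i]
   by (simp add: abs_le_square_iff[symmetric])
  then show "AE x in lborel. norm ((G x $ i $ j)^2) <= norm ((norm (G x))^2)" by auto
  show "(%x. (G x $ i $ j)^2) \<in> borel_measurable lborel" using m by measurable
 qed
 then have 2: "sq_int (%x. G x $ i $ j)" using m by (simp add: sq_int_def)
 show ?thesis using 1 2 assms by (simp add: weak_deriv_def energy_field_def)
qed

lemma energy_fieldD:
 assumes "energy_field u G"
 shows "u \<in> bm" "G \<in> bm"
  "(%x. G x $ i $ j) \<in> bm" "(%x. u x $ i) \<in> bm"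
  "sq_int (%x. G x $ i $ j)" "integrable lborel (%x. (norm (G x))^2)"
proof -
 show [measurable]: "u \<in> bm" "G \<in> bm" using assms by (auto simp: energy_field_def)
 show "(%x. G x $ i $ j) \<in> bm" "(%x. u x $ i) \<in> bm" by measurable
 show "sq_int (%x. G x $ i $ j)" by (rule weak_derivD(2)[OF energy_field_weak_deriv[OF assms]])
 show "integrable lborel (%x. (norm (G x))^2)" using assms by (simp add: energy_field_def)
qed

lemma norm_sq_matrix: "(norm (A::real^3^3))^2 = (\<Sum>i\<in>UNIV. \<Sum>j\<in>UNIV. (A $ i $ j)^2)"
 unfolding power2_norm_eq_inner inner_vec_def by (simp add: power2_eq_square)

lemma energy_fieldI:
 assumes [measurable]: "u \<in> bm" "G \<in> bm"
  and wd: "!!i j. weak_deriv j (%x. u x $ i) (%x. G x $ i $ j)"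
 shows "energy_field u G"
proof -
 have "set_integrable lborel K (%x. (norm (u x))^2)" if K: "compact K" for K
 proof -
  obtain rh where rh: "!!x. x \<in> K ==> norm x <= rh" using compact_imp_bounded[OF K] by (auto simp: bounded_iff)
  have [measurable]: "K \<in> sets borel" using compact_imp_closed[OF K] by simp
  have "integrable lborel (%x. \<Sum>i\<in>UNIV. indicator (cball 0 rh) x * (u x $ i)^2)"
   using weak_derivD(1)[OF wd] by (intro Bochner_Integration.integrable_sum) (auto simp: loc_sq_int_def)
  moreover have "(norm (u x))^2 = (\<Sum>i\<in>UNIV. (u x $ i)^2)" for x
   unfolding power2_norm_eq_inner inner_vec_def by (simp add: power2_eq_square)
  ultimately have i: "integrable lborel (%x. indicator (cball 0 rh) x * (norm (u x))^2)" by (simp add: sum_distrib_left)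
  show ?thesis unfolding set_integrable_def
   by (rule Bochner_Integration.integrable_bound[OF i]) (use rh in \<open>auto simp: indicator_def\<close>)
 qed
 moreover have "integrable lborel (%x. (norm (G x))^2)"
  unfolding norm_sq_matrix using weak_derivD(2)[OF wd]
  by (intro Bochner_Integration.integrable_sum) (auto simp: sq_int_def)
 ultimately show ?thesis using wd by (auto simp: energy_field_def weak_deriv_def)
qed

lemma weak_deriv_diff:
 assumes f: "weak_deriv j f F" and g: "weak_deriv j g H"
 shows "weak_deriv j (%x. f x - g x) (%x. F x - H x)"
 unfolding weak_deriv_def
proof (intro conjI allI impI)
 show "loc_sq_int (%x. f x - g x)" by (rule loc_sq_int_diff[OF weak_derivD(1)[OF f] weak_derivD(1)[OF g]])
 show "sq_int (%x. F x - H x)" by (rule sq_int_diff[OF weak_derivD(2)[OF f] weak_derivD(2)[OF g]])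
 fix pf assume pf: "test_function pf"
 note [measurable] = test_function_borel[OF pf] partial_deriv_borel[OF pf]
 obtain K where K: "0 <= K" "!!x. \<bar>pf x\<bar> <= K" "!!x j. \<bar>partial_deriv j pf x\<bar> <= K"
  "!!x. pf x ~= 0 ==> norm x <= K" "!!x j. partial_deriv j pf x ~= 0 ==> norm x <= K"
  using test_function_bounds[OF pf] by metis
 have i1: "integrable lborel (%x. k x * pf x)" "integrable lborel (%x. k x * partial_deriv j pf x)" if "loc_int k" for k
  using K by (auto intro!: loc_int_mult_integrable[OF that])
 note l = weak_derivD(3)[OF f] weak_derivD(3)[OF g] weak_derivD(4)[OF f] weak_derivD(4)[OF g]
 have "(LI x. f x * partial_deriv j pf x) = - (LI x. F x * pf x)"
  "(LI x. g x * partial_deriv j pf x) = - (LI x. H x * pf x)"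
  using f g pf by (auto simp: weak_deriv_def)
 then show "(LI x. (f x - g x) * partial_deriv j pf x) = - (LI x. (F x - H x) * pf x)"
  by (simp only: left_diff_distrib Bochner_Integration.integral_diff[OF i1(2)[OF l(1)] i1(2)[OF l(2)]]
    Bochner_Integration.integral_diff[OF i1(1)[OF l(3)] i1(1)[OF l(4)]])
qed

lemma energy_field_diff:
 assumes "energy_field u G" "energy_field v V"
 shows "energy_field (%x. u x - v x) (%x. G x - V x)"
proof (rule energy_fieldI)
 note [measurable] = energy_fieldD(1,2)[OF assms(1)] energy_fieldD(1,2)[OF assms(2)]
 show "(%x. u x - v x) \<in> bm" "(%x. G x - V x) \<in> bm" by measurable
 show "weak_deriv j (%x. (u x - v x) $ i) (%x. (G x - V x) $ i $ j)" for i j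
  using weak_deriv_diff[OF energy_field_weak_deriv[OF assms(1)] energy_field_weak_deriv[OF assms(2)]] by simp
qed

lemma gradient_zero_outside_fluid:
 assumes u: "energy_field u G" and bv: "boundary_values S h a u"
 shows "AE x in lborel. x \<notin> fluid_domain S h --> G x = 0"
proof -
 have "AE x in lborel. x \<notin> fluid_domain S h --> G x $ i $ j = 0" for i j
 proof -
  have "closed {x::real^3. x $ 3 <= 0}" by (intro closed_Collect_le continuous_intros)
  then have "AE x in lborel. x \<in> {x. x $ 3 <= 0} --> G x $ i $ j = 0"
   by (intro weak_deriv_zero_on_level_set[OF energy_field_weak_deriv[OF u], where c=0])
    (use bv in \<open>auto simp: boundary_values_def elim: eventually_mono\<close>)
  moreover have "AE x in lborel. x \<in> closure (shifted S h) --> G x $ i $ j = 0"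
   by (intro weak_deriv_zero_on_level_set[OF energy_field_weak_deriv[OF u], where c="a $ i"])
    (use bv in \<open>auto simp: boundary_values_def elim: eventually_mono\<close>)
  ultimately show ?thesis by eventually_elim (auto simp: fluid_domain_def)
 qed
 then have "AE x in lborel. \<forall>i\<in>UNIV. \<forall>j\<in>UNIV. x \<notin> fluid_domain S h --> G x $ i $ j = 0"
  by (intro AE_finite_allI) auto
 then show ?thesis by eventually_elim (auto simp: vec_eq_iff)
qed

lemma fluid_domain_borel [measurable]: "fluid_domain S h \<in> sets borel"
proof -
 have "open {x::real^3. 0 < x $ 3}" by (intro open_Collect_less continuous_intros)
 then show ?thesis unfolding fluid_domain_def by (intro sets.Diff) auto
qed

lemma stress_inner:
 "stress A q \<bullet> B = A \<bullet> B + (\<Sum>i\<in>UNIV. \<Sum>j\<in>UNIV. A $ j $ i * B $ i $ j) - q * trace B"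
proof -
 have "(mat 1 :: real^3^3) \<bullet> B = trace B"
  by (simp add: inner_vec_def mat_def trace_def sum_3)
 moreover have "transpose A \<bullet> B = (\<Sum>i\<in>UNIV. \<Sum>j\<in>UNIV. A $ j $ i * B $ i $ j)"
  by (simp add: inner_vec_def transpose_def)
 moreover have "stress A q = A + transpose A - q *\<^sub>R mat 1"
  by (simp add: stress_def sym_part_def)
 ultimately show ?thesis by (simp add: inner_diff_left inner_add_left)
qed

lemma matrix_inner_integrable:
 assumes "!!i j. sq_int (%x. A x $ i $ j)" "!!i j. sq_int (%x. B x $ i $ j)"
 shows "integrable lborel (%x. (A x :: real^3^3) \<bullet> B x)"
 unfolding inner_vec_def using sq_int_mult_integrable[OF assms]
 by (simp add: Bochner_Integration.integrable_sum)

lemma normalized_drag_minimal_energy: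
 assumes "is_normalized_drag S h F"
 obtains u G where "energy_field u G" "boundary_values S h e_z u"
  "AE x in lborel. x \<notin> fluid_domain S h --> G x = 0" "AE x in lborel. trace (G x) = 0"
  "F = (LI x. (norm (G x))^2)"
  "!!Ps DPs. energy_field Ps DPs ==> boundary_values S h e_z Ps ==> AE x in lborel. trace (DPs x) = 0 ==>
    F <= (LI x. (norm (DPs x))^2)"
proof -
 obtain u G p Ph DPh where st: "stokes_solution S h u G p" and Ph: "energy_field Ph DPh" "boundary_values S h e_z Ph"
  and F: "F = (LINT x:fluid_domain S h|lborel. stress (G x) (p x) \<bullet> DPh x)"
  using assms unfolding is_normalized_drag_def by blast
 define Fl where "Fl = fluid_domain S h"
 have [measurable]: "Fl \<in> sets borel" by (simp add: Fl_def)
 have u: "energy_field u G" "boundary_values S h e_z u"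
  and tr: "AE x in lborel. x \<in> Fl --> trace (G x) = 0"
  and [measurable]: "p \<in> bm"
  and pint: "set_integrable lborel Fl (%x. (p x)^2)"
  and weak: "!!w W. energy_field w W ==> boundary_values S h 0 w ==>
    (LINT x:Fl|lborel. G x \<bullet> W x - p x * trace (W x)) = 0"
  using st by (auto simp: stokes_solution_def Fl_def)
 have G0: "AE x in lborel. x \<notin> Fl --> G x = 0" and Ph0: "AE x in lborel. x \<notin> Fl --> DPh x = 0"
  using gradient_zero_outside_fluid[OF u] gradient_zero_outside_fluid[OF Ph] by (simp_all add: Fl_def)
 have tr0: "AE x in lborel. trace (G x) = 0"
  using tr G0 by eventually_elim (auto simp: trace_def)
 have sp: "sq_int (%x. indicator Fl x * p x)"
 proof -
  have "(indicator Fl x * p x)^2 = indicator Fl x *\<^sub>R (p x)^2" for x by (simp add: indicator_def)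
  then show ?thesis using pint by (simp add: sq_int_def set_integrable_def)
 qed
 define V where "V W = (LI x. G x \<bullet> W x)" for W
 \<comment> \<open>The difference of two fields with the same boundary values is an admissible test
   field. As the velocity gradient vanishes off the fluid, only the pressure needs to keep the
   indicator.\<close>
 have weak': "(LI x. G x \<bullet> (DB x - G x) - indicator Fl x * p x * trace (DB x - G x)) = 0"
  and iweak: "integrable lborel (%x. G x \<bullet> (DB x - G x) - indicator Fl x * p x * trace (DB x - G x))"
  if B: "energy_field B DB" "boundary_values S h e_z B" for B DB
 proof -
  note ed = energy_field_diff[OF B(1) u(1)]
  note [measurable] = energy_fieldD(2)[OF ed] energy_fieldD(2)[OF u(1)] energy_fieldD(2)[OF B(1)]
  have "boundary_values S h 0 (%x. B x - u x)"
   using B(2) u(2) unfolding boundary_values_def by (auto elim: eventually_elim2)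
  from weak[OF ed this]
  have "(LINT x:Fl|lborel. G x \<bullet> (DB x - G x) - p x * trace (DB x - G x)) = 0" .
  moreover have "(LINT x:Fl|lborel. G x \<bullet> (DB x - G x) - p x * trace (DB x - G x))
   = (LI x. G x \<bullet> (DB x - G x) - indicator Fl x * p x * trace (DB x - G x))"
   unfolding set_lebesgue_integral_def
  proof (rule integral_cong_AE)
   show "AE x in lborel. indicator Fl x *\<^sub>R (G x \<bullet> (DB x - G x) - p x * trace (DB x - G x))
    = G x \<bullet> (DB x - G x) - indicator Fl x * p x * trace (DB x - G x)"
    using G0 by eventually_elim (auto simp: indicator_def)
  qed (simp_all add: trace_def inner_vec_def)
  ultimately show "(LI x. G x \<bullet> (DB x - G x) - indicator Fl x * p x * trace (DB x - G x)) = 0" by simp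
  have "integrable lborel (%x. indicator Fl x * p x * (\<Sum>i\<in>UNIV. (DB x - G x) $ i $ i))"
   unfolding sum_distrib_left
   by (intro Bochner_Integration.integrable_sum sq_int_mult_integrable[OF sp] energy_fieldD(5)[OF ed])
  then show "integrable lborel (%x. G x \<bullet> (DB x - G x) - indicator Fl x * p x * trace (DB x - G x))"
   using matrix_inner_integrable[OF energy_fieldD(5)[OF u(1)] energy_fieldD(5)[OF ed]]
   by (intro Bochner_Integration.integrable_diff) (auto simp: trace_def)
 qed
 have iG: "integrable lborel (%x. (norm (G x))^2)" by (rule energy_fieldD(6)[OF u(1)])
 define E where "E = (LI x. (norm (G x))^2)"
 have "F = E"
 proof -
  note [measurable] = energy_fieldD(2)[OF u(1)] energy_fieldD(2)[OF Ph(1)]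
  define T where "T x = (\<Sum>i\<in>UNIV. \<Sum>j\<in>UNIV. G x $ j $ i * DPh x $ i $ j)" for x
  have ij: "integrable lborel (%x. G x $ j $ i * DPh x $ k $ l)" for i j k l
   by (rule sq_int_mult_integrable[OF energy_fieldD(5)[OF u(1)] energy_fieldD(5)[OF Ph(1)]])
  have iT: "integrable lborel T" unfolding T_def by (intro Bochner_Integration.integrable_sum ij)
  have "(LI x. T x) = (\<Sum>i\<in>UNIV. \<Sum>j\<in>UNIV. (LI x. G x $ j $ i * DPh x $ i $ j))"
   unfolding T_def by (simp add: Bochner_Integration.integral_sum Bochner_Integration.integrable_sum ij)
  also have "... = (\<Sum>i\<in>UNIV. \<Sum>j\<in>UNIV. (LI x. G x $ j $ j * DPh x $ i $ i))"
  proof (intro sum.cong refl)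
   fix i j :: 3
   have "AE x in lborel. x $ 3 <= 0 --> Ph x $ i = 0"
    using Ph(2) by (auto simp: boundary_values_def elim: eventually_mono)
   then show "(LI x. G x $ j $ i * DPh x $ i $ j) = (LI x. G x $ j $ j * DPh x $ i $ i)"
    by (rule mixed_weak_derivs[OF energy_field_weak_deriv[OF u(1)] energy_field_weak_deriv[OF u(1)] energy_field_weak_deriv[OF Ph(1)]])
  qed
  also have "... = (LI x. (\<Sum>i\<in>UNIV. \<Sum>j\<in>UNIV. G x $ j $ j * DPh x $ i $ i))"
   by (simp add: Bochner_Integration.integral_sum Bochner_Integration.integrable_sum ij)
  also have "... = (LINT x|(lborel :: (real^3) measure). 0)"
  proof (rule integral_cong_AE)
   show "AE x in lborel. (\<Sum>i\<in>UNIV. \<Sum>j\<in>UNIV. G x $ j $ j * DPh x $ i $ i) = 0"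
    using tr0 by eventually_elim (simp add: trace_def flip: sum_distrib_right)
  qed simp_all
  finally have T0: "(LI x. T x) = 0" by simp
  have "F = (LI x. ((G x \<bullet> (DPh x - G x) - indicator Fl x * p x * trace (DPh x - G x)) + (norm (G x))^2) + T x)"
   unfolding F set_lebesgue_integral_def Fl_def[symmetric]
  proof (rule integral_cong_AE)
   show "AE x in lborel. indicator Fl x *\<^sub>R (stress (G x) (p x) \<bullet> DPh x)
    = ((G x \<bullet> (DPh x - G x) - indicator Fl x * p x * trace (DPh x - G x)) + (norm (G x))^2) + T x"
    using G0 Ph0 tr0
   proof eventually_elim
    case (elim x)
    show ?case
    proof (cases "x \<in> Fl")
     case True
     have "trace (DPh x - G x) = trace (DPh x)" using elim(3) by (simp add: trace_def sum_subtractf)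
     then show ?thesis using True
      by (simp add: stress_inner T_def inner_diff_right power2_norm_eq_inner)
    next
     case False
     then show ?thesis using elim by (simp add: T_def)
    qed
   qed
   show "(%x. indicator Fl x *\<^sub>R (stress (G x) (p x) \<bullet> DPh x)) \<in> borel_measurable lborel"
    using energy_fieldD(3)[OF u(1)] energy_fieldD(3)[OF Ph(1)]
    unfolding stress_inner trace_def unfolding inner_vec_def by measurable
   show "(%x. G x \<bullet> (DPh x - G x) - indicator Fl x * p x * trace (DPh x - G x) + (norm (G x))^2 + T x) \<in> borel_measurable lborel"
    unfolding T_def trace_def inner_vec_def by measurable
  qed
  also have "... = E"
   using Bochner_Integration.integral_add[OF Bochner_Integration.integrable_add[OF iweak[OF Ph] iG] iT]
    Bochner_Integration.integral_add[OF iweak[OF Ph] iG] weak'[OF Ph] T0 by (simp add: E_def)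
  finally show ?thesis .
 qed
 \<comment> \<open>The difference of the two gradients is orthogonal to the velocity gradient, so
   its energy is the excess.\<close>
 moreover have "E <= (LI x. (norm (DPs x))^2)"
  if Ps: "energy_field Ps DPs" "boundary_values S h e_z Ps" and tPs: "AE x in lborel. trace (DPs x) = 0" for Ps DPs
 proof -
  note ed = energy_field_diff[OF Ps(1) u(1)]
  note [measurable] = energy_fieldD(2)[OF u(1)] energy_fieldD(2)[OF Ps(1)]
  have iGW: "integrable lborel (%x. G x \<bullet> (DPs x - G x))"
   by (rule matrix_inner_integrable[OF energy_fieldD(5)[OF u(1)] energy_fieldD(5)[OF ed]])
  have iW: "integrable lborel (%x. (norm (DPs x - G x))^2)" by (rule energy_fieldD(6)[OF ed])
  have "(LI x. G x \<bullet> (DPs x - G x)) = (LI x. G x \<bullet> (DPs x - G x) - indicator Fl x * p x * trace (DPs x - G x))"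
  proof (rule integral_cong_AE)
   show "AE x in lborel. G x \<bullet> (DPs x - G x) = G x \<bullet> (DPs x - G x) - indicator Fl x * p x * trace (DPs x - G x)"
    using tr0 tPs by eventually_elim (simp add: trace_def sum_subtractf)
  qed (simp_all add: trace_def inner_vec_def)
  then have 0: "(LI x. G x \<bullet> (DPs x - G x)) = 0" using weak'[OF Ps] by simp
  have "(norm (DPs x))^2 = ((norm (G x))^2 + 2 * (G x \<bullet> (DPs x - G x))) + (norm (DPs x - G x))^2" for x
   by (simp add: power2_norm_eq_inner inner_diff_left inner_diff_right inner_commute)
  then have "(LI x. (norm (DPs x))^2) = E + (LI x. (norm (DPs x - G x))^2)"
   using Bochner_Integration.integral_add[OF Bochner_Integration.integrable_add[OF iG integrable_mult_right[OF iGW, of 2]] iW]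
    Bochner_Integration.integral_add[OF iG integrable_mult_right[OF iGW, of 2]] 0 by (simp add: E_def)
  then show ?thesis by simp
 qed
 ultimately show ?thesis using that[OF u G0[unfolded Fl_def] tr0] unfolding E_def by blast
qed

section \<open>Integration in cylindrical coordinates\<close>

text \<open>Groups the horizontal coordinates into a plane with Euclidean norm
  \<open>radius\<close>, so that Fubini separates the height from a planar integral.\<close>

definition of_plane :: "(real \<times> real) \<times> real => real^3" where
 "of_plane y = (\<chi> i. if i = 1 then fst (fst y) else if i = 2 then snd (fst y) else snd y)"

lemma of_plane_nth [simp]:
 "of_plane y $ 1 = fst (fst y)" "of_plane y $ 2 = snd (fst y)" "of_plane y $ 3 = snd y"
 by (simp_all add: of_plane_def)

lemma of_plane_borel [measurable]: "of_plane \<in> borel \<rightarrow>\<^sub>M borel"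
proof (intro borel_measurable_continuous_onI)
 have "continuous_on UNIV (%y::(real \<times> real) \<times> real. if i = 1 then fst (fst y) else if i = 2 then snd (fst y) else snd y)" for i :: 3
  by (cases "i = 1"; cases "i = 2") (auto intro!: continuous_intros)
 then show "continuous_on UNIV of_plane" unfolding of_plane_def by (rule continuous_on_vec_lambda)
qed

lemma prod_over_3: "(\<Prod>j\<in>UNIV. f (j::3)) = f 1 * f 2 * (f 3 :: real)"
proof -
 have U: "(UNIV :: 3 set) = {1, 2, 3}" using exhaust_3 by auto
 show ?thesis unfolding U by simp
qed

lemma lborel_eq_distr_of_plane: "(lborel :: (real^3) measure) = distr lborel borel of_plane"
proof (rule lborel_eqI)
 fix l u :: "real^3"
 assume le: "!!b. b \<in> Basis ==> l \<bullet> b <= u \<bullet> b"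
 have le': "l $ i <= u $ i" for i
  using le[of "axis i 1"] by (simp add: inner_axis axis_in_Basis_iff)
 have B: "(Basis :: (real^3) set) = (%i. axis i 1) ` UNIV" by (auto simp: Basis_vec_def)
 have "(\<Prod>b\<in>Basis. (u - l) \<bullet> b) = (\<Prod>i\<in>UNIV. u $ i - l $ i)"
  unfolding B by (subst prod.reindex) (auto simp: inj_on_def axis_eq_axis inner_axis)
 then have P: "(\<Prod>b\<in>Basis. (u - l) \<bullet> b) = (u $ 1 - l $ 1) * (u $ 2 - l $ 2) * (u $ 3 - l $ 3)"
  by (simp only: prod_over_3)
 have pre: "of_plane -` box l u \<inter> space lborel = box ((l $ 1, l $ 2), l $ 3) ((u $ 1, u $ 2), u $ 3)"
 proof -
  have "x \<in> box l u \<longleftrightarrow> (\<forall>i. l $ i < x $ i \<and> x $ i < u $ i)" for x by (simp add: mem_box_cart)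
  then show ?thesis
   by (auto simp: forall_3 mem_box Basis_prod_def ball_Un)
 qed
 have "emeasure (distr lborel borel of_plane) (box l u) = emeasure lborel (box ((l $ 1, l $ 2), l $ 3) ((u $ 1, u $ 2), u $ 3))"
  by (subst emeasure_distr) (use pre in auto)
 also have "... = ennreal (\<Prod>b\<in>Basis. (((u $ 1, u $ 2), u $ 3) - ((l $ 1, l $ 2), l $ 3)) \<bullet> b)"
  using le' by (intro emeasure_lborel_box) (auto simp: Basis_prod_def)
 also have "(\<Prod>b\<in>Basis. (((u $ 1, u $ 2), u $ 3) - ((l $ 1, l $ 2), l $ 3)) \<bullet> b) = (u $ 1 - l $ 1) * (u $ 2 - l $ 2) * (u $ 3 - l $ 3)"
  by (simp add: Basis_prod_def image_Un)
 finally show "emeasure (distr lborel borel of_plane) (box l u) = ennreal (\<Prod>b\<in>Basis. (u - l) \<bullet> b)"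
  using P by simp
qed simp

text \<open>Polar coordinates for radial functions without a change of variables: both measures give
  a half-line the area of a disc, and half-lines generate the Borel sets.\<close>

lemma distr_norm_plane:
 "distr lborel borel (norm :: real \<times> real => real) = density lborel (%r. ennreal (2 * pi * r) * indicator {0..} r)"
proof (rule measure_eqI_generator_eq[where E="range (%a::real. {..a})" and \<Omega>=UNIV and A="%i. {..real i}"])
 show "Int_stable (range (%a::real. {..a}))" by (auto simp: Int_stable_def)
 show "sets (distr lborel borel (norm :: real \<times> real => real)) = sigma_sets UNIV (range (%a::real. {..a}))"
  "sets (density lborel (%r. ennreal (2 * pi * r) * indicator {0..} r)) = sigma_sets UNIV (range (%a::real. {..a}))"
  by (simp_all add: borel_eq_atMost)
 show "(\<Union>i::nat. {..real i}) = UNIV" using real_arch_simple by auto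
 have L: "emeasure (distr lborel borel (norm :: real \<times> real => real)) {..a} = (if 0 <= a then ennreal (pi * a^2) else 0)" for a
 proof -
  have "(norm :: real \<times> real => real) -` {..a} \<inter> space lborel = cball 0 a" by auto
  then have "emeasure (distr lborel borel (norm :: real \<times> real => real)) {..a} = emeasure lborel (cball (0::real \<times> real) a)"
   by (subst emeasure_distr) auto
  also have "... = (if 0 <= a then ennreal (pi * a^2) else 0)"
   by (auto simp: emeasure_cball unit_ball_vol_2 power2_eq_square)
  finally show ?thesis .
 qed
 have R: "emeasure (density lborel (%r. ennreal (2 * pi * r) * indicator {0..} r)) {..a} = (if 0 <= a then ennreal (pi * a^2) else 0)" for a :: real
 proof -
  have "emeasure (density lborel (%r. ennreal (2 * pi * r) * indicator {0..} r)) {..a}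
    = (\<integral>\<^sup>+r. ennreal (2 * pi * r) * indicator {0..} r * indicator {..a} r \<partial>lborel)"
   by (subst emeasure_density) auto
  also have "... = (\<integral>\<^sup>+r. ennreal (2 * pi * r) * indicator {0..a} r \<partial>lborel)"
   by (intro nn_integral_cong) (auto simp: indicator_def)
  also have "... = (if 0 <= a then ennreal (pi * a^2) else 0)"
  proof (cases "0 <= a")
   case True
   have "(\<integral>\<^sup>+r. ennreal (2 * pi * r) * indicator {0..a} r \<partial>lborel) = ennreal (pi * a^2 - pi * 0^2)"
    by (rule nn_integral_FTC_Icc) (use True in \<open>auto intro!: derivative_eq_intros\<close>)
   then show ?thesis using True by simp
  qed simp
  finally show ?thesis .
 qed
 show "emeasure (distr lborel borel (norm :: real \<times> real => real)) X = emeasure (density lborel (%r. ennreal (2 * pi * r) * indicator {0..} r)) X"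
  if "X \<in> range (%a::real. {..a})" for X using that L R by auto
 show "emeasure (distr lborel borel (norm :: real \<times> real => real)) {..real i} ~= \<infinity>" for i by (simp add: L)
qed auto

lemma radius_borel [measurable]: "radius \<in> bm"
 unfolding radius_def[abs_def] by measurable

lemma nn_integral_cylindrical:
 fixes f :: "real \<times> real => ennreal"
 assumes [measurable]: "f \<in> bm"
 shows "(\<integral>\<^sup>+x. f (radius x, x $ 3) \<partial>lborel) = (\<integral>\<^sup>+r. ennreal (2 * pi * r) * indicator {0..} r * (\<integral>\<^sup>+z. f (r, z) \<partial>lborel) \<partial>lborel)"
proof -
 have fb[measurable]: "f \<in> borel_measurable (borel \<Otimes>\<^sub>M borel)" using assms by (simp add: borel_prod)
 have "(\<integral>\<^sup>+x. f (radius x, x $ 3) \<partial>lborel) = (\<integral>\<^sup>+x. f (radius x, x $ 3) \<partial>(distr lborel borel of_plane))"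
  by (simp flip: lborel_eq_distr_of_plane)
 also have "... = (\<integral>\<^sup>+y. f (radius (of_plane y), of_plane y $ 3) \<partial>lborel)"
  by (subst nn_integral_distr) auto
 also have "... = (\<integral>\<^sup>+y. f (norm (fst y), snd y) \<partial>(lborel \<Otimes>\<^sub>M lborel :: ((real \<times> real) \<times> real) measure))"
 proof -
  have "norm p = sqrt ((fst p)^2 + (snd p)^2)" for p :: "real \<times> real" by (cases p) (simp add: norm_Pair)
  then show ?thesis by (simp add: lborel_prod radius_def)
 qed
 also have "... = (\<integral>\<^sup>+(p::real\<times>real). \<integral>\<^sup>+z. f (norm (fst (p, z)), snd (p, z)) \<partial>lborel \<partial>lborel)"
  by (rule lborel.nn_integral_fst[symmetric]) measurable
 also have "... = (\<integral>\<^sup>+p. (\<integral>\<^sup>+z. f (norm (p::real\<times>real), z) \<partial>lborel) \<partial>lborel)" by simp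
 also have "... = (\<integral>\<^sup>+r. (\<integral>\<^sup>+z. f (r, z) \<partial>lborel) \<partial>(distr lborel borel (norm :: real \<times> real => real)))"
  by (subst nn_integral_distr) auto
 also have "... = (\<integral>\<^sup>+r. ennreal (2 * pi * r) * indicator {0..} r * (\<integral>\<^sup>+z. f (r, z) \<partial>lborel) \<partial>lborel)"
  unfolding distr_norm_plane by (subst nn_integral_density) auto
 finally show ?thesis .
qed

text \<open>Serves to discard cylinders and graphs over the radius, the surfaces at which piecewise
  formulas change.\<close>

lemma AE_cylindrical:
 assumes [measurable]: "Measurable.pred borel P"
  and "AE r in lborel. 0 < r --> (AE z in lborel. P (r, z))"
 shows "AE x in lborel. P (radius x, x $ 3)"
proof -
 define f where "f y = (if P y then 0 else 1 :: ennreal)" for y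
 have [measurable]: "f \<in> bm" unfolding f_def by measurable
 have "AE r in lborel. ennreal (2 * pi * r) * indicator {0..} r * (\<integral>\<^sup>+z. f (r, z) \<partial>lborel) = 0"
  using assms(2)
 proof eventually_elim
  case (elim r)
  show ?case
  proof (cases "0 < r")
   case True
   then have "AE z in lborel. f (r, z) = 0" using elim by (auto simp: f_def elim: eventually_mono)
   then have "(\<integral>\<^sup>+z. f (r, z) \<partial>lborel) = (\<integral>\<^sup>+z. 0 \<partial>(lborel :: real measure))" by (intro nn_integral_cong_AE) auto
   then show ?thesis by simp
  qed (auto simp: indicator_def)
 qed
 then have "(\<integral>\<^sup>+r. ennreal (2 * pi * r) * indicator {0..} r * (\<integral>\<^sup>+z. f (r, z) \<partial>lborel) \<partial>lborel) = (\<integral>\<^sup>+r. 0 \<partial>(lborel :: real measure))"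
  by (intro nn_integral_cong_AE) auto
 then have "(\<integral>\<^sup>+x. f (radius x, x $ 3) \<partial>lborel) = 0" by (subst nn_integral_cylindrical) auto
 then have "AE x in lborel. f (radius x, x $ 3) = 0" by (subst (asm) nn_integral_0_iff_AE) auto
 then show ?thesis by eventually_elim (auto simp: f_def split: if_splits)
qed

lemma AE_radius_neq: "AE x in lborel. radius x ~= c"
proof -
 have "AE r in lborel. r ~= c" by (rule AE_lborel_singleton)
 then have "AE r in lborel. 0 < r --> (AE z::real in lborel. fst (r, z) ~= c)" by eventually_elim auto
 moreover have "Measurable.pred borel (%y::real \<times> real. fst y ~= c)"
  unfolding borel_prod[symmetric] by measurable
 ultimately have "AE x in lborel. fst (radius x, x $ 3) ~= c" by (intro AE_cylindrical)
 then show ?thesis by simp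
qed

lemma AE_height_neq:
 assumes [measurable]: "k \<in> bm"
 shows "AE x in lborel. x $ 3 ~= k (radius x)"
proof -
 have "AE r in lborel. 0 < r --> (AE z in lborel. snd (r, z) ~= k (fst (r, z)))"
  using AE_lborel_singleton by auto
 moreover have "Measurable.pred borel (%y::real \<times> real. snd y ~= k (fst y))"
  unfolding borel_prod[symmetric] by measurable
 ultimately have "AE x in lborel. snd (radius x, x $ 3) ~= k (fst (radius x, x $ 3))"
  by (intro AE_cylindrical[where P="%y. snd y ~= k (fst y)"])
 then show ?thesis by simp
qed

text \<open>The bridge between Lebesgue integrals over space and the gauge integrals in
  \<open>approx_drag\<close>: the integral over heights enters as an evaluated function
  \<open>Z\<close>, and the remaining radial integral as a \<open>has_integral\<close> fact.\<close>

lemma has_integral_cylindrical: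
 fixes f :: "real \<times> real => real"
 assumes [measurable]: "f \<in> bm" and nn: "!!y. 0 <= f y"
  and Z: "!!r. 0 < r ==> r < rh ==> (\<integral>\<^sup>+z. ennreal (f (r, z)) \<partial>lborel) = ennreal (Z r)" "!!r. 0 < r ==> r < rh ==> 0 <= Z r"
  and supp: "!!r z. rh < r ==> f (r, z) = 0"
  and I: "((%r. 2 * pi * r * Z r) has_integral I) {0..rh}"
 shows "integrable lborel (%x. f (radius x, x $ 3))" "(LI x. f (radius x, x $ 3)) = I"
proof -
 define g where "g r = (if 0 < r \<and> r < rh then 2 * pi * r * Z r else 0)" for r
 have g0: "0 <= g r" for r using Z(2) by (simp add: g_def)
 have Ig: "(g has_integral I) {0..rh}"
  by (rule has_integral_spike[OF negligible_finite[of "{0, rh}"] _ I]) (auto simp: g_def)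
 have eq: "AE r in lborel. ennreal (2 * pi * r) * indicator {0..} r * (\<integral>\<^sup>+z. ennreal (f (r, z)) \<partial>lborel) = ennreal (g r)"
  using AE_lborel_singleton[of 0] AE_lborel_singleton[of rh]
 proof eventually_elim
  case (elim r)
  consider "r < 0" | "0 < r" "r < rh" | "rh < r" using elim by linarith
  then show ?case
  proof cases
   case 2
   then show ?thesis by (simp add: Z g_def ennreal_mult)
  next
   case 3
   then show ?thesis by (simp add: supp g_def)
  qed (simp add: g_def)
 qed
 have "(\<integral>\<^sup>+x. ennreal (f (radius x, x $ 3)) \<partial>lborel) = (\<integral>\<^sup>+r. ennreal (2 * pi * r) * indicator {0..} r * (\<integral>\<^sup>+z. ennreal (f (r, z)) \<partial>lborel) \<partial>lborel)"
  by (rule nn_integral_cylindrical) measurable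
 also have "... = (\<integral>\<^sup>+r. ennreal (g r) \<partial>lborel)"
  by (rule nn_integral_cong_AE[OF eq])
 also have "... = (\<integral>\<^sup>+r. ennreal (indicator {0..rh} r * g r) \<partial>lborel)"
  by (intro nn_integral_cong) (auto simp: g_def indicator_def)
 also have "... = ennreal I"
  using nn_integral_has_integral_lebesgue[OF g0 Ig] by simp
 finally have nnI: "(\<integral>\<^sup>+x. ennreal (f (radius x, x $ 3)) \<partial>lborel) = ennreal I" .
 have I0: "0 <= I" by (rule has_integral_nonneg[OF Ig]) (rule g0)
 have m: "(%x. f (radius x, x $ 3)) \<in> borel_measurable lborel" by measurable
 show "integrable lborel (%x. f (radius x, x $ 3))" using nnI nn m by (intro integrableI_nonneg) auto
 show "(LI x. f (radius x, x $ 3)) = I"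
  using nnI nn I0 m by (subst integral_eq_nn_integral) auto
qed

section \<open>The lower bound\<close>

lemma radius_eq_norm: "radius x = norm (x $ 1, x $ 2)"
 by (simp add: radius_def norm_Pair)

lemma radius_nonneg [simp]: "0 <= radius x"
 by (simp add: radius_eq_norm)

lemma component_le_radius: "\<bar>x $ 1\<bar> <= radius x" "\<bar>x $ 2\<bar> <= radius x"
 using norm_fst_le[of "x $ 1" "x $ 2"] norm_snd_le[of "x $ 2" "x $ 1"] by (simp_all add: radius_eq_norm)

lemma norm_le_radius: "norm x <= radius x + \<bar>x $ 3\<bar>"
proof -
 have "(norm x)^2 = (radius x)^2 + (x $ 3)^2"
  by (simp add: norm_vec_def L2_set_def sum_3 radius_def)
 also have "... <= (radius x + \<bar>x $ 3\<bar>)^2" by (simp add: power2_sum)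
 finally show ?thesis by (rule power2_le_imp_le) simp
qed

lemma radius_axis3 [simp]: "radius (x + t *\<^sub>R axis 3 1) = radius x"
 by (simp add: radius_def axis_def)

lemma radius_lipschitz: "\<bar>radius (x + t *\<^sub>R axis i 1) - radius x\<bar> <= \<bar>t\<bar>"
proof -
 have "norm ((x + t *\<^sub>R axis i 1) $ 1, (x + t *\<^sub>R axis i 1) $ 2) - norm (x $ 1, x $ 2) <= \<bar>t\<bar>"
  "norm (x $ 1, x $ 2) - norm ((x + t *\<^sub>R axis i 1) $ 1, (x + t *\<^sub>R axis i 1) $ 2) <= \<bar>t\<bar>"
  using norm_triangle_ineq3[of "((x + t *\<^sub>R axis i 1) $ 1, (x + t *\<^sub>R axis i 1) $ 2)" "(x $ 1, x $ 2)"]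
   exhaust_3[of i] by (auto simp: axis_def norm_Pair)
 then show ?thesis by (simp add: radius_eq_norm abs_le_iff)
qed

lemma radius_has_derivative:
 assumes "radius x ~= 0" "i = 1 \<or> i = 2"
 shows "((%t. radius (x + t *\<^sub>R axis i 1)) has_real_derivative x $ i / radius x) (at 0)"
proof -
 have "0 < (x $ 1)^2 + (x $ 2)^2"
 proof -
  have "(x $ 1)^2 + (x $ 2)^2 ~= 0" using assms(1) unfolding radius_def by force
  then show ?thesis using sum_power2_ge_zero[of "x $ 1" "x $ 2"] by linarith
 qed
 then have pos: "0 < (x $ i + 0)^2 + k" if "k + (x $ i)^2 = (x $ 1)^2 + (x $ 2)^2" for k
  using that by (simp only: add_0_right)
 have D: "((%t. sqrt ((x $ i + t)^2 + k)) has_real_derivative x $ i / radius x) (at 0)"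
  if k: "k + (x $ i)^2 = (x $ 1)^2 + (x $ 2)^2" for k
 proof -
  have "((%t. (x $ i + t)^2 + k) has_real_derivative 2 * x $ i) (at 0)"
   by (auto intro!: derivative_eq_intros)
  from DERIV_chain2[OF DERIV_real_sqrt[OF pos[OF k]] this]
  have d: "((%t. sqrt ((x $ i + t)^2 + k)) has_real_derivative inverse (sqrt ((x $ i + 0)^2 + k)) / 2 * (2 * x $ i)) (at 0)" .
  have "(x $ i + 0)^2 + k = (x $ 1)^2 + (x $ 2)^2" using k by (simp only: add_0_right)
  then have s: "sqrt ((x $ i + 0)^2 + k) = radius x" unfolding radius_def by (rule arg_cong)
  have "inverse (radius x) / 2 * (2 * x $ i) = x $ i / radius x" using assms(1) by (simp add: field_simps)
  then show ?thesis using d unfolding s by (simp only:)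
 qed
 show ?thesis
  using assms(2)
 proof
  assume i: "i = 1"
  have "radius (x + t *\<^sub>R axis i 1) = sqrt ((x $ i + t)^2 + (x $ 2)^2)" for t by (simp add: radius_def axis_def i)
  then show ?thesis using D[of "(x $ 2)^2"] i by simp
 next
  assume i: "i = 2"
  have "radius (x + t *\<^sub>R axis i 1) = sqrt ((x $ i + t)^2 + (x $ 1)^2)" for t by (simp add: radius_def axis_def i)
  then show ?thesis using D[of "(x $ 1)^2"] i by simp
 qed
qed

lemma smoothstep'_range: "0 <= smoothstep' s" "smoothstep' s <= 2"
proof -
 define t where "t = max 0 (min 1 s)"
 have t: "0 <= t" "t <= 1" by (auto simp: t_def)
 have "0 <= 6 * t * (1 - t)" using t by simp
 moreover have "6 * t * (1 - t) <= 2"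
  using zero_le_power2[of "t - 1/2"] by (simp add: power2_eq_square algebra_simps)
 ultimately show "0 <= smoothstep' s" "smoothstep' s <= 2"
  by (auto simp: smoothstep'_def Let_def t_def)
qed

lemma smoothstep_lipschitz: "\<bar>smoothstep a - smoothstep b\<bar> <= 2 * \<bar>a - b\<bar>"
 using field_differentiable_bound[of UNIV smoothstep smoothstep' 2 a b] has_real_derivative_smoothstep smoothstep'_range
 by simp

lemma smoothstep_borel [measurable]: "smoothstep \<in> bm" "smoothstep' \<in> bm"
 unfolding smoothstep_def[abs_def] smoothstep'_def[abs_def] Let_def by measurable

lemma smoothstep_chain [derivative_intros]:
 "(f has_real_derivative f') (at x within S) ==>
  ((%x. smoothstep (f x)) has_real_derivative smoothstep' (f x) * f') (at x within S)"
 by (rule DERIV_chain2[OF has_real_derivative_smoothstep])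

lemma abs_mult_diff_le:
 fixes a b a' b' :: real
 assumes "\<bar>a\<bar> <= A" "\<bar>b'\<bar> <= B" "\<bar>a - a'\<bar> <= x" "\<bar>b - b'\<bar> <= y"
 shows "\<bar>a * b - a' * b'\<bar> <= A * y + x * B"
proof -
 have "a * b - a' * b' = a * (b - b') + (a - a') * b'" by (simp add: algebra_simps)
 then have "\<bar>a * b - a' * b'\<bar> <= \<bar>a\<bar> * \<bar>b - b'\<bar> + \<bar>a - a'\<bar> * \<bar>b'\<bar>"
  using abs_triangle_ineq[of "a * (b - b')" "(a - a') * b'"] by (simp add: abs_mult)
 also have "... <= A * y + x * B" using assms by (intro add_mono mult_mono) auto
 finally show ?thesis .
qed

text \<open>\<open>H\<close> is the height of the gap, and \<open>d\<close> the thickness of a layer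
  of solid above it in which the velocity is known. Test functions decay inside this layer and below
  the wall, where they meet prescribed values only.\<close>

locale thin_gap =
 fixes H H' :: "real => real" and h rh d M :: real
 assumes h: "0 < h" and rh: "0 < rh" and d: "0 < d"
  and H_ge: "!!r. 0 <= r ==> r <= rh ==> h <= H r"
  and H_lip: "!!r s. 0 <= r ==> r <= rh ==> 0 <= s ==> s <= rh ==> \<bar>H r - H s\<bar> <= M * \<bar>r - s\<bar>"
  and H_der: "!!r. 0 < r ==> r < rh ==> (H has_real_derivative H' r) (at r)"
  and H_borel [measurable]: "H \<in> bm" "H' \<in> bm"
begin

text \<open>Equal to 1 throughout the gap. The first factor falls to zero on
  \<open>-1 <= z <= 0\<close>, the second one within the layer of thickness
  \<open>d\<close>.\<close>

definition "cutoff r z = smoothstep (1 + z) * (1 - smoothstep ((z - H r) / d))"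

definition "cutoff_z r z = smoothstep' (1 + z) * (1 - smoothstep ((z - H r) / d))
  - smoothstep (1 + z) * (smoothstep' ((z - H r) / d) / d)"

definition "Hmax = H 0 + M * rh"

text \<open>The lubrication pressure up to a constant: \<open>6 s / H^3\<close> is its radial
  gradient when the upper surface rises with unit speed over a fixed wall.\<close>

definition "J r = integral {0..r} (%s. 6 * s / (H s) ^ 3)"

text \<open>The same pressure normalised to vanish from \<open>rh\<close> on. It thereby has bounded
  radial support without any radial cutoff, at the price of a kink at \<open>rh\<close>.\<close>

definition "Q r = J (max 0 (min rh r)) - J rh"

lemma M_nonneg: "0 <= M"
proof -
 have "0 <= M * \<bar>rh - 0\<bar>" using H_lip[of rh 0] rh by linarith
 then show ?thesis using rh by (simp add: zero_le_mult_iff)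
qed

lemma H_le_Hmax: "0 <= r ==> r <= rh ==> H r <= Hmax"
proof -
 assume r: "0 <= r" "r <= rh"
 have "\<bar>H r - H 0\<bar> <= M * \<bar>r - 0\<bar>" using H_lip[of r 0] r rh by simp
 moreover have "M * \<bar>r - 0\<bar> <= M * rh" using r M_nonneg by (intro mult_left_mono) auto
 ultimately show ?thesis unfolding Hmax_def by linarith
qed

lemma Hmax_pos: "0 < Hmax"
 using H_le_Hmax[of 0] H_ge[of 0] h rh by simp

lemma continuous_on_H: "continuous_on {0..rh} H"
proof -
 have "M-lipschitz_on {0..rh} H"
  by (rule lipschitz_onI) (use H_lip M_nonneg in \<open>auto simp: dist_real_def\<close>)
 then show ?thesis by (rule lipschitz_on_continuous_on)
qed

lemma continuous_on_weight: "continuous_on {0..rh} (%s. 6 * s / (H s) ^ 3)"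
 using H_ge h by (intro continuous_intros continuous_on_H) fastforce

lemma weight_bounds: assumes "0 <= r" "r <= rh" shows "0 <= 6 * r / (H r) ^ 3" "6 * r / (H r) ^ 3 <= 6 * rh / h ^ 3"
proof -
 have "h <= H r" using H_ge assms by simp
 then have "h ^ 3 <= (H r) ^ 3" using h by (intro power_mono) auto
 then show "6 * r / (H r) ^ 3 <= 6 * rh / h ^ 3" using assms h by (intro frac_le) auto
 show "0 <= 6 * r / (H r) ^ 3" using assms \<open>h <= H r\<close> h by simp
qed

lemma J_derivative: "0 <= r ==> r <= rh ==> (J has_real_derivative 6 * r / (H r) ^ 3) (at r within {0..rh})"
 unfolding J_def using continuous_on_weight by (intro integral_has_real_derivative) auto

lemma J_mono: "0 <= r ==> r <= rh ==> J r <= J rh"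
proof -
 assume r: "0 <= r" "r <= rh"
 have "(%s. 6 * s / (H s) ^ 3) integrable_on {0..x}" if "x <= rh" for x
  using continuous_on_subset[OF continuous_on_weight, of "{0..x}"] that by (intro integrable_continuous_interval) auto
 then show ?thesis
  unfolding J_def using r weight_bounds by (intro integral_subset_le) auto
qed

lemma J_lipschitz: "0 <= r ==> r <= rh ==> 0 <= s ==> s <= rh ==> \<bar>J r - J s\<bar> <= 6 * rh / h ^ 3 * \<bar>r - s\<bar>"
proof -
 assume rs: "0 <= r" "r <= rh" "0 <= s" "s <= rh"
 have "norm (6 * x / (H x) ^ 3) <= 6 * rh / h ^ 3" if "x \<in> {0..rh}" for x
  unfolding real_norm_def using that by (subst abs_of_nonneg) (auto intro!: weight_bounds)
 then have "norm (J r - J s) <= 6 * rh / h ^ 3 * norm (r - s)"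
  using rs by (intro field_differentiable_bound[of "{0..rh}" J "%r. 6 * r / (H r) ^ 3"]) (auto intro: J_derivative)
 then show ?thesis by simp
qed

lemma Q_lipschitz: "\<bar>Q r - Q s\<bar> <= 6 * rh / h ^ 3 * \<bar>r - s\<bar>"
proof -
 have "\<bar>Q r - Q s\<bar> <= 6 * rh / h ^ 3 * \<bar>max 0 (min rh r) - max 0 (min rh s)\<bar>"
  unfolding Q_def using J_lipschitz[of "max 0 (min rh r)" "max 0 (min rh s)"] rh by simp
 also have "... <= 6 * rh / h ^ 3 * \<bar>r - s\<bar>" using rh h by (intro mult_left_mono) (auto simp: max_def min_def)
 finally show ?thesis .
qed

lemma Q_zero [simp]: "rh <= r ==> Q r = 0" using rh by (simp add: Q_def)

lemma Q_nonpos: "Q r <= 0" unfolding Q_def using J_mono[of "max 0 (min rh r)"] rh by simp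

lemma Q_bound: "0 <= r ==> \<bar>Q r\<bar> <= 6 * rh / h ^ 3 * rh"
proof -
 assume r: "0 <= r"
 show ?thesis
 proof (cases "r <= rh")
  case True
  have "\<bar>Q r - Q rh\<bar> <= 6 * rh / h ^ 3 * \<bar>r - rh\<bar>" by (rule Q_lipschitz)
  also have "... <= 6 * rh / h ^ 3 * rh" using r True rh h by (intro mult_left_mono) auto
  finally show ?thesis by simp
 qed (use rh h in simp)
qed

lemma Q_continuous: "continuous_on S Q"
proof -
 have "(6 * rh / h ^ 3)-lipschitz_on S Q"
  by (rule lipschitz_onI) (use Q_lipschitz rh h in \<open>auto simp: dist_real_def\<close>)
 then show ?thesis by (rule lipschitz_on_continuous_on)
qed

lemma Q_borel [measurable]: "Q \<in> bm"
 by (intro borel_measurable_continuous_onI Q_continuous)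

lemma Q_derivative: assumes "0 < r" "r < rh" shows "(Q has_real_derivative 6 * r / (H r) ^ 3) (at r)"
proof -
 have "(J has_real_derivative 6 * r / (H r) ^ 3) (at r within {0..rh})" using assms J_derivative by simp
 moreover have "at r within {0..rh} = at r" using assms by (intro at_within_interior) (auto simp: interior_atLeastAtMost_real)
 ultimately have "(J has_real_derivative 6 * r / (H r) ^ 3) (at r)" by simp
 then have "((%r. J r - J rh) has_real_derivative 6 * r / (H r) ^ 3) (at r)" by (auto intro!: derivative_eq_intros)
 then show ?thesis
  by (rule has_field_derivative_transform_within_open[of _ _ _ "{0<..<rh}"]) (use assms in \<open>auto simp: Q_def\<close>)
qed

lemma cutoff_bounds: "0 <= cutoff r z" "cutoff r z <= 1"
 unfolding cutoff_def using smoothstep_range[of "1 + z"] smoothstep_range[of "(z - H r) / d"]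
 by (simp_all add: mult_le_one)

lemma cutoff_support: assumes "cutoff r z ~= 0 \<or> cutoff_z r z ~= 0" shows "- 1 < z" "z < H r + d"
proof -
 show "- 1 < z" using assms by (rule_tac ccontr) (auto simp: cutoff_def cutoff_z_def)
 have "1 <= (z - H r) / d" if "H r + d <= z" using that d by (simp add: le_divide_eq)
 then show "z < H r + d" using assms by (rule_tac ccontr) (auto simp: cutoff_def cutoff_z_def)
qed

lemma cutoff_gap: assumes "0 <= z" "z <= H r" shows "cutoff r z = 1" "cutoff_z r z = 0"
proof -
 have "(z - H r) / d <= 0" using assms d by (simp add: divide_le_0_iff)
 then show "cutoff r z = 1" "cutoff_z r z = 0" using assms by (auto simp: cutoff_def cutoff_z_def)
qed

lemma cutoff_derivative: "(cutoff r has_real_derivative cutoff_z r z) (at z)"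
 unfolding cutoff_def[abs_def] cutoff_z_def using d by (auto intro!: derivative_eq_intros)

lemma cutoff_z_bound: "\<bar>cutoff_z r z\<bar> <= 2 + 2 / d"
proof -
 have a: "\<bar>smoothstep' (1 + z) * (1 - smoothstep ((z - H r) / d))\<bar> <= 2 * 1"
  unfolding abs_mult using smoothstep_range[of "(z - H r) / d"] smoothstep'_range[of "1 + z"] by (intro mult_mono) auto
 have b: "\<bar>smoothstep (1 + z) * (smoothstep' ((z - H r) / d) / d)\<bar> <= 1 * (2 / d)"
  unfolding abs_mult using smoothstep_range[of "1 + z"] smoothstep'_range[of "(z - H r) / d"] d
  by (intro mult_mono) (auto intro: divide_right_mono)
 show ?thesis
  unfolding cutoff_z_def by (rule order_trans[OF abs_triangle_ineq4]) (use a b in linarith)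
qed

lemma cutoff_lipschitz_z: "\<bar>cutoff r z - cutoff r z'\<bar> <= (2 + 2 / d) * \<bar>z - z'\<bar>"
 using field_differentiable_bound[of UNIV "cutoff r" "cutoff_z r" "2 + 2 / d" z z'] cutoff_derivative cutoff_z_bound by simp

lemma cutoff_lipschitz_r:
 assumes "0 <= r" "r <= rh" "0 <= s" "s <= rh"
 shows "\<bar>cutoff r z - cutoff s z\<bar> <= 2 * M / d * \<bar>r - s\<bar>"
proof -
 have "cutoff r z - cutoff s z = smoothstep (1 + z) * (smoothstep ((z - H s) / d) - smoothstep ((z - H r) / d))"
  unfolding cutoff_def by (simp only: algebra_simps)
 then have "\<bar>cutoff r z - cutoff s z\<bar> <= 1 * \<bar>smoothstep ((z - H s) / d) - smoothstep ((z - H r) / d)\<bar>"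
  using smoothstep_range[of "1 + z"] by (simp only: abs_mult) (intro mult_right_mono, auto)
 also have "... <= 2 * \<bar>(z - H s) / d - (z - H r) / d\<bar>" using smoothstep_lipschitz by simp
 also have "... = 2 * \<bar>H r - H s\<bar> / d" using d by (simp add: diff_divide_distrib[symmetric])
 also have "... <= 2 * (M * \<bar>r - s\<bar>) / d" using H_lip[OF assms] d by (intro divide_right_mono) auto
 finally show ?thesis by simp
qed

lemma cutoff_borel [measurable]: "(%y. cutoff (fst y) (snd y)) \<in> borel_measurable (borel \<Otimes>\<^sub>M borel)"
  "(%y. cutoff_z (fst y) (snd y)) \<in> borel_measurable (borel \<Otimes>\<^sub>M borel)"
 unfolding cutoff_def cutoff_z_def by measurable

lemma cutoff_borel' [measurable]: "(%x. cutoff (radius x) (x $ 3)) \<in> bm"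
  "(%x. cutoff_z (radius x) (x $ 3)) \<in> bm"
 unfolding cutoff_def cutoff_z_def by measurable

text \<open>Integration by parts against the disc area \<open>pi * r^2\<close>; the boundary terms
  drop because \<open>Q\<close> vanishes at \<open>rh\<close> and the area at the axis.\<close>

lemma flux_integral:
 "((%r. 2 * pi * r * - Q r) has_integral 6 * pi * integral {0..rh} (%r. r ^ 3 / (H r) ^ 3)) {0..rh}"
proof -
 have S1: "((%r. 2 * pi * r * - Q r - pi * r^2 * (6 * r / (H r) ^ 3)) has_integral (pi * rh^2 * - Q rh - pi * 0^2 * - Q 0)) {0..rh}"
 proof (rule fundamental_theorem_of_calculus_interior)
  show "((%r. pi * r^2 * - Q r) has_vector_derivative 2 * pi * r * - Q r - pi * r^2 * (6 * r / (H r) ^ 3)) (at r)"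
   if "r \<in> {0<..<rh}" for r
   unfolding has_real_derivative_iff_has_vector_derivative[symmetric]
   using that by (auto intro!: derivative_eq_intros Q_derivative simp: power2_eq_square)
 qed (use rh in \<open>auto intro!: continuous_intros Q_continuous\<close>)
 have S2: "((%r. 6 * pi * (r ^ 3 / (H r) ^ 3)) has_integral 6 * pi * integral {0..rh} (%r. r ^ 3 / (H r) ^ 3)) {0..rh}"
  using H_ge h by (intro has_integral_mult_right integrable_integral integrable_continuous_interval continuous_intros continuous_on_H) fastforce
 have "((%r. 2 * pi * r * - Q r) has_integral
   (pi * rh^2 * - Q rh - pi * 0^2 * - Q 0) + 6 * pi * integral {0..rh} (%r. r ^ 3 / (H r) ^ 3)) {0..rh}"
  by (rule has_integral_eq[OF _ has_integral_add[OF S1 S2]]) (simp add: power2_eq_square power3_eq_cube)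
 then show ?thesis by simp
qed

lemma layer_integral:
 "(\<integral>\<^sup>+z. ennreal (smoothstep' ((z - a) / d) / d) \<partial>lborel) = 1"
proof -
 have "(\<integral>\<^sup>+z. ennreal (smoothstep' ((z - a) / d) / d) \<partial>lborel)
   = (\<integral>\<^sup>+z. ennreal (smoothstep' ((z - a) / d) / d) * indicator {a..a + d} z \<partial>lborel)"
 proof (intro nn_integral_cong)
  fix z
  have "smoothstep' ((z - a) / d) = 0" if "z \<notin> {a..a + d}"
  proof -
   have "(z - a) / d <= 0 \<or> 1 <= (z - a) / d" using that d by (auto simp: divide_le_0_iff le_divide_eq)
   then show ?thesis by auto
  qed
  then show "ennreal (smoothstep' ((z - a) / d) / d) = ennreal (smoothstep' ((z - a) / d) / d) * indicator {a..a + d} z"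
   by (auto simp: indicator_def)
 qed
 also have "... = ennreal (smoothstep ((a + d - a) / d) - smoothstep ((a - a) / d))"
  by (rule nn_integral_FTC_Icc) (use d smoothstep'_range in \<open>auto intro!: derivative_eq_intros\<close>)
 finally show ?thesis using d by simp
qed

lemma weight_component_bound:
 assumes "radius x < rh" "i = 1 \<or> i = 2"
 shows "\<bar>6 * x $ i / (H (radius x)) ^ 3\<bar> <= 6 * rh / h ^ 3"
proof -
 have Hr: "0 < H (radius x)" using H_ge[of "radius x"] assms(1) h by simp
 have "\<bar>6 * x $ i / (H (radius x)) ^ 3\<bar> = 6 * \<bar>x $ i\<bar> / (H (radius x)) ^ 3"
  using Hr by (simp add: abs_mult)
 also have "... <= 6 * radius x / (H (radius x)) ^ 3"
  using component_le_radius[of x] assms(2) Hr by (intro divide_right_mono) auto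
 also have "... <= 6 * rh / h ^ 3" using assms(1) by (intro weight_bounds) auto
 finally show ?thesis .
qed

lemma cutoff_shift_derivative:
 "((%t. cutoff r (z + t)) has_real_derivative cutoff_z r z) (at 0)"
proof -
 have "((%t. z + t) has_real_derivative 1) (at 0)" by (auto intro!: derivative_eq_intros)
 from DERIV_chain2[where f="cutoff r" and g="%t. z + t", OF _ this, OF cutoff_derivative] show ?thesis by simp
qed

text \<open>Three integrations by parts evaluate the pairing of the gradient with the shear
  \<open>T\<close>. Vertically it becomes a pairing of the horizontal velocity with the pressure
  gradient (\<open>A\<close>), then the pressure times the horizontal divergence
  (\<open>BB\<close>), which incompressibility turns into the pressure times the vertical
  derivative; that one sees the boundary values alone (\<open>CC\<close>). The pairing and the
  integral of the square of \<open>T\<close> over the gap are both \<open>I\<close>, so the bound is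
  \<open>2 * I - I\<close>.\<close>

lemma energy_lower_bound:
 assumes u: "energy_field u G" and tr: "AE x in lborel. trace (G x) = 0"
  and wall: "AE x in lborel. x $ 3 <= 0 --> u x = 0"
  and solid: "AE x in lborel. radius x < rh \<and> H (radius x) < x $ 3 \<and> x $ 3 <= H (radius x) + d --> u x = e_z"
  and G0: "AE x in lborel. x $ 3 <= 0 \<or> radius x < rh \<and> H (radius x) < x $ 3 \<and> x $ 3 <= H (radius x) + d --> G x = 0"
 shows "6 * pi * integral {0..rh} (%r. r ^ 3 / (H r) ^ 3) <= (LI x. (norm (G x))^2)"
proof -
 define I where "I = 6 * pi * integral {0..rh} (%r. r ^ 3 / (H r) ^ 3)"
 define B where "B = 1 + Hmax + d"
 define R where "R = rh + B"
 define W where "W = 6 * rh / h ^ 3"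
 have B: "0 < B" "1 <= B" using Hmax_pos d by (auto simp: B_def)
 have W: "0 <= W" using rh h by (simp add: W_def)
 have R: "0 <= R" using rh B by (simp add: R_def)
 have ez: "e_z $ 1 = 0" "e_z $ 2 = 0" "e_z $ 3 = 1" by (simp_all add: e_z_def axis_def)
 note [measurable] = energy_fieldD(1,2,3,4)[OF u]
 have zB: "\<bar>z - H r / 2\<bar> <= B" "\<bar>z\<bar> <= B" if "0 <= r" "r <= rh" "cutoff r z ~= 0 \<or> cutoff_z r z ~= 0" for r z
  using cutoff_support[OF that(3)] H_le_Hmax[OF that(1,2)] H_ge[OF that(1,2)] h d by (auto simp: B_def abs_le_iff)
 \<comment> \<open>The vertical shear, continued beyond the gap by the cutoff. It jumps at radius
   \<open>rh\<close>, which is admissible because it is tested in the vertical direction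
   only.\<close>
 define T where "T i x = (if radius x < rh then (6 * x $ i / (H (radius x)) ^ 3) * ((x $ 3 - H (radius x) / 2) * cutoff (radius x) (x $ 3)) else 0)" for i x
 define T' where "T' i x = (if radius x < rh then (6 * x $ i / (H (radius x)) ^ 3) * (cutoff (radius x) (x $ 3) + (x $ 3 - H (radius x) / 2) * cutoff_z (radius x) (x $ 3)) else 0)" for i x
 define P where "P i x = (if radius x < rh \<and> 0 < x $ 3 \<and> x $ 3 <= H (radius x) then 6 * x $ i / (H (radius x)) ^ 3 * u x $ i else 0)" for i x
 have [measurable]: "T i \<in> bm" "T' i \<in> bm" "P i \<in> bm" for i
  unfolding T_def T'_def P_def by measurable
 have Tb: "\<bar>T i x\<bar> <= W * B" and Ts: "T i x ~= 0 ==> norm x <= R" if i: "i = 1 \<or> i = 2" for i x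
 proof -
  have "\<bar>(x $ 3 - H (radius x) / 2) * cutoff (radius x) (x $ 3)\<bar> <= B * 1" if "radius x < rh"
  proof (cases "cutoff (radius x) (x $ 3) = 0")
   case False
   then show ?thesis unfolding abs_mult
    using zB(1)[of "radius x" "x $ 3"] that cutoff_bounds[of "radius x" "x $ 3"] B by (intro mult_mono) auto
  qed (use B in simp)
  then have "\<bar>6 * x $ i / (H (radius x)) ^ 3\<bar> * \<bar>(x $ 3 - H (radius x) / 2) * cutoff (radius x) (x $ 3)\<bar> <= W * B"
   if "radius x < rh"
   using weight_component_bound[OF that i] that W by (intro mult_mono) (auto simp: W_def)
  then show "\<bar>T i x\<bar> <= W * B" using W B by (simp add: T_def flip: abs_mult)
  show "norm x <= R" if "T i x ~= 0"
  proof -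
   have r: "radius x < rh" and c: "cutoff (radius x) (x $ 3) ~= 0" using that by (auto simp: T_def split: if_splits)
   then show ?thesis using zB(2)[of "radius x" "x $ 3"] norm_le_radius[of x] by (simp add: R_def)
  qed
 qed
 have Tder: "((%t. T i (x + t *\<^sub>R axis 3 1)) has_real_derivative T' i x) (at 0)" if i: "i = 1 \<or> i = 2" for i x
 proof -
  have c: "(x + t *\<^sub>R axis 3 1) $ i = x $ i" "(x + t *\<^sub>R axis 3 1) $ 3 = x $ 3 + t" for t
   using i by (auto simp: axis_def)
  have "((%t. (x $ 3 + t - H (radius x) / 2) * cutoff (radius x) (x $ 3 + t)) has_real_derivative
    cutoff (radius x) (x $ 3) + (x $ 3 - H (radius x) / 2) * cutoff_z (radius x) (x $ 3)) (at 0)"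
   by (auto intro!: derivative_eq_intros cutoff_shift_derivative)
  from DERIV_cmult[OF this, of "6 * x $ i / H (radius x) ^ 3"]
  show ?thesis unfolding T_def T'_def c radius_axis3
   by (cases "radius x < rh") (simp_all only: if_True if_False simp_thms DERIV_const)
 qed
 have Tlip: "\<bar>T i (x + t *\<^sub>R axis 3 1) - T i x\<bar> <= W * (1 + B * (2 + 2 / d)) * \<bar>t\<bar>" if i: "i = 1 \<or> i = 2" for i x t
 proof (cases "radius x < rh")
  case True
  have "norm ((x $ 3 + t - H (radius x) / 2) * cutoff (radius x) (x $ 3 + t) - (x $ 3 - H (radius x) / 2) * cutoff (radius x) (x $ 3))
    <= (1 + B * (2 + 2 / d)) * norm (x $ 3 + t - x $ 3)"
  proof (rule field_differentiable_bound[of UNIV "%z. (z - H (radius x) / 2) * cutoff (radius x) z"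
     "%z. cutoff (radius x) z + (z - H (radius x) / 2) * cutoff_z (radius x) z"])
   show "((%z. (z - H (radius x) / 2) * cutoff (radius x) z) has_field_derivative
     cutoff (radius x) z + (z - H (radius x) / 2) * cutoff_z (radius x) z) (at z within UNIV)" for z
    by (auto intro!: derivative_eq_intros cutoff_derivative)
   have "\<bar>(z - H (radius x) / 2) * cutoff_z (radius x) z\<bar> <= B * (2 + 2 / d)" for z
   proof (cases "cutoff_z (radius x) z = 0")
    case False
    then show ?thesis unfolding abs_mult
     using zB(1)[of "radius x" z] True cutoff_z_bound[of "radius x" z] B by (intro mult_mono) auto
   qed (use B d in simp)
   then show "norm (cutoff (radius x) z + (z - H (radius x) / 2) * cutoff_z (radius x) z) <= 1 + B * (2 + 2 / d)" for z
    unfolding real_norm_def using cutoff_bounds[of "radius x" z]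
    by (intro order_trans[OF abs_triangle_ineq] add_mono) auto
  qed auto
  then have "\<bar>6 * x $ i / (H (radius x)) ^ 3\<bar> * \<bar>(x $ 3 + t - H (radius x) / 2) * cutoff (radius x) (x $ 3 + t) - (x $ 3 - H (radius x) / 2) * cutoff (radius x) (x $ 3)\<bar>
   <= W * ((1 + B * (2 + 2 / d)) * \<bar>t\<bar>)"
   using weight_component_bound[OF True i] W by (intro mult_mono) (auto simp: W_def)
  moreover have c: "(x + t *\<^sub>R axis 3 1) $ i = x $ i" "(x + t *\<^sub>R axis 3 1) $ 3 = x $ 3 + t"
   using i by (auto simp: axis_def)
  ultimately show ?thesis using True unfolding T_def c radius_axis3
   by (simp only: if_True right_diff_distrib[symmetric] abs_mult mult.assoc)
 next
  case False
  then show ?thesis using W B d by (simp add: T_def)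
 qed
 \<comment> \<open>Inside the gap the vertical derivative of \<open>T\<close> is the pressure
   gradient \<open>6 * x $ i / H^3\<close>; in the layers where the cutoff varies the horizontal
   velocity is zero.\<close>
 have A: "(LI x. G x $ i $ 3 * T i x) = - (LI x. P i x)" if i: "i = 1 \<or> i = 2" for i
 proof -
  have "(LI x. u x $ i * T' i x) = - (LI x. G x $ i $ 3 * T i x)"
   by (rule weak_deriv_lipschitz_test[OF energy_field_weak_deriv[OF u] _ _ Tb[OF i] Ts[OF i] R Tlip[OF i]])
    (use Tder[OF i] in auto)
  moreover have "(LI x. u x $ i * T' i x) = (LI x. P i x)"
  proof (rule integral_cong_AE)
   show "AE x in lborel. u x $ i * T' i x = P i x"
    using wall solid
   proof eventually_elim
    case (elim x)
    consider "\<not> radius x < rh" | "radius x < rh" "x $ 3 <= 0" | "radius x < rh" "0 < x $ 3" "x $ 3 <= H (radius x)"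
     | "radius x < rh" "H (radius x) < x $ 3" "x $ 3 <= H (radius x) + d" | "radius x < rh" "H (radius x) + d < x $ 3" by linarith
    then show ?case
    proof cases
     case 2
     then show ?thesis using elim by (simp add: P_def)
    next
     case 3
     then show ?thesis using cutoff_gap[of "x $ 3" "radius x"] by (simp add: P_def T'_def)
    next
     case 4
     then show ?thesis using elim i ez by (auto simp: P_def)
    next
     case 5
     then have "cutoff (radius x) (x $ 3) = 0" "cutoff_z (radius x) (x $ 3) = 0"
      using cutoff_support[of "radius x" "x $ 3"] by force+
     then show ?thesis using 5 d by (simp add: P_def T'_def)
    qed (simp add: P_def T'_def)
   qed
  qed measurable
  ultimately show ?thesis by simp
 qed
 \<comment> \<open>The pressure as a Lipschitz test function, for all three diagonal entries of the
   gradient.\<close>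
 define pf where "pf x = Q (radius x) * cutoff (radius x) (x $ 3)" for x
 have [measurable]: "pf \<in> bm" unfolding pf_def by measurable
 define K where "K = 6 * rh / h ^ 3 * rh"
 have K: "0 <= K" using rh h by (simp add: K_def)
 have QK: "\<bar>Q r\<bar> <= K" if "0 <= r" for r using Q_bound[OF that] by (simp add: K_def)
 have pfb: "\<bar>pf x\<bar> <= K" for x
  using mult_mono[OF QK[of "radius x"], of "\<bar>cutoff (radius x) (x $ 3)\<bar>" 1] cutoff_bounds[of "radius x" "x $ 3"] K
  by (simp add: pf_def abs_mult)
 have pfs: "norm x <= R" if "pf x ~= 0" for x
 proof -
  have c: "cutoff (radius x) (x $ 3) ~= 0" and q: "Q (radius x) ~= 0" using that by (auto simp: pf_def)
  have r: "radius x < rh" using q Q_zero not_le by metis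
  then show ?thesis using zB(2)[of "radius x" "x $ 3"] c norm_le_radius[of x] by (simp add: R_def)
 qed
 define ps where "ps i x = (if 0 < radius x \<and> radius x < rh then 6 * x $ i / (H (radius x)) ^ 3 * cutoff (radius x) (x $ 3)
   + Q (radius x) * (smoothstep (1 + x $ 3) * (smoothstep' ((x $ 3 - H (radius x)) / d) * H' (radius x) / d)) * (x $ i / radius x) else 0)" for i x
 have [measurable]: "ps i \<in> bm" for i unfolding ps_def by measurable
 define LP where "LP = K * (2 * M / d) + W"
 have LP: "0 <= LP" using K M_nonneg d W by (simp add: LP_def)
 have Plip: "\<bar>Q r * cutoff r z - Q s * cutoff s z\<bar> <= LP * \<bar>r - s\<bar>" if rs: "0 <= r" "0 <= s" for r s z
 proof -
  have 1: "\<bar>Q r * cutoff r z - Q s * cutoff s z\<bar> <= LP * \<bar>r - s\<bar>" if "0 <= r" "r <= rh" "0 <= s" "s <= rh" for r s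
  proof -
   have "\<bar>Q r * cutoff r z - Q s * cutoff s z\<bar> <= K * (2 * M / d * \<bar>r - s\<bar>) + (W * \<bar>r - s\<bar>) * 1"
    using QK[OF that(1)] cutoff_bounds[of s z] Q_lipschitz[of r s] cutoff_lipschitz_r[OF that]
    by (intro abs_mult_diff_le) (auto simp: W_def)
   then show ?thesis by (simp add: LP_def algebra_simps)
  qed
  have 2: "\<bar>Q r * cutoff r z - Q s * cutoff s z\<bar> <= LP * \<bar>r - s\<bar>" if "0 <= r" "r <= rh" "rh < s" for r s
  proof -
   have "\<bar>Q r * cutoff r z - Q rh * cutoff rh z\<bar> <= LP * \<bar>r - rh\<bar>" using 1[of r rh] that by simp
   also have "... <= LP * \<bar>r - s\<bar>" using LP that by (intro mult_left_mono) auto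
   finally show ?thesis using that by simp
  qed
  consider "r <= rh" "s <= rh" | "r <= rh" "rh < s" | "rh < r" "s <= rh" | "rh < r" "rh < s" by linarith
  then show ?thesis
  proof cases
   case 3
   then show ?thesis using 2[of s r] rs by (simp add: abs_minus_commute)
  qed (use 1 2 rs LP in auto)
 qed
 have pflip: "\<bar>pf (x + t *\<^sub>R axis i 1) - pf x\<bar> <= LP * \<bar>t\<bar>" if i: "i = 1 \<or> i = 2" for i x t
 proof -
  have "(x + t *\<^sub>R axis i 1) $ 3 = x $ 3" using i by (auto simp: axis_def)
  then have "\<bar>pf (x + t *\<^sub>R axis i 1) - pf x\<bar> <= LP * \<bar>radius (x + t *\<^sub>R axis i 1) - radius x\<bar>"
   unfolding pf_def by (simp only:) (intro Plip radius_nonneg)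
  also have "... <= LP * \<bar>t\<bar>" by (intro mult_left_mono radius_lipschitz LP)
  finally show ?thesis .
 qed
 have Qc_der: "((%r. Q r * cutoff r z) has_real_derivative
   6 * r / (H r) ^ 3 * cutoff r z + Q r * (smoothstep (1 + z) * (smoothstep' ((z - H r) / d) * H' r / d))) (at r)"
  if "0 < r" "r < rh" for r z
  unfolding cutoff_def
  using d by (auto intro!: derivative_eq_intros Q_derivative[OF that] H_der[OF that])
 have pfder: "AE x in lborel. ((%t. pf (x + t *\<^sub>R axis i 1)) has_real_derivative ps i x) (at 0)" if i: "i = 1 \<or> i = 2" for i
  using AE_radius_neq[of 0] AE_radius_neq[of rh]
 proof eventually_elim
  case (elim x)
  have z: "(x + t *\<^sub>R axis i 1) $ 3 = x $ 3" for t using i by (auto simp: axis_def)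
  have r0: "0 < radius x" using elim radius_nonneg[of x] by linarith
  note rd = radius_has_derivative[OF elim(1) i]
  show ?case
  proof (cases "radius x < rh")
   case True
   have "((%t. Q (radius (x + t *\<^sub>R axis i 1)) * cutoff (radius (x + t *\<^sub>R axis i 1)) (x $ 3)) has_real_derivative
    (6 * radius x / (H (radius x)) ^ 3 * cutoff (radius x) (x $ 3)
     + Q (radius x) * (smoothstep (1 + x $ 3) * (smoothstep' ((x $ 3 - H (radius x)) / d) * H' (radius x) / d))) * (x $ i / radius x)) (at 0)"
    using DERIV_chain2[where f="%r. Q r * cutoff r (x $ 3)" and g="%t. radius (x + t *\<^sub>R axis i 1)" and x=0, OF _ rd]
     Qc_der[OF r0 True, of "x $ 3"] by simp
   moreover have e: "(6 * radius x / k * c + q) * (x $ i / radius x) = 6 * x $ i / k * c + q * (x $ i / radius x)" for k c q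
    by (cases "k = 0") (use r0 in \<open>simp_all add: field_simps\<close>)
   ultimately show ?thesis using True r0 unfolding pf_def ps_def z by (simp only: e if_True simp_thms)
  next
   case False
   then have gt: "rh < radius x" using elim by simp
   have "((%r. Q r * cutoff r (x $ 3)) has_real_derivative 0) (at (radius (x + 0 *\<^sub>R axis i 1)))"
    by (rule has_field_derivative_transform_within_open[of "%_. 0" _ _ "{rh<..}"]) (use gt in auto)
   from DERIV_chain2[where f="%r. Q r * cutoff r (x $ 3)" and g="%t. radius (x + t *\<^sub>R axis i 1)", OF this rd]
   have "((%t. Q (radius (x + t *\<^sub>R axis i 1)) * cutoff (radius (x + t *\<^sub>R axis i 1)) (x $ 3)) has_real_derivative 0) (at 0)"
    by simp
   then show ?thesis using False unfolding pf_def ps_def z by simp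
  qed
 qed
 \<comment> \<open>The radial derivative of the cutoff is supported in the solid layer, where the
   horizontal velocity vanishes; only the derivative of \<open>Q\<close> is left.\<close>
 have BB: "(LI x. P i x) = - (LI x. G x $ i $ i * pf x)" if i: "i = 1 \<or> i = 2" for i
 proof -
  have "(LI x. u x $ i * ps i x) = - (LI x. G x $ i $ i * pf x)"
   by (rule weak_deriv_lipschitz_test[OF energy_field_weak_deriv[OF u] _ _ pfb pfs R pflip[OF i] pfder[OF i]]) auto
  moreover have "(LI x. u x $ i * ps i x) = (LI x. P i x)"
  proof (rule integral_cong_AE)
   show "AE x in lborel. u x $ i * ps i x = P i x"
    using wall solid AE_radius_neq[of 0]
   proof eventually_elim
    case (elim x)
    have r0: "0 < radius x" using elim(3) radius_nonneg[of x] by linarith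
    consider "\<not> radius x < rh" | "radius x < rh" "x $ 3 <= 0" | "radius x < rh" "0 < x $ 3" "x $ 3 <= H (radius x)"
     | "radius x < rh" "H (radius x) < x $ 3" "x $ 3 <= H (radius x) + d" | "radius x < rh" "H (radius x) + d < x $ 3" by linarith
    then show ?case
    proof cases
     case 2
     then show ?thesis using elim by (simp add: P_def)
    next
     case 3
     then have "(x $ 3 - H (radius x)) / d <= 0" using d by (simp add: divide_le_0_iff)
     then show ?thesis using 3 r0 cutoff_gap[of "x $ 3" "radius x"] by (simp add: P_def ps_def)
    next
     case 4
     then show ?thesis using elim i ez by (auto simp: P_def)
    next
     case 5
     then have "cutoff (radius x) (x $ 3) = 0" "1 <= (x $ 3 - H (radius x)) / d"
      using cutoff_support[of "radius x" "x $ 3"] d by (force, simp add: le_divide_eq)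
     then show ?thesis using 5 d by (simp add: P_def ps_def)
    qed (simp add: P_def ps_def)
   qed
  qed measurable
  ultimately show ?thesis by simp
 qed
 \<comment> \<open>What remains after the boundary values are inserted: vertical velocity 1 in the
   solid layer, 0 below the wall. The cutoff drops by exactly 1 over the layer, so integration in
   height leaves \<open>- Q\<close>.\<close>
 define f where "f y = - Q (fst y) * (smoothstep' ((snd y - H (fst y)) / d) / d)" for y
 have fm [measurable]: "f \<in> bm" unfolding f_def[abs_def] borel_prod[symmetric] by measurable
 have fz: "(\<integral>\<^sup>+z. ennreal (f (r, z)) \<partial>lborel) = ennreal (- Q r)" for r
 proof -
  have "(\<integral>\<^sup>+z. ennreal (f (r, z)) \<partial>lborel) = (\<integral>\<^sup>+z. ennreal (- Q r) * ennreal (smoothstep' ((z - H r) / d) / d) \<partial>lborel)"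
   unfolding f_def fst_conv snd_conv using Q_nonpos[of r] smoothstep'_range d by (intro nn_integral_cong ennreal_mult) auto
  also have "... = ennreal (- Q r) * 1"
   by (subst nn_integral_cmult) (auto simp: layer_integral)
  finally show ?thesis by simp
 qed
 have f0: "0 <= f y" for y
  unfolding f_def using Q_nonpos[of "fst y"] smoothstep'_range[of "(snd y - H (fst y)) / d"] d
  by (intro mult_nonneg_nonneg divide_nonneg_nonneg) auto
 have Qpos: "0 <= - Q r" for r using Q_nonpos[of r] by simp
 have fsupp: "f (r, z) = 0" if "rh < r" for r z using that by (simp add: f_def)
 have f: "integrable lborel (%x. f (radius x, x $ 3))" "(LI x. f (radius x, x $ 3)) = I"
  by (rule has_integral_cylindrical(1)[where Z="%r. - Q r" and rh=rh and I=I],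
    rule fm, rule f0, rule fz, rule Qpos, erule fsupp, rule flux_integral[folded I_def],
    rule has_integral_cylindrical(2)[where Z="%r. - Q r" and rh=rh and I=I],
    rule fm, rule f0, rule fz, rule Qpos, erule fsupp, rule flux_integral[folded I_def])
 have CC: "I = - (LI x. G x $ 3 $ 3 * pf x)"
 proof -
  have "(LI x. u x $ 3 * (Q (radius x) * cutoff_z (radius x) (x $ 3))) = - (LI x. G x $ 3 $ 3 * pf x)"
  proof (rule weak_deriv_lipschitz_test[OF energy_field_weak_deriv[OF u] _ _ pfb pfs R])
   show "\<bar>pf (x + t *\<^sub>R axis 3 1) - pf x\<bar> <= K * (2 + 2 / d) * \<bar>t\<bar>" for x t
   proof -
    have "(x + t *\<^sub>R axis 3 1) $ 3 = x $ 3 + t" by (simp add: axis_def)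
    then have "\<bar>pf (x + t *\<^sub>R axis 3 1) - pf x\<bar> = \<bar>Q (radius x)\<bar> * \<bar>cutoff (radius x) (x $ 3 + t) - cutoff (radius x) (x $ 3)\<bar>"
     by (simp add: pf_def right_diff_distrib flip: abs_mult)
    also have "... <= K * ((2 + 2 / d) * \<bar>x $ 3 + t - x $ 3\<bar>)" by (intro mult_mono QK cutoff_lipschitz_z K) auto
    finally show ?thesis by (simp add: mult.assoc)
   qed
   show "AE x in lborel. ((%t. pf (x + t *\<^sub>R axis 3 1)) has_real_derivative Q (radius x) * cutoff_z (radius x) (x $ 3)) (at 0)"
   proof (rule AE_I2)
    fix x :: "real^3"
    have "(x + t *\<^sub>R axis 3 1) $ 3 = x $ 3 + t" for t by (simp add: axis_def)
    then show "((%t. pf (x + t *\<^sub>R axis 3 1)) has_real_derivative Q (radius x) * cutoff_z (radius x) (x $ 3)) (at 0)"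
     using DERIV_cmult[OF cutoff_shift_derivative] by (simp add: pf_def)
   qed
  qed measurable
  moreover have "(LI x. u x $ 3 * (Q (radius x) * cutoff_z (radius x) (x $ 3))) = (LI x. f (radius x, x $ 3))"
  proof (rule integral_cong_AE)
   show "AE x in lborel. u x $ 3 * (Q (radius x) * cutoff_z (radius x) (x $ 3)) = f (radius x, x $ 3)"
    using wall solid
   proof eventually_elim
    case (elim x)
    consider "\<not> radius x < rh" | "radius x < rh" "x $ 3 <= 0" | "radius x < rh" "0 < x $ 3" "x $ 3 <= H (radius x)"
     | "radius x < rh" "H (radius x) < x $ 3" "x $ 3 <= H (radius x) + d" | "radius x < rh" "H (radius x) + d < x $ 3" by linarith
    then show ?case
    proof cases
     case 1
     then show ?thesis by (simp add: f_def)
    next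
     case 2
     then have "x $ 3 <= H (radius x)" using H_ge[of "radius x"] h by simp
     then have "(x $ 3 - H (radius x)) / d <= 0" using d by (simp add: divide_le_0_iff)
     then show ?thesis using elim 2 by (simp add: f_def)
    next
     case 3
     then have "(x $ 3 - H (radius x)) / d <= 0" using d by (simp add: divide_le_0_iff)
     then show ?thesis using 3 cutoff_gap[of "x $ 3" "radius x"] by (simp add: f_def)
    next
     case 4
     then have "0 < x $ 3" using H_ge[of "radius x"] h by simp
     then show ?thesis using elim 4 ez by (simp add: f_def cutoff_z_def)
    next
     case 5
     then have "cutoff_z (radius x) (x $ 3) = 0" "1 <= (x $ 3 - H (radius x)) / d"
      using cutoff_support[of "radius x" "x $ 3"] d by (force, simp add: le_divide_eq)
     then show ?thesis by (simp add: f_def)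
    qed
   qed
  qed measurable
  ultimately show ?thesis using f(2) by simp
 qed
 have iGpf: "integrable lborel (%x. G x $ i $ i * pf x)" for i
  by (rule loc_int_mult_integrable[OF weak_derivD(4)[OF energy_field_weak_deriv[OF u]] _ pfb pfs]) auto
 have "(LI x. G x $ 1 $ 1 * pf x) + (LI x. G x $ 2 $ 2 * pf x) + (LI x. G x $ 3 $ 3 * pf x)
   = (LI x. (G x $ 1 $ 1 * pf x + G x $ 2 $ 2 * pf x) + G x $ 3 $ 3 * pf x)"
  using Bochner_Integration.integral_add[OF Bochner_Integration.integrable_add[OF iGpf[of 1] iGpf[of 2]] iGpf[of 3]]
   Bochner_Integration.integral_add[OF iGpf[of 1] iGpf[of 2]] by linarith
 also have "... = (LINT x|(lborel :: (real^3) measure). 0)"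
 proof (rule integral_cong_AE)
  show "AE x in lborel. (G x $ 1 $ 1 * pf x + G x $ 2 $ 2 * pf x) + G x $ 3 $ 3 * pf x = 0"
   using tr by eventually_elim (simp add: trace_def sum_3 flip: distrib_right)
 qed measurable
 finally have sum0: "(LI x. G x $ 1 $ 1 * pf x) + (LI x. G x $ 2 $ 2 * pf x) + (LI x. G x $ 3 $ 3 * pf x) = 0" by simp
 have TT: "(LI x. G x $ 1 $ 3 * T 1 x) + (LI x. G x $ 2 $ 3 * T 2 x) = I"
  using A[of 1] A[of 2] BB[of 1] BB[of 2] CC sum0 by simp
 \<comment> \<open>The square of \<open>T\<close> on the gap. Its integral in height is
   \<open>3 * r^2 / H^3\<close>, and the factor \<open>2 * pi * r\<close> makes this the density of
   \<open>I\<close>.\<close>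
 define k where "k y = (if 0 < fst y \<and> fst y < rh \<and> 0 < snd y \<and> snd y <= H (fst y) then 36 * (fst y)^2 / (H (fst y)) ^ 6 * (snd y - H (fst y) / 2)^2 else 0)" for y
 have km [measurable]: "k \<in> bm" unfolding k_def[abs_def] borel_prod[symmetric] by measurable
 have kz: "(\<integral>\<^sup>+z. ennreal (k (r, z)) \<partial>lborel) = ennreal (3 * r^2 / (H r) ^ 3)" if r: "0 < r" "r < rh" for r
 proof -
  have Hr: "0 < H r" using H_ge[of r] r h by simp
  have "(\<integral>\<^sup>+z. ennreal (k (r, z)) \<partial>lborel) = (\<integral>\<^sup>+z. ennreal (36 * r^2 / (H r) ^ 6 * (z - H r / 2)^2) * indicator {0..H r} z \<partial>lborel)"
   using AE_lborel_singleton[of 0]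
   by (intro nn_integral_cong_AE) (auto elim!: eventually_mono simp: k_def r indicator_def)
  also have "... = ennreal (12 * r^2 / (H r) ^ 6 * (H r - H r / 2) ^ 3 - 12 * r^2 / (H r) ^ 6 * (0 - H r / 2) ^ 3)"
  proof (rule nn_integral_FTC_Icc)
   show "((%z. 12 * r^2 / (H r) ^ 6 * (z - H r / 2) ^ 3) has_real_derivative 36 * r^2 / (H r) ^ 6 * (z - H r / 2)^2) (at z)" for z
    by (rule derivative_eq_intros refl)+ simp
  qed (use Hr in auto)
  also have "12 * r^2 / (H r) ^ 6 * (H r - H r / 2) ^ 3 - 12 * r^2 / (H r) ^ 6 * (0 - H r / 2) ^ 3 = 3 * r^2 / (H r) ^ 3"
  proof -
   have "12 * r^2 / s ^ 6 * (s - s / 2) ^ 3 - 12 * r^2 / s ^ 6 * (0 - s / 2) ^ 3 = 3 * r^2 / s ^ 3" if "0 < s" for s :: real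
    using that by (simp add: power_divide field_simps eval_nat_numeral)
   then show ?thesis using Hr by blast
  qed
  finally show ?thesis .
 qed
 have I6: "((%r. 6 * pi * (r ^ 3 / (H r) ^ 3)) has_integral I) {0..rh}"
  unfolding I_def using H_ge h
  by (intro has_integral_mult_right integrable_integral integrable_continuous_interval continuous_intros continuous_on_H) fastforce
 have kI: "((%r. 2 * pi * r * (3 * r^2 / (H r) ^ 3)) has_integral I) {0..rh}"
  by (rule has_integral_eq[OF _ I6]) (simp add: power2_eq_square power3_eq_cube)
 have k0: "0 <= k y" for y by (simp add: k_def)
 have kpos: "0 <= 3 * r^2 / (H r) ^ 3" if "0 < r" "r < rh" for r using H_ge[of r] that h by simp
 have ksupp: "k (r, z) = 0" if "rh < r" for r z using that by (simp add: k_def)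
 have kk: "integrable lborel (%x. k (radius x, x $ 3))" "(LI x. k (radius x, x $ 3)) = I"
  by (rule has_integral_cylindrical(1)[where Z="%r. 3 * r^2 / (H r) ^ 3" and rh=rh and I=I],
    rule km, rule k0, erule (1) kz, erule (1) kpos, erule ksupp, rule kI,
    rule has_integral_cylindrical(2)[where Z="%r. 3 * r^2 / (H r) ^ 3" and rh=rh and I=I],
    rule km, rule k0, erule (1) kz, erule (1) kpos, erule ksupp, rule kI)
 have iGT: "integrable lborel (%x. G x $ i $ 3 * T i x)" if i: "i = 1 \<or> i = 2" for i
  by (rule loc_int_mult_integrable[OF weak_derivD(4)[OF energy_field_weak_deriv[OF u]] _ Tb[OF i] Ts[OF i]]) auto
 have g1: "integrable lborel (%x. G x $ 1 $ 3 * T 1 x)" and g2: "integrable lborel (%x. G x $ 2 $ 3 * T 2 x)"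
  by (rule iGT, simp)+
 \<comment> \<open>Off the gap either the gradient or \<open>T\<close> vanishes, so it suffices to
   subtract the square of \<open>T\<close> on the gap.\<close>
 have "2 * I - I = (LI x. 2 * (G x $ 1 $ 3 * T 1 x + G x $ 2 $ 3 * T 2 x) - k (radius x, x $ 3))"
 proof -
  have "(LI x. 2 * (G x $ 1 $ 3 * T 1 x + G x $ 2 $ 3 * T 2 x)) = 2 * (LI x. G x $ 1 $ 3 * T 1 x + G x $ 2 $ 3 * T 2 x)"
   by (rule integral_mult_right_zero)
  then show ?thesis
   using Bochner_Integration.integral_diff[OF integrable_mult_right[OF Bochner_Integration.integrable_add[OF g1 g2], of 2] kk(1)]
    Bochner_Integration.integral_add[OF g1 g2] TT kk(2) by linarith
 qed
 also have "... <= (LI x. (norm (G x))^2)"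
 proof (rule integral_mono_AE)
  show "integrable lborel (%x. 2 * (G x $ 1 $ 3 * T 1 x + G x $ 2 $ 3 * T 2 x) - k (radius x, x $ 3))"
   using iGT[of 1] iGT[of 2] kk(1) by (intro Bochner_Integration.integrable_diff integrable_mult_right Bochner_Integration.integrable_add) auto
  show "integrable lborel (%x. (norm (G x))^2)" by (rule energy_fieldD(6)[OF u])
  show "AE x in lborel. 2 * (G x $ 1 $ 3 * T 1 x + G x $ 2 $ 3 * T 2 x) - k (radius x, x $ 3) <= (norm (G x))^2"
   using G0 AE_radius_neq[of 0]
  proof eventually_elim
   case (elim x)
   have r0: "0 < radius x" using elim(2) radius_nonneg[of x] by linarith
   note k0 = k0[of "(radius x, x $ 3)"]
   consider "\<not> radius x < rh" | "radius x < rh" "x $ 3 <= 0" | "radius x < rh" "0 < x $ 3" "x $ 3 <= H (radius x)"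
    | "radius x < rh" "H (radius x) < x $ 3" "x $ 3 <= H (radius x) + d" | "radius x < rh" "H (radius x) + d < x $ 3" by linarith
   then show ?case
   proof cases
    case 3
    have c: "cutoff (radius x) (x $ 3) = 1" using 3 cutoff_gap[of "x $ 3" "radius x"] by simp
    have rr: "(radius x)^2 = (x $ 1)^2 + (x $ 2)^2" by (simp add: radius_def)
    have "k (radius x, x $ 3) = (T 1 x)^2 + (T 2 x)^2"
    proof -
     have "36 * (a^2 + b^2) / s ^ 6 * q^2 = (6 * a / s ^ 3 * (q * 1))^2 + (6 * b / s ^ 3 * (q * 1))^2" for a b s q :: real
      by (simp add: power_mult_distrib power_divide distrib_right distrib_left add_divide_distrib flip: power_mult)
     then show ?thesis
      unfolding k_def T_def using 3 r0 by (simp only: fst_conv snd_conv if_True simp_thms c rr)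
    qed
    moreover have "2 * (G x $ 1 $ 3 * T 1 x + G x $ 2 $ 3 * T 2 x) <= (G x $ 1 $ 3)^2 + (G x $ 2 $ 3)^2 + (T 1 x)^2 + (T 2 x)^2"
     using zero_le_power2[of "G x $ 1 $ 3 - T 1 x"] zero_le_power2[of "G x $ 2 $ 3 - T 2 x"] by (simp add: power2_diff)
    moreover have "(G x $ 1 $ 3)^2 + (G x $ 2 $ 3)^2 <= (norm (G x))^2"
     by (simp add: norm_sq_matrix sum_3)
    ultimately show ?thesis by linarith
   next
    case 5
    then have "cutoff (radius x) (x $ 3) = 0" using cutoff_support[of "radius x" "x $ 3"] by force
    then have "T i x = 0" for i by (simp add: T_def)
    then show ?thesis using k0 zero_le_power2[of "norm (G x)"]
     by (simp only: mult_zero_right add_0_right; linarith)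
   next
    case 1
    then have "T i x = 0" for i by (simp add: T_def)
    then show ?thesis using k0 zero_le_power2[of "norm (G x)"]
     by (simp only: mult_zero_right add_0_right; linarith)
   qed (use elim k0 in \<open>auto simp: T_def\<close>)
  qed
 qed
 finally show ?thesis by (simp add: I_def)
qed

end

section \<open>Lipschitz fields\<close>

text \<open>Difference quotients have integral zero by translation invariance, and they converge
  boundedly within a fixed ball.\<close>

lemma integral_partial_deriv_zero:
 assumes pf: "test_function pf" shows "(LI x. partial_deriv j pf x) = 0"
proof -
 define e :: "real^3" where "e = axis j 1"
 have ne: "norm e = 1" by (simp add: e_def)
 obtain L where L: "0 <= L" "!!x. \<bar>pf x\<bar> <= L" "!!x y. \<bar>pf x - pf y\<bar> <= L * norm (x - y)"
  "!!x. pf x ~= 0 ==> norm x <= L" using test_function_bounds[OF pf] by metis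
 note [measurable] = test_function_borel[OF pf] partial_deriv_borel[OF pf]
 define X where "X n = inverse (real (Suc n))" for n
 have X: "X \<longlonglongrightarrow> 0" "!!n. X n ~= 0" "!!n. 0 < X n" "!!n. X n <= 1"
  unfolding X_def using LIMSEQ_inverse_real_of_nat by (auto simp: inverse_le_1_iff)
 have supp: "norm x <= L + 1" if "pf (x - X n *\<^sub>R e) ~= 0 \<or> pf x ~= 0" for x n
  using that L(4)[of x] L(4)[of "x - X n *\<^sub>R e"] norm_triangle_ineq[of "x - X n *\<^sub>R e" "X n *\<^sub>R e"] ne X(3,4)[of n] by auto
 have "(%n. LINT x|lborel. (pf (x - X n *\<^sub>R e) - pf x) / X n) \<longlonglongrightarrow> (LI x. - partial_deriv j pf x)"
 proof (rule integral_dominated_convergence[where w="%x. L * indicator (cball 0 (L + 1)) x"])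
  show "integrable lborel (%x. L * indicator (cball (0::real^3) (L + 1)) x)" by (intro integrable_mult_right integrable_indicator_cball)
  have "(%n. (pf (x - X n *\<^sub>R e) - pf x) / X n) \<longlonglongrightarrow> - partial_deriv j pf x" for x
   using test_function_line_derivative[OF pf, of x j 0] X
   unfolding has_field_derivative_iff tendsto_at_iff_sequentially e_def[symmetric] by (auto simp: o_def)
  then show "AE x in lborel. (%n. (pf (x - X n *\<^sub>R e) - pf x) / X n) \<longlonglongrightarrow> - partial_deriv j pf x" by simp
  have "\<bar>(pf (x - X n *\<^sub>R e) - pf x) / X n\<bar> <= L * indicator (cball 0 (L + 1)) x" for n x
  proof (cases "norm x <= L + 1")
   case True
   then show ?thesis using L(3)[of "x - X n *\<^sub>R e" x] X(3)[of n] ne by (simp add: divide_le_eq)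
  next
   case False
   then have "pf (x - X n *\<^sub>R e) = 0" "pf x = 0" using supp by blast+
   then show ?thesis using L by simp
  qed
  then show "AE x in lborel. norm ((pf (x - X n *\<^sub>R e) - pf x) / X n) <= L * indicator (cball 0 (L + 1)) x" for n by simp
 qed measurable
 moreover have "(LI x. (pf (x - X n *\<^sub>R e) - pf x) / X n) = 0" for n
 proof -
  have i: "integrable lborel pf" by (rule integrable_bounded_support[OF _ L(2,4)]) auto
  have i2: "integrable lborel (%x. pf (x - X n *\<^sub>R e))" using integrable_shift[OF i, of "- X n *\<^sub>R e"] by simp
  have e1: "(LI x. (pf (x - X n *\<^sub>R e) - pf x) / X n) = ((LI x. pf (x - X n *\<^sub>R e)) - (LI x. pf x)) / X n"
   by (simp only: integral_divide_zero Bochner_Integration.integral_diff[OF i2 i])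
  have e2: "(LI x. pf (x - X n *\<^sub>R e)) = (LI x. pf x)"
   using integral_shift[of pf "- X n *\<^sub>R e"] by simp
  show ?thesis unfolding e1 e2 by simp
 qed
 ultimately have "(%n::nat. 0::real) \<longlonglongrightarrow> (LI x. - partial_deriv j pf x)" by (simp only:)
 then have "(LI x. - partial_deriv j pf x) = 0" using LIMSEQ_unique tendsto_const by blast
 then show ?thesis by simp
qed

lemma test_function_weak_deriv:
 assumes pf: "test_function pf" shows "weak_deriv j pf (partial_deriv j pf)"
proof -
 obtain L where L: "0 <= L" "!!x. \<bar>pf x\<bar> <= L" "!!x j. \<bar>partial_deriv j pf x\<bar> <= L"
  "!!x. pf x ~= 0 ==> norm x <= L" "!!x j. partial_deriv j pf x ~= 0 ==> norm x <= L"
  using test_function_bounds[OF pf] by metis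
 note [measurable] = test_function_borel[OF pf] partial_deriv_borel[OF pf]
 have sq: "sq_int k" if [measurable]: "k \<in> bm" and k: "!!x. \<bar>k x\<bar> <= L" "!!x. k x ~= 0 ==> norm x <= L" for k
 proof -
  have "integrable lborel (%x. (k x)^2)"
  proof (rule integrable_bounded_support[where M="L^2" and rh=L])
   show "\<bar>(k x)^2\<bar> <= L^2" for x using power_mono[OF k(1)[of x], of 2] by simp
  qed (use k in auto)
  then show ?thesis by (simp add: sq_int_def)
 qed
 have s: "sq_int pf" "sq_int (partial_deriv j pf)" using L by (auto intro!: sq)
 have "(LI x. pf x * partial_deriv j ps x) = - (LI x. partial_deriv j pf x * ps x)" if ps: "test_function ps" for ps
 proof -
  note [measurable] = test_function_borel[OF ps] partial_deriv_borel[OF ps]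
  obtain K where K: "0 <= K" "!!x. \<bar>ps x\<bar> <= K" "!!x j. \<bar>partial_deriv j ps x\<bar> <= K"
   "!!x. ps x ~= 0 ==> norm x <= K" "!!x j. partial_deriv j ps x ~= 0 ==> norm x <= K"
   using test_function_bounds[OF ps] by metis
  have l: "loc_int pf" "loc_int (partial_deriv j pf)"
   by (rule loc_sq_int_imp_loc_int, rule sq_int_imp_loc, rule s)+
  have i: "integrable lborel (%x. pf x * partial_deriv j ps x)" "integrable lborel (%x. partial_deriv j pf x * ps x)"
   using K by (auto intro!: loc_int_mult_integrable[OF l(1)] loc_int_mult_integrable[OF l(2)])
  have c: "continuously_diff pf" "continuously_diff ps" using pf ps by (auto simp: test_function_iff)
  have "(LI x. partial_deriv j (%x. pf x * ps x) x) = 0"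
   by (rule integral_partial_deriv_zero[OF test_function_mult[OF pf ps]])
  then have "(LI x. pf x * partial_deriv j ps x + partial_deriv j pf x * ps x) = 0"
   by (simp only: partial_deriv_mult[OF c])
  then show ?thesis using Bochner_Integration.integral_add[OF i] by linarith
 qed
 then show ?thesis using sq_int_imp_loc[OF s(1)] s(2) by (auto simp: weak_deriv_def)
qed

text \<open>The roles in \<open>weak_deriv_lipschitz_test\<close> are exchanged: the test function
  is the weakly differentiable factor, and the component of \<open>u\<close> the Lipschitz one.
  Differentiability almost everywhere is a hypothesis here, because explicit fields come with
  formulas for their derivatives.\<close>

lemma lipschitz_energy_field:
 fixes u :: "real^3 => real^3"
 assumes lip: "!!i x y. \<bar>u x $ i - u y $ i\<bar> <= L * norm (x - y)"
  and supp: "!!x. u x ~= 0 ==> norm x <= R" and "0 <= R"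
  and ex: "!!i j. AE x in lborel. \<exists>D. ((%t. u (x + t *\<^sub>R axis j 1) $ i) has_real_derivative D) (at 0)"
 obtains G where "energy_field u G"
  "!!x i j D. ((%t. u (x + t *\<^sub>R axis j 1) $ i) has_real_derivative D) (at 0) ==> G x $ i $ j = D"
proof -
 define X where "X n = inverse (real (Suc n))" for n
 have X: "X \<longlonglongrightarrow> 0" "!!n. X n ~= 0" "!!n. 0 < X n"
  unfolding X_def using LIMSEQ_inverse_real_of_nat by auto
 have L: "0 <= L"
 proof -
  have "0 <= L * norm (axis 1 1 - 0 :: real^3)" using lip[of "axis 1 1" 1 0] by linarith
  then show ?thesis by simp
 qed
 have cont: "continuous_on UNIV (%x. u x $ i)" for i
 proof -
  have "L-lipschitz_on UNIV (%x. u x $ i)"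
   by (rule lipschitz_onI) (use lip L in \<open>auto simp: dist_norm\<close>)
  then show ?thesis by (rule lipschitz_on_continuous_on)
 qed
 have [measurable]: "(%x. u x $ i) \<in> bm" for i
  by (intro borel_measurable_continuous_onI cont)
 have um: "u \<in> bm"
  by (intro borel_measurable_continuous_onI continuous_on_vec_lambda[of UNIV "%i x. u x $ i", simplified] cont)
 define q where "q i j n x = (u (x + X n *\<^sub>R axis j 1) $ i - u x $ i) / X n" for i j n x
 have [measurable]: "q i j n \<in> bm" for i j n unfolding q_def by measurable
 \<comment> \<open>Measurable as a limit of measurable quotients. Where the limit does not exist
   \<open>lim\<close> has some unspecified value, which happens on a null set only.\<close>
 define g where "g i j x = lim (%n. q i j n x)" for i j x
 have gm [measurable]: "g i j \<in> bm" for i j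
  unfolding g_def by (rule borel_measurable_lim_metric) measurable
 define G :: "real^3 => real^3^3" where "G x = (\<chi> i j. g i j x)" for x
 have Gg: "G x $ i $ j = g i j x" for x i j by (simp add: G_def)
 have gD: "g i j x = D" "q i j \<longlonglongrightarrow> (%_. D) \<or> True" "(%n. q i j n x) \<longlonglongrightarrow> D"
  if "((%t. u (x + t *\<^sub>R axis j 1) $ i) has_real_derivative D) (at 0)" for i j x D
 proof -
  show "(%n. q i j n x) \<longlonglongrightarrow> D"
   using that X unfolding has_field_derivative_iff tendsto_at_iff_sequentially q_def by (auto simp: o_def)
  then show "g i j x = D" unfolding g_def by (rule limI)
 qed simp
 have qb: "\<bar>q i j n x\<bar> <= L" for i j n x
  using lip[of "x + X n *\<^sub>R axis j 1" i x] X(3)[of n] by (simp add: q_def divide_le_eq)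
 have gb: "AE x in lborel. \<bar>g i j x\<bar> <= L" for i j
  using ex[of j i]
 proof eventually_elim
  case (elim x)
  then obtain D where D: "((%t. u (x + t *\<^sub>R axis j 1) $ i) has_real_derivative D) (at 0)" by blast
  have "\<bar>D\<bar> <= L" by (rule Lim_bounded[OF tendsto_rabs[OF gD(3)[OF D]]]) (use qb in auto)
  then show ?case using gD(1)[OF D] by simp
 qed
 have u0: "u y $ i = 0" if "R < norm y" for y i
  using supp[of y] that by force
 have gs: "g i j x = 0" if "R < norm x" for i j x
 proof -
  have "open {t::real. R < norm (x + t *\<^sub>R axis j 1)}" by (intro open_Collect_less continuous_intros)
  then have "((%t. u (x + t *\<^sub>R axis j 1) $ i) has_real_derivative 0) (at 0)"
   by (intro has_field_derivative_transform_within_open[OF DERIV_const[of 0 "at 0"], of "{t. R < norm (x + t *\<^sub>R axis j 1)}"])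
    (use that u0 in auto)
  then show ?thesis by (rule gD(1))
 qed
 have sg: "sq_int (g i j)" for i j
 proof -
  have "integrable lborel (%x. (g i j x)^2)"
  proof (rule Bochner_Integration.integrable_bound[of _ "%x. L^2 * indicator (cball 0 R) x"])
   show "integrable lborel (%x. L^2 * indicator (cball (0::real^3) R) x)" by (intro integrable_mult_right integrable_indicator_cball)
   show "AE x in lborel. norm ((g i j x)^2) <= norm (L^2 * indicator (cball 0 R) x)"
    using gb[of i j]
   proof eventually_elim
    case (elim x)
    then show ?case using gs[of x i j] power_mono[OF elim, of 2] by (cases "norm x <= R") auto
   qed
  qed measurable
  then show ?thesis by (simp add: sq_int_def)
 qed
 have usupp: "norm x <= R" if "u x $ i ~= 0" for x i using supp[of x] that by force
 have ub: "\<bar>u x $ i\<bar> <= L * (2 * R + 1)" for x i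
 proof (cases "norm x <= R")
  case True
  \<comment> \<open>A point just outside the support: \<open>u\<close> is zero there, so the
    Lipschitz constant bounds \<open>u\<close> everywhere.\<close>
  define y :: "real^3" where "y = (R + 1) *\<^sub>R axis 1 1"
  have ny: "norm y = R + 1" using \<open>0 <= R\<close> by (simp add: y_def)
  then have "u y $ i = 0" using usupp[of y i] by force
  then have "\<bar>u x $ i\<bar> <= L * norm (x - y)" using lip[of x i y] by simp
  also have "... <= L * (2 * R + 1)" using norm_triangle_ineq4[of x y] ny True L by (intro mult_left_mono) auto
  finally show ?thesis .
 next
  case False
  then show ?thesis using usupp[of x i] L \<open>0 <= R\<close> by force
 qed
 have su: "sq_int (%x. u x $ i)" for i
 proof -
  have "integrable lborel (%x. (u x $ i)^2)"
  proof (rule integrable_bounded_support[where M="(L * (2 * R + 1))^2" and rh=R])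
   show "\<bar>(u x $ i)^2\<bar> <= (L * (2 * R + 1))^2" for x using power_mono[OF ub[of x i], of 2] by simp
  qed (use usupp in auto)
  then show ?thesis by (simp add: sq_int_def)
 qed
 have wd: "weak_deriv j (%x. u x $ i) (%x. G x $ i $ j)" for i j
  unfolding weak_deriv_def Gg
 proof (intro conjI allI impI)
  fix pf assume pf: "test_function pf"
  have "(LI x. pf x * g i j x) = - (LI x. partial_deriv j pf x * u x $ i)"
  proof (rule weak_deriv_lipschitz_test[OF test_function_weak_deriv[OF pf] _ gm ub usupp \<open>0 <= R\<close>])
   show "\<bar>u (x + t *\<^sub>R axis j 1) $ i - u x $ i\<bar> <= L * \<bar>t\<bar>" for x t
    using lip[of "x + t *\<^sub>R axis j 1" i x] by simp
   show "AE x in lborel. ((%t. u (x + t *\<^sub>R axis j 1) $ i) has_real_derivative g i j x) (at 0)"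
    using ex[of j i] by eventually_elim (use gD(1) in blast)
  qed measurable
  then show "(LI x. u x $ i * partial_deriv j pf x) = - (LI x. g i j x * pf x)"
   by (simp add: mult.commute)
 qed (auto intro: sq_int_imp_loc su sg)
 have "G \<in> bm"
 proof -
  have "(%x. \<Sum>i\<in>UNIV. \<Sum>j\<in>UNIV. g i j x *\<^sub>R (axis i (axis j 1) :: real^3^3)) \<in> bm"
   by (intro borel_measurable_sum borel_measurable_scaleR borel_measurable_const gm)
  moreover have "(%x. \<Sum>i\<in>UNIV. \<Sum>j\<in>UNIV. g i j x *\<^sub>R (axis i (axis j 1) :: real^3^3)) = G"
   by (auto simp: fun_eq_iff vec_eq_iff G_def axis_def sum_3 forall_3)
  ultimately show ?thesis by simp
 qed
 then have "energy_field u G" using um wd by (intro energy_fieldI)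
 then show ?thesis using that gD(1) Gg by blast
qed

section \<open>Bounded Lipschitz functions\<close>

text \<open>Boundedness is carried along because it makes the class closed under products, and under
  quotients with a positive lower bound of the denominator; the components of the test field are
  assembled in this way.\<close>

definition bounded_lipschitz :: "'a::metric_space set => ('a => real) => bool" where
 "bounded_lipschitz S f \<longleftrightarrow> (\<exists>B. \<forall>x\<in>S. \<bar>f x\<bar> <= B) \<and> (\<exists>L. \<forall>x\<in>S. \<forall>y\<in>S. \<bar>f x - f y\<bar> <= L * dist x y)"

lemma bounded_lipschitzI:
 "(!!x. x \<in> S ==> \<bar>f x\<bar> <= B) ==> (!!x y. x \<in> S ==> y \<in> S ==> \<bar>f x - f y\<bar> <= L * dist x y) ==> bounded_lipschitz S f"
 unfolding bounded_lipschitz_def by blast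

lemma bounded_lipschitzE:
 assumes "bounded_lipschitz S f"
 obtains B L where "0 <= B" "0 <= L" "!!x. x \<in> S ==> \<bar>f x\<bar> <= B"
  "!!x y. x \<in> S ==> y \<in> S ==> \<bar>f x - f y\<bar> <= L * dist x y"
proof -
 obtain B L where B: "!!x. x \<in> S ==> \<bar>f x\<bar> <= B" and L: "!!x y. x \<in> S ==> y \<in> S ==> \<bar>f x - f y\<bar> <= L * dist x y"
  using assms unfolding bounded_lipschitz_def by blast
 have "\<bar>f x\<bar> <= \<bar>B\<bar>" if "x \<in> S" for x using B[OF that] by linarith
 moreover have "\<bar>f x - f y\<bar> <= \<bar>L\<bar> * dist x y" if "x \<in> S" "y \<in> S" for x y
  using L[OF that] mult_right_mono[OF abs_ge_self[of L] zero_le_dist[of x y]] by linarith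
 ultimately show ?thesis using that[of "\<bar>B\<bar>" "\<bar>L\<bar>"] by simp
qed

lemma bounded_lipschitz_const [intro!]: "bounded_lipschitz S (%x. c)"
 by (rule bounded_lipschitzI[of _ _ "\<bar>c\<bar>" 0]) auto

lemma bounded_lipschitz_add:
 assumes "bounded_lipschitz S f" "bounded_lipschitz S g" shows "bounded_lipschitz S (%x. f x + g x)"
proof -
 from assms(1) obtain A L where f: "0 <= A" "0 <= L" "!!x. x \<in> S ==> \<bar>f x\<bar> <= A"
  "!!x y. x \<in> S ==> y \<in> S ==> \<bar>f x - f y\<bar> <= L * dist x y" by (rule bounded_lipschitzE) blast
 from assms(2) obtain B M where g: "0 <= B" "0 <= M" "!!x. x \<in> S ==> \<bar>g x\<bar> <= B"
  "!!x y. x \<in> S ==> y \<in> S ==> \<bar>g x - g y\<bar> <= M * dist x y" by (rule bounded_lipschitzE) blast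
 show ?thesis
 proof (rule bounded_lipschitzI[of _ _ "A + B" "L + M"])
  show "\<bar>f x + g x\<bar> <= A + B" if "x \<in> S" for x using f(3) g(3) that by fastforce
  show "\<bar>f x + g x - (f y + g y)\<bar> <= (L + M) * dist x y" if "x \<in> S" "y \<in> S" for x y
   using f(4)[OF that] g(4)[OF that] by (simp add: distrib_right)
 qed
qed

lemma bounded_lipschitz_mult:
 assumes "bounded_lipschitz S f" "bounded_lipschitz S g" shows "bounded_lipschitz S (%x. f x * g x)"
proof -
 from assms(1) obtain A L where f: "0 <= A" "0 <= L" "!!x. x \<in> S ==> \<bar>f x\<bar> <= A"
  "!!x y. x \<in> S ==> y \<in> S ==> \<bar>f x - f y\<bar> <= L * dist x y" by (rule bounded_lipschitzE) blast
 from assms(2) obtain B M where g: "0 <= B" "0 <= M" "!!x. x \<in> S ==> \<bar>g x\<bar> <= B"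
  "!!x y. x \<in> S ==> y \<in> S ==> \<bar>g x - g y\<bar> <= M * dist x y" by (rule bounded_lipschitzE) blast
 show ?thesis
 proof (rule bounded_lipschitzI[of _ _ "A * B" "A * M + L * B"])
  show "\<bar>f x * g x\<bar> <= A * B" if "x \<in> S" for x using f g that by (auto simp: abs_mult intro!: mult_mono)
  show "\<bar>f x * g x - f y * g y\<bar> <= (A * M + L * B) * dist x y" if "x \<in> S" "y \<in> S" for x y
   using abs_mult_diff_le[OF f(3)[OF that(1)] g(3)[OF that(2)] f(4)[OF that] g(4)[OF that]] by (simp add: algebra_simps)
 qed
qed

lemma bounded_lipschitz_minus: "bounded_lipschitz S f ==> bounded_lipschitz S (%x. - f x)"
 using bounded_lipschitz_mult[OF bounded_lipschitz_const[of S "-1"], of f] by simp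

lemma bounded_lipschitz_diff:
 "bounded_lipschitz S f ==> bounded_lipschitz S g ==> bounded_lipschitz S (%x. f x - g x)"
 using bounded_lipschitz_add[OF _ bounded_lipschitz_minus, of S f g] by simp

lemma bounded_lipschitz_compose:
 assumes f: "bounded_lipschitz T f" and g: "!!x. x \<in> S ==> g x \<in> T" "!!x y. x \<in> S ==> y \<in> S ==> dist (g x) (g y) <= M * dist x y"
 shows "bounded_lipschitz S (%x. f (g x))"
proof -
 from f obtain B L where f: "0 <= B" "0 <= L" "!!x. x \<in> T ==> \<bar>f x\<bar> <= B"
  "!!x y. x \<in> T ==> y \<in> T ==> \<bar>f x - f y\<bar> <= L * dist x y" by (rule bounded_lipschitzE) blast
 show ?thesis
 proof (rule bounded_lipschitzI[of _ _ B "L * M"])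
  show "\<bar>f (g x) - f (g y)\<bar> <= L * M * dist x y" if "x \<in> S" "y \<in> S" for x y
   using f(4)[of "g x" "g y"] g that mult_left_mono[OF g(2)[OF that] f(2)] by (auto simp: mult.assoc)
 qed (use f g in auto)
qed

lemma bounded_lipschitz_inverse:
 assumes "bounded_lipschitz S f" "0 < c" "!!x. x \<in> S ==> c <= f x"
 shows "bounded_lipschitz S (%x. 1 / f x)"
proof -
 from assms(1) obtain B L where f: "0 <= B" "0 <= L" "!!x. x \<in> S ==> \<bar>f x\<bar> <= B"
  "!!x y. x \<in> S ==> y \<in> S ==> \<bar>f x - f y\<bar> <= L * dist x y" by (rule bounded_lipschitzE) blast
 show ?thesis
 proof (rule bounded_lipschitzI[of _ _ "1 / c" "L / (c * c)"])
  show "\<bar>1 / f x\<bar> <= 1 / c" if "x \<in> S" for x using assms(2) assms(3)[OF that] by (simp add: frac_le)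
  show "\<bar>1 / f x - 1 / f y\<bar> <= L / (c * c) * dist x y" if "x \<in> S" "y \<in> S" for x y
  proof -
   have p: "0 < f x" "0 < f y" "c * c <= f x * f y"
    using assms(2) assms(3)[OF that(1)] assms(3)[OF that(2)] by (auto intro!: mult_mono)
   have "1 / f x - 1 / f y = (f y - f x) / (f x * f y)" using p by (simp add: field_simps)
   then have "\<bar>1 / f x - 1 / f y\<bar> = \<bar>f x - f y\<bar> / (f x * f y)" using p by (simp add: abs_mult abs_minus_commute)
   also have "... <= (L * dist x y) / (c * c)" using f(4)[OF that] p assms(2) by (intro frac_le) auto
   finally show ?thesis by simp
  qed
 qed
qed

lemma bounded_lipschitz_divide:
 assumes "bounded_lipschitz S g" "bounded_lipschitz S f" "0 < c" "!!x. x \<in> S ==> c <= f x"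
 shows "bounded_lipschitz S (%x. g x / f x)"
 using bounded_lipschitz_mult[OF assms(1) bounded_lipschitz_inverse[OF assms(2-4)]] by simp

lemma bounded_lipschitz_cong:
 "bounded_lipschitz S f ==> (!!x. x \<in> S ==> f x = g x) ==> bounded_lipschitz S g"
 unfolding bounded_lipschitz_def by auto

definition smoothstep'' :: "real => real" where
 "smoothstep'' s = (if 0 < s \<and> s < 1 then 6 - 12 * s else 0)"

lemma smoothstep''_bound: "\<bar>smoothstep'' s\<bar> <= 6"
 by (auto simp: smoothstep''_def abs_le_iff)

lemma has_real_derivative_smoothstep':
 assumes "s ~= 0" "s ~= 1" shows "(smoothstep' has_real_derivative smoothstep'' s) (at s)"
proof -
 consider "s < 0" | "0 < s" "s < 1" | "1 < s" using assms by linarith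
 then show ?thesis
 proof cases
  case 1
  show ?thesis
   by (rule has_field_derivative_transform_within_open[of "%_. 0" _ _ "{..<0}"])
    (use 1 in \<open>auto simp: smoothstep''_def\<close>)
 next
  case 2
  have "((%s. 6 * s * (1 - s)) has_real_derivative smoothstep'' s) (at s)"
   using 2 by (auto intro!: derivative_eq_intros simp: smoothstep''_def)
  then show ?thesis
   by (rule has_field_derivative_transform_within_open[of _ _ _ "{0<..<1}"])
    (use 2 in \<open>auto simp: smoothstep_between\<close>)
 next
  case 3
  show ?thesis
   by (rule has_field_derivative_transform_within_open[of "%_. 0" _ _ "{1<..}"])
    (use 3 in \<open>auto simp: smoothstep''_def\<close>)
 qed
qed

lemma smoothstep'_lipschitz: "\<bar>smoothstep' a - smoothstep' b\<bar> <= 6 * \<bar>a - b\<bar>"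
proof -
 define s where "s = max 0 (min 1 a)"
 define t where "t = max 0 (min 1 b)"
 have st: "0 <= s" "s <= 1" "0 <= t" "t <= 1" "\<bar>s - t\<bar> <= \<bar>a - b\<bar>" by (auto simp: s_def t_def)
 have "smoothstep' a - smoothstep' b = 6 * ((s - t) * (1 - s - t))"
  by (simp add: smoothstep'_def Let_def s_def[symmetric] t_def[symmetric] algebra_simps)
 then have "\<bar>smoothstep' a - smoothstep' b\<bar> = 6 * (\<bar>s - t\<bar> * \<bar>1 - s - t\<bar>)" by (simp add: abs_mult)
 also have "... <= 6 * (\<bar>a - b\<bar> * 1)" using st by (intro mult_left_mono mult_mono) auto
 finally show ?thesis by simp
qed

lemma bounded_lipschitz_smoothstep:
 "bounded_lipschitz UNIV smoothstep" "bounded_lipschitz UNIV smoothstep'"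
 by (rule bounded_lipschitzI[of _ _ 2 2], use smoothstep_range smoothstep_lipschitz in \<open>auto simp: dist_real_def abs_le_iff intro: order_trans[of _ 1]\<close>)
  (rule bounded_lipschitzI[of _ _ 2 6], use smoothstep'_range smoothstep'_lipschitz in \<open>auto simp: dist_real_def abs_le_iff\<close>)

section \<open>Axisymmetric fields\<close>

text \<open>The radial velocity is \<open>r * a\<close>. Writing the horizontal components as
  \<open>x $ i * a\<close> avoids the direction vector \<open>x / r\<close>, which is singular on
  the axis.\<close>

definition axisym_field :: "(real => real => real) => (real => real => real) => real^3 => real^3" where
 "axisym_field a b x = (\<chi> i. if i = 3 then b (radius x) (x $ 3) else x $ i * a (radius x) (x $ 3))"

lemma axisym_field_nth:
 "axisym_field a b x $ 3 = b (radius x) (x $ 3)"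
 "i = 1 \<or> i = 2 ==> axisym_field a b x $ i = x $ i * a (radius x) (x $ 3)"
 by (auto simp: axisym_field_def)

lemma axisym_field_derivatives:
 assumes r: "radius x ~= 0"
  and ar: "((%r. a r (x $ 3)) has_real_derivative ar) (at (radius x))"
  and az: "((%z. a (radius x) z) has_real_derivative az) (at (x $ 3))"
  and br: "((%r. b r (x $ 3)) has_real_derivative br) (at (radius x))"
  and bz: "((%z. b (radius x) z) has_real_derivative bz) (at (x $ 3))"
 shows "i = 1 \<or> i = 2 ==> j = 1 \<or> j = 2 ==> ((%t. axisym_field a b (x + t *\<^sub>R axis j 1) $ i) has_real_derivative
   ((if i = j then a (radius x) (x $ 3) else 0) + x $ i * (ar * (x $ j / radius x)))) (at 0)"
  "i = 1 \<or> i = 2 ==> ((%t. axisym_field a b (x + t *\<^sub>R axis 3 1) $ i) has_real_derivative x $ i * az) (at 0)"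
  "j = 1 \<or> j = 2 ==> ((%t. axisym_field a b (x + t *\<^sub>R axis j 1) $ 3) has_real_derivative br * (x $ j / radius x)) (at 0)"
  "((%t. axisym_field a b (x + t *\<^sub>R axis 3 1) $ 3) has_real_derivative bz) (at 0)"
proof -
 have z: "(x + t *\<^sub>R axis j 1) $ 3 = x $ 3" if "j = 1 \<or> j = 2" for j t using that by (auto simp: axis_def)
 have zz: "(x + t *\<^sub>R axis 3 1) $ 3 = x $ 3 + t" "i = 1 \<or> i = 2 ==> (x + t *\<^sub>R axis 3 1) $ i = x $ i" for i t
  by (auto simp: axis_def)
 have R: "((%t. f (radius (x + t *\<^sub>R axis j 1)) (x $ 3)) has_real_derivative D * (x $ j / radius x)) (at 0)"
  if "((%r. f r (x $ 3)) has_real_derivative D) (at (radius x))" "j = 1 \<or> j = 2" for f j D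
  using DERIV_chain2[where f="%r. f r (x $ 3)" and g="%t. radius (x + t *\<^sub>R axis j 1)", OF _ radius_has_derivative[OF r that(2)]] that(1)
  by simp
 have S: "((%t. f (x $ 3 + t)) has_real_derivative D) (at 0)" if "(f has_real_derivative D) (at (x $ 3))" for f D
  using DERIV_shift[of f D 0 "x $ 3"] that by (simp add: add.commute)
 show "((%t. axisym_field a b (x + t *\<^sub>R axis 3 1) $ i) has_real_derivative x $ i * az) (at 0)" if i: "i = 1 \<or> i = 2"
  unfolding axisym_field_nth(2)[OF i] zz zz(2)[OF i] radius_axis3 by (rule DERIV_cmult[OF S[OF az]])
 show "((%t. axisym_field a b (x + t *\<^sub>R axis 3 1) $ 3) has_real_derivative bz) (at 0)"
  unfolding axisym_field_nth zz radius_axis3 by (rule S[OF bz])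
 show "((%t. axisym_field a b (x + t *\<^sub>R axis j 1) $ 3) has_real_derivative br * (x $ j / radius x)) (at 0)" if j: "j = 1 \<or> j = 2"
  unfolding axisym_field_nth z[OF j] by (rule R[of b br j, OF br j])
 show "((%t. axisym_field a b (x + t *\<^sub>R axis j 1) $ i) has_real_derivative
   ((if i = j then a (radius x) (x $ 3) else 0) + x $ i * (ar * (x $ j / radius x)))) (at 0)"
  if i: "i = 1 \<or> i = 2" and j: "j = 1 \<or> j = 2"
 proof -
  have c: "(x + t *\<^sub>R axis j 1) $ i = x $ i + t * (if i = j then 1 else 0)" for t
   by (auto simp: axis_def)
  have "((%t. x $ i + t * (if i = j then 1 else 0)) has_real_derivative (if i = j then 1 else 0)) (at 0)"
   by (auto intro!: derivative_eq_intros)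
  from DERIV_mult[OF this R[of a ar j, OF ar j]]
  show ?thesis unfolding axisym_field_nth(2)[OF i] z[OF j] c
   by (cases "i = j") (simp_all add: mult.commute)
 qed
qed

section \<open>The test field for the upper bound\<close>

text \<open>The share of the flux of a parabolic flow that passes below the relative height
  \<open>w\<close>; its derivative is the parabola \<open>6 * w * (1 - w)\<close> of mean 1.\<close>

definition profile :: "real => real" where "profile w = w^2 * (3 - 2 * w)"

definition profile' :: "real => real" where "profile' w = 6 * w * (1 - w)"

lemma profile_chain [derivative_intros]:
 "(f has_real_derivative f') (at x within S) ==>
  ((%x. profile (f x)) has_real_derivative profile' (f x) * f') (at x within S)"
 "(f has_real_derivative f') (at x within S) ==>
  ((%x. profile' (f x)) has_real_derivative (6 - 12 * f x) * f') (at x within S)"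
 unfolding profile_def profile'_def
 by (auto intro!: derivative_eq_intros simp: power2_eq_square algebra_simps)

lemma profile_simps [simp]: "profile 0 = 0" "profile' 0 = 0" "profile 1 = 1" "profile' 1 = 0"
 by (simp_all add: profile_def profile'_def)

lemma radius_le_norm_diff: "\<bar>radius x - radius y\<bar> <= norm (x - y)"
proof -
 have "\<bar>radius x - radius y\<bar> <= norm ((x $ 1, x $ 2) - (y $ 1, y $ 2))"
  unfolding radius_eq_norm by (rule norm_triangle_ineq3)
 also have "... = sqrt ((x $ 1 - y $ 1)^2 + (x $ 2 - y $ 2)^2)" by (simp add: norm_Pair)
 also have "... <= sqrt ((x $ 1 - y $ 1)^2 + (x $ 2 - y $ 2)^2 + (x $ 3 - y $ 3)^2)" by simp
 also have "... = norm (x - y)" by (simp add: norm_vec_def L2_set_def sum_3)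
 finally show ?thesis .
qed

text \<open>With \<open>g = profile (W r z) cr(r) cz(z)\<close>, where \<open>W\<close> is \<open>z / K r\<close> clipped to \<open>[0, 1]\<close>, the test field has
 the components \<open>x\<^sub>1 a\<close>, \<open>x\<^sub>2 a\<close> and \<open>b\<close> with \<open>a = - g\<^sub>z / 2\<close> and \<open>b = g + r g\<^sub>r / 2\<close>.  Below, \<open>fa\<close> and \<open>fb\<close> are
 \<open>a\<close> and \<open>b\<close>, and \<open>ar\<close>, \<open>az\<close>, \<open>br\<close>, \<open>bz\<close> their partial derivatives.\<close>

locale squeeze_flow =
 fixes K K' K'' :: "real => real" and h r1 R Z :: real
 assumes h: "0 < h" and r1: "0 < r1" and R: "0 < R"
  and K_ge: "!!r. 0 <= r ==> h <= K r" and K_less: "!!r. 0 <= r ==> K r < Z"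
  and K_lip: "bounded_lipschitz {0..} K" and P_lip: "bounded_lipschitz {0..} (%r. r * K' r)"
  and K_der: "!!r. 0 < r ==> (K has_real_derivative K' r) (at r)"
  and K'_der: "!!r. 0 < r ==> r ~= r1 ==> r ~= 2 * r1 ==> (K' has_real_derivative K'' r) (at r)"
begin

definition "cr r = 1 - smoothstep (r - R)"
definition "cr1 r = - smoothstep' (r - R)"
definition "cr2 r = - smoothstep'' (r - R)"
definition "cz z = 1 - smoothstep (z - Z)"
definition "cz1 z = - smoothstep' (z - Z)"
definition "cz2 z = - smoothstep'' (z - Z)"
definition "W r z = min (K r) (max 0 z) / K r"
definition "Wz r z = (if 0 < z \<and> z < K r then 1 / K r else 0)"
definition "Wr r z = - (W r z * K' r * Wz r z)"

definition "fa r z = - (1 / 2) * cr r * (profile' (W r z) * cz z / K r + profile (W r z) * cz1 z)"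
definition "fb r z = cz z * (profile (W r z) * (cr r + r * cr1 r / 2) - 1 / 2 * cr r * profile' (W r z) * W r z * (r * K' r) / K r)"
definition "ar r z = - (1 / 2) * (cr1 r * (profile' (W r z) * cz z / K r + profile (W r z) * cz1 z)
  + cr r * ((6 - 12 * W r z) * Wr r z * cz z / K r - profile' (W r z) * cz z * K' r / (K r)^2 + profile' (W r z) * Wr r z * cz1 z))"
definition "az r z = - (1 / 2) * cr r * ((6 - 12 * W r z) * Wz r z * cz z / K r + profile' (W r z) * cz1 z / K r
  + profile' (W r z) * Wz r z * cz1 z + profile (W r z) * cz2 z)"
definition "br r z = cz z * (profile' (W r z) * Wr r z * (cr r + r * cr1 r / 2) + profile (W r z) * (cr1 r + cr1 r / 2 + r * cr2 r / 2)
  - 1 / 2 * (cr1 r * profile' (W r z) * W r z * (r * K' r) / K r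
   + cr r * ((6 - 12 * W r z) * Wr r z * W r z + profile' (W r z) * Wr r z) * (r * K' r) / K r
   + cr r * profile' (W r z) * W r z * (K' r + r * K'' r) / K r
   - cr r * profile' (W r z) * W r z * (r * K' r) * K' r / (K r)^2))"
definition "bz r z = cz1 z * (profile (W r z) * (cr r + r * cr1 r / 2) - 1 / 2 * cr r * profile' (W r z) * W r z * (r * K' r) / K r)
  + cz z * (profile' (W r z) * Wz r z * (cr r + r * cr1 r / 2)
   - 1 / 2 * cr r * ((6 - 12 * W r z) * Wz r z * W r z + profile' (W r z) * Wz r z) * (r * K' r) / K r)"

lemma K_pos: "0 <= r ==> 0 < K r"
 using K_ge[of r] h by simp

lemma W_cases:
 assumes "0 <= r"
 shows "z <= 0 ==> W r z = 0" "0 <= z ==> z <= K r ==> W r z = z / K r" "K r <= z ==> W r z = 1"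
 using K_pos[OF assms] by (auto simp: W_def min_def max_def)

lemma W_range: assumes "0 <= r" shows "0 <= W r z" "W r z <= 1"
 using K_pos[OF assms] by (auto simp: W_def min_def max_def divide_le_eq)

lemma W_derivatives:
 assumes r: "0 < r" and z: "z ~= 0" "z ~= K r"
 shows "((%r. W r z) has_real_derivative Wr r z) (at r)" "((%z. W r z) has_real_derivative Wz r z) (at z)"
proof -
 note Kp = K_pos[of r]
 have K0: "K r ~= 0" using Kp r by simp
 have cont: "isCont K r" using K_der[OF r] by (rule DERIV_isCont)
 have pos: "\<forall>\<^sub>F s in nhds r. 0 < s" using eventually_nhds_in_open[of "{0<..}" r] r by auto
 have nh: "\<forall>\<^sub>F s in nhds r. P s" if "\<forall>\<^sub>F s in at r. P s" "P r" for P
  using that by (simp add: eventually_nhds_conv_at)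
 consider "z < 0" | "0 < z" "z < K r" | "K r < z" using z by linarith
 then show "((%r. W r z) has_real_derivative Wr r z) (at r)"
 proof cases
  case 1
  have "\<forall>\<^sub>F s in nhds r. 0 = W s z" using pos by eventually_elim (use 1 W_cases(1) in auto)
  then show ?thesis
   using DERIV_cong_ev[OF refl, of "%_. 0" "%s. W s z" r 0 "Wr r z"] 1 r by (simp add: Wr_def Wz_def)
 next
  case 2
  have "\<forall>\<^sub>F s in nhds r. z < K s"
   using cont 2 by (intro nh order_tendstoD(1)) (auto simp: isCont_def)
  then have "\<forall>\<^sub>F s in nhds r. z / K s = W s z"
   using pos by eventually_elim (use 2 W_cases(2) in auto)
  moreover have "((%s. z / K s) has_real_derivative Wr r z) (at r)"
   using K0 2 r W_cases(2)[of r z]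
   by (auto intro!: derivative_eq_intros K_der[OF r] simp: Wr_def Wz_def)
  ultimately show ?thesis
   using DERIV_cong_ev[OF refl, of "%s. z / K s" "%s. W s z" r "Wr r z" "Wr r z"] by simp
 next
  case 3
  have "\<forall>\<^sub>F s in nhds r. K s < z"
   using cont 3 by (intro nh order_tendstoD(2)) (auto simp: isCont_def)
  then have "\<forall>\<^sub>F s in nhds r. 1 = W s z"
   using pos by eventually_elim (use W_cases(3) in auto)
  then show ?thesis
   using DERIV_cong_ev[OF refl, of "%_. 1" "%s. W s z" r 0 "Wr r z"] 3 r Kp by (simp add: Wr_def Wz_def)
 qed
 consider "z < 0" | "0 < z" "z < K r" | "K r < z" using z by linarith
 then show "((%z. W r z) has_real_derivative Wz r z) (at z)"
 proof cases
  case 1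
  then show ?thesis
   using has_field_derivative_transform_within_open[of "%_. 0" 0 z "{..<0}" "W r"] W_cases(1)[of r] r by (simp add: Wz_def)
 next
  case 2
  have "((%z. z / K r) has_real_derivative Wz r z) (at z)"
   using K0 2 by (auto intro!: derivative_eq_intros simp: Wz_def)
  then show ?thesis
   by (rule has_field_derivative_transform_within_open[of _ _ _ "{0<..<K r}"]) (use 2 r W_cases(2)[of r] in auto)
 next
  case 3
  have "((%z. 1) has_real_derivative Wz r z) (at z)" using 3 by (simp add: Wz_def)
  then show ?thesis
   by (rule has_field_derivative_transform_within_open[of _ _ _ "{K r<..}"]) (use 3 r W_cases(3)[of r] in auto)
 qed
qed

lemma cr_derivatives:
 "(cr has_real_derivative cr1 r) (at r)"
 "r ~= R ==> r ~= R + 1 ==> (cr1 has_real_derivative cr2 r) (at r)"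
 "(cz has_real_derivative cz1 z) (at z)"
 "z ~= Z ==> z ~= Z + 1 ==> (cz1 has_real_derivative cz2 z) (at z)"
proof -
 show "(cr has_real_derivative cr1 r) (at r)" "(cz has_real_derivative cz1 z) (at z)"
  unfolding cr_def[abs_def] cr1_def cz_def[abs_def] cz1_def by (auto intro!: derivative_eq_intros)
 have s: "((%x. smoothstep' (x - c)) has_real_derivative smoothstep'' (x - c)) (at x)" if "x ~= c" "x ~= c + 1" for x c
 proof -
  have "((%x. x - c) has_real_derivative 1) (at x)" by (auto intro!: derivative_eq_intros)
  from DERIV_chain2[OF has_real_derivative_smoothstep' this] that show ?thesis by auto
 qed
 show "(cr1 has_real_derivative cr2 r) (at r)" if "r ~= R" "r ~= R + 1"
  unfolding cr1_def[abs_def] cr2_def by (rule DERIV_minus[OF s[OF that]])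
 show "(cz1 has_real_derivative cz2 z) (at z)" if "z ~= Z" "z ~= Z + 1"
  unfolding cz1_def[abs_def] cz2_def by (rule DERIV_minus[OF s[OF that]])
qed

lemma field_derivatives:
 assumes r: "0 < r" "r ~= r1" "r ~= 2 * r1" "r ~= R" "r ~= R + 1"
  and z: "z ~= 0" "z ~= K r" "z ~= Z" "z ~= Z + 1"
 shows "((%r. fa r z) has_real_derivative ar r z) (at r)" "((%z. fa r z) has_real_derivative az r z) (at z)"
  "((%r. fb r z) has_real_derivative br r z) (at r)" "((%z. fb r z) has_real_derivative bz r z) (at z)"
proof -
 have K0: "K r ~= 0" using K_pos[of r] r by simp
 note D = W_derivatives[OF r(1) z(1,2)] cr_derivatives(1) cr_derivatives(2)[OF r(4,5)] cr_derivatives(3)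
  cr_derivatives(4)[OF z(3,4)] K_der[OF r(1)] K'_der[OF r(1-3)]
 show "((%r. fa r z) has_real_derivative ar r z) (at r)"
  unfolding fa_def ar_def
  by (rule derivative_eq_intros D K0 refl | simp add: K0)+ (simp add: K0 field_simps power2_eq_square)
 show "((%z. fa r z) has_real_derivative az r z) (at z)"
  unfolding fa_def az_def
  by (rule derivative_eq_intros D K0 refl | simp add: K0)+ (simp add: K0 field_simps power2_eq_square)
 show "((%r. fb r z) has_real_derivative br r z) (at r)"
  unfolding fb_def br_def
  by (rule derivative_eq_intros D K0 refl | simp add: K0)+ (simp add: K0 field_simps power2_eq_square)
 show "((%z. fb r z) has_real_derivative bz r z) (at z)"
  unfolding fb_def bz_def
  by (rule derivative_eq_intros D K0 refl | simp add: K0)+ (simp add: K0 field_simps power2_eq_square)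
qed

text \<open>The stream function makes this automatic. For the explicit formulas it is an algebraic
  identity as soon as \<open>Wz\<close> is \<open>1 / K r\<close>; above and below the gap
  \<open>W\<close> is constant and each term is compared directly.\<close>

lemma divergence_free:
 assumes "0 < r" "z ~= 0" "z ~= K r"
 shows "2 * fa r z + r * ar r z + bz r z = 0"
proof -
 have K0: "K r ~= 0" using K_pos[of r] assms by simp
 have "W r z = 0 \<and> Wz r z = 0 \<or> Wz r z = 1 / K r \<or> W r z = 1 \<and> Wz r z = 0"
  using assms W_cases[of r z] by (auto simp: Wz_def)
 then consider "W r z = 0" "Wz r z = 0" | "Wz r z = 1 / K r" | "W r z = 1" "Wz r z = 0" by blast
 then show ?thesis
 proof cases
  case 2
  show ?thesis
   unfolding fa_def ar_def bz_def Wr_def 2 using K0 by (simp add: field_simps power2_eq_square)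
 qed (simp_all add: fa_def ar_def bz_def Wr_def field_simps)
qed

definition "field = axisym_field fa fb"

lemma bounded_lipschitz_field: "bounded_lipschitz UNIV (%x. field x $ i)"
proof -
 have rad: "dist (radius x) (radius y) <= 1 * dist x y" for x y
  using radius_le_norm_diff[of x y] by (simp add: dist_norm)
 have k: "bounded_lipschitz UNIV (%x. K (radius x))" "bounded_lipschitz UNIV (%x. radius x * K' (radius x))"
  by (rule bounded_lipschitz_compose[OF K_lip _ rad] bounded_lipschitz_compose[OF P_lip _ rad], simp)+
 have kh: "h <= K (radius x)" for x by (rule K_ge) simp
 have c: "bounded_lipschitz UNIV (%x::real^3. smoothstep (radius x - R))" "bounded_lipschitz UNIV (%x::real^3. smoothstep' (radius x - R))"
  by (rule bounded_lipschitz_compose[OF bounded_lipschitz_smoothstep(1), where M=1]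
    bounded_lipschitz_compose[OF bounded_lipschitz_smoothstep(2), where M=1],
    simp, use rad in \<open>simp add: dist_real_def\<close>)+
 have zl: "\<bar>x $ i - y $ i\<bar> <= dist x y" for x y :: "real^3" and i
  using component_le_norm_cart[of "x - y" i] by (simp add: dist_norm)
 have d: "bounded_lipschitz UNIV (%x::real^3. smoothstep (x $ 3 - Z))" "bounded_lipschitz UNIV (%x::real^3. smoothstep' (x $ 3 - Z))"
  by (rule bounded_lipschitz_compose[OF bounded_lipschitz_smoothstep(1), where M=1]
    bounded_lipschitz_compose[OF bounded_lipschitz_smoothstep(2), where M=1],
    simp, use zl[of _ 3] in \<open>simp add: dist_real_def\<close>)+
 have cc: "bounded_lipschitz UNIV (%x. cr (radius x))" "bounded_lipschitz UNIV (%x. cr1 (radius x))"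
  "bounded_lipschitz UNIV (%x::real^3. cz (x $ 3))" "bounded_lipschitz UNIV (%x::real^3. cz1 (x $ 3))"
  unfolding cr_def cr1_def cz_def cz1_def
  by (rule bounded_lipschitz_diff bounded_lipschitz_minus bounded_lipschitz_const c d)+
 obtain B L where BL: "0 <= B" "0 <= L" "!!x. \<bar>K (radius x)\<bar> <= B" "!!x y. \<bar>K (radius x) - K (radius y)\<bar> <= L * dist x y"
  using bounded_lipschitzE[OF k(1)] by (metis UNIV_I)
 have "bounded_lipschitz UNIV (%x. min (K (radius x)) (max 0 (x $ 3)))"
 proof (rule bounded_lipschitzI[of _ _ B "L + 1"])
  show "\<bar>min (K (radius x)) (max 0 (x $ 3))\<bar> <= B" for x using BL(3)[of x] kh[of x] h by (simp add: min_def max_def)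
  have "\<bar>min a c - min b d\<bar> <= \<bar>a - b\<bar> + \<bar>c - d\<bar>" "\<bar>max 0 c - max 0 d\<bar> <= \<bar>c - d\<bar>" for a b c d :: real
   by (auto simp: min_def max_def)
  then have "\<bar>min (K (radius x)) (max 0 (x $ 3)) - min (K (radius y)) (max 0 (y $ 3))\<bar>
    <= \<bar>K (radius x) - K (radius y)\<bar> + \<bar>x $ 3 - y $ 3\<bar>" for x y
   by (meson add_left_mono order_trans)
  then show "\<bar>min (K (radius x)) (max 0 (x $ 3)) - min (K (radius y)) (max 0 (y $ 3))\<bar> <= (L + 1) * dist x y" for x y
   using BL(4)[of x y] zl[of x 3 y] by (simp add: distrib_right)
 qed
 then have w: "bounded_lipschitz UNIV (%x. W (radius x) (x $ 3))"
  unfolding W_def by (rule bounded_lipschitz_divide[OF _ k(1) h kh])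
 then have p: "bounded_lipschitz UNIV (%x. profile (W (radius x) (x $ 3)))" "bounded_lipschitz UNIV (%x. profile' (W (radius x) (x $ 3)))"
  unfolding profile_def profile'_def power2_eq_square
  by (auto intro!: bounded_lipschitz_mult bounded_lipschitz_diff)
 \<comment> \<open>Coordinates and radius are unbounded, but they occur only multiplied by radial
   cutoffs that vanish from \<open>R + 1\<close> on. Clamping them there keeps every factor bounded
   and leaves the products unchanged.\<close>
 define clamp where "clamp y = max (- (R + 1)) (min (R + 1) y)" for y
 have cl: "\<bar>clamp a\<bar> <= R + 1" "\<bar>clamp a - clamp b\<bar> <= \<bar>a - b\<bar>" for a b
  using R by (auto simp: clamp_def max_def min_def)
 have cli: "clamp y = y" if "\<bar>y\<bar> <= R + 1" for y using that by (auto simp: clamp_def)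
 have bc: "bounded_lipschitz UNIV (%x::real^3. clamp (x $ i))" for i
  by (rule bounded_lipschitzI[of _ _ "R + 1" 1]) (use cl zl order_trans in \<open>fastforce+\<close>)
 have bcr: "bounded_lipschitz UNIV (%x. clamp (radius x))"
  by (rule bounded_lipschitzI[of _ _ "R + 1" 1]) (use cl rad order_trans in \<open>fastforce simp: dist_real_def\<close>)+
 have big: "cr r = 0 \<and> cr1 r = 0" if "R + 1 <= r" for r using that by (simp add: cr_def cr1_def)
 have xi: "bounded_lipschitz UNIV (%x. x $ i * cr (radius x))" if i: "i = 1 \<or> i = 2" for i
 proof (rule bounded_lipschitz_cong[OF bounded_lipschitz_mult[OF bc[of i] cc(1)]])
  show "clamp (x $ i) * cr (radius x) = x $ i * cr (radius x)" for x
   using big[of "radius x"] cli[of "x $ i"] component_le_radius[of x] i by (cases "R + 1 <= radius x") auto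
 qed
 have rc: "bounded_lipschitz UNIV (%x. radius x * cr1 (radius x))"
 proof (rule bounded_lipschitz_cong[OF bounded_lipschitz_mult[OF bcr cc(2)]])
  show "clamp (radius x) * cr1 (radius x) = radius x * cr1 (radius x)" for x
   using big[of "radius x"] cli[of "radius x"] by (cases "R + 1 <= radius x") auto
 qed
 have A: "bounded_lipschitz UNIV (%x. field x $ i)" if i: "i = 1 \<or> i = 2" for i
 proof -
  have "bounded_lipschitz UNIV (%x. - (1 / 2) * (x $ i * cr (radius x)) *
    (profile' (W (radius x) (x $ 3)) * cz (x $ 3) / K (radius x) + profile (W (radius x) (x $ 3)) * cz1 (x $ 3)))"
   by (intro bounded_lipschitz_mult bounded_lipschitz_add bounded_lipschitz_const p cc xi[OF i]
     bounded_lipschitz_divide[OF _ k(1) h kh])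
  then show ?thesis
   by (rule bounded_lipschitz_cong) (simp add: field_def axisym_field_nth(2)[OF i] fa_def)
 qed
 have B: "bounded_lipschitz UNIV (%x. field x $ 3)"
 proof -
  have "bounded_lipschitz UNIV (%x. cz (x $ 3) * (profile (W (radius x) (x $ 3)) * (cr (radius x) + (radius x * cr1 (radius x)) * (1 / 2))
    - 1 / 2 * cr (radius x) * profile' (W (radius x) (x $ 3)) * W (radius x) (x $ 3) * (radius x * K' (radius x)) / K (radius x)))"
   by (intro bounded_lipschitz_mult bounded_lipschitz_add bounded_lipschitz_diff bounded_lipschitz_const p cc rc w k
     bounded_lipschitz_divide[OF _ k(1) h kh])
  then show ?thesis
   by (rule bounded_lipschitz_cong) (simp add: field_def axisym_field_nth(1) fb_def)
 qed
 show ?thesis using A B exhaust_3[of i] by blast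
qed

lemma field_values:
 "x $ 3 <= 0 ==> field x = 0"
 "radius x <= R ==> K (radius x) <= x $ 3 ==> x $ 3 <= Z ==> field x = e_z"
 "R + 1 <= radius x \<or> Z + 1 <= x $ 3 ==> field x = 0"
 by (auto simp: vec_eq_iff forall_3 field_def axisym_field_def fa_def fb_def W_cases e_z_def axis_def cr_def cr1_def cz_def cz1_def)

text \<open>The five squares are the entries of the gradient in the cylindrical frame. With radial
  velocity \<open>r * a\<close> these are its derivative in height, the azimuthal stretching
  \<open>a\<close>, its radial derivative \<open>a + r * ar\<close>, and the two derivatives of
  \<open>b\<close>.\<close>

lemma field_gradient:
 obtains G where "energy_field field G" "AE x in lborel. trace (G x) = 0"
  "AE x in lborel. (norm (G x))^2 = (radius x * az (radius x) (x $ 3))^2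
    + (fa (radius x) (x $ 3))^2 + (fa (radius x) (x $ 3) + radius x * ar (radius x) (x $ 3))^2
    + (br (radius x) (x $ 3))^2 + (bz (radius x) (x $ 3))^2"
proof -
 have Kc: "continuous_on {0..} K"
 proof -
  obtain L where "0 <= L" "!!x y. x \<in> {0..} ==> y \<in> {0..} ==> \<bar>K x - K y\<bar> <= L * dist x y"
   using bounded_lipschitzE[OF K_lip] by metis
  then have "L-lipschitz_on {0..} K" by (intro lipschitz_onI) (auto simp: dist_real_def)
  then show ?thesis by (rule lipschitz_on_continuous_on)
 qed
 have "continuous_on UNIV (%r. K \<bar>r\<bar>)"
  by (rule continuous_on_compose2[OF Kc]) (auto intro!: continuous_intros)
 then have "(%r. K \<bar>r\<bar>) \<in> bm" by (rule borel_measurable_continuous_onI)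
 from AE_height_neq[OF this] have nK: "AE x in lborel. x $ 3 ~= K (radius x)" by simp
 have nz: "AE x::real^3 in lborel. x $ 3 ~= c" for c :: real using AE_height_neq[of "%_. c"] by simp
 \<comment> \<open>The formulas hold off finitely many cylinders, planes and the graph of
   \<open>K\<close>, where some piecewise definition changes; all of these are null sets.\<close>
 have gen: "AE x in lborel. 0 < radius x \<and> radius x ~= r1 \<and> radius x ~= 2 * r1 \<and> radius x ~= R \<and> radius x ~= R + 1
   \<and> x $ 3 ~= 0 \<and> x $ 3 ~= K (radius x) \<and> x $ 3 ~= Z \<and> x $ 3 ~= Z + 1"
  using AE_radius_neq[of 0] AE_radius_neq[of r1] AE_radius_neq[of "2 * r1"] AE_radius_neq[of R] AE_radius_neq[of "R + 1"]
   nK nz[of 0] nz[of Z] nz[of "Z + 1"]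
  by eventually_elim (use radius_nonneg le_less in \<open>metis\<close>)
 have "\<exists>L. \<forall>x y. \<bar>field x $ i - field y $ i\<bar> <= L * norm (x - y)" for i
  using bounded_lipschitz_field[of i] by (auto simp: bounded_lipschitz_def dist_norm)
 then obtain L where L: "!!i x y. \<bar>field x $ i - field y $ i\<bar> <= L i * norm (x - y)" by metis
 have L': "\<bar>field x $ i - field y $ i\<bar> <= (\<Sum>i\<in>UNIV. \<bar>L i\<bar>) * norm (x - y)" for i x y
 proof -
  have "L i <= (\<Sum>i\<in>UNIV. \<bar>L i\<bar>)"
   by (rule order_trans[OF abs_ge_self member_le_sum[of i UNIV "%i. \<bar>L i\<bar>"]]) auto
  then show ?thesis using L[of x i y] mult_right_mono[OF _ norm_ge_zero[of "x - y"]] order_trans by blast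
 qed
 have supp: "norm x <= R + Z + 2" if "field x ~= 0" for x
 proof -
  have "0 < x $ 3" "radius x < R + 1" "x $ 3 < Z + 1" using that field_values(1,3)[of x] by force+
  then show ?thesis using norm_le_radius[of x] by simp
 qed
 have Z: "0 < Z" using K_ge[of 0] K_less[of 0] h by simp
 have D: "!!i j. i = 1 \<or> i = 2 ==> j = 1 \<or> j = 2 ==> ((%t. field (x + t *\<^sub>R axis j 1) $ i) has_real_derivative
    ((if i = j then fa (radius x) (x $ 3) else 0) + x $ i * (ar (radius x) (x $ 3) * (x $ j / radius x)))) (at 0)"
   "!!i. i = 1 \<or> i = 2 ==> ((%t. field (x + t *\<^sub>R axis 3 1) $ i) has_real_derivative x $ i * az (radius x) (x $ 3)) (at 0)"
   "!!j. j = 1 \<or> j = 2 ==> ((%t. field (x + t *\<^sub>R axis j 1) $ 3) has_real_derivative br (radius x) (x $ 3) * (x $ j / radius x)) (at 0)"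
   "((%t. field (x + t *\<^sub>R axis 3 1) $ 3) has_real_derivative bz (radius x) (x $ 3)) (at 0)"
  if g: "0 < radius x \<and> radius x ~= r1 \<and> radius x ~= 2 * r1 \<and> radius x ~= R \<and> radius x ~= R + 1
   \<and> x $ 3 ~= 0 \<and> x $ 3 ~= K (radius x) \<and> x $ 3 ~= Z \<and> x $ 3 ~= Z + 1" for x
 proof -
  have "((%r. fa r (x $ 3)) has_real_derivative ar (radius x) (x $ 3)) (at (radius x))"
   "((%z. fa (radius x) z) has_real_derivative az (radius x) (x $ 3)) (at (x $ 3))"
   "((%r. fb r (x $ 3)) has_real_derivative br (radius x) (x $ 3)) (at (radius x))"
   "((%z. fb (radius x) z) has_real_derivative bz (radius x) (x $ 3)) (at (x $ 3))"
   using g by (intro field_derivatives; simp)+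
  note d = axisym_field_derivatives[OF _ this, folded field_def]
  have r0: "radius x ~= 0" using g by simp
  show "!!i j. i = 1 \<or> i = 2 ==> j = 1 \<or> j = 2 ==> ((%t. field (x + t *\<^sub>R axis j 1) $ i) has_real_derivative
    ((if i = j then fa (radius x) (x $ 3) else 0) + x $ i * (ar (radius x) (x $ 3) * (x $ j / radius x)))) (at 0)"
   "!!i. i = 1 \<or> i = 2 ==> ((%t. field (x + t *\<^sub>R axis 3 1) $ i) has_real_derivative x $ i * az (radius x) (x $ 3)) (at 0)"
   "!!j. j = 1 \<or> j = 2 ==> ((%t. field (x + t *\<^sub>R axis j 1) $ 3) has_real_derivative br (radius x) (x $ 3) * (x $ j / radius x)) (at 0)"
   "((%t. field (x + t *\<^sub>R axis 3 1) $ 3) has_real_derivative bz (radius x) (x $ 3)) (at 0)"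
   by (rule d(1)[OF r0], assumption, assumption) (rule d(2)[OF r0] d(3)[OF r0] d(4)[OF r0], assumption?)+
 qed
 have ex: "AE x in lborel. \<exists>D. ((%t. field (x + t *\<^sub>R axis j 1) $ i) has_real_derivative D) (at 0)" for i j
  using gen
 proof eventually_elim
  case (elim x)
  show ?case using D[OF elim] exhaust_3[of i] exhaust_3[of j] by metis
 qed
 obtain G where G: "energy_field field G"
  "!!x i j D. ((%t. field (x + t *\<^sub>R axis j 1) $ i) has_real_derivative D) (at 0) ==> G x $ i $ j = D"
  using lipschitz_energy_field[OF L' supp _ ex] R Z by auto
 have entries: "AE x in lborel. trace (G x) = 0 \<and> (norm (G x))^2 = (radius x * az (radius x) (x $ 3))^2
    + (fa (radius x) (x $ 3))^2 + (fa (radius x) (x $ 3) + radius x * ar (radius x) (x $ 3))^2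
    + (br (radius x) (x $ 3))^2 + (bz (radius x) (x $ 3))^2"
  using gen
 proof eventually_elim
  case (elim x)
  define r where "r = radius x"
  define p where "p = x $ 1 / r"
  define q where "q = x $ 2 / r"
  have r0: "0 < r" using elim by (simp add: r_def)
  have pq: "p^2 + q^2 = 1" "x $ 1 = r * p" "x $ 2 = r * q"
  proof -
   have rr: "(x $ 1)^2 + (x $ 2)^2 = r^2" by (simp add: r_def radius_def)
   have "p^2 + q^2 = ((x $ 1)^2 + (x $ 2)^2) / r^2" by (simp add: p_def q_def power_divide add_divide_distrib)
   then show "p^2 + q^2 = 1" using r0 unfolding rr by simp
  qed (use r0 in \<open>simp_all add: p_def q_def\<close>)
  define a where "a = fa r (x $ 3)"
  define k where "k = r * ar r (x $ 3)"
  define m where "m = r * az r (x $ 3)"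
  define n where "n = br r (x $ 3)"
  define l where "l = bz r (x $ 3)"
  have e: "G x $ 1 $ 1 = a + k * (p * p)" "G x $ 1 $ 2 = k * (p * q)" "G x $ 1 $ 3 = p * m"
   "G x $ 2 $ 1 = k * (p * q)" "G x $ 2 $ 2 = a + k * (q * q)" "G x $ 2 $ 3 = q * m"
   "G x $ 3 $ 1 = n * p" "G x $ 3 $ 2 = n * q" "G x $ 3 $ 3 = l"
   using G(2)[OF D(1)[OF elim]] G(2)[OF D(2)[OF elim]] G(2)[OF D(3)[OF elim]] G(2)[OF D(4)[OF elim]] r0
   by (simp_all add: r_def[symmetric] p_def[symmetric] q_def[symmetric] pq(2,3) a_def k_def m_def n_def l_def)
  have "trace (G x) = 2 * a + k * (p^2 + q^2) + l"
   by (simp add: trace_def sum_3 e power2_eq_square distrib_left)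
  also have "... = 0" using divergence_free[of r "x $ 3"] elim r0 by (simp add: pq(1) a_def k_def l_def r_def)
  finally have t: "trace (G x) = 0" .
  have "(norm (G x))^2 = m^2 * (p^2 + q^2) + 2 * a^2 + 2 * a * k * (p^2 + q^2) + k^2 * (p^2 + q^2)^2 + n^2 * (p^2 + q^2) + l^2"
   unfolding norm_sq_matrix by (simp add: sum_3 e power2_eq_square algebra_simps)
  then have "(norm (G x))^2 = m^2 + a^2 + (a + k)^2 + n^2 + l^2"
   unfolding pq(1) by (simp add: power2_sum)
  then show ?case using t by (simp add: a_def k_def m_def n_def l_def r_def)
 qed
 show ?thesis by (rule that[OF G(1)]) (use entries in \<open>auto elim: eventually_mono\<close>)
qed

end

text \<open>Starts a calculus of crude bounds by powers of one number \<open>N\<close>: the rules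
  follow the syntax of an expression and add up exponents. Where the density needs no precision,
  this replaces all estimates by hand; the final exponent 1000 is merely generous.\<close>

lemma abs_le_power_mono: "1 <= (N::real) ==> \<bar>x\<bar> <= N ^ i ==> i <= k ==> \<bar>x\<bar> <= N ^ k"
 by (meson order_trans power_increasing)

lemma abs_le_power_mult: "1 <= (N::real) ==> \<bar>x\<bar> <= N ^ i ==> \<bar>y\<bar> <= N ^ j ==> \<bar>x * y\<bar> <= N ^ (i + j)"
 by (auto simp: abs_mult power_add intro!: mult_mono)

lemma abs_le_power_power2: "1 <= (N::real) ==> \<bar>x\<bar> <= N ^ i ==> \<bar>x^2\<bar> <= N ^ (i + i)"
 using abs_le_power_mult[of N x i x i] by (simp add: power2_eq_square)

lemma abs_le_power_add: "2 <= (N::real) ==> \<bar>x\<bar> <= N ^ i ==> \<bar>y\<bar> <= N ^ j ==> \<bar>x + y\<bar> <= N ^ (i + j + 1)"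
proof -
 assume N: "2 <= N" and x: "\<bar>x\<bar> <= N ^ i" and y: "\<bar>y\<bar> <= N ^ j"
 have "N ^ i <= N ^ (i + j)" "N ^ j <= N ^ (i + j)" using N by (auto intro!: power_increasing)
 then have "\<bar>x + y\<bar> <= 2 * N ^ (i + j)" using x y by linarith
 also have "... <= N * N ^ (i + j)" using N by (intro mult_right_mono) auto
 finally show ?thesis by simp
qed

lemma abs_le_power_minus: "\<bar>x\<bar> <= (N::real) ^ i ==> \<bar>- x\<bar> <= N ^ i" by simp

lemma abs_le_power_diff: "2 <= (N::real) ==> \<bar>x\<bar> <= N ^ i ==> \<bar>y\<bar> <= N ^ j ==> \<bar>x - y\<bar> <= N ^ (i + j + 1)"
 using abs_le_power_add[of N x i "- y" j] by simp

lemma abs_le_power_divide: "1 <= (N::real) ==> \<bar>x\<bar> <= N ^ i ==> \<bar>1 / y\<bar> <= N ^ j ==> \<bar>x / y\<bar> <= N ^ (i + j)"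
 using abs_le_power_mult[of N x i "1 / y" j] by simp

section \<open>The energy of the test field\<close>

context squeeze_flow begin

lemma cutoffs_bound:
 "\<bar>cr r\<bar> <= 1" "\<bar>cr1 r\<bar> <= 2" "\<bar>cr2 r\<bar> <= 6" "\<bar>cz z\<bar> <= 1" "\<bar>cz1 z\<bar> <= 2" "\<bar>cz2 z\<bar> <= 6"
 using smoothstep_range[of "r - R"] smoothstep'_range[of "r - R"] smoothstep''_bound[of "r - R"]
  smoothstep_range[of "z - Z"] smoothstep'_range[of "z - Z"] smoothstep''_bound[of "z - Z"]
 by (auto simp: cr_def cr1_def cr2_def cz_def cz1_def cz2_def)

lemma profile_bounds:
 assumes "0 <= w" "w <= 1" shows "\<bar>profile w\<bar> <= 3" "\<bar>profile' w\<bar> <= 2"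
proof -
 have "w^2 <= 1" using assms by (simp add: power_le_one)
 then have "w^2 * (3 - 2 * w) <= 1 * 3" using assms by (intro mult_mono) auto
 then show "\<bar>profile w\<bar> <= 3" using assms by (simp add: profile_def)
 have "6 * w * (1 - w) <= 2" using zero_le_power2[of "w - 1/2"] by (simp add: power2_eq_square algebra_simps)
 then show "\<bar>profile' w\<bar> <= 2" using assms by (simp add: profile'_def)
qed

definition "density_sq r z = (r * az r z)^2 + (fa r z)^2 + (fa r z + r * ar r z)^2 + (br r z)^2 + (bz r z)^2"

text \<open>Above the graph \<open>W\<close> is constant, so neither \<open>K\<close> nor its
  derivatives enter, and the bound holds even where \<open>K\<close> is as small as
  \<open>h\<close>.\<close>

lemma density_bound_above_gap:
 assumes r: "0 < r" and z: "0 < z" "K r < z" and N: "12 <= N" "R + 1 <= N"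
 shows "density_sq r z <= N ^ 1000"
proof (cases "r <= R + 1")
 case True
 have W: "W r z = 1" "Wz r z = 0" "Wr r z = 0" using z r W_cases(3)[of r z] by (auto simp: Wz_def Wr_def)
 have N2: "1 <= N" "2 <= N" using N by auto
 have atoms: "\<bar>cr r\<bar> <= N ^ 1" "\<bar>cr1 r\<bar> <= N ^ 1" "\<bar>cr2 r\<bar> <= N ^ 1" "\<bar>cz z\<bar> <= N ^ 1" "\<bar>cz1 z\<bar> <= N ^ 1" "\<bar>cz2 z\<bar> <= N ^ 1"
  "\<bar>r\<bar> <= N ^ 1" "\<bar>1 / 2\<bar> <= N ^ 1"
  using cutoffs_bound(1-3)[of r] cutoffs_bound(4-6)[of z] N True r by auto
 note rules = atoms abs_le_power_mult[OF N2(1)] abs_le_power_power2[OF N2(1)] abs_le_power_add[OF N2(2)]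
  abs_le_power_diff[OF N2(2)] abs_le_power_minus abs_le_power_divide[OF N2(1)]
 have e: "fa r z = - (1 / 2) * cr r * cz1 z" "ar r z = - (1 / 2) * (cr1 r * cz1 z)" "az r z = - (1 / 2) * cr r * cz2 z"
  "br r z = cz z * (cr1 r + cr1 r / 2 + r * cr2 r / 2)" "bz r z = cz1 z * (cr r + r * cr1 r / 2)"
  by (simp_all add: fa_def ar_def az_def br_def bz_def W)
 have "\<bar>density_sq r z\<bar> <= N ^ 1000"
  unfolding density_sq_def e by (rule abs_le_power_mono[OF N2(1)], (rule rules)+, simp)
 then show ?thesis by simp
next
 case False
 then have "cr r = 0" "cr1 r = 0" "cr2 r = 0" by (auto simp: cr_def cr1_def cr2_def smoothstep''_def)
 then have "density_sq r z = 0" by (simp add: density_sq_def fa_def ar_def az_def br_def bz_def)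
 then show ?thesis using N by simp
qed

text \<open>Applied for \<open>r >= r1\<close>, where the reciprocal height and the derivatives of
  \<open>K\<close> are bounded independently of \<open>h\<close> and of the perturbation.\<close>

lemma density_bound_outside_tip:
 assumes r: "0 < r" and z: "0 < z" and N: "12 <= N" "R + 1 <= N"
  and K: "1 / K r <= N" "\<bar>K' r\<bar> <= N" "\<bar>K'' r\<bar> <= N"
 shows "density_sq r z <= N ^ 1000"
proof (cases "r <= R + 1")
 case True
 have N2: "1 <= N" "2 <= N" using N by auto
 have Kp: "0 < K r" using K_pos[of r] r by simp
 have Wz: "\<bar>Wz r z\<bar> <= N ^ 1" using K(1) Kp N by (simp add: Wz_def)
 have W: "\<bar>W r z\<bar> <= N ^ 1" using W_range[of r z] r N by simp
 have K2: "\<bar>1 / (K r)^2\<bar> <= N ^ 2" using power_mono[OF K(1), of 2] Kp by (simp add: power_divide)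
 have atoms: "\<bar>cr r\<bar> <= N ^ 1" "\<bar>cr1 r\<bar> <= N ^ 1" "\<bar>cr2 r\<bar> <= N ^ 1" "\<bar>cz z\<bar> <= N ^ 1" "\<bar>cz1 z\<bar> <= N ^ 1" "\<bar>cz2 z\<bar> <= N ^ 1"
  "\<bar>r\<bar> <= N ^ 1" "\<bar>1 / 2\<bar> <= N ^ 1"
  using cutoffs_bound(1-3)[of r] cutoffs_bound(4-6)[of z] N True r by auto
 have "\<bar>profile (W r z)\<bar> <= 3" "\<bar>profile' (W r z)\<bar> <= 2"
  using profile_bounds[of "W r z"] W_range[of r z] r by simp_all
 then have atoms2: "\<bar>profile (W r z)\<bar> <= N ^ 1" "\<bar>profile' (W r z)\<bar> <= N ^ 1" "\<bar>6\<bar> <= N ^ 1" "\<bar>12\<bar> <= N ^ 1"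
  using N by simp_all
 have atoms3: "\<bar>K' r\<bar> <= N ^ 1" "\<bar>K'' r\<bar> <= N ^ 1" "\<bar>1 / K r\<bar> <= N ^ 1" using K Kp by simp_all
 note rules0 = W Wz K2 atoms atoms2 atoms3 abs_le_power_mult[OF N2(1)] abs_le_power_power2[OF N2(1)] abs_le_power_add[OF N2(2)]
  abs_le_power_diff[OF N2(2)] abs_le_power_minus abs_le_power_divide[OF N2(1)]
 have Wr: "\<bar>Wr r z\<bar> <= N ^ 3" unfolding Wr_def by (rule abs_le_power_mono[OF N2(1)], (rule rules0)+, simp)
 note rules = Wr rules0
 have a: "\<bar>fa r z\<bar> <= N ^ 10" unfolding fa_def by (rule abs_le_power_mono[OF N2(1)], (rule rules)+, simp)
 have b: "\<bar>ar r z\<bar> <= N ^ 50" unfolding ar_def by (rule abs_le_power_mono[OF N2(1)], (rule rules)+, simp)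
 have c: "\<bar>az r z\<bar> <= N ^ 50" unfolding az_def by (rule abs_le_power_mono[OF N2(1)], (rule rules)+, simp)
 have d: "\<bar>br r z\<bar> <= N ^ 100" unfolding br_def by (rule abs_le_power_mono[OF N2(1)], (rule rules)+, simp)
 have e: "\<bar>bz r z\<bar> <= N ^ 100" unfolding bz_def by (rule abs_le_power_mono[OF N2(1)], (rule rules)+, simp)
 have "\<bar>density_sq r z\<bar> <= N ^ 1000"
  unfolding density_sq_def by (rule abs_le_power_mono[OF N2(1)], (rule a b c d e rules)+, simp)
 then show ?thesis by simp
next
 case False
 then have "cr r = 0" "cr1 r = 0" "cr2 r = 0" by (auto simp: cr_def cr1_def cr2_def smoothstep''_def)
 then have "density_sq r z = 0" by (simp add: density_sq_def fa_def ar_def az_def br_def bz_def)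
 then show ?thesis using N by simp
qed

lemma density_zero:
 assumes "0 < r" "z < 0 \<or> R + 1 < r \<or> Z + 1 < z" shows "density_sq r z = 0"
proof -
 consider "z < 0" | "R + 1 < r" | "Z + 1 < z" using assms(2) by blast
 then show ?thesis
 proof cases
  case 1
  then have "W r z = 0" "Wz r z = 0" "Wr r z = 0" using W_cases(1)[of r z] assms(1) by (auto simp: Wr_def Wz_def)
  then show ?thesis by (simp add: density_sq_def fa_def ar_def az_def br_def bz_def)
 next
  case 2
  then have "cr r = 0" "cr1 r = 0" "cr2 r = 0" by (auto simp: cr_def cr1_def cr2_def smoothstep''_def)
  then show ?thesis by (simp add: density_sq_def fa_def ar_def az_def br_def bz_def)
 next
  case 3
  then have "cz z = 0" "cz1 z = 0" "cz2 z = 0" by (auto simp: cz_def cz1_def cz2_def smoothstep''_def)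
  then show ?thesis by (simp add: density_sq_def fa_def ar_def az_def br_def bz_def)
 qed
qed

text \<open>Here the constant of the leading term matters. The vertical shear \<open>r * az\<close>
  is computed exactly and gives the lubrication density. The other entries are expressed by
  \<open>y = r * K' / K\<close> and \<open>v = r * K'' / K\<close>, bounded by 3 and by
  \<open>2 * K' / K\<close>, so they cost only multiples of \<open>1 / K\<close> and
  \<open>K' / K\<close>.\<close>

lemma density_bound_tip:
 assumes r: "0 < r" "r < R" and z: "0 < z" "z < K r"
  and K: "0 <= K' r" "r * K' r <= 3 * K r" "\<bar>r * K'' r\<bar> <= 2 * K' r"
 shows "density_sq r z <= 9 * r^2 * (K r - 2 * z)^2 / (K r) ^ 6 + 400 / (K r)^2 + 400 * (K' r / K r)^2"
proof -
 have Kp: "0 < K r" using K_pos[of r] r by simp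
 have zZ: "z < Z" using z K_less[of r] r by simp
 have c: "cr r = 1" "cr1 r = 0" "cr2 r = 0" "cz z = 1" "cz1 z = 0" "cz2 z = 0"
  using r zZ by (auto simp: cr_def cr1_def cr2_def cz_def cz1_def cz2_def smoothstep''_def)
 define w where "w = z / K r"
 define t where "t = K' r / K r"
 define y where "y = r * K' r / K r"
 define v where "v = r * K'' r / K r"
 define p where "p = profile' w"
 have w: "0 <= w" "w <= 1" using z Kp by (auto simp: w_def)
 have WW: "W r z = w" "Wz r z = 1 / K r" "Wr r z = - (w * t)"
  using W_cases(2)[of r z] z r by (auto simp: w_def Wz_def Wr_def t_def)
 have t: "0 <= t" using K Kp by (simp add: t_def)
 have y: "0 <= y" "y <= 3" using K r Kp by (auto simp: y_def divide_le_eq)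
 have v: "\<bar>v\<bar> <= 2 * t"
 proof -
  have "\<bar>v\<bar> = \<bar>r * K'' r\<bar> / K r" using Kp by (simp add: v_def abs_mult)
  also have "... <= 2 * K' r / K r" using K(3) Kp by (intro divide_right_mono) auto
  finally show ?thesis by (simp add: t_def)
 qed
 have p: "0 <= p" "p <= 2" using profile_bounds[OF w] w by (auto simp: p_def profile'_def)
 have q: "\<bar>6 - 12 * w\<bar> <= 6" using w by (auto simp: abs_le_iff)
 have A: "(r * az r z)^2 = 9 * r^2 * (K r - 2 * z)^2 / (K r) ^ 6"
 proof -
  have "r * az r z = - (3 * r * (K r - 2 * z) / (K r) ^ 3)"
   unfolding az_def c WW w_def using Kp by (simp add: field_simps power3_eq_cube)
  then show ?thesis by (simp add: power_divide power_mult_distrib flip: power_mult)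
 qed
 have B: "\<bar>fa r z\<bar> <= 1 / K r"
 proof -
  have "fa r z = - (p / 2) / K r" by (simp add: fa_def c WW p_def)
  then show ?thesis using p Kp by (simp add: field_simps)
 qed
 have C: "\<bar>r * ar r z\<bar> <= 12 / K r"
 proof -
  have "r * ar r z = (1 / 2) * (y * ((6 - 12 * w) * w + p)) / K r"
   unfolding ar_def c WW p_def[symmetric] t_def y_def using Kp by (simp add: field_simps power2_eq_square)
  moreover have "\<bar>y * ((6 - 12 * w) * w + p)\<bar> <= 3 * 8"
  proof -
   have "\<bar>(6 - 12 * w) * w\<bar> <= 6 * 1" unfolding abs_mult using q w by (intro mult_mono) auto
   then have "\<bar>(6 - 12 * w) * w + p\<bar> <= 8" using p by linarith
   then show ?thesis unfolding abs_mult[of y] using y by (intro mult_mono) auto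
  qed
  ultimately show ?thesis using Kp by (simp add: abs_mult divide_le_eq)
 qed
 \<comment> \<open>Read off from the vanishing divergence, \<open>bz = - (2 * fa + r * ar)\<close>,
   instead of from its own formula.\<close>
 have D: "\<bar>bz r z\<bar> <= 14 / K r"
 proof -
  have "14 / K r = 12 / K r + 2 * (1 / K r)" by (simp add: add_divide_distrib[symmetric])
  then show ?thesis using divergence_free[of r z] r z B C by linarith
 qed
 have E: "\<bar>br r z\<bar> <= 20 * t"
 proof -
  have "br r z = - (p * w * t) - 1 / 2 * (- (((6 - 12 * w) * w * w + p * w) * (t * y)) + p * w * (t + v) - p * w * (y * t))"
  proof -
   have q1: "A * (r * K' r) / K r = A * y" for A by (simp add: y_def)
   have q2: "A * (K' r + r * K'' r) / K r = A * (t + v)" for A by (simp add: t_def v_def flip: add_divide_distrib)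
   have q3: "A * (r * K' r) * K' r / (K r)^2 = A * (y * t)" for A by (simp add: y_def t_def power2_eq_square)
   show ?thesis unfolding br_def c WW p_def[symmetric] q1 q2 q3 by (simp add: algebra_simps)
  qed
  moreover have "\<bar>p * w * t\<bar> <= 2 * 1 * t" unfolding abs_mult using p w t by (intro mult_mono) auto
  moreover have "\<bar>((6 - 12 * w) * w * w + p * w) * (t * y)\<bar> <= (6 * 1 * 1 + 2 * 1) * (t * 3)"
  proof -
   have "\<bar>(6 - 12 * w) * w * w\<bar> <= 6 * 1 * 1" unfolding abs_mult using q w by (intro mult_mono) auto
   moreover have "\<bar>p * w\<bar> <= 2 * 1" unfolding abs_mult using p w by (intro mult_mono) auto
   ultimately have "\<bar>(6 - 12 * w) * w * w + p * w\<bar> <= 6 * 1 * 1 + 2 * 1" by linarith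
   moreover have "\<bar>t * y\<bar> <= t * 3" unfolding abs_mult using t y by (intro mult_mono) auto
   ultimately show ?thesis unfolding abs_mult[of "(6 - 12 * w) * w * w + p * w"] by (intro mult_mono) auto
  qed
  moreover have "\<bar>p * w * (t + v)\<bar> <= 2 * 1 * (3 * t)" unfolding abs_mult using p w t v by (intro mult_mono) auto
  moreover have "\<bar>p * w * (y * t)\<bar> <= 2 * 1 * (3 * t)" unfolding abs_mult using p w t y by (intro mult_mono) auto
  moreover have "\<bar>B\<bar> <= 20 * t" if "B = - a1 - 1 / 2 * (- a2 + a3 - a4)" "\<bar>a1\<bar> <= 2 * 1 * t" "\<bar>a2\<bar> <= (6 * 1 * 1 + 2 * 1) * (t * 3)"
   "\<bar>a3\<bar> <= 2 * 1 * (3 * t)" "\<bar>a4\<bar> <= 2 * 1 * (3 * t)" for B a1 a2 a3 a4 using that by argo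
  ultimately show ?thesis by blast
 qed
 have sq: "x^2 <= y^2" if "\<bar>x\<bar> <= y" for x y :: real using power_mono[OF that, of 2] by simp
 have "(fa r z)^2 <= (1 / K r)^2" by (rule sq[OF B])
 moreover have "(fa r z + r * ar r z)^2 <= (13 / K r)^2"
 proof (rule sq)
  have "13 / K r = 1 / K r + 12 / K r" by (simp add: add_divide_distrib[symmetric])
  then show "\<bar>fa r z + r * ar r z\<bar> <= 13 / K r" using B C by linarith
 qed
 moreover have "(bz r z)^2 <= (14 / K r)^2" by (rule sq[OF D])
 moreover have "(br r z)^2 <= (20 * t)^2" by (rule sq[OF E])
 ultimately have "density_sq r z <= 9 * r^2 * (K r - 2 * z)^2 / (K r) ^ 6 + ((1 / K r)^2 + (13 / K r)^2 + (14 / K r)^2) + (20 * t)^2"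
  unfolding density_sq_def A by linarith
 also have "(1 / K r)^2 + (13 / K r)^2 + (14 / K r)^2 = 366 / (K r)^2" by (simp add: power_divide add_divide_distrib[symmetric])
 also have "366 / (K r)^2 <= 400 / (K r)^2" using Kp by (intro divide_right_mono) auto
 also have "(20 * t)^2 = 400 * (K' r / K r)^2" by (simp only: t_def power_mult_distrib) simp
 finally show ?thesis by simp
qed

lemma continuous_on_K: "continuous_on {0..} K"
proof -
 obtain L where "0 <= L" "!!x y. x \<in> {0..} ==> y \<in> {0..} ==> \<bar>K x - K y\<bar> <= L * dist x y"
  using bounded_lipschitzE[OF K_lip] by metis
 then have "L-lipschitz_on {0..} K" by (intro lipschitz_onI) (auto simp: dist_real_def)
 then show ?thesis by (rule lipschitz_on_continuous_on)
qed

text \<open>Integration over \<open>0 < z < K r\<close> turns \<open>1 / K^2\<close> into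
  \<open>1 / K\<close>, and \<open>Ga / (r * K)\<close> into \<open>Ga / r\<close>; the weight
  \<open>2 * pi * r\<close> of cylindrical coordinates makes the latter a constant. Everything off
  the tip is a bounded density on a ball.\<close>

lemma energy_upper_bound:
 assumes u: "energy_field field G"
  and dens: "AE x in lborel. (norm (G x))^2 = density_sq (radius x) (x $ 3)"
  and r1R: "r1 < R" and N: "12 <= N" "R + 1 <= N"
  and tip: "!!r. 0 < r ==> r < r1 ==> 0 <= K' r \<and> r * K' r <= 3 * K r \<and> \<bar>r * K'' r\<bar> <= 2 * K' r \<and> (K' r / K r)^2 <= Ga / (r * K r)"
  and out: "!!r. r1 <= r ==> 1 / K r <= N \<and> \<bar>K' r\<bar> <= N \<and> \<bar>K'' r\<bar> <= N" and "0 <= Ga"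
 shows "(LI x. (norm (G x))^2) <= 6 * pi * integral {0..r1} (%r. r ^ 3 / (K r) ^ 3)
   + 800 * pi * integral {0..r1} (%r. r / K r) + 800 * pi * Ga * r1 + N ^ 1000 * measure lborel (cball (0::real^3) (R + Z + 2))"
proof -
 \<comment> \<open>\<open>K\<close> is controlled for nonnegative arguments only; reflection gives a
   function that is continuous, hence measurable, on the whole line.\<close>
 define Ka where "Ka r = K \<bar>r\<bar>" for r
 have [measurable]: "Ka \<in> bm"
  unfolding Ka_def[abs_def]
  by (intro borel_measurable_continuous_onI continuous_on_compose2[OF continuous_on_K]) (auto intro!: continuous_intros)
 have Kc: "continuous_on {0..r1} K" by (rule continuous_on_subset[OF continuous_on_K]) auto
 have K0: "K r ~= 0" if "0 <= r" for r using K_pos[OF that] by simp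
 define f where "f y = (if 0 < fst y \<and> fst y < r1 \<and> 0 < snd y \<and> snd y < Ka (fst y)
   then 9 * (fst y)^2 * (Ka (fst y) - 2 * snd y)^2 / (Ka (fst y)) ^ 6 + 400 / (Ka (fst y))^2 + 400 * (Ga / (fst y * Ka (fst y))) else 0)" for y
 have fm: "f \<in> bm" unfolding f_def[abs_def] borel_prod[symmetric] by measurable
 have Kap: "0 < Ka r" for r using K_pos[of "\<bar>r\<bar>"] by (simp add: Ka_def)
 have f0: "0 <= f y" for y
  using Kap[of "fst y"] \<open>0 <= Ga\<close> by (auto simp: f_def intro!: add_nonneg_nonneg divide_nonneg_nonneg mult_nonneg_nonneg less_imp_le)
 define Zr where "Zr r = 3 * r^2 / (K r) ^ 3 + 400 / K r + 400 * Ga / r" for r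
 have Zr0: "0 <= Zr r" if "0 < r" "r < r1" for r
  using K_pos[of r] that \<open>0 <= Ga\<close> by (auto simp: Zr_def intro!: add_nonneg_nonneg divide_nonneg_nonneg)
 have fz: "(\<integral>\<^sup>+z. ennreal (f (r, z)) \<partial>lborel) = ennreal (Zr r)" if r: "0 < r" "r < r1" for r
 proof -
  define k where "k = K r"
  define c where "c = 400 / k^2 + 400 * (Ga / (r * k))"
  have k: "0 < k" using K_pos[of r] r by (simp add: k_def)
  have ka: "Ka r = k" using r by (simp add: Ka_def k_def)
  have c0: "0 <= c" using k r \<open>0 <= Ga\<close> by (auto simp: c_def intro!: add_nonneg_nonneg divide_nonneg_nonneg mult_nonneg_nonneg)
  have "(\<integral>\<^sup>+z. ennreal (f (r, z)) \<partial>lborel) = (\<integral>\<^sup>+z. ennreal (9 * r^2 * (k - 2 * z)^2 / k ^ 6 + c) * indicator {0..k} z \<partial>lborel)"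
   using AE_lborel_singleton[of 0] AE_lborel_singleton[of k]
   by (intro nn_integral_cong_AE, eventually_elim) (auto simp: f_def r ka c_def indicator_def add.assoc)
  also have "... = ennreal ((- (3 / 2) * (r^2 / k ^ 6) * (k - 2 * k) ^ 3 + c * k) - (- (3 / 2) * (r^2 / k ^ 6) * (k - 2 * 0) ^ 3 + c * 0))"
  proof (rule nn_integral_FTC_Icc)
   show "((%z. - (3 / 2) * (r^2 / k ^ 6) * (k - 2 * z) ^ 3 + c * z) has_real_derivative 9 * r^2 * (k - 2 * z)^2 / k ^ 6 + c) (at z)" for z
   proof -
    define A where "A = r^2 / k ^ 6"
    have "((%z. - (3 / 2) * A * (k - 2 * z) ^ 3 + c * z) has_real_derivative 9 * A * (k - 2 * z)^2 + c) (at z)"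
     by (auto intro!: derivative_eq_intros)
    then show ?thesis by (simp add: A_def)
   qed
  qed (use k c0 in \<open>auto intro!: add_nonneg_nonneg divide_nonneg_nonneg mult_nonneg_nonneg\<close>)
  also have "(- (3 / 2) * (r^2 / k ^ 6) * (k - 2 * k) ^ 3 + c * k) - (- (3 / 2) * (r^2 / k ^ 6) * (k - 2 * 0) ^ 3 + c * 0) = Zr r"
  proof -
   have k6: "k ^ 6 = k ^ 3 * k ^ 3" by (simp flip: power_add)
   define q where "q = r^2 / k ^ 6"
   have "q * k ^ 3 = r^2 / k ^ 3" unfolding q_def k6 using k by (simp add: divide_simps)
   moreover have "c * k = 400 / k + 400 * Ga / r" using k r by (simp add: c_def field_simps power2_eq_square)
   moreover have "(k - 2 * k) ^ 3 = - (k ^ 3)" by (simp add: power3_eq_cube)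
   ultimately show ?thesis unfolding q_def[symmetric] by (simp add: Zr_def k_def[symmetric])
  qed
  finally show ?thesis .
 qed
 have fs: "f (r, z) = 0" if "r1 < r" for r z using that by (simp add: f_def)
 define I where "I = 6 * pi * integral {0..r1} (%r. r ^ 3 / (K r) ^ 3) + 800 * pi * integral {0..r1} (%r. r / K r) + 800 * pi * Ga * r1"
 have "((%r. 6 * pi * (r ^ 3 / (K r) ^ 3) + 800 * pi * (r / K r) + 800 * pi * Ga) has_integral
   6 * pi * integral {0..r1} (%r. r ^ 3 / (K r) ^ 3) + 800 * pi * integral {0..r1} (%r. r / K r) + 800 * pi * Ga * (r1 - 0)) {0..r1}"
  using r1 K0 has_integral_const_real[of "800 * pi * Ga" 0 r1]
  by (intro has_integral_add has_integral_mult_right integrable_integral integrable_continuous_interval continuous_intros Kc)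
   (auto simp: mult.commute)
 then have FI0: "((%r. 6 * pi * (r ^ 3 / (K r) ^ 3) + 800 * pi * (r / K r) + 800 * pi * Ga) has_integral I) {0..r1}"
  by (simp add: I_def)
 have FI: "((%r. 2 * pi * r * Zr r) has_integral I) {0..r1}"
 proof (rule has_integral_spike[OF negligible_sing[of 0] _ FI0])
  show "2 * pi * r * Zr r = 6 * pi * (r ^ 3 / (K r) ^ 3) + 800 * pi * (r / K r) + 800 * pi * Ga" if "r \<in> {0..r1} - {0}" for r
   using that by (simp add: Zr_def distrib_left power2_eq_square power3_eq_cube)
 qed
 have ff: "integrable lborel (%x. f (radius x, x $ 3))" "(LI x. f (radius x, x $ 3)) = I"
  by (rule has_integral_cylindrical(1)[where Z=Zr and rh=r1 and I=I],
    rule fm, rule f0, erule (1) fz, erule (1) Zr0, erule fs, rule FI,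
    rule has_integral_cylindrical(2)[where Z=Zr and rh=r1 and I=I],
    rule fm, rule f0, erule (1) fz, erule (1) Zr0, erule fs, rule FI)
 have nK: "AE x in lborel. x $ 3 ~= K (radius x)" using AE_height_neq[of Ka] by (simp add: Ka_def)
 have n0: "AE x::real^3 in lborel. x $ 3 ~= 0" using AE_height_neq[of "%_. 0"] by simp
 have "(LI x. (norm (G x))^2) <= (LI x. f (radius x, x $ 3) + N ^ 1000 * indicator (cball 0 (R + Z + 2)) x)"
 proof (rule integral_mono_AE)
  show "integrable lborel (%x. (norm (G x))^2)" by (rule energy_fieldD(6)[OF u])
  show "integrable lborel (%x. f (radius x, x $ 3) + N ^ 1000 * indicator (cball 0 (R + Z + 2)) x)"
   using ff(1) by (intro Bochner_Integration.integrable_add integrable_mult_right integrable_indicator_cball)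
  show "AE x in lborel. (norm (G x))^2 <= f (radius x, x $ 3) + N ^ 1000 * indicator (cball 0 (R + Z + 2)) x"
   using dens nK n0 AE_radius_neq[of 0]
  proof eventually_elim
   case (elim x)
   define r where "r = radius x"
   define z where "z = x $ 3"
   have r: "0 < r" using elim(4) radius_nonneg[of x] unfolding r_def by linarith
   have NN: "0 <= N ^ 1000 * indicator (cball 0 (R + Z + 2)) x" using N by simp
   have "density_sq r z <= f (r, z) + N ^ 1000 * indicator (cball 0 (R + Z + 2)) x"
   proof (cases "z < 0 \<or> R + 1 < r \<or> Z + 1 < z")
    case True
    then have "density_sq r z = 0" using density_zero r by blast
    then show ?thesis using f0[of "(r, z)"] NN by linarith
   next
    case False
    then have zp: "0 < z" and rb: "r <= R + 1" "z <= Z + 1" using elim(3) by (auto simp: z_def)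
    have "norm x <= R + Z + 2" using norm_le_radius[of x] zp rb by (simp add: r_def z_def)
    then have ind: "indicator (cball 0 (R + Z + 2)) x = (1::real)" by simp
    consider "r < r1" "z < K r" | "K r < z" | "r1 <= r" using elim(2) unfolding r_def z_def by linarith
    then show ?thesis
    proof cases
     case 1
     have "density_sq r z <= 9 * r^2 * (K r - 2 * z)^2 / (K r) ^ 6 + 400 / (K r)^2 + 400 * (K' r / K r)^2"
      using tip[OF r 1(1)] 1 r zp r1R by (intro density_bound_tip) auto
     also have "... <= f (r, z)"
      using tip[OF r 1(1)] 1 r zp by (simp add: f_def Ka_def)
     finally show ?thesis using NN by linarith
    next
     case 2
     then show ?thesis using density_bound_above_gap[OF r zp 2 N] f0[of "(r, z)"] ind by simp
    next
     case 3
     then show ?thesis using density_bound_outside_tip[OF r zp N] out[OF 3] f0[of "(r, z)"] ind by simp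
    qed
   qed
   then show ?case using elim(1) by (simp add: r_def z_def)
  qed
 qed
 also have "... = (LI x. f (radius x, x $ 3)) + (LI x. N ^ 1000 * indicator (cball (0::real^3) (R + Z + 2)) x)"
  by (rule Bochner_Integration.integral_add[OF ff(1) integrable_mult_right[OF integrable_indicator_cball]])
 also have "... = I + N ^ 1000 * measure lborel (cball (0::real^3) (R + Z + 2))" by (simp add: ff(2))
 finally show ?thesis by (simp add: I_def)
qed

end

section \<open>The profile of the tip\<close>

text \<open>The finite exceptional set is for \<open>r1\<close> and \<open>2 * r1\<close>, where the
  slope of the bent profile has corners.\<close>

lemma derivative_bound_imp_lipschitz:
 fixes f :: "real => real"
 assumes "finite T" and "continuous_on {a..b} f"
  and "!!r. a < r ==> r < b ==> r \<notin> T ==> (f has_real_derivative f' r) (at r)"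
  and "!!r. a < r ==> r < b ==> r \<notin> T ==> \<bar>f' r\<bar> <= L" and L: "0 <= L"
  and xy: "x \<in> {a..b}" "y \<in> {a..b}"
 shows "\<bar>f x - f y\<bar> <= L * \<bar>x - y\<bar>"
proof -
 have *: "\<bar>f x - f y\<bar> <= L * \<bar>x - y\<bar>" if "x <= y" "a <= x" "y <= b" for x y
 proof -
  have "(f' has_integral f y - f x) {x..y}"
   using that assms(1-3)
   by (intro fundamental_theorem_of_calculus_interior_strong[of T])
    (auto intro: continuous_on_subset simp: has_real_derivative_iff_has_vector_derivative[symmetric])
  then have i: "(f' has_integral f y - f x) (cbox x y)" by simp
  have "norm (f' r) <= L" if "r \<in> cbox x y - (T \<union> {x, y})" for r
   using assms(4)[of r] that \<open>a <= x\<close> \<open>y <= b\<close> by auto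
  then have "norm (f y - f x) <= L * Henstock_Kurzweil_Integration.content (cbox x y)"
   using has_integral_bound_spike_finite[OF L _ i, of "T \<union> {x, y}"] assms(1) by blast
  then show ?thesis using that by (simp add: abs_minus_commute)
 qed
 show ?thesis
  using *[of x y] *[of y x] xy by (cases "x <= y") (auto simp: abs_minus_commute)
qed

text \<open>The comparison is asked for in the open interval only: the majorant may blow up at an
  end as long as its antiderivative stays continuous.\<close>

lemma integral_le_antiderivative:
 fixes f :: "real => real"
 assumes "a <= b" "f integrable_on {a..b}" "continuous_on {a..b} Ph"
  and "!!r. a < r ==> r < b ==> (Ph has_real_derivative pf r) (at r)"
  and "!!r. a < r ==> r < b ==> f r <= pf r"
 shows "integral {a..b} f <= Ph b - Ph a"
proof -
 have I: "(pf has_integral Ph b - Ph a) {a..b}"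
  using assms(1,3,4)
  by (intro fundamental_theorem_of_calculus_interior) (auto simp: has_real_derivative_iff_has_vector_derivative[symmetric])
 have "((%r. if r = a \<or> r = b then f r else pf r) has_integral Ph b - Ph a) {a..b}"
  by (rule has_integral_spike_finite[OF _ _ I, of "{a, b}"]) auto
 then show ?thesis
  using assms(5) by (intro has_integral_le[OF integrable_integral[OF assms(2)]]) force+
qed

definition gamma1 :: "real => real => real => real" where
 "gamma1 al ep r = r / sqrt (1 - r^2) + ep * ((1 + al) * r powr al)"

definition gamma2 :: "real => real => real => real" where
 "gamma2 al ep r = 1 / sqrt (1 - r^2) ^ 3 + ep * ((1 + al) * (al * r powr (al - 1)))"

text \<open>With \<open>q = sqrt (1 - r^2)\<close> everything follows from
  \<open>r^2 = (1 - q) * (1 + q)\<close> and the identity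
  \<open>1 - q = r^2 / 2 + (1 - q)^2 / 2\<close>.\<close>

lemma sphere_bounds:
 assumes "0 <= r" "r <= (1::real)"
 shows "r^2 / 2 <= 1 - sqrt (1 - r^2)" "1 - sqrt (1 - r^2) <= r^2" "1 - sqrt (1 - r^2) <= r^2 / 2 + r ^ 4 / 2"
proof -
 define q where "q = sqrt (1 - r^2)"
 have r1: "r^2 <= 1" using assms by (simp add: power_le_one)
 have q: "0 <= q" "q <= 1" "r^2 = 1 - q^2" using r1 by (auto simp: q_def)
 have f: "r^2 = (1 - q) * (1 + q)" using q(3) by (simp add: power2_eq_square algebra_simps)
 have "(1 - q) * (1 + q) <= (1 - q) * 2" using q by (intro mult_left_mono) auto
 then show "r^2 / 2 <= 1 - sqrt (1 - r^2)" unfolding q_def[symmetric] unfolding f by simp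
 have "(1 - q) * 1 <= (1 - q) * (1 + q)" using q by (intro mult_left_mono) auto
 then show le: "1 - sqrt (1 - r^2) <= r^2" unfolding q_def[symmetric] unfolding f by simp
 have "(1 - q)^2 <= (r^2)^2" unfolding q_def[symmetric] using le[folded q_def] q(1,2) by (intro power_mono) auto
 also have "(r^2)^2 = r ^ 4" by (simp add: power2_eq_square power4_eq_xxxx)
 finally have "(1 - q)^2 <= r ^ 4" .
 moreover have "1 - q = r^2 / 2 + (1 - q)^2 / 2"
 proof -
  have "1 - q = (1 - q^2) / 2 + (1 - q)^2 / 2" by (simp add: power2_eq_square field_simps)
  then show ?thesis by (simp only: q(3))
 qed
 ultimately show "1 - sqrt (1 - r^2) <= r^2 / 2 + r ^ 4 / 2" unfolding q_def[symmetric] by linarith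
qed

lemma sqrt_one_minus_ge: assumes "0 <= r" "r <= (1/2::real)" shows "4 / 5 <= sqrt (1 - r^2)"
proof (rule real_le_rsqrt)
 have "r^2 <= (1/2)^2" using assms by (intro power_mono) auto
 then show "(4 / 5)^2 <= 1 - r^2" by (simp add: power2_eq_square)
qed

text \<open>\<open>al\<close> and \<open>ep\<close> are the \<open>\<alpha>\<close> and \<open>\<epsilon>\<close> of the theorem.\<close>

locale tip_profile =
 fixes al ep :: real
 assumes al: "0 <= al" "al < 1" and ep: "0 < ep"
begin

lemma gamma_ge:
 assumes "0 <= r" "r <= 1"
 shows "r^2 / 2 + ep * r powr (1 + al) <= gamma_S al ep r" "r^2 / 2 <= gamma_S al ep r" "0 <= gamma_S al ep r"
proof -
 show "r^2 / 2 + ep * r powr (1 + al) <= gamma_S al ep r" using sphere_bounds(1)[OF assms] by (simp add: gamma_S_def)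
 moreover have "0 <= ep * r powr (1 + al)" using ep by simp
 ultimately show "r^2 / 2 <= gamma_S al ep r" by linarith
 then show "0 <= gamma_S al ep r" using zero_le_power2[of r] by linarith
qed

lemma powr_le_1: "0 <= (r::real) ==> r <= 1 ==> 0 <= s ==> r powr s <= 1"
 using powr_mono2[of s r 1] by simp

lemma gamma_le: assumes "0 <= r" "r <= 1" shows "gamma_S al ep r <= 1 + ep"
proof -
 have "ep * r powr (1 + al) <= ep * 1" using ep al powr_le_1[OF assms, of "1 + al"] by (intro mult_left_mono) auto
 moreover have "1 - sqrt (1 - r^2) <= 1" using assms by (simp add: power_le_one)
 ultimately show ?thesis unfolding gamma_S_def by linarith
qed

lemma gamma_derivatives:
 assumes "0 < r" "r < 1"
 shows "(gamma_S al ep has_real_derivative gamma1 al ep r) (at r)"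
  "(gamma1 al ep has_real_derivative gamma2 al ep r) (at r)"
proof -
 have "r^2 < 1" using assms by (simp add: power_less_one_iff abs_square_less_1)
 then have p: "0 < 1 - r^2" by simp
 then have q: "0 < sqrt (1 - r^2)" "sqrt (1 - r^2) * sqrt (1 - r^2) = 1 - r^2" by simp_all
 have d: "((%r. sqrt (1 - r^2)) has_real_derivative - (r / sqrt (1 - r^2))) (at r)"
  using p q by (auto intro!: derivative_eq_intros simp: field_simps)
 have pw: "((%r. r powr s) has_real_derivative s * r powr (s - 1)) (at r)" for s
  using assms by (auto intro!: derivative_eq_intros)
 have "((%r. 1 - sqrt (1 - r^2) + ep * r powr (1 + al)) has_real_derivative 0 - - (r / sqrt (1 - r^2)) + ep * ((1 + al) * r powr (1 + al - 1))) (at r)"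
  by (intro DERIV_add DERIV_diff DERIV_cmult pw d DERIV_const)
 then show "(gamma_S al ep has_real_derivative gamma1 al ep r) (at r)"
  by (simp add: gamma_S_def[abs_def] gamma1_def)
 have "((%r. r / sqrt (1 - r^2)) has_real_derivative (1 * sqrt (1 - r^2) - r * - (r / sqrt (1 - r^2))) / (sqrt (1 - r^2) * sqrt (1 - r^2))) (at r)"
  using q by (intro DERIV_divide d DERIV_ident) auto
 moreover have "(1 * s - r * - (r / s)) / (s * s) = 1 / s ^ 3" if "s * s = 1 - r^2" "0 < s" for s :: real
 proof -
  have "1 * s - r * - (r / s) = (s * s + r^2) / s" using that by (simp add: field_simps power2_eq_square)
  also have "... = 1 / s" using that by simp
  finally show ?thesis by (simp add: power3_eq_cube)
 qed
 ultimately have "((%r. r / sqrt (1 - r^2)) has_real_derivative 1 / sqrt (1 - r^2) ^ 3) (at r)" using q by metis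
 then show "(gamma1 al ep has_real_derivative gamma2 al ep r) (at r)"
  unfolding gamma1_def[abs_def] gamma2_def by (intro DERIV_add DERIV_cmult pw)
qed

lemma continuous_on_gamma: "continuous_on {0..1} (gamma_S al ep)"
 unfolding gamma_S_def[abs_def] using al by (intro continuous_intros continuous_on_powr') auto

lemma gamma_borel [measurable]:
 "gamma_S al ep \<in> bm" "gamma1 al ep \<in> bm"
  unfolding gamma_S_def[abs_def] gamma1_def[abs_def] by measurable

lemma gamma_quotient_integrable:
 assumes "0 < h" "0 <= a" "b <= 1"
 shows "(%r. r ^ m / (h + gamma_S al ep r) ^ n) integrable_on {a..b}"
proof (rule integrable_continuous_interval, intro continuous_intros)
 show "continuous_on {a..b} (gamma_S al ep)" using assms by (intro continuous_on_subset[OF continuous_on_gamma]) auto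
 have "0 < h + gamma_S al ep r" if "r \<in> {a..b}" for r using gamma_ge(3)[of r] that assms by auto
 then show "\<forall>r\<in>{a..b}. (h + gamma_S al ep r) ^ n ~= 0" by force
qed

text \<open>Each of the two parts of the profile behaves like a power of \<open>r\<close> with
  exponent at most 2, for which such homogeneous bounds hold whatever its coefficient. The constants
  3 and 2 leave room for the factor \<open>5 / 4\<close> of the square root on
  \<open>r <= 1 / 2\<close>. Only the last bound depends on \<open>ep\<close>.\<close>

lemma gamma_tip_bounds:
 assumes r: "0 < r" "r <= 1 / 2"
 shows "0 <= gamma1 al ep r" "r * gamma1 al ep r <= 3 * gamma_S al ep r" "\<bar>r * gamma2 al ep r\<bar> <= 2 * gamma1 al ep r"
  "gamma1 al ep r <= 1 + 2 * ep"
proof -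
 define q where "q = sqrt (1 - r^2)"
 define e where "e = ep * r powr al"
 have q: "4 / 5 <= q" using sqrt_one_minus_ge[of r] r by (simp add: q_def)
 have e: "0 <= e" using ep by (simp add: e_def)
 have e1: "e <= ep" using mult_left_mono[OF powr_le_1[of r al], of ep] r al ep by (simp add: e_def)
 have rq: "r / q <= 5 / 4 * r" using mult_left_mono[of "4/5" q r] q r by (simp add: divide_le_eq)
 have g1: "gamma1 al ep r = r / q + (1 + al) * e" by (simp add: gamma1_def q_def e_def)
 have g2: "r * gamma2 al ep r = r / q ^ 3 + (1 + al) * al * e"
 proof -
  have "r * r powr (al - 1) = r powr al" using r by (simp add: powr_diff)
  then have "r * (ep * ((1 + al) * (al * r powr (al - 1)))) = (1 + al) * al * e"
   unfolding e_def by (metis mult.assoc mult.left_commute)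
  then show ?thesis by (simp add: gamma2_def q_def distrib_left)
 qed
 have g: "r^2 / 2 + r * e <= gamma_S al ep r"
  using gamma_ge(1)[of r] r by (simp add: e_def powr_add mult_ac)
 have ae: "(1 + al) * e <= 2 * e" using al e by (intro mult_right_mono) auto
 have rq0: "0 <= r / q" using r q by simp
 show "0 <= gamma1 al ep r" unfolding g1 using rq0 al e by simp
 show "gamma1 al ep r <= 1 + 2 * ep" unfolding g1 using rq r ae e1 by linarith
 have "r * gamma1 al ep r <= r * (5 / 4 * r + 2 * e)" unfolding g1 using rq ae r by (intro mult_left_mono) linarith+
 also have "... <= 3 * (r^2 / 2 + r * e)" using r e by (simp add: algebra_simps power2_eq_square)
 also have "... <= 3 * gamma_S al ep r" using g by (intro mult_left_mono) auto
 finally show "r * gamma1 al ep r <= 3 * gamma_S al ep r" .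
 have "(4/5)^2 <= q^2" using q by (intro power_mono) auto
 then have "1 / q^2 <= 1 / (16/25)" by (intro frac_le) (auto simp: power2_eq_square)
 then have q2: "1 / q^2 <= 2" by simp
 have "r / q ^ 3 = r / q * (1 / q^2)" by (simp add: power2_eq_square power3_eq_cube)
 also have "... <= r / q * 2" using q2 rq0 by (rule mult_left_mono)
 finally have "r / q ^ 3 <= 2 * (r / q)" by (simp add: mult.commute)
 moreover have "0 <= r / q ^ 3" using r q by simp
 moreover have "(1 + al) * al * e <= (1 + al) * 2 * e" "0 <= (1 + al) * al * e" using al e by (intro mult_right_mono mult_left_mono, auto)
 ultimately have "r / q ^ 3 + (1 + al) * al * e <= 2 * (r / q) + (1 + al) * 2 * e" "0 <= r / q ^ 3 + (1 + al) * al * e" by linarith+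
 moreover have "2 * (r / q) + (1 + al) * 2 * e = 2 * (r / q + (1 + al) * e)" by (simp add: distrib_left)
 ultimately show "\<bar>r * gamma2 al ep r\<bar> <= 2 * gamma1 al ep r" unfolding g1 g2 by linarith
qed

end

text \<open>The floor \<open>K\<close> of the test field's solid region follows the tip up to
  \<open>r1\<close> and is bent, between \<open>r1\<close> and \<open>2 * r1\<close>, to the
  constant height \<open>h + kp\<close>. Since \<open>kp <= r1^2 / 2\<close> lies below the tip from
  \<open>r1\<close> on, the bend never rises above the tip. The bound \<open>epm\<close> on
  \<open>ep\<close> keeps all constants uniform.\<close>

locale bottom_profile = tip_profile +
 fixes epm h r1 kp :: real
 assumes epm: "ep <= epm" and h: "0 < h" "h <= 1" and r1: "0 < r1" "r1 <= 1 / 4" and kp: "0 < kp" "kp <= r1^2 / 2"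
begin

definition "eta r = 1 - smoothstep ((r - r1) / r1)"
definition "eta1 r = - (smoothstep' ((r - r1) / r1) / r1)"
definition "eta2 r = - (smoothstep'' ((r - r1) / r1) / r1^2)"
definition "g r = gamma_S al ep r - kp"
definition "K r = h + kp + eta r * g r"
definition "K1 r = eta r * gamma1 al ep r + eta1 r * g r"
definition "K2 r = eta r * gamma2 al ep r + 2 * (eta1 r * gamma1 al ep r) + eta2 r * g r"

lemma eta_inner: assumes "r <= r1" shows "eta r = 1" "eta1 r = 0"
proof -
 have "(r - r1) / r1 <= 0" using assms r1 by (simp add: divide_le_eq)
 then show "eta r = 1" "eta1 r = 0" by (simp_all add: eta_def eta1_def)
qed

lemma eta2_inner: assumes "r < r1" shows "eta2 r = 0"
proof -
 have "(r - r1) / r1 < 0" using assms r1 by (simp add: divide_less_eq)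
 then show "eta2 r = 0" by (simp add: eta2_def smoothstep''_def)
qed

lemma eta_outer: assumes "2 * r1 <= r" shows "eta r = 0" "eta1 r = 0"
proof -
 have "1 <= (r - r1) / r1" using assms r1 by (simp add: le_divide_eq)
 then show "eta r = 0" "eta1 r = 0" by (simp_all add: eta_def eta1_def)
qed

lemma eta2_outer: assumes "2 * r1 < r" shows "eta2 r = 0"
proof -
 have "1 < (r - r1) / r1" using assms r1 by (simp add: less_divide_eq)
 then show "eta2 r = 0" by (simp add: eta2_def smoothstep''_def)
qed

lemma eta_range: "0 <= eta r" "eta r <= 1" "\<bar>eta1 r\<bar> <= 2 / r1" "\<bar>eta2 r\<bar> <= 6 / r1^2"
 using smoothstep_range[of "(r - r1) / r1"] smoothstep'_range[of "(r - r1) / r1"] smoothstep''_bound[of "(r - r1) / r1"] r1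
 by (auto simp: eta_def eta1_def eta2_def intro!: divide_right_mono)

lemma K_inner: assumes "r <= r1" shows "K r = h + gamma_S al ep r" "K1 r = gamma1 al ep r"
 using eta_inner[OF assms] by (simp_all add: K_def K1_def g_def)

lemma K2_inner: "r < r1 ==> K2 r = gamma2 al ep r"
 using eta_inner[of r] eta2_inner[of r] by (simp add: K2_def)

lemma K_outer: assumes "2 * r1 <= r" shows "K r = h + kp" "K1 r = 0"
 using eta_outer[OF assms] by (simp_all add: K_def K1_def)

lemma K2_outer: "2 * r1 < r ==> K2 r = 0"
 using eta_outer[of r] eta2_outer[of r] by (simp add: K2_def)

lemma kp_le_1: "kp <= 1"
 using kp r1 power_le_one[of r1 2] by simp

lemma g_bounds:
 assumes "0 <= r" "r <= 1" shows "- kp <= g r" "\<bar>g r\<bar> <= 1 + epm"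
 using gamma_ge(3)[OF assms] gamma_le[OF assms] kp kp_le_1 ep epm by (auto simp: g_def abs_le_iff)

lemma g_nonneg: assumes "r1 <= r" "r <= 1" shows "0 <= g r"
proof -
 have "r1^2 <= r^2" using assms r1 by (intro power_mono) auto
 moreover have "r^2 / 2 <= gamma_S al ep r" using gamma_ge(2)[of r] assms r1 by simp
 ultimately show ?thesis using kp unfolding g_def by linarith
qed

lemma K_ge: assumes "0 <= r" shows "h <= K r"
proof (cases "r <= 2 * r1")
 case True
 have "eta r * - kp <= eta r * g r" using g_bounds[of r] eta_range[of r] True assms r1 by (intro mult_left_mono) auto
 moreover have "eta r * kp <= 1 * kp" using eta_range[of r] kp by (intro mult_right_mono) auto
 ultimately show ?thesis by (simp add: K_def)
next
 case False
 then show ?thesis using K_outer[of r] kp by simp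
qed

lemma K_ge_kp: assumes "r1 <= r" shows "kp <= K r"
proof (cases "r <= 2 * r1")
 case True
 then have "0 <= eta r * g r" using g_nonneg[of r] eta_range[of r] assms r1 by simp
 then show ?thesis using h by (simp add: K_def)
next
 case False
 then show ?thesis using K_outer[of r] h by simp
qed

lemma K_le: assumes "0 <= r" shows "K r <= 3 + epm"
proof (cases "r <= 2 * r1")
 case True
 have "\<bar>eta r * g r\<bar> <= 1 * (1 + epm)" unfolding abs_mult using g_bounds[of r] eta_range[of r] True assms r1 by (intro mult_mono) auto
 then show ?thesis using h kp_le_1 by (simp add: K_def)
next
 case False
 then show ?thesis using K_outer[of r] h kp_le_1 ep epm by simp
qed

text \<open>Bounds for the first two derivatives of \<open>K\<close> in terms of \<open>epm\<close>
  and \<open>r1\<close> alone, hence the same for all \<open>ep\<close> and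
  \<open>h\<close>.\<close>

definition "B1 = 1 + 2 * epm + 2 / r1 * (1 + epm)"
definition "B2 = 2 * (1 + 2 * epm) / r1 + 2 * (2 / r1 * (1 + 2 * epm)) + 6 / r1^2 * (1 + epm)"

lemma B_nonneg: "0 <= B1" "0 <= B2"
 using r1 ep epm by (auto simp: B1_def B2_def)

lemma gamma_far_bounds:
 assumes "0 < r" "r <= 2 * r1"
 shows "0 <= gamma1 al ep r" "\<bar>gamma1 al ep r\<bar> <= 1 + 2 * epm" "\<bar>g r\<bar> <= 1 + epm" "\<bar>r * gamma2 al ep r\<bar> <= 2 * (1 + 2 * epm)"
 using gamma_tip_bounds[of r] g_bounds[of r] assms r1 epm ep by auto

lemma K1_bound: assumes "0 < r" shows "\<bar>K1 r\<bar> <= B1"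
proof (cases "r <= 2 * r1")
 case True
 have "\<bar>eta r * gamma1 al ep r\<bar> <= 1 * (1 + 2 * epm)" unfolding abs_mult
  using gamma_far_bounds[of r] eta_range[of r] True assms by (intro mult_mono) auto
 moreover have "\<bar>eta1 r * g r\<bar> <= 2 / r1 * (1 + epm)" unfolding abs_mult
  using gamma_far_bounds[of r] eta_range[of r] True assms r1 by (intro mult_mono) auto
 ultimately show ?thesis unfolding K1_def B1_def mult_1_left by linarith
next
 case False
 then show ?thesis using K_outer[of r] B_nonneg by simp
qed

lemma K2_bound: assumes "r1 <= r" shows "\<bar>K2 r\<bar> <= B2"
proof (cases "r <= 2 * r1")
 case True
 have r: "0 < r" using assms r1 by simp
 have "r1 * \<bar>gamma2 al ep r\<bar> <= r * \<bar>gamma2 al ep r\<bar>" using assms by (intro mult_right_mono) auto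
 also have "... <= 2 * (1 + 2 * epm)" using gamma_far_bounds(4)[OF r True] r by (simp add: abs_mult)
 finally have g2: "\<bar>gamma2 al ep r\<bar> <= 2 * (1 + 2 * epm) / r1" using r1 by (simp add: le_divide_eq mult.commute)
 have "\<bar>eta r * gamma2 al ep r\<bar> <= 1 * (2 * (1 + 2 * epm) / r1)" unfolding abs_mult
  using g2 eta_range[of r] by (intro mult_mono) auto
 moreover have "\<bar>eta1 r * gamma1 al ep r\<bar> <= 2 / r1 * (1 + 2 * epm)" unfolding abs_mult
  using gamma_far_bounds[OF r True] eta_range[of r] r1 by (intro mult_mono) auto
 moreover have "\<bar>eta2 r * g r\<bar> <= 6 / r1^2 * (1 + epm)" unfolding abs_mult
  using gamma_far_bounds[OF r True] eta_range[of r] r1 by (intro mult_mono) auto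
 ultimately show ?thesis unfolding K2_def B2_def mult_1_left by linarith
next
 case False
 then show ?thesis using K2_outer[of r] B_nonneg by simp
qed

lemma eta_derivatives:
 "(eta has_real_derivative eta1 r) (at r)"
 "r ~= r1 ==> r ~= 2 * r1 ==> (eta1 has_real_derivative eta2 r) (at r)"
proof -
 have d: "((%r. (r - r1) / r1) has_real_derivative 1 / r1) (at r)"
  using r1 by (auto intro!: derivative_eq_intros)
 from DERIV_diff[OF DERIV_const DERIV_chain2[OF has_real_derivative_smoothstep d]]
 show "(eta has_real_derivative eta1 r) (at r)" by (simp add: eta_def[abs_def] eta1_def)
 assume "r ~= r1" "r ~= 2 * r1"
 then have "(r - r1) / r1 ~= 0" "(r - r1) / r1 ~= 1" using r1 by (auto simp: divide_eq_eq)
 from DERIV_minus[OF DERIV_cdivide[OF DERIV_chain2[OF has_real_derivative_smoothstep'[OF this] d], of r1]]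
 show "(eta1 has_real_derivative eta2 r) (at r)" by (simp add: eta1_def[abs_def] eta2_def power2_eq_square)
qed

lemma K_derivatives:
 assumes r: "0 < r"
 shows "(K has_real_derivative K1 r) (at r)"
  "r ~= r1 ==> r ~= 2 * r1 ==> (K1 has_real_derivative K2 r) (at r)"
proof -
 have gd: "(g has_real_derivative gamma1 al ep r) (at r)" if "r < 1"
  using DERIV_diff[OF gamma_derivatives(1)[OF r that] DERIV_const, of kp] by (simp add: g_def[abs_def])
 show "(K has_real_derivative K1 r) (at r)"
 proof (cases "r < 1")
  case True
  have "((%r. h + kp + eta r * g r) has_real_derivative 0 + (eta1 r * g r + gamma1 al ep r * eta r)) (at r)"
   by (intro DERIV_add DERIV_const DERIV_mult eta_derivatives gd True)
  then show ?thesis by (simp add: K_def[abs_def] K1_def add.commute mult.commute)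
 next
  case False
  have "((%r. h + kp) has_real_derivative K1 r) (at r)" using False r1 K_outer[of r] by simp
  then show ?thesis
   by (rule has_field_derivative_transform_within_open[of _ _ _ "{1/2<..}"]) (use False r1 K_outer in auto)
 qed
 assume ne: "r ~= r1" "r ~= 2 * r1"
 show "(K1 has_real_derivative K2 r) (at r)"
 proof (cases "r < 1")
  case True
  have "((%r. eta r * gamma1 al ep r + eta1 r * g r) has_real_derivative
    (eta1 r * gamma1 al ep r + gamma2 al ep r * eta r) + (eta2 r * g r + gamma1 al ep r * eta1 r)) (at r)"
   by (intro DERIV_add DERIV_mult eta_derivatives gd True gamma_derivatives r ne)
  then show ?thesis by (simp add: K1_def[abs_def] K2_def algebra_simps)
 next
  case False
  have "((%r. 0) has_real_derivative K2 r) (at r)" using False r1 K2_outer[of r] by simp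
  then show ?thesis
   by (rule has_field_derivative_transform_within_open[of _ _ _ "{1/2<..}"]) (use False r1 K_outer in auto)
 qed
qed

lemma continuous_on_smoothstep_cut: "continuous_on S eta" "continuous_on S eta1"
proof -
 show "continuous_on S eta"
  by (rule DERIV_continuous_on[of _ _ eta1]) (rule has_field_derivative_at_within[OF eta_derivatives(1)])
 have "continuous_on S (%r. - (smoothstep' ((r - r1) / r1) / r1))"
  using r1 by (intro continuous_intros) auto
 then show "continuous_on S eta1" by (simp add: eta1_def[abs_def])
qed

lemma continuous_on_outer_const:
 fixes f :: "real => real"
 assumes "continuous_on {0..1/2} f" "!!r. 1 / 2 <= r ==> f r = c" shows "continuous_on {0..} f"
proof -
 have "continuous_on ({0..1/2} \<union> {1/2..}) f"
  using assms(1) by (intro continuous_on_closed_Un) (auto intro: continuous_on_cong[THEN iffD1, OF refl _ continuous_on_const] simp: assms(2))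
 moreover have "{0..1/2} \<union> {1/2..} = {0::real..}" by auto
 ultimately show ?thesis by simp
qed

lemma continuous_on_g: "continuous_on {0..1/2} g"
 unfolding g_def[abs_def] by (intro continuous_intros continuous_on_subset[OF continuous_on_gamma]) auto

lemma bounded_lipschitz_K: "bounded_lipschitz {0..} K"
proof (rule bounded_lipschitzI[of _ _ "3 + epm" B1])
 show "\<bar>K r\<bar> <= 3 + epm" if "r \<in> {0..}" for r using K_le[of r] K_ge[of r] h that by simp
 have "continuous_on {0..1/2} K" unfolding K_def[abs_def] by (intro continuous_intros continuous_on_smoothstep_cut continuous_on_g)
 then have c: "continuous_on {0..} K" by (rule continuous_on_outer_const) (use K_outer(1) r1 in auto)
 show "\<bar>K x - K y\<bar> <= B1 * dist x y" if "x \<in> {0..}" "y \<in> {0..}" for x y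
  unfolding dist_real_def using that K_derivatives K1_bound B_nonneg
  by (intro derivative_bound_imp_lipschitz[of "{}" 0 "max x y" K K1] continuous_on_subset[OF c]) auto
qed

text \<open>For \<open>0 < al\<close> the slope \<open>K1\<close> has an unbounded derivative at the
  axis, but \<open>r * K1\<close> has the derivative \<open>K1 + r * K2\<close>, which is bounded
  because \<open>r * gamma2\<close> is controlled by \<open>gamma1\<close>. This product is the only
  form in which the slope enters the test field itself.\<close>

lemma bounded_lipschitz_P: "bounded_lipschitz {0..} (%r. r * K1 r)"
proof (rule bounded_lipschitzI)
 \<comment> \<open>\<open>r * gamma1\<close> with the powers of \<open>r\<close> collected, so that
   continuity at the axis is visible.\<close>
 define p where "p r = r^2 / sqrt (1 - r^2) + ep * (1 + al) * r powr (1 + al)" for r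
 have pg: "r * gamma1 al ep r = p r" if "0 <= r" for r
  using that by (cases "r = 0") (simp_all add: gamma1_def p_def powr_add distrib_left power2_eq_square)
 have q0: "sqrt (1 - r^2) ~= 0" if "r \<in> {0..1/2}" for r using sqrt_one_minus_ge[of r] that by auto
 have "continuous_on {0..1/2} p" unfolding p_def[abs_def] using q0 al
  by (intro continuous_intros continuous_on_powr') auto
 then have "continuous_on {0..1/2} (%r. eta r * p r + r * (eta1 r * g r))"
  by (intro continuous_intros continuous_on_smoothstep_cut continuous_on_g)
 then have "continuous_on {0..1/2} (%r. r * K1 r)"
  by (rule continuous_on_cong[THEN iffD1, OF refl, rotated]) (auto simp: K1_def distrib_left mult.left_commute[of _ "eta _"] pg)
 then have c: "continuous_on {0..} (%r. r * K1 r)" by (rule continuous_on_outer_const[where c=0]) (use K_outer r1 in auto)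
 define L where "L = B1 + (2 * (1 + 2 * epm) + B2)"
 have L: "0 <= L" using B_nonneg ep epm by (simp add: L_def)
 have b: "\<bar>K1 r + r * K2 r\<bar> <= L" if "0 < r" for r
 proof -
  have "\<bar>r * K2 r\<bar> <= 2 * (1 + 2 * epm) + B2"
  proof -
   consider "r < r1" | "r1 <= r" "r <= 2 * r1" | "2 * r1 < r" by linarith
   then show ?thesis
   proof cases
    case 1
    then show ?thesis using gamma_far_bounds(4)[of r] that K2_inner[of r] B_nonneg by simp
   next
    case 2
    have "\<bar>r * K2 r\<bar> <= 1 * B2" unfolding abs_mult using K2_bound[of r] 2 r1 by (intro mult_mono) auto
    then show ?thesis using ep epm by simp
   next
    case 3
    then show ?thesis using K2_outer[of r] B_nonneg ep epm by simp
   qed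
  qed
  then show ?thesis using K1_bound[OF that] unfolding L_def by linarith
 qed
 show "\<bar>x * K1 x - y * K1 y\<bar> <= L * dist x y" if "x \<in> {0..}" "y \<in> {0..}" for x y
 proof -
  have d: "((%r. r * K1 r) has_real_derivative K1 r + r * K2 r) (at r)" if "0 < r" "r \<notin> {r1, 2 * r1}" for r
   using DERIV_mult[OF DERIV_ident K_derivatives(2)[of r]] that by (simp add: mult.commute)
  show ?thesis unfolding dist_real_def using that b L d
   by (intro derivative_bound_imp_lipschitz[of "{r1, 2 * r1}" 0 "max x y" "%r. r * K1 r" "%r. K1 r + r * K2 r"] continuous_on_subset[OF c]) auto
 qed
 show "\<bar>r * K1 r\<bar> <= B1" if "r \<in> {0..}" for r
 proof (cases "r = 0 \<or> 2 * r1 <= r")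
  case True
  then show ?thesis using K_outer[of r] B_nonneg by auto
 next
  case False
  have "\<bar>r * K1 r\<bar> <= 1 * B1" unfolding abs_mult using K1_bound[of r] False that r1 by (intro mult_mono) auto
  then show ?thesis by simp
 qed
qed

lemma squeeze_flow:
 assumes R: "0 < R" shows "squeeze_flow K K1 K2 h r1 R (R + 4 + epm)"
proof
 show "K r < R + 4 + epm" if "0 <= r" for r using K_le[OF that] R by simp
qed (use R h r1 K_ge bounded_lipschitz_K bounded_lipschitz_P K_derivatives in auto)

text \<open>In the last estimate one factor \<open>K1\<close> is spent on its bound
  \<open>1 + 2 * epm\<close> and the other on \<open>r * K1 <= 3 * K\<close>. This yields
  \<open>1 / (r * K)\<close>, which is integrable in the gap with the cylindrical weight.\<close>

lemma tip_conditions: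
 assumes r: "0 < r" "r < r1"
 shows "0 <= K1 r \<and> r * K1 r <= 3 * K r \<and> \<bar>r * K2 r\<bar> <= 2 * K1 r \<and> (K1 r / K r)^2 <= 3 * (1 + 2 * epm) / (r * K r)"
proof -
 have Kr: "K r = h + gamma_S al ep r" "K1 r = gamma1 al ep r" "K2 r = gamma2 al ep r" using r K_inner K2_inner by auto
 note b = gamma_tip_bounds[of r] gamma_far_bounds[of r]
 have Kp: "0 < K r" using K_ge[of r] r h by simp
 have a: "0 <= K1 r" "r * K1 r <= 3 * K r" "\<bar>r * K2 r\<bar> <= 2 * K1 r" "K1 r <= 1 + 2 * epm"
  using b r r1 h unfolding Kr by auto
 have "K1 r * (r * K1 r) <= (1 + 2 * epm) * (3 * K r)" by (rule mult_mono[OF a(4) a(2)]) (use a r ep epm in auto)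
 moreover have "(a / k)^2 <= 3 * E / (r * k)" if "a * (r * a) <= E * (3 * k)" "0 < k" for a k E :: real
 proof -
  have "(a / k)^2 = a * (r * a) / (r * k * k)" using r that(2) by (simp add: power2_eq_square)
  also have "... <= E * (3 * k) / (r * k * k)" using r that by (intro divide_right_mono) auto
  also have "... = 3 * E / (r * k)" using r that(2) by simp
  finally show ?thesis .
 qed
 ultimately have "(K1 r / K r)^2 <= 3 * (1 + 2 * epm) / (r * K r)" using Kp by blast
 then show ?thesis using a by blast
qed

lemma test_field:
 assumes R: "1 <= R"
 obtains Ps DPs where "energy_field Ps DPs" "AE x in lborel. trace (DPs x) = 0"
  "!!x. x $ 3 <= 0 ==> Ps x = 0"
  "!!x. radius x <= R ==> K (radius x) <= x $ 3 ==> x $ 3 <= R + 4 + epm ==> Ps x = e_z"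
  "(LI x. (norm (DPs x))^2) <= 6 * pi * integral {0..r1} (%r. r ^ 3 / (h + gamma_S al ep r) ^ 3)
    + 800 * pi * integral {0..r1} (%r. r / (h + gamma_S al ep r))
    + (800 * pi * (3 * (1 + 2 * epm)) * r1
     + (13 + R + 1 / kp + B1 + B2) ^ 1000 * measure lborel (cball (0::real^3) (R + (R + 4 + epm) + 2)))"
proof -
 \<comment> \<open>The ceiling lies above \<open>K\<close>, which is at most \<open>3 + epm\<close>,
   and above the shifted solid, whose points have height at most \<open>R + h\<close>.\<close>
 interpret F: squeeze_flow K K1 K2 h r1 R "R + 4 + epm" by (rule squeeze_flow) (use R in simp)
 obtain G where G: "energy_field F.field G" "AE x in lborel. trace (G x) = 0"
  "AE x in lborel. (norm (G x))^2 = (radius x * F.az (radius x) (x $ 3))^2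
    + (F.fa (radius x) (x $ 3))^2 + (F.fa (radius x) (x $ 3) + radius x * F.ar (radius x) (x $ 3))^2
    + (F.br (radius x) (x $ 3))^2 + (F.bz (radius x) (x $ 3))^2" by (rule F.field_gradient)
 define N where "N = 13 + R + 1 / kp + B1 + B2"
 have kpp: "0 < 1 / kp" using kp by simp
 have N: "12 <= N" "R + 1 <= N" using R B_nonneg kpp by (auto simp: N_def)
 have out: "1 / K r <= N \<and> \<bar>K1 r\<bar> <= N \<and> \<bar>K2 r\<bar> <= N" if "r1 <= r" for r
 proof -
  have "1 / K r <= 1 / kp" using K_ge_kp[OF that] kp by (intro divide_left_mono) auto
  moreover have "\<bar>K1 r\<bar> <= B1" "\<bar>K2 r\<bar> <= B2" using K1_bound[of r] K2_bound[of r] that r1 by auto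
  ultimately show ?thesis using R B_nonneg kpp unfolding N_def by (intro conjI) linarith+
 qed
 have "(LI x. (norm (G x))^2) <= 6 * pi * integral {0..r1} (%r. r ^ 3 / (K r) ^ 3)
   + 800 * pi * integral {0..r1} (%r. r / K r) + 800 * pi * (3 * (1 + 2 * epm)) * r1
   + N ^ 1000 * measure lborel (cball (0::real^3) (R + (R + 4 + epm) + 2))"
 proof (rule F.energy_upper_bound[OF G(1)])
  show "AE x in lborel. (norm (G x))^2 = F.density_sq (radius x) (x $ 3)" using G(3) by (simp only: F.density_sq_def)
 qed (use tip_conditions out N R r1 ep epm in auto)
 also have "integral {0..r1} (%r. r ^ 3 / (K r) ^ 3) = integral {0..r1} (%r. r ^ 3 / (h + gamma_S al ep r) ^ 3)"
  by (rule integral_cong) (simp add: K_inner)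
 also have "integral {0..r1} (%r. r / K r) = integral {0..r1} (%r. r / (h + gamma_S al ep r))"
  by (rule integral_cong) (simp add: K_inner)
 finally show ?thesis
  using F.field_values(1,2) by (intro that[OF G(1,2)]) (auto simp: N_def add.assoc)
qed

end

section \<open>The drag and its lubrication approximation\<close>

context tip_profile begin

text \<open>The slope of the sphere is infinite at \<open>r = 1\<close>, so the gap is Lipschitz
  only over discs of radius \<open>rh < r0\<close>. The value at \<open>r0\<close> is reached by
  continuity of the integral in its upper limit.\<close>

lemma approx_drag_le_drag:
 assumes r0: "0 < r0" "r0 <= 1" and tip: "has_tip r0 (gamma_S al ep) S" and h: "0 < h"
  and drag: "is_normalized_drag S h F"
 shows "approx_drag al r0 ep h <= F"
proof -
 obtain u G where u: "energy_field u G" "boundary_values S h e_z u"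
  "AE x in lborel. x \<notin> fluid_domain S h --> G x = 0" "AE x in lborel. trace (G x) = 0"
  "F = (LI x. (norm (G x))^2)"
  by (rule normalized_drag_minimal_energy[OF drag]) blast
 obtain d where d: "0 < d" and dS: "!!x. radius x <= r0 ==> x $ 3 < gamma_S al ep (radius x) + d ==>
   x \<in> S \<longleftrightarrow> gamma_S al ep (radius x) < x $ 3"
  using tip unfolding has_tip_def by blast
 \<comment> \<open>The layer is closed at its top, whereas \<open>has_tip\<close> describes the
   solid strictly below thickness \<open>d\<close>; half of \<open>d\<close> is safe.\<close>
 have inS: "x \<in> closure (shifted S h)"
  if "radius x < r0" "h + gamma_S al ep (radius x) < x $ 3" "x $ 3 <= h + gamma_S al ep (radius x) + d / 2" for x
 proof -
  define y where "y = x - h *\<^sub>R e_z"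
  have y: "radius y = radius x" "y $ 3 = x $ 3 - h" by (simp_all add: y_def radius_def e_z_def axis_def)
  have "y \<in> S" using dS[of y] that d unfolding y by simp
  then have "x \<in> shifted S h" unfolding shifted_def by (intro image_eqI[of _ _ y]) (simp_all add: y_def)
  then show ?thesis using closure_subset by blast
 qed
 have le: "6 * pi * integral {0..rh} (%r. r ^ 3 / (h + gamma_S al ep r) ^ 3) <= F" if rh: "0 < rh" "rh < r0" for rh
 proof -
  define M where "M = rh / sqrt (1 - rh^2) + ep * (1 + al)"
  have "rh^2 < 1" using rh r0 by (simp add: abs_square_less_1)
  then have q: "0 < sqrt (1 - rh^2)" by simp
  have M: "0 <= M" using q rh ep al by (simp add: M_def)
  have g1: "\<bar>gamma1 al ep r\<bar> <= M" if r: "0 < r" "r < rh" for r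
  proof -
   have "r^2 <= rh^2" using r by (intro power_mono) auto
   then have "r / sqrt (1 - r^2) <= rh / sqrt (1 - rh^2)" "0 <= r / sqrt (1 - r^2)"
   proof -
    have "r^2 < 1" using \<open>r^2 <= rh^2\<close> \<open>rh^2 < 1\<close> by linarith
    then show "0 <= r / sqrt (1 - r^2)" using r by (intro divide_nonneg_nonneg real_sqrt_ge_zero) auto
    show "r / sqrt (1 - r^2) <= rh / sqrt (1 - rh^2)"
     using r q \<open>r^2 <= rh^2\<close> by (intro frac_le real_sqrt_le_mono) auto
   qed
   moreover have "ep * ((1 + al) * r powr al) <= ep * ((1 + al) * 1)"
    using powr_le_1[of r al] r rh r0 al ep by (intro mult_left_mono) auto
   moreover have "0 <= ep * ((1 + al) * r powr al)" using al ep by simp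
   ultimately show ?thesis unfolding gamma1_def M_def mult_1_right by linarith
  qed
  interpret T: thin_gap "%r. h + gamma_S al ep r" "gamma1 al ep" h rh "d / 2" M
  proof
   show "h <= h + gamma_S al ep r" if "0 <= r" "r <= rh" for r using gamma_ge(3)[of r] that rh r0 by simp
   show "\<bar>h + gamma_S al ep r - (h + gamma_S al ep s)\<bar> <= M * \<bar>r - s\<bar>" if "0 <= r" "r <= rh" "0 <= s" "s <= rh" for r s
    using derivative_bound_imp_lipschitz[of "{}" 0 rh "gamma_S al ep" "gamma1 al ep" M r s]
     continuous_on_subset[OF continuous_on_gamma, of "{0..rh}"] gamma_derivatives(1) g1 M that rh r0 by auto
   show "((%r. h + gamma_S al ep r) has_real_derivative gamma1 al ep r) (at r)" if "0 < r" "r < rh" for r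
    using DERIV_add[OF DERIV_const gamma_derivatives(1)[of r]] that rh r0 by simp
  qed (use h rh d in auto)
  show ?thesis unfolding u(5)
  proof (rule T.energy_lower_bound[OF u(1,4)])
   show "AE x in lborel. x $ 3 <= 0 --> u x = 0" using u(2) by (simp add: boundary_values_def)
   have "AE x in lborel. x \<in> closure (shifted S h) --> u x = e_z" using u(2) by (simp add: boundary_values_def)
   then show "AE x in lborel. radius x < rh \<and> h + gamma_S al ep (radius x) < x $ 3 \<and> x $ 3 <= h + gamma_S al ep (radius x) + d / 2 --> u x = e_z"
    by eventually_elim (use inS rh in force)
   show "AE x in lborel. x $ 3 <= 0 \<or> radius x < rh \<and> h + gamma_S al ep (radius x) < x $ 3 \<and> x $ 3 <= h + gamma_S al ep (radius x) + d / 2 --> G x = 0"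
    using u(3) by eventually_elim (use inS rh in \<open>force simp: fluid_domain_def\<close>)
  qed
 qed
 define f where "f rh = 6 * pi * integral {0..rh} (%r. r ^ 3 / (h + gamma_S al ep r) ^ 3)" for rh
 have "continuous_on {0..r0} f" unfolding f_def[abs_def]
  using h r0 by (intro continuous_intros indefinite_integral_continuous_1 gamma_quotient_integrable) auto
 moreover have cl: "closure {0<..<r0} = {0..r0}" using r0 by simp
 ultimately have "f r0 <= F"
  using continuous_le_on_closure[of "{0<..<r0}" f r0 F] le r0 unfolding f_def[symmetric] cl by auto
 then show ?thesis by (simp add: f_def approx_drag_def)
qed

text \<open>Division by \<open>r powr (1 + al)\<close> turns the majorant into a multiple of the
  logarithmic derivative of \<open>ep + r powr (1 - al) / 2\<close>. Its lower end contributes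
  \<open>ln ep\<close>, and \<open>h\<close> does not enter.\<close>

lemma integral_le_log:
 assumes r1: "0 < r1" "r1 <= 1" and f: "f integrable_on {0..r1}"
  and le: "!!r. 0 < r ==> r < r1 ==> f r <= r / (r^2 / 2 + ep * r powr (1 + al))"
 shows "integral {0..r1} f <= 2 / (1 - al) * (ln (1 + ep) + \<bar>ln ep\<bar>)"
proof -
 have p: "0 < ep + r powr (1 - al) / 2" for r using ep by (simp add: add_pos_nonneg)
 have "integral {0..r1} f <= 2 / (1 - al) * ln (ep + r1 powr (1 - al) / 2) - 2 / (1 - al) * ln (ep + 0 powr (1 - al) / 2)"
 proof (rule integral_le_antiderivative[where pf = "%r. r powr - al / (ep + r powr (1 - al) / 2)"])
  show "((%r. 2 / (1 - al) * ln (ep + r powr (1 - al) / 2)) has_real_derivative r powr - al / (ep + r powr (1 - al) / 2)) (at r)"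
   if "0 < r" for r
  proof -
   have "((%r. ep + r powr (1 - al) / 2) has_real_derivative (1 - al) / 2 * r powr - al) (at r)"
    using that by (auto intro!: derivative_eq_intros)
   note d = DERIV_cmult[OF DERIV_ln_divide[THEN DERIV_chain2, OF p this], of "2 / (1 - al)"]
   have "2 / (1 - al) * (1 / y * ((1 - al) / 2 * a)) = a / y" for a y :: real using al by simp
   from d[unfolded this] show ?thesis .
  qed
  have "continuous_on {0..r1} (%r. r powr (1 - al))" using al by (intro continuous_on_powr' continuous_intros) auto
  then show "continuous_on {0..r1} (%r. 2 / (1 - al) * ln (ep + r powr (1 - al) / 2))"
   by (intro continuous_on_mult continuous_on_const continuous_on_ln continuous_on_add continuous_on_divide)
    (simp_all add: p[THEN less_imp_neq, THEN not_sym])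
  show "f r <= r powr - al / (ep + r powr (1 - al) / 2)" if r: "0 < r" "r < r1" for r
  proof -
   have "r^2 / 2 + ep * r powr (1 + al) = r * r powr al * (ep + r powr (1 - al) / 2)"
    using r by (simp add: powr_diff powr_add power2_eq_square field_simps)
   then have "f r <= r / (r * r powr al * (ep + r powr (1 - al) / 2))" using le[OF r] by simp
   also have "... = r powr - al / (ep + r powr (1 - al) / 2)" using r by (simp add: powr_minus_divide)
   finally show ?thesis .
  qed
 qed (use r1 f in auto)
 also have "... = 2 / (1 - al) * (ln (ep + r1 powr (1 - al) / 2) - ln ep)" by (simp add: right_diff_distrib)
 also have "... <= 2 / (1 - al) * (ln (1 + ep) + \<bar>ln ep\<bar>)"
 proof (intro mult_left_mono)
  have "ln (ep + r1 powr (1 - al) / 2) <= ln (1 + ep)"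
   using powr_le_1[of r1 "1 - al"] r1 al ep p[of r1] by (subst ln_le_cancel_iff) auto
  then show "ln (ep + r1 powr (1 - al) / 2) - ln ep <= ln (1 + ep) + \<bar>ln ep\<bar>" by linarith
 qed (use al in simp)
 finally show ?thesis .
qed

lemma sphere_log_integral:
 fixes h r1 :: real
 assumes h: "0 < h" "h <= 1 / 2" and r1: "0 < r1" "r1 <= 1"
 shows "(%r. r / (h + r^2 / 2)) integrable_on {0..r1}" "integral {0..r1} (%r. r / (h + r^2 / 2)) <= \<bar>ln h\<bar>"
proof -
 have p: "0 < h + r^2 / 2" for r using h by (simp add: add_pos_nonneg)
 show I: "(%r. r / (h + r^2 / 2)) integrable_on {0..r1}"
  using p by (intro integrable_continuous_interval continuous_intros) (simp_all add: p[THEN less_imp_neq, THEN not_sym])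
 have "integral {0..r1} (%r. r / (h + r^2 / 2)) <= ln (h + r1^2 / 2) - ln (h + 0^2 / 2)"
 proof (rule integral_le_antiderivative[where pf = "%r. r / (h + r^2 / 2)"])
  show "((%r. ln (h + r^2 / 2)) has_real_derivative r / (h + r^2 / 2)) (at r)" for r
   using p[of r] by (auto intro!: derivative_eq_intros)
  show "continuous_on {0..r1} (%r. ln (h + r^2 / 2))" using p by (intro continuous_intros) (simp_all add: p[THEN less_imp_neq, THEN not_sym])
 qed (use r1 I in auto)
 also have "... <= \<bar>ln h\<bar>"
 proof -
  have "r1^2 <= 1" using r1 by (simp add: power_le_one)
  then have "ln (h + r1^2 / 2) <= ln 1" using h by (subst ln_le_cancel_iff) (auto intro: add_pos_nonneg)
  then show ?thesis by simp
 qed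
 finally show "integral {0..r1} (%r. r / (h + r^2 / 2)) <= \<bar>ln h\<bar>" .
qed

lemma log_integral:
 assumes h: "0 < h" "h <= 1 / 2" and r1: "0 < r1" "r1 <= 1"
 shows "integral {0..r1} (%r. r / (h + gamma_S al ep r)) <= \<bar>ln h\<bar>"
  "integral {0..r1} (%r. r / (h + gamma_S al ep r)) <= 2 / (1 - al) * (ln (1 + ep) + \<bar>ln ep\<bar>)"
proof -
 have I: "(%r. r / (h + gamma_S al ep r)) integrable_on {0..r1}"
  using gamma_quotient_integrable[of h 0 r1 1 1] h r1 by simp
 have p: "0 < h + r^2 / 2" for r using h by (simp add: add_pos_nonneg)
 have "integral {0..r1} (%r. r / (h + gamma_S al ep r)) <= integral {0..r1} (%r. r / (h + r^2 / 2))"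
 proof (rule integral_le[OF I sphere_log_integral(1)[OF h r1]])
  show "r / (h + gamma_S al ep r) <= r / (h + r^2 / 2)" if "r \<in> {0..r1}" for r
   using gamma_ge(2)[of r] that r1 p[of r] by (intro divide_left_mono mult_pos_pos) (auto intro: less_le_trans)
 qed
 then show "integral {0..r1} (%r. r / (h + gamma_S al ep r)) <= \<bar>ln h\<bar>"
  using sphere_log_integral(2)[OF h r1] by linarith
 show "integral {0..r1} (%r. r / (h + gamma_S al ep r)) <= 2 / (1 - al) * (ln (1 + ep) + \<bar>ln ep\<bar>)"
 proof (rule integral_le_log[OF r1 I])
  show "r / (h + gamma_S al ep r) <= r / (r^2 / 2 + ep * r powr (1 + al))" if r: "0 < r" "r < r1" for r
  proof -
   have "0 < r^2 / 2 + ep * r powr (1 + al)" using r ep by (simp add: add_pos_pos)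
   then show ?thesis using gamma_ge(1)[of r] r r1 h by (intro divide_left_mono mult_pos_pos) auto
  qed
 qed
qed

end

context bottom_profile begin

text \<open>Within \<open>r0\<close> the tip condition decides, and the bend of \<open>K\<close>
  stays below the tip. Beyond \<open>r0\<close> only the height of the frontier is known, and a
  vertical line transfers it to the interior.\<close>

lemma solid_above_profile:
 assumes r1r0: "4 * r1 = r0" and tip: "has_tip r0 (gamma_S al ep) S" and S: "S \<subseteq> cball 0 R"
  and c: "!!x. x \<in> frontier S ==> r0 <= radius x ==> kp <= x $ 3" and y: "y \<in> S"
 shows "K (radius y) <= y $ 3 + h"
proof -
 obtain d where d: "0 < d" and dS: "!!x. radius x <= r0 ==> x $ 3 < gamma_S al ep (radius x) + d ==>
   x \<in> S \<longleftrightarrow> gamma_S al ep (radius x) < x $ 3"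
  using tip unfolding has_tip_def by blast
 define r where "r = radius y"
 have r: "0 <= r" by (simp add: r_def radius_nonneg)
 have above: "gamma_S al ep r < y $ 3" if "r <= r0"
  using dS[of y] that y d unfolding r_def[symmetric] by linarith
 consider "r <= r1" | "r1 <= r" "r <= 2 * r1" | "2 * r1 <= r" "r <= r0" | "r0 <= r" using r1 r1r0 by linarith
 then have "K r <= y $ 3 + h"
 proof cases
  case 1
  then show ?thesis using above K_inner[of r] r1 r1r0 by simp
 next
  case 2
  have "eta r * g r <= 1 * g r" using g_nonneg[of r] eta_range[of r] 2 r1 by (intro mult_right_mono) auto
  then show ?thesis using above 2 r1 r1r0 by (simp add: K_def g_def)
 next
  case 3
  then show ?thesis using above K_outer[of r] g_nonneg[of r] r1 r1r0 by (simp add: g_def)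
 next
  case 4
  \<comment> \<open>A point straight below \<open>y\<close>, outside the ball that contains
    \<open>S\<close>. The segment between them crosses the frontier at the same radius, at height at
    least \<open>kp\<close> and not above \<open>y\<close>.\<close>
  define z where "z = y - (2 * R + 1) *\<^sub>R e_z"
  have z3: "z $ 3 = y $ 3 - (2 * R + 1)" by (simp add: z_def e_z_def axis_def)
  have "norm y <= R" using y S by auto
  then have "\<bar>y $ 3\<bar> <= R" using component_le_norm_cart[of y 3] by linarith
  then have "z \<notin> S" using z3 component_le_norm_cart[of z 3] S by auto
  then have "closed_segment y z \<inter> S ~= {}" "closed_segment y z - S ~= {}" using y by auto
  then have "closed_segment y z \<inter> frontier S ~= {}"
   by (intro connected_Int_frontier convex_connected) auto
  then obtain p where p: "p \<in> closed_segment y z" "p \<in> frontier S" by blast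
  obtain t where t: "0 <= t" "t <= 1" "p = (1 - t) *\<^sub>R y + t *\<^sub>R z" using p(1) unfolding closed_segment_def by blast
  have pe: "p = y - (t * (2 * R + 1)) *\<^sub>R e_z" unfolding t(3) z_def by (simp add: algebra_simps)
  have "0 <= t * (2 * R + 1)" using t order_trans[OF norm_ge_zero \<open>norm y <= R\<close>] by (intro mult_nonneg_nonneg) auto
  moreover have "radius p = radius y" by (simp add: pe radius_def e_z_def axis_def)
  moreover have "p $ 3 = y $ 3 - t * (2 * R + 1)" by (simp add: pe e_z_def axis_def)
  ultimately have "kp <= y $ 3" using c[OF p(2)] 4 by (simp add: r_def)
  then show ?thesis using K_outer[of r] 4 r1 r1r0 by simp
 qed
 then show ?thesis by (simp add: r_def)
qed

lemma drag_le:
 assumes r1r0: "4 * r1 = r0" and tip: "has_tip r0 (gamma_S al ep) S" and S: "S \<subseteq> cball 0 R" and R: "1 <= R"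
  and c: "!!x. x \<in> frontier S ==> r0 <= radius x ==> kp <= x $ 3"
  and drag: "is_normalized_drag S h F"
 shows "F <= 6 * pi * integral {0..r1} (%r. r ^ 3 / (h + gamma_S al ep r) ^ 3)
    + 800 * pi * integral {0..r1} (%r. r / (h + gamma_S al ep r))
    + (800 * pi * (3 * (1 + 2 * epm)) * r1
     + (13 + R + 1 / kp + B1 + B2) ^ 1000 * measure lborel (cball (0::real^3) (R + (R + 4 + epm) + 2)))"
proof -
 obtain Ps DPs where Ps: "energy_field Ps DPs" "AE x in lborel. trace (DPs x) = 0"
  "!!x. x $ 3 <= 0 ==> Ps x = 0"
  "!!x. radius x <= R ==> K (radius x) <= x $ 3 ==> x $ 3 <= R + 4 + epm ==> Ps x = e_z"
  and le: "(LI x. (norm (DPs x))^2) <= 6 * pi * integral {0..r1} (%r. r ^ 3 / (h + gamma_S al ep r) ^ 3)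
    + 800 * pi * integral {0..r1} (%r. r / (h + gamma_S al ep r))
    + (800 * pi * (3 * (1 + 2 * epm)) * r1
     + (13 + R + 1 / kp + B1 + B2) ^ 1000 * measure lborel (cball (0::real^3) (R + (R + 4 + epm) + 2)))"
  by (rule test_field[OF R]) (rule that; assumption)
 \<comment> \<open>A closed region on which the test field is \<open>e_z\<close>, so that containing
   the shifted solid it also contains its closure.\<close>
 define B where "B = {x::real^3. radius x <= R} \<inter> {x. K (radius x) <= x $ 3} \<inter> {x. x $ 3 <= R + 4 + epm}"
 have rc: "continuous_on UNIV radius" unfolding radius_def[abs_def] by (intro continuous_intros)
 have kc: "continuous_on UNIV (%x. K (radius x))"
 proof (rule continuous_on_compose2[OF _ rc])
  obtain L where "0 <= L" "!!x y. x \<in> {0..} ==> y \<in> {0..} ==> \<bar>K x - K y\<bar> <= L * dist x y"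
   using bounded_lipschitzE[OF bounded_lipschitz_K] by metis
  then have "L-lipschitz_on {0..} K" by (intro lipschitz_onI) (auto simp: dist_real_def)
  then show "continuous_on {0..} K" by (rule lipschitz_on_continuous_on)
 qed (auto simp: radius_nonneg)
 have "closed B" unfolding B_def by (intro closed_Int closed_Collect_le rc kc continuous_intros)
 moreover have "shifted S h \<subseteq> B"
 proof
  fix x assume "x \<in> shifted S h"
  then obtain y where y: "y \<in> S" "x = y + h *\<^sub>R e_z" by (auto simp: shifted_def)
  have x: "radius x = radius y" "x $ 3 = y $ 3 + h" by (simp_all add: y(2) radius_def e_z_def axis_def)
  have "norm y <= R" using y S by auto
  moreover have "radius y <= norm y" unfolding radius_def norm_vec_def L2_set_def sum_3 by (intro real_sqrt_le_mono) simp
  moreover have "y $ 3 <= norm y" using component_le_norm_cart[of y 3] by simp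
  ultimately show "x \<in> B" using solid_above_profile[OF r1r0 tip S c y(1)] h ep epm unfolding B_def by (simp add: x)
 qed
 ultimately have "closure (shifted S h) \<subseteq> B" by (simp add: closure_minimal)
 then have "Ps x = e_z" if "x \<in> closure (shifted S h)" for x using that by (intro Ps(4)) (auto simp: B_def)
 then have "boundary_values S h e_z Ps" unfolding boundary_values_def using Ps(3) by (intro conjI AE_I2) auto
 moreover obtain u G where "!!Ps DPs. energy_field Ps DPs ==> boundary_values S h e_z Ps ==> AE x in lborel. trace (DPs x) = 0 ==>
    F <= (LI x. (norm (DPs x))^2)"
  by (rule normalized_drag_minimal_energy[OF drag]) blast
 ultimately show ?thesis using Ps(1,2) le by (meson order_trans)
qed

end

lemma solid_family_lower:
 assumes "0 <= al" "al < 1" "0 < r0" "r0 <= 1" "solid_family al r0 epm S" "ep \<in> {0<..epm}" "0 < h" "is_normalized_drag (S ep) h F"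
 shows "approx_drag al r0 ep h <= F"
proof -
 interpret tip_profile al ep by unfold_locales (use assms in auto)
 show ?thesis using assms by (intro approx_drag_le_drag[of r0 "S ep"]) (auto simp: solid_family_def)
qed

text \<open>The \<open>1 +\<close> collects the energy off the tip. It cannot be merged into the
  minimum here, because \<open>ln ep\<close> may vanish.\<close>

lemma solid_family_upper:
 assumes al: "0 <= al" "al < 1" and r0: "0 < r0" "r0 <= 1" and fam: "solid_family al r0 epm S" and epm: "0 < epm"
 obtains C where "0 <= C" "!!ep h F. ep \<in> {0<..epm} ==> 0 < h ==> h < 1 / 2 ==> is_normalized_drag (S ep) h F ==>
  F <= approx_drag al r0 ep h + C * (1 + min \<bar>ln ep\<bar> \<bar>ln h\<bar>)"
proof -
 obtain R0 where R0: "!!ep. ep \<in> {0<..epm} ==> S ep \<subseteq> cball 0 R0" using fam unfolding solid_family_def by blast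
 obtain c where c: "0 < c" "!!ep x. ep \<in> {0<..epm} ==> x \<in> frontier (S ep) ==> r0 <= radius x ==> c <= x $ 3"
  using fam unfolding solid_family_def by blast
 define R where "R = max R0 1"
 \<comment> \<open>A quarter of \<open>r0\<close> keeps the bend, up to \<open>2 * r1\<close>,
   within \<open>r <= 1 / 2\<close>, where the derivative bounds of the tip are available.\<close>
 define r1 where "r1 = r0 / 4"
 \<comment> \<open>Low enough to lie below the tip from \<open>r1\<close> on and below the rest of
   the solid.\<close>
 define kp where "kp = min (r1^2 / 2) c"
 define b1 where "b1 = 1 + 2 * epm + 2 / r1 * (1 + epm)"
 define b2 where "b2 = 2 * (1 + 2 * epm) / r1 + 2 * (2 / r1 * (1 + 2 * epm)) + 6 / r1^2 * (1 + epm)"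
 define A where "A = 800 * pi * (3 * (1 + 2 * epm)) * r1
     + (13 + R + 1 / kp + b1 + b2) ^ 1000 * measure lborel (cball (0::real^3) (R + (R + 4 + epm) + 2))"
 define D where "D = 1 + 2 / (1 - al) * (1 + ln (1 + epm))"
 have rr1: "0 < r1" "r1 <= 1 / 4" "r1 <= r0" using r0 by (auto simp: r1_def)
 have kk: "0 < kp" "kp <= r1^2 / 2" "kp <= c" using rr1 c by (auto simp: kp_def)
 have A: "0 <= A" using epm rr1 kk unfolding A_def R_def b1_def b2_def by (intro add_nonneg_nonneg mult_nonneg_nonneg zero_le_power) auto
 have l: "0 <= ln (1 + epm)" using epm by simp
 have D: "1 <= D" using l al by (simp add: D_def)
 show ?thesis
 proof (rule that[of "800 * pi * D + A"])
  show "0 <= 800 * pi * D + A" using A D by simp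
  fix ep h F assume e: "ep \<in> {0<..epm}" and hh: "0 < h" "h < 1 / 2" and drag: "is_normalized_drag (S ep) h F"
  interpret bottom_profile al ep epm h r1 kp by unfold_locales (use al e hh rr1 kk in auto)
  have b: "b1 = B1" "b2 = B2" by (simp_all add: b1_def b2_def B1_def B2_def)
  define m where "m = min \<bar>ln ep\<bar> \<bar>ln h\<bar>"
  define J where "J = integral {0..r1} (%r. r / (h + gamma_S al ep r))"
  have "F <= 6 * pi * integral {0..r1} (%r. r ^ 3 / (h + gamma_S al ep r) ^ 3) + 800 * pi * J + A"
   unfolding A_def b J_def
  proof (rule drag_le[of r0 "S ep"])
   show "has_tip r0 (gamma_S al ep) (S ep)" using fam e unfolding solid_family_def by blast
   show "S ep \<subseteq> cball 0 R" using R0[OF e] by (auto simp: R_def)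
   show "kp <= x $ 3" if "x \<in> frontier (S ep)" "r0 <= radius x" for x using c(2)[OF e that] kk by simp
  qed (use drag in \<open>auto simp: R_def r1_def\<close>)
  moreover have "integral {0..r1} (%r. r ^ 3 / (h + gamma_S al ep r) ^ 3) <= integral {0..r0} (%r. r ^ 3 / (h + gamma_S al ep r) ^ 3)"
  proof (rule integral_subset_le)
   have "0 <= h + gamma_S al ep r" if "r \<in> {0..r0}" for r using gamma_ge(3)[of r] that r0 hh by auto
   then show "\<forall>r\<in>{0..r0}. 0 <= r ^ 3 / (h + gamma_S al ep r) ^ 3" by auto
  qed (use rr1 r0 hh gamma_quotient_integrable in auto)
  then have "6 * pi * integral {0..r1} (%r. r ^ 3 / (h + gamma_S al ep r) ^ 3) <= approx_drag al r0 ep h"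
   unfolding approx_drag_def by (intro mult_left_mono) auto
  moreover have "J <= D * (1 + m)"
  proof -
   have lj: "J <= \<bar>ln h\<bar>" "J <= 2 / (1 - al) * (ln (1 + ep) + \<bar>ln ep\<bar>)" unfolding J_def using log_integral[of h r1] hh rr1 by auto
   have "ln (1 + ep) <= ln (1 + epm)" using e by simp
   then have "ln (1 + ep) + \<bar>ln ep\<bar> <= (1 + ln (1 + epm)) * (1 + \<bar>ln ep\<bar>)" using mult_nonneg_nonneg[OF l abs_ge_zero[of "ln ep"]] by (simp add: algebra_simps)
   then have "2 / (1 - al) * (ln (1 + ep) + \<bar>ln ep\<bar>) <= 2 / (1 - al) * ((1 + ln (1 + epm)) * (1 + \<bar>ln ep\<bar>))" using al by (intro mult_left_mono) auto
   also have "... = (D - 1) * (1 + \<bar>ln ep\<bar>)" by (simp add: D_def)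
   also have "... <= D * (1 + \<bar>ln ep\<bar>)" by (intro mult_right_mono) auto
   finally have "J <= D * (1 + \<bar>ln ep\<bar>)" using lj by linarith
   moreover have "1 * \<bar>ln h\<bar> <= D * (1 + \<bar>ln h\<bar>)" using D by (intro mult_mono) auto
   then have "J <= D * (1 + \<bar>ln h\<bar>)" using lj by linarith
   ultimately show ?thesis unfolding m_def min_def by auto
  qed
  then have "800 * pi * J <= 800 * pi * (D * (1 + m))" by (intro mult_left_mono) auto
  moreover have "A * 1 <= A * (1 + m)" using A unfolding m_def by (intro mult_left_mono) auto
  ultimately have "F <= approx_drag al r0 ep h + 800 * pi * (D * (1 + m)) + A * (1 + m)" by linarith
  also have "... = approx_drag al r0 ep h + (800 * pi * D + A) * (1 + m)" by (simp add: algebra_simps)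
  finally show "F <= approx_drag al r0 ep h + (800 * pi * D + A) * (1 + min \<bar>ln ep\<bar> \<bar>ln h\<bar>)" by (simp add: m_def)
 qed
qed

text \<open>At \<open>ep = 1\<close> the minimum is zero although the error need not be. The lower
  bound \<open>de\<close> on the size of \<open>ln ep\<close>, together with \<open>ln 2\<close> for
  \<open>ln h\<close>, lets a multiple of the minimum absorb the constant.\<close>

lemma part_a:
 assumes al: "0 <= al" "al < 1" and r0: "0 < r0" "r0 <= 1" and fam: "solid_family al r0 epm S" and epm: "0 < epm" and de: "0 < de"
 shows "\<exists>C. \<exists>h\<^sub>0>0. \<forall>ep\<in>{0<..epm}. \<forall>h\<in>{0<..<h\<^sub>0}. \<forall>F.
    de <= \<bar>ln ep\<bar> \<and> is_normalized_drag (S ep) h F -->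
    \<bar>F - approx_drag al r0 ep h\<bar> <= C * min \<bar>ln ep\<bar> \<bar>ln h\<bar>"
proof -
 obtain C where C: "0 <= C" "!!ep h F. ep \<in> {0<..epm} ==> 0 < h ==> h < 1 / 2 ==> is_normalized_drag (S ep) h F ==>
  F <= approx_drag al r0 ep h + C * (1 + min \<bar>ln ep\<bar> \<bar>ln h\<bar>)"
  using solid_family_upper[OF al r0 fam epm] by metis
 define l where "l = min de (ln 2)"
 have l: "0 < l" using de by (simp add: l_def)
 show ?thesis
 proof (rule exI[of _ "C * (1 / l + 1)"], rule exI[of _ "1 / 2"], intro conjI ballI allI impI)
  fix ep h F assume ep: "ep \<in> {0<..epm}" and h: "h \<in> {0<..<1 / 2}" and H: "de <= \<bar>ln ep\<bar> \<and> is_normalized_drag (S ep) h F"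
  define m where "m = min \<bar>ln ep\<bar> \<bar>ln h\<bar>"
  have "ln h <= ln (1 / 2)" using h by (subst ln_le_cancel_iff) auto
  then have "ln 2 <= \<bar>ln h\<bar>" by (simp add: ln_div)
  then have "l <= m" using H by (auto simp: l_def m_def)
  then have "1 <= 1 / l * m" using l by (simp add: le_divide_eq)
  then have "C * (1 + m) <= C * (1 / l * m + m)" using C(1) by (intro mult_left_mono) auto
  then have "C * (1 + m) <= C * (1 / l + 1) * m" by (simp add: algebra_simps)
  then show "\<bar>F - approx_drag al r0 ep h\<bar> <= C * (1 / l + 1) * min \<bar>ln ep\<bar> \<bar>ln h\<bar>"
   using C(2)[OF ep, of h F] solid_family_lower[OF al r0 fam ep, of h F] h H unfolding m_def[symmetric] by auto
 qed simp
qed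

section \<open>Asymptotics of the lubrication integral\<close>

lemma expansionI:
 assumes X: "0 < X" and le: "\<bar>F - X\<bar> <= C * e * X + C * l" and nn: "0 <= C * e" "0 <= C * l"
 shows "expansion C F X e l"
proof -
 \<comment> \<open>As much of the deviation as the additive error allows; what is left is counted as
   relative error.\<close>
 define b where "b = max (- (C * l)) (min (C * l) (F - X))"
 have b: "\<bar>b\<bar> <= C * l" "\<bar>F - X - b\<bar> <= C * e * X" using le nn X by (auto simp: b_def min_def max_def abs_if mult_nonneg_nonneg)
 have "\<bar>(F - X - b) / X\<bar> <= C * e" using b(2) X by (simp add: divide_le_eq)
 moreover have "F = X * (1 + (F - X - b) / X) + b" using X by (simp add: field_simps)
 ultimately show ?thesis unfolding expansion_def using b(1) by blast
qed

text \<open>From \<open>1 - t^3 <= 3 * (1 - t)\<close> with \<open>t = x / y\<close>. One reciprocal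
  of the larger height \<open>y\<close> is kept, since the error integrals draw their convergence
  from it.\<close>

lemma diff_cubes_le:
 fixes x y :: real assumes "0 < x" "x <= y"
 shows "0 <= 1 / x ^ 3 - 1 / y ^ 3" "1 / x ^ 3 - 1 / y ^ 3 <= 3 * (y - x) / (x ^ 3 * y)"
proof -
 have "x ^ 3 <= y ^ 3" using assms by (intro power_mono) auto
 then show "0 <= 1 / x ^ 3 - 1 / y ^ 3" using assms by (simp add: frac_le)
 define t where "t = x / y"
 have t: "0 < t" "t <= 1" using assms by (auto simp: t_def)
 have "1 - t ^ 3 = (1 - t) * (1 + t + t^2)" by (simp add: power2_eq_square power3_eq_cube algebra_simps)
 also have "... <= (1 - t) * 3"
  using t power_le_one[of t 2] by (intro mult_left_mono) auto
 also have "... = 3 * (y - x) / y" using assms by (simp add: t_def field_simps)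
 finally have "(1 - t ^ 3) / x ^ 3 <= 3 * (y - x) / y / x ^ 3" using assms by (intro divide_right_mono) auto
 moreover have "(1 - t ^ 3) / x ^ 3 = 1 / x ^ 3 - 1 / y ^ 3" using assms by (simp add: t_def power_divide diff_divide_distrib)
 ultimately show "1 / x ^ 3 - 1 / y ^ 3 <= 3 * (y - x) / (x ^ 3 * y)" by (simp add: mult.commute)
qed

lemma ln_ge_ln2: assumes "0 < (h::real)" "h < 1 / 2" shows "ln 2 <= \<bar>ln h\<bar>"
proof -
 have "ln h <= ln (1 / 2)" using assms by (subst ln_le_cancel_iff) auto
 then show ?thesis by (simp add: ln_div)
qed

lemma ln_1_plus_le: assumes "0 < (ep::real)" shows "ln (1 + ep) <= 1 + \<bar>ln ep\<bar>"
proof (cases "ep <= 1")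
 case True
 have "ln (1 + ep) <= ep" using ln_add_one_self_le_self2[of ep] assms by simp
 then show ?thesis using True by linarith
next
 case False
 then have "ln (1 + ep) <= ln (2 * ep)" by (subst ln_le_cancel_iff) auto
 also have "... = ln 2 + ln ep" using assms by (simp add: ln_mult)
 finally show ?thesis using ln_2_less_1 by linarith
qed

lemma borel_imp_lebesgue_on: "f \<in> bm ==> f \<in> borel_measurable (lebesgue_on S)"
 by (intro measurable_restrict_space1 measurable_completion) simp

lemma integral_from_0_bound:
 fixes f :: "real => real"
 assumes "f \<in> bm" "-1 < a" "0 <= c" "!!s. 0 <= s ==> s <= c ==> 0 <= f s \<and> f s <= A * s powr a"
 shows "f integrable_on {0..c}" "integral {0..c} f <= A * (c powr (a + 1) / (a + 1))"
proof -
 have I: "((%s. A * s powr a) has_integral A * (c powr (a + 1) / (a + 1))) {0..c}"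
  by (rule has_integral_mult_right[OF has_integral_powr_from_0[OF assms(2,3)]])
 show fi: "f integrable_on {0..c}"
  by (rule measurable_bounded_by_integrable_imp_integrable[OF borel_imp_lebesgue_on[OF assms(1)] has_integral_integrable[OF I]])
   (use assms(4) in auto)
 show "integral {0..c} f <= A * (c powr (a + 1) / (a + 1))"
  by (rule has_integral_le[OF integrable_integral[OF fi] I]) (use assms(4) in auto)
qed

lemma integral_to_inf_bound:
 fixes f :: "real => real"
 assumes "f \<in> bm" "a < -1" "0 < c" "!!s. c <= s ==> 0 <= f s \<and> f s <= A * s powr a"
 shows "f integrable_on {c..}" "integral {c..} f <= A * (- (c powr (a + 1)) / (a + 1))" "0 <= integral {c..} f"
proof -
 have I: "((%s. A * s powr a) has_integral A * (- (c powr (a + 1)) / (a + 1))) {c..}"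
  by (rule has_integral_mult_right[OF has_integral_powr_to_inf[OF assms(2,3)]])
 show fi: "f integrable_on {c..}"
  by (rule measurable_bounded_by_integrable_imp_integrable[OF borel_imp_lebesgue_on[OF assms(1)] has_integral_integrable[OF I]])
   (use assms(4) in auto)
 show "integral {c..} f <= A * (- (c powr (a + 1)) / (a + 1))"
  by (rule has_integral_le[OF integrable_integral[OF fi] I]) (use assms(4) in auto)
 show "0 <= integral {c..} f" by (rule integral_nonneg[OF fi]) (use assms(4) in auto)
qed

lemma half_line_integral:
 fixes f :: "real => real"
 assumes "f integrable_on {0..c}" "f integrable_on {c..}" "0 <= c"
 shows "f integrable_on {0..}" "integral {0..} f = integral {0..c} f + integral {c..} f"
proof -
 have "(f has_integral integral {0..c} f + integral {c..} f) ({0..c} \<union> {c..})"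
 proof (rule has_integral_Un)
  have "{0..c} \<inter> {c..} = {c}" using assms(3) by auto
  then show "negligible ({0..c} \<inter> {c..})" by simp
 qed (use assms in \<open>auto intro: integrable_integral\<close>)
 moreover have "{0..c} \<union> {c..} = {0..}" using assms(3) by auto
 ultimately have "(f has_integral integral {0..c} f + integral {c..} f) {0..}" by simp
 then show "f integrable_on {0..}" "integral {0..} f = integral {0..c} f + integral {c..} f"
  by (auto intro: integral_unique)
qed

text \<open>For the constants \<open>mu_above\<close> and \<open>mu_below\<close>: an absolute error
  becomes a relative one after division by them.\<close>

lemma half_line_integral_pos:
 fixes f :: "real => real"
 assumes f: "f integrable_on {0..}" and nn: "!!s. 0 <= s ==> 0 <= f s" and c: "0 < c" "!!s. 1 <= s ==> s <= 2 ==> c <= f s"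
 shows "0 < integral {0..} f"
proof -
 have f12: "f integrable_on {1..2}" by (rule integrable_on_subinterval[OF f]) auto
 have "c = integral {1..2::real} (%_. c)" by simp
 also have "... <= integral {1..2} f" by (rule integral_le[OF _ f12]) (use c in auto)
 also have "... <= integral {0..} f" by (rule integral_subset_le[OF _ f12 f]) (use nn in auto)
 finally show ?thesis using c by simp
qed

lemma integral_stretch:
 fixes f g :: "real => real"
 assumes f: "f integrable_on {0..c}" and rh: "0 < rh" and fg: "!!s. 0 <= s ==> s <= c / rh ==> f (rh * s) = B * g s"
 shows "integral {0..c} f = rh * B * integral {0..c / rh} g"
proof -
 have "((%x. f (rh * x)) has_integral (1 / \<bar>rh\<bar>) *\<^sub>R integral {0..c} f) ((%x. x / rh) ` {0..c})"
  using rh by (intro has_integral_stretch_real integrable_integral f) auto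
 then have "((%x. f (rh * x)) has_integral integral {0..c} f / rh) {0..c / rh}" using rh by simp
 then have "integral {0..c} f / rh = integral {0..c / rh} (%x. f (rh * x))" by (simp add: integral_unique)
 also have "... = integral {0..c / rh} (%x. B * g x)" by (rule integral_cong) (use fg in auto)
 also have "... = B * integral {0..c / rh} g" by simp
 finally show ?thesis using rh by (simp add: field_simps)
qed

lemma power_eq_exp: "0 < (x::real) ==> x ^ n = exp (real n * ln x)"
 by (simp add: exp_of_nat_mult)

section \<open>Small \<open>beta\<close>: the perturbed sphere\<close>

context tip_profile begin

definition "w r = ep * r powr (1 + al)"

lemma w_pos: "0 <= w r" "0 < r ==> 0 < w r"
 using ep by (auto simp: w_def)

lemma gamma_upper: "0 <= r ==> r <= 1 ==> gamma_S al ep r <= r^2 + w r" "0 <= r ==> r <= 1 ==> gamma_S al ep r <= r^2 / 2 + r ^ 4 / 2 + w r"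
 using sphere_bounds(2,3)[of r] by (auto simp: gamma_S_def w_def)

lemma gamma_lower: "0 <= r ==> r <= 1 ==> r^2 / 2 + w r <= gamma_S al ep r"
 using gamma_ge(1)[of r] by (simp add: w_def)

lemma w_borel [measurable]: "w \<in> bm"
 unfolding w_def[abs_def] by measurable

text \<open>The exponents \<open>(1 - al) / 2\<close> and \<open>(1 + al) / 2\<close> add up to 1,
  so the corresponding powers of \<open>h\<close> and \<open>r^2\<close> have a product of at most
  \<open>h + r^2\<close>. In this way \<open>beta\<close> becomes the relative size of the
  perturbation, uniformly in \<open>r\<close>.\<close>

lemma w_le: assumes "0 < h" "0 <= r" shows "w r <= 2 * beta al ep h * (h + r^2 / 2)"
proof (cases "r = 0")
 case True
 then show ?thesis using assms ep al by (simp add: w_def beta_def)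
next
 case False
 then have r: "0 < r" using assms by simp
 define m where "m = h + r^2"
 have m: "h <= m" "r^2 <= m" "0 < m" using assms by (auto simp: m_def add_pos_nonneg)
 have "h powr ((1 - al) / 2) * (r^2) powr ((1 + al) / 2) <= m powr ((1 - al) / 2) * m powr ((1 + al) / 2)"
  using m al assms by (intro mult_mono powr_mono2) auto
 also have "... = m" using m by (simp add: powr_add[symmetric] add_divide_distrib[symmetric])
 also have "(r^2) powr ((1 + al) / 2) = r powr (1 + al)" using r by (simp add: powr_def ln_realpow)
 finally have *: "h powr ((1 - al) / 2) * r powr (1 + al) <= m" .
 have "h powr ((al - 1) / 2) * h powr ((1 - al) / 2) = 1" using assms by (simp add: powr_add[symmetric] add_divide_distrib[symmetric])
 then have "w r = beta al ep h * (h powr ((1 - al) / 2) * r powr (1 + al))" by (simp add: w_def beta_def mult.assoc)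
 also have "... <= beta al ep h * m" using * ep by (intro mult_left_mono) (auto simp: beta_def)
 also have "... <= beta al ep h * (2 * (h + r^2 / 2))" using ep assms by (intro mult_left_mono) (auto simp: beta_def m_def)
 finally show ?thesis by (simp add: algebra_simps)
qed

text \<open>With \<open>u = h + r^2 / 2\<close> one has \<open>r^2 = 2 * (u - h)\<close>, which
  splits the integrand into two pure powers of \<open>u\<close> times \<open>r = u'\<close>.\<close>

lemma sphere_integral:
 fixes rh :: real assumes h: "0 < h" and rh: "0 <= rh"
 shows "((%r. r ^ 3 / (h + r^2 / 2) ^ 3) has_integral 1 / h - 2 / (h + rh^2 / 2) + h / (h + rh^2 / 2)^2) {0..rh}"
proof -
 define u where "u r = h + r^2 / 2" for r
 have u: "0 < u r" for r using h by (simp add: u_def add_pos_nonneg)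
 have du: "(u has_real_derivative r) (at r within {0..rh})" for r unfolding u_def[abs_def] by (auto intro!: derivative_eq_intros)
 have d: "((%r. - 2 / u r + h / (u r)^2) has_real_derivative r ^ 3 / (u r) ^ 3) (at r within {0..rh})" for r
 proof -
  have e: "r ^ 3 / k ^ 3 = 2 * r / k^2 - 2 * h * r / k ^ 3" if "k = u r" "0 < k" for k
  proof -
   have "2 * r / k^2 - 2 * h * r / k ^ 3 = r * (2 * (k - h)) / k ^ 3" using that(2) by (simp add: field_simps power2_eq_square power3_eq_cube)
   also have "2 * (k - h) = r^2" using that(1) by (simp add: u_def)
   finally show ?thesis by (simp add: power2_eq_square power3_eq_cube)
  qed
  show ?thesis unfolding e[OF refl u]
   using u[of r] by (auto intro!: derivative_eq_intros du simp: field_simps power2_eq_square power3_eq_cube)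
 qed
 have "((%r. r ^ 3 / (u r) ^ 3) has_integral (- 2 / u rh + h / (u rh)^2) - (- 2 / u 0 + h / (u 0)^2)) {0..rh}"
  using rh d by (intro fundamental_theorem_of_calculus) (auto simp: has_real_derivative_iff_has_vector_derivative[symmetric])
 moreover have "(- 2 / u rh + h / (u rh)^2) - (- 2 / u 0 + h / (u 0)^2) = 1 / h - 2 / u rh + h / (u rh)^2"
  using h by (simp add: u_def power2_eq_square)
 ultimately have "((%r. r ^ 3 / (u r) ^ 3) has_integral 1 / h - 2 / u rh + h / (u rh)^2) {0..rh}" by metis
 then show ?thesis by (simp add: u_def)
qed

text \<open>The height exceeds \<open>k = h + r^2 / 2\<close> by at most
  \<open>(2 * b + r^2) * k\<close>. The first summand produces the factor \<open>1 - 6 * b\<close>,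
  nonnegative for \<open>b < 1 / 6\<close>; the second, from the quartic term of the sphere, leaves
  a multiple of \<open>r / k\<close>, a logarithmic integral.\<close>

lemma approx_drag_near_sphere:
 assumes h: "0 < h" "h < 1 / 2" and r0: "0 < r0" "r0 <= 1" and be: "beta al ep h < 1 / 6"
 shows "approx_drag al r0 ep h <= 6 * pi / h"
  "6 * pi / h - 6 * pi * (6 * beta al ep h / h + 4 / r0^2 + 12 * \<bar>ln h\<bar>) <= approx_drag al r0 ep h"
proof -
 define b where "b = beta al ep h"
 have b: "0 <= b" "b < 1 / 6" using ep be by (auto simp: b_def beta_def)
 define u where "u r = h + r^2 / 2" for r
 have u: "0 < u r" "h <= u r" "r^2 / 2 <= u r" for r using h by (auto simp: u_def add_pos_nonneg)
 define I where "I = integral {0..r0} (%r. r ^ 3 / (h + gamma_S al ep r) ^ 3)"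
 have Ii: "(%r. r ^ 3 / (h + gamma_S al ep r) ^ 3) integrable_on {0..r0}" using gamma_quotient_integrable h r0 by simp
 define s where "s = 1 / h - 2 / u r0 + h / (u r0)^2"
 have S: "((%r. r ^ 3 / (u r) ^ 3) has_integral s) {0..r0}"
  using sphere_integral[of h r0] h r0 by (simp add: u_def s_def)
 have "h / (u r0)^2 <= 1 / u r0" using u[of r0] by (simp add: power2_eq_square divide_le_eq)
 moreover have "0 <= h / (u r0)^2" "0 < 1 / u r0" using u[of r0] h by auto
 moreover have "1 / u r0 <= 1 / (r0^2 / 2)" using u[of r0] r0 by (intro divide_left_mono) auto
 ultimately have s: "s <= 1 / h" "1 / h - 4 / r0^2 <= s" unfolding s_def by auto
 have "I <= s" unfolding I_def
 proof (rule has_integral_le[OF integrable_integral[OF Ii] S])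
  show "r ^ 3 / (h + gamma_S al ep r) ^ 3 <= r ^ 3 / (u r) ^ 3" if "r \<in> {0..r0}" for r
   using gamma_ge(2)[of r] that r0 h u[of r] by (intro divide_left_mono power_mono mult_pos_pos zero_less_power) (auto simp: u_def)
 qed
 then have up: "I <= 1 / h" using s by linarith
 have L: "((%r. r / u r) has_integral integral {0..r0} (%r. r / u r)) {0..r0}" "integral {0..r0} (%r. r / u r) <= \<bar>ln h\<bar>"
  using sphere_log_integral[of h r0] h r0 by (auto simp: u_def intro: integrable_integral)
 have "(1 - 6 * b) * s - 12 * integral {0..r0} (%r. r / u r) <= I" unfolding I_def
 proof (rule has_integral_le[OF _ integrable_integral[OF Ii]])
  show "((%r. (1 - 6 * b) * (r ^ 3 / (u r) ^ 3) - 12 * (r / u r)) has_integral (1 - 6 * b) * s - 12 * integral {0..r0} (%r. r / u r)) {0..r0}"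
   by (intro has_integral_diff has_integral_mult_right S L)
  fix r assume r: "r \<in> {0..r0}"
  define y where "y = h + gamma_S al ep r"
  define k where "k = u r"
  have k: "0 < k" "r^2 / 2 <= k" using u by (auto simp: k_def)
  have ky: "k <= y" using gamma_ge(2)[of r] r r0 by (simp add: k_def u_def y_def)
  have "r ^ 4 / 2 = r^2 * (r^2 / 2)" by (simp add: power2_eq_square power4_eq_xxxx)
  also have "... <= r^2 * k" using k by (intro mult_left_mono) auto
  finally have r4: "r ^ 4 / 2 <= r^2 * k" .
  have "w r <= 2 * b * k" using w_le[of h r] r h by (simp add: b_def k_def u_def)
  moreover have "y - k <= r ^ 4 / 2 + w r" using gamma_upper(2)[of r] r r0 by (simp add: y_def k_def u_def)
  ultimately have "y - k <= (2 * b + r^2) * k" using r4 unfolding distrib_right by linarith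
  then have "3 * (y - k) / (k ^ 3 * y) <= 3 * ((2 * b + r^2) * k) / (k ^ 3 * k)"
   using k ky b by (intro frac_le mult_left_mono mult_pos_pos mult_nonneg_nonneg) auto
  then have "1 / k ^ 3 - 1 / y ^ 3 <= 3 * ((2 * b + r^2) * k) / (k ^ 3 * k)" using diff_cubes_le(2)[OF k(1) ky] by linarith
  also have "... = 6 * b * (1 / k ^ 3) + 3 * r^2 / k ^ 3" using k by (simp add: field_simps)
  finally have "r ^ 3 * ((1 - 6 * b) * (1 / k ^ 3) - 3 * r^2 / k ^ 3) <= r ^ 3 * (1 / y ^ 3)"
   using r by (intro mult_left_mono) (auto simp: algebra_simps)
  moreover have "r ^ 3 * (3 * r^2 / k ^ 3) <= 12 * (r / k)"
  proof -
   have "(r^2 / 2)^2 <= k^2" using k by (intro power_mono) auto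
   then have "r * (r^2)^2 <= r * (4 * k^2)" using r by (intro mult_left_mono) (auto simp: power_divide)
   then have "3 * (r * (r^2)^2) / k ^ 3 <= 3 * (r * (4 * k^2)) / k ^ 3" using k by (intro divide_right_mono mult_left_mono[of _ _ "3::real"]) auto
   moreover have "3 * (r * (4 * k^2)) / k ^ 3 = 12 * (r / k)" using k by (simp add: power2_eq_square power3_eq_cube)
   moreover have "r ^ 3 * (3 * r^2 / k ^ 3) = 3 * (r * (r^2)^2) / k ^ 3" by (simp add: power2_eq_square power3_eq_cube)
   ultimately show ?thesis by linarith
  qed
  moreover have "a * ((1 - 6 * b) * (1 / c) - d) = (1 - 6 * b) * (a / c) - a * d" for a c d :: real
   by (simp add: algebra_simps diff_divide_distrib)
  from this[of "r ^ 3" "k ^ 3" "3 * r^2 / k ^ 3"]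
  have "r ^ 3 * ((1 - 6 * b) * (1 / k ^ 3) - 3 * r^2 / k ^ 3) = (1 - 6 * b) * (r ^ 3 / k ^ 3) - r ^ 3 * (3 * r^2 / k ^ 3)" .
  moreover have "r ^ 3 * (1 / y ^ 3) = r ^ 3 / y ^ 3" by simp
  ultimately have "(1 - 6 * b) * (r ^ 3 / k ^ 3) - 12 * (r / k) <= r ^ 3 / y ^ 3" by linarith
  then show "(1 - 6 * b) * (r ^ 3 / (u r) ^ 3) - 12 * (r / u r) <= r ^ 3 / (h + gamma_S al ep r) ^ 3" by (simp add: k_def y_def)
 qed
 moreover have "(1 - 6 * b) * (1 / h - 4 / r0^2) <= (1 - 6 * b) * s" using s b by (intro mult_left_mono) auto
 moreover have "(1 - 6 * b) * (1 / h - 4 / r0^2) = 1 / h - 6 * b / h - 4 / r0^2 + 6 * b * (4 / r0^2)" by (simp add: algebra_simps diff_divide_distrib)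
 moreover have "0 <= 6 * b * (4 / r0^2)" using b by simp
 ultimately have lo: "1 / h - (6 * b / h + 4 / r0^2 + 12 * \<bar>ln h\<bar>) <= I" using L(2) by linarith
 have A: "approx_drag al r0 ep h = 6 * pi * I" by (simp add: approx_drag_def I_def)
 show "approx_drag al r0 ep h <= 6 * pi / h" using mult_left_mono[OF up, of "6 * pi"] by (simp add: A)
 show "6 * pi / h - 6 * pi * (6 * beta al ep h / h + 4 / r0^2 + 12 * \<bar>ln h\<bar>) <= approx_drag al r0 ep h"
  using mult_left_mono[OF lo, of "6 * pi"] unfolding A b_def[symmetric] by (simp add: right_diff_distrib)
qed

end

lemma lambda_coeff_nonneg: assumes "0 <= al" "al < 1" shows "0 <= lambda_coeff al"
proof -
 have "0 < cos (pi * al / 2)"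
 proof (rule cos_gt_zero_pi)
  have "0 <= pi * al" "pi * al < pi * 1" using assms by (auto intro: mult_strict_left_mono)
  then show "- (pi / 2) < pi * al / 2" "pi * al / 2 < pi / 2" using pi_gt_zero by linarith+
 qed
 moreover have "al^2 <= 1" using assms by (simp add: power_le_one)
 ultimately show ?thesis using assms unfolding lambda_coeff_def by (intro divide_nonneg_nonneg mult_nonneg_nonneg) auto
qed

lemma part_b:
 assumes al: "0 <= al" "al < 1" and r0: "0 < r0" "r0 <= 1"
 shows "\<exists>C. \<exists>h\<^sub>0>0. \<exists>be\<^sub>0>0. \<forall>ep>0. \<forall>h\<in>{0<..<h\<^sub>0}. beta al ep h < be\<^sub>0 -->
    expansion C (approx_drag al r0 ep h)
     (6 * pi / (h + lambda_coeff al * ep * h powr ((al + 1) / 2)))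
     (beta al ep h) \<bar>ln h\<bar>"
proof -
 define La where "La = lambda_coeff al"
 have La: "0 <= La" using lambda_coeff_nonneg[OF al] by (simp add: La_def)
 \<comment> \<open>\<open>6\<close> comes from the perturbed integrand, \<open>2 * La\<close> covers
   the passage from \<open>6 * pi / h\<close> to the stated leading term, and the rest absorbs
   \<open>4 / r0^2\<close> into the logarithm by means of
   \<open>ln 2 <= \<bar>ln h\<bar>\<close>.\<close>
 define C where "C = 6 + 2 * La + 6 * pi * (4 / r0^2 / ln 2 + 12)"
 have C0: "0 <= 6 * pi * (4 / r0^2 / ln 2 + 12)" by simp
 show ?thesis
 proof (rule exI[of _ C], rule exI[of _ "1 / 2"], intro conjI, simp, rule exI[of _ "1 / 6"], intro conjI allI ballI impI)
  fix ep h :: real assume ep: "0 < ep" and h: "h \<in> {0<..<1 / 2}" and b6: "beta al ep h < 1 / 6"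
  interpret tip_profile al ep by unfold_locales (use al ep in auto)
  define b where "b = beta al ep h"
  have b: "0 <= b" "b < 1 / 6" using ep b6 by (auto simp: b_def beta_def)
  have hh: "0 < h" "h < 1 / 2" using h by auto
  define X where "X = 6 * pi / (h + lambda_coeff al * ep * h powr ((al + 1) / 2))"
  define A where "A = approx_drag al r0 ep h"
  have "h powr ((al - 1) / 2) * h = h powr ((al + 1) / 2)"
   using powr_add[of h "(al - 1) / 2" 1] hh by (simp add: field_simps)
  then have "h + lambda_coeff al * ep * h powr ((al + 1) / 2) = h * (1 + La * b)"
   by (simp add: La_def b_def beta_def algebra_simps)
  then have X: "X = 6 * pi / (h * (1 + La * b))" by (simp add: X_def)
  have lb: "0 <= La * b" using La b by simp
  then have p1: "0 < 1 + La * b" by linarith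
  have Xp: "0 < X" unfolding X using hh p1 by (intro divide_pos_pos mult_pos_pos) auto
  have ph: "6 * pi / h = X + La * b * X"
  proof -
   have "6 * pi / h = X * (1 + La * b)" unfolding X using p1 hh by simp
   then show ?thesis by (simp add: algebra_simps)
  qed
  have l2: "ln 2 <= \<bar>ln h\<bar>" using ln_ge_ln2[OF hh] .
  have bound: "6 * pi * (6 * b / h + 4 / r0^2 + 12 * \<bar>ln h\<bar>) <= 6 * b * (X + La * b * X) + 6 * pi * (4 / r0^2 / ln 2 + 12) * \<bar>ln h\<bar>"
  proof -
   have "4 / r0^2 * 1 <= 4 / r0^2 * (\<bar>ln h\<bar> / ln 2)" using l2 by (intro mult_left_mono) auto
   then have "6 * pi * (4 / r0^2 + 12 * \<bar>ln h\<bar>) <= 6 * pi * ((4 / r0^2 / ln 2 + 12) * \<bar>ln h\<bar>)"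
    by (intro mult_left_mono) (auto simp: algebra_simps)
   moreover have "6 * pi * (6 * b / h) = 6 * b * (6 * pi / h)" by simp
   ultimately show ?thesis unfolding ph by (simp add: algebra_simps)
  qed
  have q: "La * b * b * X <= La * (1 / 6) * b * X" using La b Xp by (intro mult_right_mono mult_left_mono) auto
  have "0 <= La * b * X" "0 <= b * X" using lb Xp b by simp_all
  then have "\<bar>A - X\<bar> <= (6 + 2 * La) * b * X + 6 * pi * (4 / r0^2 / ln 2 + 12) * \<bar>ln h\<bar>"
   using approx_drag_near_sphere[OF hh r0 b6] bound q mult_nonneg_nonneg[OF C0 abs_ge_zero[of "ln h"]]
   unfolding A_def[symmetric] b_def[symmetric] ph by (simp add: abs_le_iff algebra_simps)
  moreover have "(6 + 2 * La) * b * X <= C * b * X" using b Xp C0 unfolding C_def by (intro mult_right_mono) auto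
  moreover have "6 * pi * (4 / r0^2 / ln 2 + 12) * \<bar>ln h\<bar> <= C * \<bar>ln h\<bar>" using La unfolding C_def by (intro mult_right_mono) auto
  ultimately have "\<bar>A - X\<bar> <= C * b * X + C * \<bar>ln h\<bar>" by linarith
  moreover have "0 <= C" using La C0 by (simp add: C_def)
  ultimately show "expansion C (approx_drag al r0 ep h) (6 * pi / (h + lambda_coeff al * ep * h powr ((al + 1) / 2))) (beta al ep h) \<bar>ln h\<bar>"
   unfolding X_def[symmetric] A_def[symmetric] b_def[symmetric] using b by (intro expansionI[OF Xp]) auto
 qed simp
qed

section \<open>Large \<open>beta\<close>, exponent above \<open>1 / 3\<close>\<close>

context tip_profile begin

text \<open>The spherical part of the height is dropped. What remains is homogeneous up to scaling
  and serves as leading term for \<open>al >= 1 / 3\<close>.\<close>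

definition "flat_integrand h r = r ^ 3 / (h + w r) ^ 3"
definition "lub_integrand h r = r ^ 3 / (h + gamma_S al ep r) ^ 3"

lemma approx_drag_eq: "approx_drag al r0 ep h = 6 * pi * integral {0..r0} (lub_integrand h)"
 by (simp add: approx_drag_def lub_integrand_def[abs_def])

lemma continuous_on_w: "continuous_on {0..} w"
 unfolding w_def[abs_def] using al by (intro continuous_intros continuous_on_powr') auto

lemma integrands_integrable:
 assumes "0 < h" "0 <= a" "b <= 1"
 shows "lub_integrand h integrable_on {a..b}" "flat_integrand h integrable_on {a..b}"
proof -
 show "lub_integrand h integrable_on {a..b}" unfolding lub_integrand_def[abs_def] by (rule gamma_quotient_integrable[OF assms])
 have "continuous_on {a..b} w" using assms by (intro continuous_on_subset[OF continuous_on_w]) auto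
 moreover have "h + w r ~= 0" for r using w_pos(1)[of r] assms by linarith
 ultimately show "flat_integrand h integrable_on {a..b}" unfolding flat_integrand_def[abs_def]
  by (intro integrable_continuous_interval continuous_intros) auto
qed

text \<open>The lower bound \<open>k\<close> of the height is left open: \<open>h\<close> near the
  axis, \<open>r^2 / 2\<close> farther out, and the sum of \<open>r^2 / 2\<close> and the power term
  in the critical case.\<close>

lemma integrand_diff:
 assumes "0 < h" "0 < r" "r <= 1" and k: "0 < k" "k <= h + gamma_S al ep r"
 shows "0 <= flat_integrand h r - lub_integrand h r"
  "flat_integrand h r - lub_integrand h r <= 3 * r ^ 5 / ((w r) ^ 3 * k)"
proof -
 define x where "x = h + w r"
 define y where "y = h + gamma_S al ep r"
 have x: "0 < x" "w r <= x" using w_pos(1)[of r] assms by (auto simp: x_def)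
 have wp: "0 < w r" using w_pos(2) assms by simp
 have xy: "x <= y" "y - x <= r^2" using gamma_lower[of r] gamma_upper(1)[of r] assms by (auto simp: x_def y_def intro: order_trans[rotated])
 have e: "flat_integrand h r - lub_integrand h r = r ^ 3 * (1 / x ^ 3 - 1 / y ^ 3)"
  by (simp add: flat_integrand_def lub_integrand_def x_def y_def right_diff_distrib)
 show "0 <= flat_integrand h r - lub_integrand h r"
  unfolding e using diff_cubes_le(1)[OF x(1) xy(1)] assms by (intro mult_nonneg_nonneg) auto
 have "3 * (y - x) / (x ^ 3 * y) <= 3 * r^2 / ((w r) ^ 3 * k)"
  using xy x wp k unfolding y_def[symmetric] by (intro frac_le mult_mono power_mono mult_pos_pos) auto
 then have "1 / x ^ 3 - 1 / y ^ 3 <= 3 * r^2 / ((w r) ^ 3 * k)" using diff_cubes_le(2)[OF x(1) xy(1)] by linarith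
 then have "r ^ 3 * (1 / x ^ 3 - 1 / y ^ 3) <= r ^ 3 * (3 * r^2 / ((w r) ^ 3 * k))" using assms by (intro mult_left_mono) auto
 also have "... = 3 * r ^ 5 / ((w r) ^ 3 * k)" by (simp add: power_add[symmetric])
 finally show "flat_integrand h r - lub_integrand h r <= 3 * r ^ 5 / ((w r) ^ 3 * k)" unfolding e .
qed

lemma w_cubed: "0 < r ==> (w r) ^ 3 = ep ^ 3 * r powr (3 + 3 * al)"
 by (simp add: w_def power_mult_distrib powr_power algebra_simps)

text \<open>The integral is split at \<open>sqrt h\<close>, where the lower bounds \<open>h\<close>
  and \<open>r^2 / 2\<close> change places. The inner part, of order
  \<open>r powr (2 - 3 * al) / h\<close>, converges at 0 since \<open>al < 1\<close>; the outer one,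
  of order \<open>r powr (- 3 * al)\<close>, is governed by its lower end since
  \<open>al > 1 / 3\<close>. Both yield the same power of \<open>h\<close>.\<close>

lemma flat_lub_above:
 assumes h: "0 < h" "h < r0^2" and r0: "0 < r0" "r0 <= 1" and al3: "1 / 3 < al"
 shows "0 <= integral {0..r0} (flat_integrand h) - integral {0..r0} (lub_integrand h)"
  "integral {0..r0} (flat_integrand h) - integral {0..r0} (lub_integrand h)
    <= (3 / (3 - 3 * al) + 6 / (3 * al - 1)) * (h powr ((1 - 3 * al) / 2) / ep ^ 3)"
proof -
 define f where "f r = flat_integrand h r - lub_integrand h r" for r
 define c where "c = sqrt h"
 have c: "0 < c" "c <= r0" "c^2 = h" using h r0 by (auto simp: c_def real_le_lsqrt)
 have fi: "f integrable_on {a..b}" if "0 <= a" "b <= 1" for a b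
  unfolding f_def[abs_def] using h(1) that by (intro integrable_diff integrands_integrable) auto
 have f0: "0 <= f r" if "0 <= r" "r <= 1" for r
  using integrand_diff(1)[of h r "h + gamma_S al ep r"] gamma_ge(3)[of r] that h
  by (cases "r = 0") (auto simp: f_def flat_integrand_def lub_integrand_def)
 have J: "integral {0..r0} f = integral {0..r0} (flat_integrand h) - integral {0..r0} (lub_integrand h)"
  unfolding f_def[abs_def] using h r0 by (intro integral_diff integrands_integrable) auto
 show "0 <= integral {0..r0} (flat_integrand h) - integral {0..r0} (lub_integrand h)"
  unfolding J[symmetric] by (intro integral_nonneg fi) (use r0 f0 in auto)
 have cut: "3 * r ^ 5 / ((w r) ^ 3 * k) = 3 / ep ^ 3 * (r powr (2 - 3 * al) / k)" if "0 < r" for r k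
 proof -
  have "r ^ 5 / r powr (3 + 3 * al) = r powr (2 - 3 * al)" using that powr_diff[of r 5 "3 + 3 * al"] by simp
  moreover have "3 * r ^ 5 / ((w r) ^ 3 * k) = 3 / ep ^ 3 * (r ^ 5 / r powr (3 + 3 * al) / k)" using that by (simp add: w_cubed)
  ultimately show ?thesis by simp
 qed
 have "integral {0..c} f <= 3 / ep ^ 3 / h * (c powr (3 - 3 * al) / (3 - 3 * al)) - 3 / ep ^ 3 / h * (0 powr (3 - 3 * al) / (3 - 3 * al))"
 proof (rule integral_le_antiderivative[where pf = "%r. 3 / ep ^ 3 / h * r powr (2 - 3 * al)"])
  show "((%r. 3 / ep ^ 3 / h * (r powr (3 - 3 * al) / (3 - 3 * al))) has_real_derivative 3 / ep ^ 3 / h * r powr (2 - 3 * al)) (at r)" if "0 < r" for r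
  proof (rule DERIV_cmult)
   have "((%r. r powr (3 - 3 * al) / (3 - 3 * al)) has_real_derivative (3 - 3 * al) * r powr (3 - 3 * al - 1) / (3 - 3 * al)) (at r)"
    using that by (intro DERIV_cdivide) (auto intro!: derivative_eq_intros)
   then show "((%r. r powr (3 - 3 * al) / (3 - 3 * al)) has_real_derivative r powr (2 - 3 * al)) (at r)" using al by simp
  qed
  have "continuous_on {0..c} (%r. r powr (3 - 3 * al))" using al by (intro continuous_on_powr' continuous_intros) auto
  then show "continuous_on {0..c} (%r. 3 / ep ^ 3 / h * (r powr (3 - 3 * al) / (3 - 3 * al)))"
   using al by (intro continuous_on_mult continuous_on_const continuous_on_divide) auto
  show "f r <= 3 / ep ^ 3 / h * r powr (2 - 3 * al)" if "0 < r" "r < c" for r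
   using integrand_diff(2)[of h r h] gamma_ge(3)[of r] that c r0 h by (simp add: f_def cut)
 qed (use c r0 fi in auto)
 also have "... = 3 / (3 - 3 * al) * (h powr ((1 - 3 * al) / 2) / ep ^ 3)"
 proof -
  have "c powr (3 - 3 * al) = h powr ((3 - 3 * al) / 2)" using h by (simp add: c_def powr_half_sqrt[symmetric] powr_powr)
  also have "... / h = h powr ((1 - 3 * al) / 2)" using h powr_diff[of h "(3 - 3 * al) / 2" 1] by (simp add: field_simps)
  finally have "c powr (3 - 3 * al) / h = h powr ((1 - 3 * al) / 2)" .
  moreover have "3 / E / h * (C / D) - 3 / E / h * (0 powr (3 - 3 * al) / D) = 3 / D * (C / h / E)" for C D E :: real by simp
  ultimately show ?thesis by metis
 qed
 finally have 1: "integral {0..c} f <= 3 / (3 - 3 * al) * (h powr ((1 - 3 * al) / 2) / ep ^ 3)" .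
 have "integral {c..r0} f <= 6 / ep ^ 3 * (r0 powr (1 - 3 * al) / (1 - 3 * al)) - 6 / ep ^ 3 * (c powr (1 - 3 * al) / (1 - 3 * al))"
 proof (rule integral_le_antiderivative[where pf = "%r. 6 / ep ^ 3 * r powr (- 3 * al)"])
  show d: "((%r. 6 / ep ^ 3 * (r powr (1 - 3 * al) / (1 - 3 * al))) has_real_derivative 6 / ep ^ 3 * r powr (- 3 * al)) (at r)" if "c < r" for r
  proof (rule DERIV_cmult)
   have "((%r. r powr (1 - 3 * al) / (1 - 3 * al)) has_real_derivative (1 - 3 * al) * r powr (1 - 3 * al - 1) / (1 - 3 * al)) (at r)"
    using that c by (intro DERIV_cdivide) (auto intro!: derivative_eq_intros)
   then show "((%r. r powr (1 - 3 * al) / (1 - 3 * al)) has_real_derivative r powr (- 3 * al)) (at r)" using al3 by simp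
  qed
  have "continuous_on {c..r0} (%r. r powr (1 - 3 * al))" using c by (intro continuous_on_powr continuous_intros) auto
  then show "continuous_on {c..r0} (%r. 6 / ep ^ 3 * (r powr (1 - 3 * al) / (1 - 3 * al)))"
   using al3 by (intro continuous_on_mult continuous_on_const continuous_on_divide) auto
  show "f r <= 6 / ep ^ 3 * r powr (- 3 * al)" if "c < r" "r < r0" for r
  proof -
   have r: "0 < r" "r <= 1" using that c r0 by auto
   have "f r <= 3 * r ^ 5 / ((w r) ^ 3 * (r^2 / 2))"
    unfolding f_def using r h gamma_ge(2)[of r] by (intro integrand_diff) auto
   also have "... = 3 / ep ^ 3 * (r powr (2 - 3 * al) / (r^2 / 2))" by (rule cut[OF r(1)])
   also have "r powr (2 - 3 * al) / (r^2 / 2) = 2 * r powr (- 3 * al)"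
    using r powr_diff[of r "2" "3 * al"] by (simp add: powr_minus_divide)
   finally show ?thesis by simp
  qed
 qed (use c r0 fi in auto)
 also have "... <= 6 / (3 * al - 1) * (h powr ((1 - 3 * al) / 2) / ep ^ 3)"
 proof -
  have "r0 powr (1 - 3 * al) / (1 - 3 * al) <= 0" using al3 by (simp add: divide_nonneg_neg)
  then have "6 / ep ^ 3 * (r0 powr (1 - 3 * al) / (1 - 3 * al)) <= 0" by (rule mult_nonneg_nonpos[rotated]) (use ep in simp)
  moreover have ch: "c powr (1 - 3 * al) = h powr ((1 - 3 * al) / 2)" using h by (simp add: c_def powr_half_sqrt[symmetric] powr_powr)
  moreover have "- (6 / E * (H / - d)) = 6 / d * (H / E)" for E H d :: real by simp
  from this[of "ep ^ 3" "c powr (1 - 3 * al)" "3 * al - 1"]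
  have "- (6 / ep ^ 3 * (c powr (1 - 3 * al) / (1 - 3 * al))) = 6 / (3 * al - 1) * (c powr (1 - 3 * al) / ep ^ 3)"
   by (simp only: minus_diff_eq)
  ultimately show ?thesis unfolding ch by linarith
 qed
 finally have 2: "integral {c..r0} f <= 6 / (3 * al - 1) * (h powr ((1 - 3 * al) / 2) / ep ^ 3)" .
 have "integral {0..r0} f = integral {0..c} f + integral {c..r0} f"
  using Henstock_Kurzweil_Integration.integral_combine[of 0 c r0 f] c r0 fi[of 0 r0] by simp
 then show "integral {0..r0} (flat_integrand h) - integral {0..r0} (lub_integrand h)
    <= (3 / (3 - 3 * al) + 6 / (3 * al - 1)) * (h powr ((1 - 3 * al) / 2) / ep ^ 3)"
  using 1 2 unfolding J[symmetric] distrib_right by linarith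
qed

end

text \<open>The flat integrand after scaling by the radius at which the power term equals
  \<open>h\<close>.\<close>

definition above_integrand :: "real => real => real" where
 "above_integrand al t = t ^ 3 / (1 + t powr (1 + al)) ^ 3"

lemma above_integrand_borel [measurable]: "above_integrand al \<in> bm"
 unfolding above_integrand_def[abs_def] by measurable

lemma above_integrand_bounds:
 assumes "0 <= t" shows "0 <= above_integrand al t" "above_integrand al t <= 1 * t powr (- 3 * al)" "t <= 1 ==> above_integrand al t <= 1 * t powr 0"
proof -
 define y where "y = t powr (1 + al)"
 have y: "0 <= y" by (simp add: y_def)
 show "0 <= above_integrand al t" using assms y by (simp add: above_integrand_def y_def[symmetric])
 show "above_integrand al t <= 1 * t powr (- 3 * al)"
 proof (cases "t = 0")
  case False
  then have t: "0 < t" using assms by simp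
  then have yp: "0 < y" by (simp add: y_def)
  have "above_integrand al t <= t ^ 3 / y ^ 3" unfolding above_integrand_def y_def[symmetric]
   using yp t by (intro divide_left_mono power_mono mult_pos_pos zero_less_power) auto
  also have "y ^ 3 = t powr (3 + 3 * al)" using t by (simp add: y_def powr_power algebra_simps)
  also have "t ^ 3 = t powr 3" using t by simp
  also have "t powr 3 / t powr (3 + 3 * al) = t powr (- 3 * al)" by (simp add: powr_diff[symmetric])
  finally show ?thesis by simp
 qed (simp add: above_integrand_def)
 assume "t <= 1"
 show "above_integrand al t <= 1 * t powr 0"
 proof (cases "t = 0")
  case False
  have "t ^ 3 <= 1" using assms \<open>t <= 1\<close> by (simp add: power_le_one)
  moreover have "1 <= (1 + y) ^ 3" using y by (intro one_le_power) auto
  ultimately have "t ^ 3 / (1 + y) ^ 3 <= 1 / 1" by (intro frac_le[OF zero_le_one _ zero_less_one])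
  then show ?thesis using False by (simp add: above_integrand_def y_def)
 qed (simp add: above_integrand_def)
qed

lemma above_integrand_integrable:
 assumes "1 / 3 < al" and T: "0 < T"
 shows "above_integrand al integrable_on {0..T}" "above_integrand al integrable_on {T..}" "above_integrand al integrable_on {0..}"
  "0 <= integral {T..} (above_integrand al)" "integral {T..} (above_integrand al) <= T powr (1 - 3 * al) / (3 * al - 1)"
proof -
 have to_inf: "above_integrand al integrable_on {c..}" "integral {c..} (above_integrand al) <= 1 * (- (c powr (- 3 * al + 1)) / (- 3 * al + 1))"
  "0 <= integral {c..} (above_integrand al)" if "0 < c" for c
  using integral_to_inf_bound[OF above_integrand_borel, of "- 3 * al" c al 1] above_integrand_bounds[of _ al] assms that by auto
 have "above_integrand al integrable_on {0..1}"
  using integral_from_0_bound(1)[OF above_integrand_borel, of 0 1 al 1] above_integrand_bounds[of _ al] by auto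
 from half_line_integral(1)[OF this to_inf(1)] show i: "above_integrand al integrable_on {0..}" by simp
 show "above_integrand al integrable_on {0..T}" by (rule integrable_on_subinterval[OF i]) auto
 show "above_integrand al integrable_on {T..}" "0 <= integral {T..} (above_integrand al)" using to_inf[OF T] by auto
 have "1 * (- x / (- 3 * al + 1)) = x / (3 * al - 1)" for x using minus_divide_divide[of x "3 * al - 1"] by simp
 with to_inf(2)[OF T] show "integral {T..} (above_integrand al) <= T powr (1 - 3 * al) / (3 * al - 1)" by (simp add: add.commute)
qed

text \<open>The substitution \<open>u = t powr (1 + al)\<close> on the open half-line, whose
  Jacobian accounts for the factor \<open>1 / (1 + al)\<close>.\<close>

lemma mu_above_eq:
 assumes "1 / 3 < al" shows "mu_above al = integral {0..} (above_integrand al)" "0 < mu_above al"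
proof -
 define F where "F u = u powr ((3 - al) / (1 + al)) / (1 + u) ^ 3" for u :: real
 define g where "g t = t powr (1 + al)" for t :: real
 have img: "g ` {0<..} = {0<..}"
 proof
  show "{0<..} \<subseteq> g ` {0<..}"
  proof
   fix u :: real assume "u \<in> {0<..}"
   then have "u = g (u powr (1 / (1 + al)))" using assms by (simp add: g_def powr_powr)
   then show "u \<in> g ` {0<..}" using \<open>u \<in> {0<..}\<close> by (intro image_eqI[of _ g "u powr (1 / (1 + al))"]) auto
  qed
 qed (auto simp: g_def)
 have inj: "inj_on g {0<..}"
  by (rule inj_on_inverseI[of _ "%u. u powr (1 / (1 + al))"]) (use assms in \<open>simp add: g_def powr_powr\<close>)
 have der: "(g has_field_derivative (1 + al) * t powr al) (at t within {0<..})" if "t \<in> {0<..}" for t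
  unfolding g_def[abs_def] using that by (auto intro!: derivative_eq_intros)
 have eq: "\<bar>(1 + al) * t powr al\<bar> * F (g t) = (1 + al) * above_integrand al t" if "t \<in> {0<..}" for t
 proof -
  have "t powr al * (g t) powr ((3 - al) / (1 + al)) = t ^ 3" using that assms by (simp add: g_def powr_powr powr_add[symmetric])
  then have "t powr al * F (g t) = above_integrand al t" unfolding F_def above_integrand_def g_def by (simp add: times_divide_eq_right)
  then show ?thesis using assms by (simp add: abs_mult)
 qed
 have i0: "above_integrand al integrable_on {0..}" using above_integrand_integrable(3)[OF assms, of 1] by simp
 have cong: "(f has_integral I) {0..} \<longleftrightarrow> (f has_integral I) {0<..}" for f :: "real => real" and I
  by (rule has_integral_spike_set_eq; rule negligible_subset[OF negligible_sing[of 0]]) (auto simp: le_less)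
 have "((%t. (1 + al) * above_integrand al t) has_integral (1 + al) * integral {0..} (above_integrand al)) {0<..}"
  unfolding cong[symmetric] by (intro has_integral_mult_right integrable_integral i0)
 then have L: "((%t. \<bar>(1 + al) * t powr al\<bar> * F (g t)) has_integral (1 + al) * integral {0..} (above_integrand al)) {0<..}"
  by (rule has_integral_eq[rotated]) (use eq in simp)
 moreover have "(%t. \<bar>(1 + al) * t powr al\<bar> * F (g t)) absolutely_integrable_on {0<..}"
  by (rule nonnegative_absolutely_integrable_1[OF has_integral_integrable[OF L]]) (auto simp: F_def g_def)
 ultimately have "F absolutely_integrable_on g ` {0<..} \<and> integral (g ` {0<..}) F = (1 + al) * integral {0..} (above_integrand al)"
  using has_absolute_integral_change_of_variables_1'[OF _ der inj, of F "(1 + al) * integral {0..} (above_integrand al)"]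
  by (auto simp: integral_unique)
 then have "(F has_integral (1 + al) * integral {0..} (above_integrand al)) {0<..}" unfolding img
  using integrable_integral[of F "{0<..}"] by (auto simp: absolutely_integrable_on_def)
 then have "integral {0..} F = (1 + al) * integral {0..} (above_integrand al)" unfolding cong[symmetric] by (rule integral_unique)
 then show "mu_above al = integral {0..} (above_integrand al)" using assms by (simp add: mu_above_def F_def[abs_def])
 also have "0 < ..."
 proof (rule half_line_integral_pos[OF i0 above_integrand_bounds(1)])
  fix t :: real assume t: "1 <= t" "t <= 2"
  have "1 <= t ^ 3" using t by simp
  moreover have "(1 + t powr (1 + al)) ^ 3 <= (1 + 2 powr (1 + al)) ^ 3" using t assms by (intro power_mono add_left_mono powr_mono2) auto
  ultimately show "1 / (1 + 2 powr (1 + al)) ^ 3 <= above_integrand al t" unfolding above_integrand_def using t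
   by (intro frac_le) (auto intro!: zero_less_power add_pos_nonneg)
 qed (auto intro!: divide_pos_pos zero_less_power add_pos_nonneg)
 finally show "0 < mu_above al" .
qed

lemma part_c_above:
 assumes hal: "1 / 3 < al" "al < 1" and r0: "0 < r0" "r0 <= 1"
 shows "\<exists>C. \<exists>h\<^sub>0>0. \<exists>be\<^sub>0>0. \<forall>ep>0. \<forall>h\<in>{0<..<h\<^sub>0}. beta al ep h > be\<^sub>0 -->
      expansion C (approx_drag al r0 ep h)
       (6 * pi * mu_above al /
        (ep powr (4 / (1 + al)) * h powr ((3 * al - 1) / (al + 1))))
       (beta al ep h powr ((1 - 3 * al) / (1 + al))) \<bar>ln h\<bar>"
proof -
 define mv where "mv = mu_above al"
 have mv: "0 < mv" "mv = integral {0..} (above_integrand al)" using mu_above_eq[OF hal(1)] by (auto simp: mv_def)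
 define B where "B = 3 / (3 - 3 * al) + 6 / (3 * al - 1) + r0 powr (1 - 3 * al) / (3 * al - 1)"
 have B: "0 <= B" using hal by (simp add: B_def)
 show ?thesis
 proof (rule exI[of _ "B / mv"], rule exI[of _ "r0^2"], intro conjI, use r0 in simp, rule exI[of _ 1], intro conjI allI ballI impI)
  fix ep h :: real assume ep: "0 < ep" and hh: "h \<in> {0<..<r0^2}"
  interpret tip_profile al ep by unfold_locales (use hal ep in auto)
  have h: "0 < h" "h < r0^2" "h <= 1" using hh power_le_one[of r0 2] r0 by auto
  \<comment> \<open>Each power product of \<open>h\<close> and \<open>ep\<close> below is the
    exponential of a linear form in \<open>L\<close> and \<open>M\<close>, so identities between
    them reduce to identities of coefficients.\<close>
  define L where "L = ln h"
  define M where "M = ln ep"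
  \<comment> \<open>The radius at which \<open>w\<close> reaches \<open>h\<close>, that is,
    \<open>rh powr (1 + al) = h / ep\<close>.\<close>
  define rh where "rh = exp ((L - M) / (1 + al))"
  have rh: "0 < rh" "ln rh = (L - M) / (1 + al)" by (simp_all add: rh_def)
  define P where "P = rh ^ 4 / h ^ 3"
  have Pp: "0 < P" using rh h by (simp add: P_def)
  define E where "E = h powr ((1 - 3 * al) / 2) / ep ^ 3"
  define X where "X = 6 * pi * mu_above al / (ep powr (4 / (1 + al)) * h powr ((3 * al - 1) / (al + 1)))"
  define e where "e = beta al ep h powr ((1 - 3 * al) / (1 + al))"
  have Pexp: "P = exp (4 * ((L - M) / (1 + al)) - 3 * L)"
   using rh h by (simp add: P_def power_eq_exp exp_diff L_def)
  have X: "X = 6 * pi * mv * P"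
  proof -
   have "ep powr (4 / (1 + al)) * h powr ((3 * al - 1) / (al + 1)) = exp (4 / (1 + al) * M + (3 * al - 1) / (al + 1) * L)"
    using h ep by (simp add: powr_def exp_add L_def M_def)
   moreover have "- (4 / (1 + al) * M + (3 * al - 1) / (al + 1) * L) = 4 * ((L - M) / (1 + al)) - 3 * L"
   proof -
    have "- (4 / a * M + (3 * x - 1) / a * L) = 4 * ((L - M) / a) - 3 * L"
     if "x = a - 1" "a ~= 0" for x a by (simp add: that field_simps)
    from this[of al "1 + al"] show ?thesis using hal by (simp add: add.commute)
   qed
   ultimately have "1 / (ep powr (4 / (1 + al)) * h powr ((3 * al - 1) / (al + 1))) = P"
    unfolding Pexp by (metis exp_minus inverse_eq_divide)
   then show ?thesis unfolding X_def mv_def by (metis times_divide_eq_right mult.right_neutral)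
  qed
  \<comment> \<open>The error of dropping the sphere, relative to the leading factor
    \<open>P\<close>, is exactly the stated power of \<open>beta\<close>.\<close>
  have E: "E = P * e"
  proof -
   have bp: "0 < beta al ep h" using h ep by (simp add: beta_def)
   have "ln (beta al ep h) = M + (al - 1) / 2 * L" using h ep by (simp add: beta_def ln_mult ln_powr L_def M_def)
   then have "e = exp ((1 - 3 * al) / (1 + al) * (M + (al - 1) / 2 * L))" using bp by (simp add: e_def powr_def)
   moreover have "E = exp ((1 - 3 * al) / 2 * L - 3 * M)" using h ep by (simp add: E_def power_eq_exp exp_diff powr_def L_def M_def)
   moreover have "(1 - 3 * al) / 2 * L - 3 * M = (4 * ((L - M) / (1 + al)) - 3 * L) + (1 - 3 * al) / (1 + al) * (M + (al - 1) / 2 * L)"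
   proof -
    have "(1 - 3 * x) / 2 * L - 3 * M = (4 * ((L - M) / a) - 3 * L) + (1 - 3 * x) / a * (M + (x - 1) / 2 * L)"
     if "x = a - 1" "a ~= 0" for x a by (simp add: that field_simps)
    from this[of al "1 + al"] show ?thesis using hal by simp
   qed
   ultimately show ?thesis unfolding Pexp by (simp add: exp_add)
  qed
  have r1: "rh powr (1 + al) = h / ep"
   using rh hal h ep by (simp add: powr_def exp_diff L_def M_def)
  have T: "0 < r0 / rh" using r0 rh by simp
  have flat: "integral {0..r0} (flat_integrand h) = P * integral {0..r0 / rh} (above_integrand al)"
  proof -
   have "integral {0..r0} (flat_integrand h) = rh * (rh ^ 3 / h ^ 3) * integral {0..r0 / rh} (above_integrand al)"
   proof (rule integral_stretch[OF integrands_integrable(2) rh(1)])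
    fix s :: real assume "0 <= s"
    then have "h + w (rh * s) = h * (1 + s powr (1 + al))"
     using rh ep by (simp add: w_def powr_mult r1 distrib_left)
    then show "flat_integrand h (rh * s) = rh ^ 3 / h ^ 3 * above_integrand al s"
     by (simp add: flat_integrand_def above_integrand_def power_mult_distrib)
   qed (use h r0 in auto)
   also have "rh * (rh ^ 3 / h ^ 3) = P" by (simp add: P_def power_eq_if)
   finally show ?thesis .
  qed
  define I where "I = integral {0..r0} (lub_integrand h)"
  define J where "J = integral {0..r0} (flat_integrand h)"
  define t where "t = integral {r0 / rh..} (above_integrand al)"
  have "mv = integral {0..r0 / rh} (above_integrand al) + t" unfolding mv(2) t_def
   using half_line_integral(2)[OF above_integrand_integrable(1,2)[OF hal(1) T]] T by simp
  then have PJ: "P * mv = J + P * t" by (simp add: J_def flat distrib_left)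
  have t: "0 <= t" "t <= (r0 / rh) powr (1 - 3 * al) / (3 * al - 1)"
   using above_integrand_integrable(4,5)[OF hal(1) T] by (auto simp: t_def)
  \<comment> \<open>Cutting off at \<open>r0\<close> costs a multiple of \<open>1 / ep ^ 3\<close>,
    in which \<open>h\<close> has cancelled; as \<open>h <= 1\<close> and the exponent of
    \<open>h\<close> in \<open>E\<close> is negative, this is at most a multiple of
    \<open>E\<close>.\<close>
  have Pt: "P * t <= r0 powr (1 - 3 * al) / (3 * al - 1) * E"
  proof -
   have "P * t <= P * ((r0 / rh) powr (1 - 3 * al) / (3 * al - 1))" using t Pp by (intro mult_left_mono) auto
   also have "... = r0 powr (1 - 3 * al) / (3 * al - 1) * (P * rh powr (3 * al - 1))"
   proof -
    have "(r0 / rh) powr (1 - 3 * al) = r0 powr (1 - 3 * al) * rh powr (3 * al - 1)"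
     using r0 rh powr_minus_divide[of rh "1 - 3 * al"] by (simp add: powr_divide)
    then show ?thesis by simp
   qed
   also have "P * rh powr (3 * al - 1) = 1 / ep ^ 3"
   proof -
    have "P * rh powr (3 * al - 1) = exp (4 * ((L - M) / (1 + al)) - 3 * L + (3 * al - 1) * ((L - M) / (1 + al)))"
     using rh by (simp add: Pexp exp_add powr_def)
    also have "4 * ((L - M) / (1 + al)) - 3 * L + (3 * al - 1) * ((L - M) / (1 + al)) = - (3 * M)"
    proof -
     have "4 * ((L - M) / a) - 3 * L + (3 * x - 1) * ((L - M) / a) = - (3 * M)" if "x = a - 1" "a ~= 0" for x a
      by (simp add: that field_simps)
     from this[of al "1 + al"] show ?thesis using hal by simp
    qed
    also have "exp (- (3 * M)) = 1 / ep ^ 3" using ep by (simp add: power_eq_exp M_def exp_minus inverse_eq_divide)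
    finally show ?thesis .
   qed
   also have "r0 powr (1 - 3 * al) / (3 * al - 1) * (1 / ep ^ 3) <= r0 powr (1 - 3 * al) / (3 * al - 1) * E"
   proof (intro mult_left_mono)
    have "1 powr ((1 - 3 * al) / 2) <= h powr ((1 - 3 * al) / 2)" using h hal by (intro powr_mono2') auto
    then show "1 / ep ^ 3 <= E" unfolding E_def using ep by (intro divide_right_mono) auto
   qed (use hal in simp)
   finally show ?thesis .
  qed
  note fl = flat_lub_above[OF h(1,2) r0 hal(1), folded I_def J_def E_def]
  have d: "0 <= P * mv - I" "P * mv - I <= B * E"
   using fl Pt t Pp mult_nonneg_nonneg[of P t] unfolding PJ B_def distrib_right by linarith+
  have "\<bar>6 * pi * I - X\<bar> = 6 * pi * (P * mv - I)"
  proof -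
   have "6 * pi * I - X = - (6 * pi * (P * mv - I))" unfolding X by (simp add: algebra_simps)
   then show ?thesis using d by (simp add: abs_mult)
  qed
  also have "... <= 6 * pi * (B * E)" using d by (intro mult_left_mono) auto
  also have "... = B / mv * e * X" unfolding X E using mv by simp
  also have "... <= B / mv * e * X + B / mv * \<bar>ln h\<bar>" using B mv by simp
  finally have "\<bar>6 * pi * I - X\<bar> <= B / mv * e * X + B / mv * \<bar>ln h\<bar>" .
  moreover have "0 < X" unfolding X using mv Pp by simp
  ultimately have "expansion (B / mv) (6 * pi * I) X e \<bar>ln h\<bar>"
   using B mv by (intro expansionI) (auto simp: e_def)
  then show "expansion (B / mv) (approx_drag al r0 ep h) (6 * pi * mu_above al / (ep powr (4 / (1 + al)) * h powr ((3 * al - 1) / (al + 1))))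
    (beta al ep h powr ((1 - 3 * al) / (1 + al))) \<bar>ln h\<bar>"
   unfolding approx_drag_eq I_def X_def e_def .
 qed simp
qed

section \<open>Large \<open>beta\<close>, critical exponent \<open>1 / 3\<close>\<close>

context tip_profile begin

lemma w_critical: assumes "al = 1 / 3" shows "w r = ep * r powr (4 / 3)"
proof -
 have "1 + al = 4 / 3" using assms by simp
 then show ?thesis by (simp only: w_def)
qed

text \<open>For this exponent \<open>w^2 * w'\<close> is a multiple of \<open>r^3\<close>, so with
  \<open>y = h + w\<close> the integral becomes elementary: that of \<open>(y - h)^2 / y^3\<close>,
  up to the factor \<open>3 / 4 / ep ^ 3\<close>.\<close>

lemma flat_integral_critical:
 assumes al3: "al = 1 / 3" and h: "0 < h" and r0: "0 < r0"
 shows "(flat_integrand h has_integral 3 / 4 / ep ^ 3 * (ln (h + w r0) + 2 * h / (h + w r0) - h^2 / (2 * (h + w r0)^2))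
   - 3 / 4 / ep ^ 3 * (ln (h + w 0) + 2 * h / (h + w 0) - h^2 / (2 * (h + w 0)^2))) {0..r0}"
proof (rule fundamental_theorem_of_calculus_interior)
 have k: "0 < h + w r" for r using h w_pos(1)[of r] by simp
 have kn: "h + w r ~= 0" for r using k[of r] by simp
 have wc: "continuous_on {0..r0} w" by (rule continuous_on_subset[OF continuous_on_w]) auto
 show "continuous_on {0..r0} (%r. 3 / 4 / ep ^ 3 * (ln (h + w r) + 2 * h / (h + w r) - h^2 / (2 * (h + w r)^2)))"
  by (intro continuous_on_mult continuous_on_const continuous_on_diff continuous_on_add continuous_on_ln continuous_on_divide continuous_on_power wc)
   (simp_all add: kn)
 fix r assume "r \<in> {0<..<r0}"
 then have r: "0 < r" by simp
 have dw: "(w has_real_derivative ep * (4 / 3 * r powr (1 / 3))) (at r)"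
  unfolding w_def[abs_def] unfolding al3 using r by (intro DERIV_cmult) (auto intro!: derivative_eq_intros)
 have "((%r. ln (h + w r) + 2 * h / (h + w r) - h^2 / (2 * (h + w r)^2)) has_real_derivative
   (w r)^2 * (ep * (4 / 3 * r powr (1 / 3))) / (h + w r) ^ 3) (at r)"
 proof -
  define p where "p = ep * (4 / 3 * r powr (1 / 3))"
  define y where "y = h + w r"
  have y: "0 < y" "w r = y - h" using k by (auto simp: y_def)
  have d: "((%r. h + w r) has_real_derivative p) (at r)" using DERIV_add[OF DERIV_const dw, of h] by (simp add: p_def)
  have q: "((%y. ln y + 2 * h / y - h^2 / (2 * y^2)) has_real_derivative 1 / y - 2 * h / y^2 + h^2 / y ^ 3) (at y)"
   using y(1) by (auto intro!: derivative_eq_intros simp: power2_eq_square power3_eq_cube)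
  have "(1 / y - 2 * h / y^2 + h^2 / y ^ 3) = (y - h)^2 / y ^ 3"
   using y(1) by (simp add: field_simps power2_eq_square power3_eq_cube)
  then have eq: "(1 / y - 2 * h / y^2 + h^2 / y ^ 3) * p = (w r)^2 * p / y ^ 3" by (simp add: y(2))
  show ?thesis using DERIV_chain2[OF q[unfolded y_def] d] unfolding eq[unfolded y_def] unfolding p_def .
 qed
 from DERIV_cmult[OF this, of "3 / 4 / ep ^ 3"]
 have "((%r. 3 / 4 / ep ^ 3 * (ln (h + w r) + 2 * h / (h + w r) - h^2 / (2 * (h + w r)^2))) has_real_derivative
   3 / 4 / ep ^ 3 * ((w r)^2 * (ep * (4 / 3 * r powr (1 / 3))) / (h + w r) ^ 3)) (at r)" .
 moreover have "3 / 4 / ep ^ 3 * ((w r)^2 * (ep * (4 / 3 * r powr (1 / 3))) / (h + w r) ^ 3) = flat_integrand h r"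
 proof -
  have pw: "(r powr (4 / 3))^2 * r powr (1 / 3) = r ^ 3" using r by (simp add: powr_power powr_add[symmetric])
  have gen: "(ep * x)^2 * (ep * (4 / 3 * y)) = ep ^ 3 * (4 / 3) * (x^2 * y)" for x y
   by (simp add: power2_eq_square power3_eq_cube)
  have "(w r)^2 * (ep * (4 / 3 * r powr (1 / 3))) = ep ^ 3 * (4 / 3) * r ^ 3"
   unfolding w_critical[OF al3] by (rule trans[OF gen]) (simp only: pw)
  then show ?thesis using ep by (simp add: flat_integrand_def)
 qed
 ultimately show "((%r. 3 / 4 / ep ^ 3 * (ln (h + w r) + 2 * h / (h + w r) - h^2 / (2 * (h + w r)^2))) has_vector_derivative flat_integrand h r) (at r)"
  unfolding has_real_derivative_iff_has_vector_derivative[symmetric] by simp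
qed (use r0 in simp)

text \<open>The explicit integral supplies \<open>\<bar>ln h\<bar>\<close> with the factor
  \<open>6 * pi * 3 / 4 = 9 * pi / 2\<close>. In the correction \<open>r^5 / w^3\<close> is a
  multiple of \<open>r\<close>, so it is again the logarithmic integral, bounded in terms of
  \<open>ln ep\<close> alone.\<close>

lemma approx_drag_critical:
 assumes al3: "al = 1 / 3" and h: "0 < h" "h < 1 / 2" and r0: "0 < r0" "r0 <= 1"
 shows "\<bar>approx_drag al r0 ep h - 9 * pi * \<bar>ln h\<bar> / (2 * ep ^ 3)\<bar> <= 6 * pi / ep ^ 3 * (12 + \<bar>ln r0\<bar> + 19 * \<bar>ln ep\<bar>)"
proof -
 define I where "I = integral {0..r0} (lub_integrand h)"
 define J where "J = integral {0..r0} (flat_integrand h)"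
 define l where "l = \<bar>ln ep\<bar>"
 \<comment> \<open>Normalised so that the integrand lies below
   \<open>r / (r^2 / 2 + ep * r powr (1 + al))\<close>, the majorant of
   \<open>integral_le_log\<close>.\<close>
 define D where "D = ep ^ 3 / 3 * (J - I)"
 have e3: "0 < ep ^ 3" using ep by simp
 define f where "f r = ep ^ 3 / 3 * (flat_integrand h r - lub_integrand h r)" for r
 have F: "(f has_integral D) {0..r0}" unfolding f_def[abs_def] D_def I_def J_def
  using h r0 by (intro has_integral_mult_right has_integral_diff integrable_integral integrands_integrable) auto
 note fi = has_integral_integrable[OF F]
 have "D = integral {0..r0} f" by (rule integral_unique[OF F, symmetric])
 also have "... <= 2 / (1 - al) * (ln (1 + ep) + \<bar>ln ep\<bar>)"
 proof (rule integral_le_log[OF r0 fi])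
  fix r assume r: "0 < r" "r < r0"
  define k where "k = r^2 / 2 + ep * r powr (1 + al)"
  have k: "0 < k" "k <= h + gamma_S al ep r" using gamma_ge(1)[of r] r r0 h ep by (auto simp: k_def add_pos_pos)
  have "flat_integrand h r - lub_integrand h r <= 3 * r ^ 5 / ((w r) ^ 3 * k)"
   using integrand_diff(2)[OF h(1) r(1) _ k] r r0 by simp
  also have "(w r) ^ 3 = ep ^ 3 * r ^ 4" using w_cubed[OF r(1)] r by (simp add: al3)
  also have "3 * r ^ 5 / (ep ^ 3 * r ^ 4 * k) = 3 / ep ^ 3 * (r / k)" using r by (simp add: eval_nat_numeral)
  finally have "f r <= ep ^ 3 / 3 * (3 / ep ^ 3 * (r / k))" unfolding f_def using e3 by (intro mult_left_mono) auto
  then show "f r <= r / (r^2 / 2 + ep * r powr (1 + al))" using ep by (simp add: k_def)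
 qed
 also have "... <= 3 * (1 + 2 * l)" using ln_1_plus_le[OF ep] by (simp add: al3 l_def)
 finally have D: "D <= 3 * (1 + 2 * l)" .
 have "0 <= J - I" unfolding I_def J_def
 proof -
  have "0 <= flat_integrand h r - lub_integrand h r" if "r \<in> {0..r0}" for r
   using integrand_diff(1)[of h r "h + gamma_S al ep r"] gamma_ge(3)[of r] that h r0
   by (cases "r = 0") (auto simp: flat_integrand_def lub_integrand_def)
  then have "0 <= integral {0..r0} (%r. flat_integrand h r - lub_integrand h r)"
   using h r0 by (intro integral_nonneg integrable_diff integrands_integrable) auto
  then show "0 <= integral {0..r0} (flat_integrand h) - integral {0..r0} (lub_integrand h)"
   using integrands_integrable[of h 0 r0] h r0 by (simp add: integral_diff)
 qed
 then have D0: "0 <= D" using e3 by (simp add: D_def)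
 define k where "k = h + w r0"
 have k: "0 < k" "h <= k" "w r0 <= k" using h w_pos(1)[of r0] by (auto simp: k_def)
 define E where "E = ln k + 2 * h / k - h^2 / (2 * k^2) - 3 / 2"
 have Jeq: "J = 3 / 4 / ep ^ 3 * (ln k + 2 * h / k - h^2 / (2 * k^2)) - 3 / 4 / ep ^ 3 * (ln h + 3 / 2)"
  using integral_unique[OF flat_integral_critical[OF al3 h(1) r0(1)]] h by (simp add: J_def k_def w_def power2_eq_square)
 have lh: "\<bar>ln h\<bar> = - ln h" using h by simp
 have "c * A - c * (l + 3 / 2) = c * (- l + (A - 3 / 2))" for c A l :: real by (simp add: algebra_simps)
 then have J: "J = 3 / 4 / ep ^ 3 * (\<bar>ln h\<bar> + E)" unfolding E_def lh Jeq .
 have wr: "w r0 <= ep" using powr_le_1[of r0 "1 + al"] r0 al ep mult_left_mono[of "r0 powr (1 + al)" 1 ep] by (simp add: w_def)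
 have "ln k <= ln (1 + ep)" using wr k h by (subst ln_le_cancel_iff) (auto simp: k_def)
 then have lk1: "ln k <= 1 + l" using ln_1_plus_le[OF ep] by (simp add: l_def)
 have "ln (w r0) <= ln k" using k w_pos(2)[OF r0(1)] by (subst ln_le_cancel_iff) auto
 moreover have "ln (w r0) = ln ep + 4 / 3 * ln r0" using ep r0 unfolding w_critical[OF al3] by (simp add: ln_mult ln_powr)
 ultimately have lk2: "- l - 4 / 3 * \<bar>ln r0\<bar> <= ln k" unfolding l_def by argo
 have "2 * h / k <= 2" "0 <= 2 * h / k" using k h by (auto simp: divide_le_eq)
 moreover have "h^2 <= k^2" using k h by (intro power_mono) auto
 then have "h^2 / (2 * k^2) <= 1 / 2" "0 <= h^2 / (2 * k^2)" using k by (auto simp: divide_le_eq)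
 ultimately have E: "\<bar>E\<bar> <= 3 + l + 4 / 3 * \<bar>ln r0\<bar>" using lk1 lk2 unfolding E_def l_def by argo
 have JD: "I = J - 3 / ep ^ 3 * D" using e3 by (simp add: D_def diff_divide_distrib)
 have "approx_drag al r0 ep h - 9 * pi * \<bar>ln h\<bar> / (2 * ep ^ 3) = 6 * pi / ep ^ 3 * (3 / 4 * E - 3 * D)"
  unfolding approx_drag_eq I_def[symmetric] JD J using e3 by (simp add: field_simps)
 then have "\<bar>approx_drag al r0 ep h - 9 * pi * \<bar>ln h\<bar> / (2 * ep ^ 3)\<bar> = 6 * pi / ep ^ 3 * \<bar>3 / 4 * E - 3 * D\<bar>"
  using e3 by (simp add: abs_mult)
 \<comment> \<open>The constants are \<open>9 / 4 + 9 <= 12\<close> and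
   \<open>3 / 4 + 18 <= 19\<close>, from the bounds for \<open>E\<close> and
   \<open>D\<close>.\<close>
 also have "\<bar>3 / 4 * E - 3 * D\<bar> <= 12 + \<bar>ln r0\<bar> + 19 * l" using E D D0 unfolding l_def by argo
 finally show ?thesis using e3 by (simp add: l_def mult_left_mono divide_right_mono)
qed

end

lemma part_c_critical:
 assumes r0: "0 < r0" "r0 <= 1" and de: "0 < de"
 shows "\<exists>C. \<exists>h\<^sub>0>0. \<exists>be\<^sub>0>0. \<forall>ep>0. \<forall>h\<in>{0<..<h\<^sub>0}.
      de <= \<bar>ln ep\<bar> \<and> beta (1 / 3) ep h > be\<^sub>0 -->
      \<bar>approx_drag (1 / 3) r0 ep h - 9 * pi * \<bar>ln h\<bar> / (2 * ep ^ 3)\<bar> <= C * (\<bar>ln ep\<bar> / ep ^ 3)"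
proof (rule exI[of _ "6 * pi * ((12 + \<bar>ln r0\<bar>) / de + 19)"], rule exI[of _ "1 / 2"], intro conjI, simp, rule exI[of _ 1], intro conjI allI ballI impI)
 fix ep h :: real assume ep: "0 < ep" and h: "h \<in> {0<..<1 / 2}" and l: "de <= \<bar>ln ep\<bar> \<and> beta (1 / 3) ep h > 1"
 interpret tip_profile "1 / 3" ep by unfold_locales (use ep in auto)
 have "(12 + \<bar>ln r0\<bar>) * 1 <= (12 + \<bar>ln r0\<bar>) * (\<bar>ln ep\<bar> / de)" using l de by (intro mult_left_mono) auto
 then have "12 + \<bar>ln r0\<bar> + 19 * \<bar>ln ep\<bar> <= ((12 + \<bar>ln r0\<bar>) / de + 19) * \<bar>ln ep\<bar>" by (simp add: distrib_right)
 then have "6 * pi / ep ^ 3 * (12 + \<bar>ln r0\<bar> + 19 * \<bar>ln ep\<bar>) <= 6 * pi / ep ^ 3 * (((12 + \<bar>ln r0\<bar>) / de + 19) * \<bar>ln ep\<bar>)"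
  using ep by (intro mult_left_mono) auto
 also have "... = 6 * pi * ((12 + \<bar>ln r0\<bar>) / de + 19) * (\<bar>ln ep\<bar> / ep ^ 3)" by simp
 finally show "\<bar>approx_drag (1 / 3) r0 ep h - 9 * pi * \<bar>ln h\<bar> / (2 * ep ^ 3)\<bar> <= 6 * pi * ((12 + \<bar>ln r0\<bar>) / de + 19) * (\<bar>ln ep\<bar> / ep ^ 3)"
  using approx_drag_critical[OF refl _ _ r0, of h] h by simp
qed simp

section \<open>Large \<open>beta\<close>, exponent below \<open>1 / 3\<close>\<close>

definition below_integrand :: "real => real => real => real => real" where
 "below_integrand al ep th r = r ^ 3 / ((r^2 / 2 + ep * r powr (1 + al)) ^ 3 * (r^2 / 2 + ep * r powr (1 + al)) powr th)"

lemma below_integrand_borel [measurable]: "below_integrand al ep th \<in> bm"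
 unfolding below_integrand_def[abs_def] by measurable

lemma below_integrand_nonneg: "0 <= r ==> 0 < ep ==> 0 <= below_integrand al ep th r"
 by (simp add: below_integrand_def)

lemma below_integrand_le:
 assumes "0 <= r" "0 < ep" "0 <= th"
 shows "below_integrand al ep th r <= 1 / (ep ^ 3 * ep powr th) * r powr (3 - (1 + al) * (3 + th))"
proof (cases "r = 0")
 case False
 then have r: "0 < r" using assms by simp
 define w where "w = ep * r powr (1 + al)"
 define v where "v = r^2 / 2 + w"
 have w: "0 < w" "w <= v" using r assms by (auto simp: w_def v_def)
 have "below_integrand al ep th r <= r ^ 3 / (w ^ 3 * w powr th)"
  unfolding below_integrand_def w_def[symmetric] v_def[symmetric] using w r assms
  by (intro divide_left_mono mult_mono power_mono powr_mono2 mult_pos_pos) auto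
 also have "w ^ 3 * w powr th = ep ^ 3 * ep powr th * r powr ((1 + al) * (3 + th))"
 proof -
  have "w ^ 3 = ep ^ 3 * r powr ((1 + al) * 3)" using r by (simp add: w_def power_mult_distrib powr_power algebra_simps)
  moreover have "w powr th = ep powr th * r powr ((1 + al) * th)" using r assms by (simp add: w_def powr_mult powr_powr)
  moreover have "r powr ((1 + al) * (3 + th)) = r powr ((1 + al) * 3) * r powr ((1 + al) * th)" by (simp add: distrib_left powr_add)
  ultimately show ?thesis by simp
 qed
 also have "r ^ 3 / (ep ^ 3 * ep powr th * r powr ((1 + al) * (3 + th))) = 1 / (ep ^ 3 * ep powr th) * r powr (3 - (1 + al) * (3 + th))"
  using r powr_diff[of r 3 "(1 + al) * (3 + th)"] by simp
 finally show ?thesis .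
qed (simp add: below_integrand_def)

text \<open>\<open>th\<close> is the extra power of the height in the denominator, paid for
  extracting \<open>h powr th\<close> from the error. The hypothesis on it is integrability at the
  axis, where the term \<open>ep * r powr (1 + al)\<close> governs the height.\<close>

lemma below_integrand_integrable_0:
 assumes "0 < ep" "0 <= th" "(1 + al) * (3 + th) < 4" "0 <= c"
 shows "below_integrand al ep th integrable_on {0..c}"
 by (rule integral_from_0_bound(1)[OF below_integrand_borel, where a = "3 - (1 + al) * (3 + th)" and A = "1 / (ep ^ 3 * ep powr th)"])
  (use assms below_integrand_nonneg below_integrand_le in auto)

lemma below_integrand_tail:
 assumes "0 < r" and "1 <= r \<and> 0 <= th \<or> th = 0" and "0 <= al"
 shows "below_integrand al 1 th r <= 8 * r powr (- 3)"
proof -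
 define m where "m = r^2 / 2 + 1 * r powr (1 + al)"
 have m: "r^2 / 2 <= m" "0 < m" using assms(1) by (auto simp: m_def add_pos_pos)
 have "1 <= m powr th"
 proof (cases "th = 0")
  case False
  then have "1 <= r powr (1 + al)" "0 <= th" using assms by (auto intro: ge_one_powr_ge_zero)
  then have "1 <= m" "0 <= th" using zero_le_power2[of r] by (auto simp: m_def intro: add_increasing)
  then show ?thesis by (rule ge_one_powr_ge_zero)
 qed (use m in simp)
 moreover have "(r^2 / 2) ^ 3 <= m ^ 3" using m by (intro power_mono) auto
 ultimately have "(r^2 / 2) ^ 3 * 1 <= m ^ 3 * m powr th" using m by (intro mult_mono) auto
 then have "below_integrand al 1 th r <= r ^ 3 / ((r^2 / 2) ^ 3 * 1)"
  unfolding below_integrand_def m_def[symmetric] using m assms(1) by (intro divide_left_mono mult_pos_pos) auto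
 also have "... = 8 * r powr (- 3)"
  using assms(1) by (simp add: powr_minus_divide power_divide eval_nat_numeral)
 finally show ?thesis .
qed

lemma below_integrand_integrable:
 assumes "0 <= th" "(1 + al) * (3 + th) < 4" "0 <= al"
 shows "below_integrand al 1 th integrable_on {0..}"
proof -
 have "below_integrand al 1 th integrable_on {1..}"
  by (rule integral_to_inf_bound(1)[OF below_integrand_borel, where a = "- 3" and A = 8])
   (use assms below_integrand_nonneg[of _ 1] below_integrand_tail in auto)
 then show ?thesis using half_line_integral(1)[OF below_integrand_integrable_0[of 1 th al 1]] assms by simp
qed

lemma mu_below_eq:
 assumes "0 <= al" "al < 1 / 3"
 shows "mu_below al = integral {0..} (below_integrand al 1 0)" "0 < mu_below al"
proof -
 have "s ^ 3 / (s^2 / 2 + s powr (1 + al)) ^ 3 = below_integrand al 1 0 s" for s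
  by (cases "s^2 / 2 + s powr (1 + al) = 0") (simp_all add: below_integrand_def)
 then show eq: "mu_below al = integral {0..} (below_integrand al 1 0)" by (simp add: mu_below_def)
 have i: "below_integrand al 1 0 integrable_on {0..}" using assms by (intro below_integrand_integrable) auto
 show "0 < mu_below al" unfolding eq
 proof (rule half_line_integral_pos[OF i])
  show "0 < 1 / (2 + 2 powr (1 + al)) ^ 3" by (auto intro!: divide_pos_pos zero_less_power add_pos_nonneg)
  fix s :: real assume s: "1 <= s" "s <= 2"
  define m where "m = s^2 / 2 + 1 * s powr (1 + al)"
  have "s^2 <= 2^2" using s by (intro power_mono) auto
  moreover have "s powr (1 + al) <= 2 powr (1 + al)" using s assms by (intro powr_mono2) auto
  ultimately have m: "0 < m" "m <= 2 + 2 powr (1 + al)" using s by (auto simp: m_def add_pos_nonneg)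
  then have "m ^ 3 * m powr 0 <= (2 + 2 powr (1 + al)) ^ 3" by (simp add: power_mono)
  moreover have "1 <= s ^ 3" using s by simp
  ultimately show "1 / (2 + 2 powr (1 + al)) ^ 3 <= below_integrand al 1 0 s"
   unfolding below_integrand_def m_def[symmetric] using m s by (intro frac_le) auto
 qed (use below_integrand_nonneg in auto)
qed

context tip_profile begin

text \<open>The exact height \<open>y\<close> exceeds \<open>v\<close> by at most
  \<open>h + r^4 / 2\<close>. For the first summand, \<open>h / y\<close> is at most 1 and hence at
  most its power \<open>th\<close>, after which \<open>y\<close> is replaced by \<open>v\<close>;
  this interpolates between no decay in \<open>h\<close> and divergence at the axis. The quartic
  summand leaves \<open>12 * r / v\<close>, a logarithmic integral.\<close>

lemma below_integrand_diff:
 assumes h: "0 < h" and r: "0 < r" "r <= 1" and th: "0 <= th" "th <= 1"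
 shows "0 <= below_integrand al ep 0 r - lub_integrand h r"
  "below_integrand al ep 0 r - lub_integrand h r
    <= 3 * h powr th * below_integrand al ep th r + 12 * (r / (r^2 / 2 + ep * r powr (1 + al)))"
proof -
 define v where "v = r^2 / 2 + ep * r powr (1 + al)"
 define y where "y = h + gamma_S al ep r"
 have v: "0 < v" "r^2 / 2 <= v" using r ep by (auto simp: v_def add_pos_pos)
 have y: "v <= y" "h <= y" "y - v <= h + r ^ 4 / 2"
  using gamma_ge(1,3)[of r] gamma_upper(2)[of r] r h by (auto simp: v_def y_def w_def)
 have e: "below_integrand al ep 0 r - lub_integrand h r = r ^ 3 * (1 / v ^ 3 - 1 / y ^ 3)"
  using v(1) by (simp add: below_integrand_def lub_integrand_def v_def[symmetric] y_def[symmetric] right_diff_distrib)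
 show "0 <= below_integrand al ep 0 r - lub_integrand h r"
  unfolding e using diff_cubes_le(1)[OF v(1) y(1)] r by (intro mult_nonneg_nonneg) auto
 have hy: "h / y <= h powr th / v powr th"
 proof -
  have "(h / y) powr 1 <= (h / y) powr th" using h y th by (intro powr_mono') auto
  also have "... <= (h / v) powr th" using h y v th by (intro powr_mono2 divide_left_mono mult_pos_pos) auto
  finally show ?thesis using h y v by (simp add: powr_divide)
 qed
 have "(r^2 / 2) ^ 3 <= v ^ 3" using v by (intro power_mono) auto
 then have v3: "r ^ 6 / 8 <= v ^ 3" by (simp add: power_divide flip: power_mult)
 have "r ^ 3 * (1 / v ^ 3 - 1 / y ^ 3) <= r ^ 3 * (3 * (y - v) / (v ^ 3 * y))"
  using diff_cubes_le(2)[OF v(1) y(1)] r by (intro mult_left_mono) auto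
 also have "... <= r ^ 3 * (3 * (h + r ^ 4 / 2) / (v ^ 3 * y))"
  using y v r by (intro mult_left_mono divide_right_mono) auto
 also have "... = 3 * (r ^ 3 / v ^ 3) * (h / y) + 3 / 2 * (r ^ 7 / (v ^ 3 * y))"
 proof -
  have r7: "r ^ 7 = r ^ 3 * r ^ 4" by (simp flip: power_add)
  show ?thesis unfolding r7 by (simp add: add_divide_distrib distrib_left mult_ac)
 qed
 also have "3 * (r ^ 3 / v ^ 3) * (h / y) <= 3 * (r ^ 3 / v ^ 3) * (h powr th / v powr th)"
  using hy r v by (intro mult_left_mono) auto
 also have "... = 3 * h powr th * below_integrand al ep th r" by (simp add: below_integrand_def v_def[symmetric])
 also have "r ^ 7 / (v ^ 3 * y) <= r ^ 7 / (r ^ 6 / 8 * v)"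
  using v3 y v r by (intro divide_left_mono mult_mono mult_pos_pos) auto
 also have "r ^ 7 / (r ^ 6 / 8 * v) = 8 * (r / v)" using r by (simp add: eval_nat_numeral)
 finally show "below_integrand al ep 0 r - lub_integrand h r
    <= 3 * h powr th * below_integrand al ep th r + 12 * (r / (r^2 / 2 + ep * r powr (1 + al)))"
  unfolding e v_def[symmetric] by simp
qed

lemma below_integral_diff:
 assumes h: "0 < h" and r0: "0 < r0" "r0 <= 1" and th: "0 <= th" "th <= 1" "(1 + al) * (3 + th) < 4"
 shows "0 <= integral {0..r0} (below_integrand al ep 0) - integral {0..r0} (lub_integrand h)"
  "integral {0..r0} (below_integrand al ep 0) - integral {0..r0} (lub_integrand h)
    <= 3 * h powr th * integral {0..r0} (below_integrand al ep th) + 24 / (1 - al) * (ln (1 + ep) + \<bar>ln ep\<bar>)"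
proof -
 have "0 <= (1 + al) * th" using al th by simp
 then have "(1 + al) * (3 + 0) < 4" using th(3) unfolding distrib_left by linarith
 then have i: "below_integrand al ep 0 integrable_on {0..r0}" "below_integrand al ep th integrable_on {0..r0}"
  using below_integrand_integrable_0[of ep 0 al r0] below_integrand_integrable_0[of ep th al r0] ep th r0 by auto
 have l: "lub_integrand h integrable_on {0..r0}" using integrands_integrable h r0 by simp
 have "integral {0..r0} (lub_integrand h) <= integral {0..r0} (below_integrand al ep 0)"
 proof (rule integral_le[OF l i(1)])
  show "lub_integrand h r <= below_integrand al ep 0 r" if "r \<in> {0..r0}" for r
   using below_integrand_diff(1)[OF h _ _ th(1,2), of r] that r0 by (cases "r = 0") (auto simp: lub_integrand_def below_integrand_def)
 qed
 then show "0 <= integral {0..r0} (below_integrand al ep 0) - integral {0..r0} (lub_integrand h)" by simp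
 define f where "f r = 1 / 12 * (below_integrand al ep 0 r - lub_integrand h r - 3 * h powr th * below_integrand al ep th r)" for r
 have F: "(f has_integral 1 / 12 * (integral {0..r0} (below_integrand al ep 0) - integral {0..r0} (lub_integrand h)
   - 3 * h powr th * integral {0..r0} (below_integrand al ep th))) {0..r0}"
  unfolding f_def[abs_def] by (intro has_integral_mult_right has_integral_diff integrable_integral i l)
 have "integral {0..r0} f <= 2 / (1 - al) * (ln (1 + ep) + \<bar>ln ep\<bar>)"
 proof (rule integral_le_log[OF r0 has_integral_integrable[OF F]])
  show "f r <= r / (r^2 / 2 + ep * r powr (1 + al))" if "0 < r" "r < r0" for r
  proof -
   have "below_integrand al ep 0 r - lub_integrand h r - 3 * h powr th * below_integrand al ep th r
     <= 12 * (r / (r^2 / 2 + ep * r powr (1 + al)))"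
    using below_integrand_diff(2)[OF h _ _ th(1,2), of r] that r0 by linarith
   then have "f r <= 1 / 12 * (12 * (r / (r^2 / 2 + ep * r powr (1 + al))))" unfolding f_def by (intro mult_left_mono) auto
   then show ?thesis by simp
  qed
 qed
 moreover have "x - T <= 24 / (1 - al) * y" if "1 / 12 * (x - T) <= 2 / (1 - al) * y" for x y T using that by simp
 ultimately have "integral {0..r0} (below_integrand al ep 0) - integral {0..r0} (lub_integrand h)
    - 3 * h powr th * integral {0..r0} (below_integrand al ep th) <= 24 / (1 - al) * (ln (1 + ep) + \<bar>ln ep\<bar>)"
  unfolding integral_unique[OF F] by blast
 then show "integral {0..r0} (below_integrand al ep 0) - integral {0..r0} (lub_integrand h)
    <= 3 * h powr th * integral {0..r0} (below_integrand al ep th) + 24 / (1 - al) * (ln (1 + ep) + \<bar>ln ep\<bar>)"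
  by linarith
qed

text \<open>\<open>rh\<close> is the radius at which the two parts of the height balance,
  \<open>ep * rh powr (1 + al) = rh^2\<close>; scaling by it reduces the coefficient
  \<open>ep\<close> to 1.\<close>

lemma below_integral_stretch:
 assumes r0: "0 < r0" and th: "0 <= th" "(1 + al) * (3 + th) < 4" and rh: "rh = ep powr (1 / (1 - al))"
 shows "integral {0..r0} (below_integrand al ep th) = 1 / (rh^2 * (rh^2) powr th) * integral {0..r0 / rh} (below_integrand al 1 th)"
proof -
 have p: "0 < rh" using ep by (simp add: rh)
 have er: "ep * rh powr (1 + al) = rh^2"
 proof -
  have "ep = rh powr (1 - al)" using ep al by (simp add: rh powr_powr)
  moreover have "rh powr (1 - al) * rh powr (1 + al) = rh powr 2" by (simp only: powr_add[symmetric]) simp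
  ultimately have "ep * rh powr (1 + al) = rh powr 2" by metis
  then show ?thesis using p by simp
 qed
 have "integral {0..r0} (below_integrand al ep th) = rh * (rh ^ 3 / (rh ^ 6 * (rh^2) powr th)) * integral {0..r0 / rh} (below_integrand al 1 th)"
 proof (rule integral_stretch[OF _ p])
  show "below_integrand al ep th integrable_on {0..r0}" using below_integrand_integrable_0 ep th r0 by simp
  fix s :: real assume s: "0 <= s"
  define m where "m = s^2 / 2 + 1 * s powr (1 + al)"
  have m: "0 <= m" by (simp add: m_def)
  have "ep * (rh * s) powr (1 + al) = rh^2 * s powr (1 + al)" using s p by (simp add: powr_mult er[symmetric])
  then have v: "(rh * s)^2 / 2 + ep * (rh * s) powr (1 + al) = rh^2 * m" by (simp add: m_def power_mult_distrib distrib_left)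
  show "below_integrand al ep th (rh * s) = rh ^ 3 / (rh ^ 6 * (rh^2) powr th) * below_integrand al 1 th s"
   unfolding below_integrand_def v m_def[symmetric] using m p by (simp add: power_mult_distrib powr_mult flip: power_mult)
 qed
 also have "rh * (rh ^ 3 / (rh ^ 6 * (rh^2) powr th)) = 1 / (rh^2 * (rh^2) powr th)" using p by (simp add: eval_nat_numeral)
 finally show ?thesis .
qed

end

lemma part_c_below:
 assumes hal: "0 <= al" "al < 1 / 3" and r0: "0 < r0" "r0 <= 1" and de: "0 < de"
 shows "\<exists>C. \<exists>h\<^sub>0>0. \<exists>be\<^sub>0>0. \<forall>ep>0. \<forall>h\<in>{0<..<h\<^sub>0}.
      de <= \<bar>ln ep\<bar> \<and> beta al ep h > be\<^sub>0 -->
      expansion C (approx_drag al r0 ep h)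
       (6 * pi * mu_below al / ep powr (2 / (1 - al)))
       (beta al ep h powr ((3 * al - 1) / (1 + al))) \<bar>ln ep\<bar>"
proof -
 \<comment> \<open>The factor \<open>(h / v)\<^bsup>th\<^esup>\<close> leaves the scaled integral convergent at \<open>0\<close> and turns into the stated power of \<open>beta\<close>.\<close>
 define q where "q = (1 - 3 * al) / (2 * (1 + al))"
 define th where "th = (1 - al) * q"
 have q: "0 < q" "q <= 1" "(1 + al) * q = (1 - 3 * al) / 2" "(3 * al - 1) / (1 + al) = - (2 * q)"
  using hal by (auto simp: q_def field_simps)
 have "(1 - al) * q <= 1 * 1" using hal q by (intro mult_mono) auto
 then have th: "0 <= th" "th <= 1" using hal q by (auto simp: th_def)
 have "(1 + al) * th = (1 - al) * ((1 - 3 * al) / 2)" unfolding th_def q(3)[symmetric] by simp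
 also have "... <= 1 * ((1 - 3 * al) / 2)" using hal by (intro mult_right_mono) auto
 finally have th4: "(1 + al) * (3 + th) < 4" using hal unfolding distrib_left by simp
 define Kt where "Kt = integral {0..} (below_integrand al 1 th)"
 have Kt: "0 <= Kt" unfolding Kt_def using hal th th4
  by (intro integral_nonneg below_integrand_integrable below_integrand_nonneg) auto
 define mv where "mv = mu_below al"
 have mv: "0 < mv" "mv = integral {0..} (below_integrand al 1 0)" using mu_below_eq[OF hal] by (auto simp: mv_def)
 define C1 where "C1 = 3 * Kt / mv"
 define C2 where "C2 = 6 * pi * (24 / (1 - al) * (1 / de + 2) + 4 / r0^2 / de)"
 have C: "0 <= C1" "0 <= C2" using Kt mv hal de by (auto simp: C1_def C2_def)
 show ?thesis
 proof (rule exI[of _ "C1 + C2"], rule exI[of _ 1], intro conjI, simp, rule exI[of _ 1], intro conjI allI ballI impI)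
  fix ep h :: real assume hep: "0 < ep" and hh: "h \<in> {0<..<1}" and H: "de <= \<bar>ln ep\<bar> \<and> beta al ep h > 1"
  interpret tip_profile al ep by unfold_locales (use hal hep in auto)
  have h: "0 < h" using hh by simp
  define rh where "rh = ep powr (1 / (1 - al))"
  have rh: "0 < rh" "ln rh = ln ep / (1 - al)" using hep by (auto simp: rh_def ln_powr)
  define P where "P = 1 / rh^2"
  have P: "0 < P" using rh by (simp add: P_def)
  define X where "X = 6 * pi * mu_below al / ep powr (2 / (1 - al))"
  define e where "e = beta al ep h powr ((3 * al - 1) / (1 + al))"
  have X: "X = 6 * pi * mv * P"
  proof -
   have "rh^2 = ep powr (2 / (1 - al))" using hep by (simp add: rh_def powr_power)
   then show ?thesis by (simp add: X_def mv_def P_def)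
  qed
  have e: "h powr th / (rh^2) powr th = e"
  proof -
   have bp: "0 < beta al ep h" using h hep by (simp add: beta_def)
   have "ln (beta al ep h) = ln ep + (al - 1) / 2 * ln h" using h hep by (simp add: beta_def ln_mult ln_powr)
   then have "e = exp (- (2 * q) * (ln ep + (al - 1) / 2 * ln h))" using bp by (simp add: e_def powr_def q(4))
   moreover have "h powr th / (rh^2) powr th = exp (th * ln h - th * (2 * ln rh))"
    using h rh(1) by (simp add: powr_def exp_diff ln_realpow)
   moreover have "th * ln h - th * (2 * ln rh) = - (2 * q) * (ln ep + (al - 1) / 2 * ln h)"
    unfolding th_def rh(2) using hal by (simp add: field_simps)
   ultimately show ?thesis by simp
  qed
  define I where "I = integral {0..r0} (lub_integrand h)"
  define V where "V = integral {0..r0} (below_integrand al ep 0)"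
  define t where "t = integral {r0 / rh..} (below_integrand al 1 0)"
  define l where "l = \<bar>ln ep\<bar>"
  have T: "0 < r0 / rh" using r0 rh by simp
  have tail: "below_integrand al 1 0 integrable_on {r0 / rh..}" "t <= 8 * (- ((r0 / rh) powr (- 3 + 1)) / (- 3 + 1))" "0 <= t"
   using integral_to_inf_bound[OF below_integrand_borel, of "- 3" "r0 / rh" al 1 0 8] T hal below_integrand_nonneg[of _ 1 al 0] below_integrand_tail[of _ 0 al]
   unfolding t_def by auto
  have i0: "below_integrand al 1 0 integrable_on {0..r0 / rh}" using below_integrand_integrable_0[of 1 0 al "r0 / rh"] hal T by simp
  have "mv = integral {0..r0 / rh} (below_integrand al 1 0) + t"
   unfolding mv(2) t_def using half_line_integral(2)[OF i0 tail(1)] T by simp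
  moreover have "V = P * integral {0..r0 / rh} (below_integrand al 1 0)"
   using below_integral_stretch[OF r0(1), of 0 rh] hal rh by (simp add: V_def P_def rh_def)
  ultimately have PV: "P * mv = V + P * t" by (simp add: distrib_left)
  \<comment> \<open>The tail of the scaled integral beyond \<open>r0 / rh\<close> is of order
    \<open>rh^2\<close>, which \<open>P\<close> cancels: truncation at \<open>r0\<close> costs a
    constant for every \<open>ep\<close>.\<close>
  have "(r0 / rh) powr (- 2) = rh^2 / r0^2" using r0 rh by (simp add: powr_minus_divide power_divide)
  then have "P * t <= P * (4 * (rh^2 / r0^2))" using tail(2) P by (intro mult_left_mono) auto
  then have Pt: "P * t <= 4 / r0^2" using rh by (simp add: P_def)
  have Pt0: "0 <= P * t" using P tail(3) by simp
  have W: "h powr th * integral {0..r0} (below_integrand al ep th) <= P * e * Kt"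
  proof -
   have "integral {0..r0 / rh} (below_integrand al 1 th) <= Kt" unfolding Kt_def
    using hal th th4 T by (intro integral_subset_le below_integrand_integrable below_integrand_integrable_0) (auto intro: below_integrand_nonneg)
   then have "P * e * integral {0..r0 / rh} (below_integrand al 1 th) <= P * e * Kt"
    using P by (intro mult_left_mono) (auto simp: e_def)
   moreover have "h powr th * integral {0..r0} (below_integrand al ep th) = P * e * integral {0..r0 / rh} (below_integrand al 1 th)"
    unfolding below_integral_stretch[OF r0(1) th(1) th4 rh_def] e[symmetric] P_def by simp
   ultimately show ?thesis by simp
  qed
  note bd = below_integral_diff[OF h r0 th th4, folded I_def V_def]
  have lg: "24 / (1 - al) * (ln (1 + ep) + \<bar>ln ep\<bar>) <= 24 / (1 - al) * (1 + 2 * l)"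
   using ln_1_plus_le[OF hep] hal by (intro mult_left_mono) (auto simp: l_def)
  have d0: "0 <= P * mv - I" using bd(1) Pt0 unfolding PV by linarith
  have "3 * (h powr th * integral {0..r0} (below_integrand al ep th)) = 3 * h powr th * integral {0..r0} (below_integrand al ep th)" by simp
  then have d1: "P * mv - I <= 3 * (P * e * Kt) + (24 / (1 - al) * (1 + 2 * l) + 4 / r0^2)"
   using bd(2) W lg Pt unfolding PV by linarith
  have "\<bar>6 * pi * I - X\<bar> = 6 * pi * (P * mv - I)"
  proof -
   have "6 * pi * I - X = - (6 * pi * (P * mv - I))" unfolding X by (simp add: algebra_simps)
   then show ?thesis using d0 by (simp add: abs_mult)
  qed
  also have "... <= 6 * pi * (3 * (P * e * Kt) + (24 / (1 - al) * (1 + 2 * l) + 4 / r0^2))" using d1 by (intro mult_left_mono) auto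
  also have "... = C1 * e * X + 6 * pi * (24 / (1 - al) * (1 + 2 * l) + 4 / r0^2)"
   unfolding X C1_def distrib_left using mv by simp
  also have "6 * pi * (24 / (1 - al) * (1 + 2 * l) + 4 / r0^2) <= C2 * l"
  proof -
   have l1: "1 <= l / de" using H de by (simp add: l_def)
   have "24 / (1 - al) * (1 + 2 * l) <= 24 / (1 - al) * (l / de + 2 * l)" using l1 hal by (intro mult_left_mono) auto
   moreover have "4 / r0^2 * 1 <= 4 / r0^2 * (l / de)" using l1 by (intro mult_left_mono) auto
   ultimately have "24 / (1 - al) * (1 + 2 * l) + 4 / r0^2 <= 24 / (1 - al) * (l / de + 2 * l) + 4 / r0^2 * (l / de)" by linarith
   also have "... = (24 / (1 - al) * (1 / de + 2) + 4 / r0^2 / de) * l"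
    unfolding distrib_left distrib_right by simp
   finally have "6 * pi * (24 / (1 - al) * (1 + 2 * l) + 4 / r0^2) <= 6 * pi * ((24 / (1 - al) * (1 / de + 2) + 4 / r0^2 / de) * l)" by (intro mult_left_mono) auto
   then show ?thesis by (simp only: C2_def mult.assoc)
  qed
  finally have A: "\<bar>6 * pi * I - X\<bar> <= C1 * e * X + C2 * l" by simp
  have Xp: "0 < X" unfolding X using mv P by simp
  have e0: "0 <= e" "0 <= l" by (simp_all add: e_def l_def)
  have "C1 * e * X <= (C1 + C2) * e * X" "C2 * l <= (C1 + C2) * l" using C e0 Xp by (auto intro!: mult_right_mono)
  then have "\<bar>6 * pi * I - X\<bar> <= (C1 + C2) * e * X + (C1 + C2) * l" using A by linarith
  then have "expansion (C1 + C2) (6 * pi * I) X e l" using C e0 by (intro expansionI[OF Xp]) auto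
  then show "expansion (C1 + C2) (approx_drag al r0 ep h) (6 * pi * mu_below al / ep powr (2 / (1 - al)))
       (beta al ep h powr ((3 * al - 1) / (1 + al))) \<bar>ln ep\<bar>"
   unfolding approx_drag_eq I_def X_def e_def l_def .
 qed simp
qed

text \<open>The height is at least \<open>w\<close>, and \<open>r^3 / w^3\<close> is a multiple of
  \<open>r powr (- 3 * al)\<close>, integrable at the axis exactly because
  \<open>al < 1 / 3\<close>; a lower bound on \<open>ep\<close> controls the coefficient.\<close>

lemma part_c_bounded:
 assumes hal: "0 <= al" "al < 1 / 3" and r0: "0 < r0" "r0 <= 1" and ep1: "0 < ep1"
 shows "\<exists>C. \<exists>h\<^sub>0>0. \<forall>ep\<ge>ep1. \<forall>h\<in>{0<..<h\<^sub>0}. \<bar>approx_drag al r0 ep h\<bar> <= C"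
proof (rule exI[of _ "6 * pi * (1 / ep1 ^ 3 * (r0 powr (- 3 * al + 1) / (- 3 * al + 1)))"], rule exI[of _ 1], intro conjI allI impI ballI)
 fix ep h :: real assume hep: "ep1 <= ep" and hh: "h \<in> {0<..<1}"
 interpret tip_profile al ep by unfold_locales (use hal hep ep1 in auto)
 have [measurable]: "lub_integrand h \<in> bm" unfolding lub_integrand_def[abs_def] by measurable
 have b: "0 <= lub_integrand h r \<and> lub_integrand h r <= 1 / ep1 ^ 3 * r powr (- 3 * al)" if "0 <= r" "r <= r0" for r
 proof (cases "r = 0")
  case False
  then have r: "0 < r" using that by simp
  have "r^2 / 2 + w r <= gamma_S al ep r" "0 < h" using gamma_lower[of r] that r0 hh by auto
  then have w: "0 < w r" "w r <= h + gamma_S al ep r"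
   using w_pos(2)[OF r] zero_le_power2[of r] by linarith+
  have "lub_integrand h r <= r ^ 3 / (w r) ^ 3" unfolding lub_integrand_def
   using w r by (intro divide_left_mono power_mono mult_pos_pos zero_less_power) auto
  also have "... = 1 / ep ^ 3 * r powr (- 3 * al)" using r powr_diff[of r 3 "3 + 3 * al"] by (simp add: w_cubed)
  also have "... <= 1 / ep1 ^ 3 * r powr (- 3 * al)" using hep ep1 by (intro mult_right_mono divide_left_mono power_mono mult_pos_pos zero_less_power) auto
  finally show ?thesis using w r by (simp add: lub_integrand_def)
 qed (simp add: lub_integrand_def)
 have m: "lub_integrand h \<in> bm" by measurable
 have i: "integral {0..r0} (lub_integrand h) <= 1 / ep1 ^ 3 * (r0 powr (- 3 * al + 1) / (- 3 * al + 1))" "lub_integrand h integrable_on {0..r0}"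
  using integral_from_0_bound[OF m, of "- 3 * al" r0 "1 / ep1 ^ 3"] b hal r0 by auto
 have "0 <= integral {0..r0} (lub_integrand h)" using b by (intro integral_nonneg i) auto
 then have n: "0 <= 6 * pi * integral {0..r0} (lub_integrand h)" by simp
 show "\<bar>approx_drag al r0 ep h\<bar> <= 6 * pi * (1 / ep1 ^ 3 * (r0 powr (- 3 * al + 1) / (- 3 * al + 1)))"
  unfolding approx_drag_eq abs_of_nonneg[OF n] by (rule mult_left_mono[OF i(1)]) simp
qed simp

section \<open>The theorem\<close>

theorem mainTheorem1:
  fixes \<alpha> r\<^sub>0 \<epsilon>\<^sub>m :: real and S :: "real \<Rightarrow> (real^3) set"
  assumes "0 \<le> \<alpha>" and "\<alpha> < 1" and "0 < r\<^sub>0" and "r\<^sub>0 \<le> 1" and "0 < \<epsilon>\<^sub>m"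
    and "solid_family \<alpha> r\<^sub>0 \<epsilon>\<^sub>m S"
  shows
    \<comment> \<open>(a)\<close>
    "(\<exists>h\<^sub>0>0. \<forall>\<epsilon>\<in>{0<..\<epsilon>\<^sub>m}. \<forall>h\<in>{0<..<h\<^sub>0}. \<forall>F. is_normalized_drag (S \<epsilon>) h F \<longrightarrow>
        approx_drag \<alpha> r\<^sub>0 \<epsilon> h \<le> F) \<and>
     (\<forall>\<delta>>0. \<exists>C. \<exists>h\<^sub>0>0. \<forall>\<epsilon>\<in>{0<..\<epsilon>\<^sub>m}. \<forall>h\<in>{0<..<h\<^sub>0}. \<forall>F.
        \<delta> \<le> \<bar>ln \<epsilon>\<bar> \<and> is_normalized_drag (S \<epsilon>) h F \<longrightarrow>
        \<bar>F - approx_drag \<alpha> r\<^sub>0 \<epsilon> h\<bar> \<le> C * min \<bar>ln \<epsilon>\<bar> \<bar>ln h\<bar>) \<and>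
     \<comment> \<open>(b)\<close>
     (\<exists>C. \<exists>h\<^sub>0>0. \<exists>\<beta>\<^sub>0>0. \<forall>\<epsilon>>0. \<forall>h\<in>{0<..<h\<^sub>0}. beta \<alpha> \<epsilon> h < \<beta>\<^sub>0 \<longrightarrow>
        expansion C (approx_drag \<alpha> r\<^sub>0 \<epsilon> h)
          (6 * pi / (h + lambda_coeff \<alpha> * \<epsilon> * h powr ((\<alpha> + 1) / 2)))
          (beta \<alpha> \<epsilon> h) \<bar>ln h\<bar>) \<and>
     \<comment> \<open>(c)\<close>
     (\<alpha> > 1/3 \<longrightarrow>
        (\<exists>C. \<exists>h\<^sub>0>0. \<exists>\<beta>\<^sub>0>0. \<forall>\<epsilon>>0. \<forall>h\<in>{0<..<h\<^sub>0}. beta \<alpha> \<epsilon> h > \<beta>\<^sub>0 \<longrightarrow>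
           expansion C (approx_drag \<alpha> r\<^sub>0 \<epsilon> h)
             (6 * pi * mu_above \<alpha> /
                (\<epsilon> powr (4 / (1 + \<alpha>)) * h powr ((3 * \<alpha> - 1) / (\<alpha> + 1))))
             (beta \<alpha> \<epsilon> h powr ((1 - 3 * \<alpha>) / (1 + \<alpha>))) \<bar>ln h\<bar>)) \<and>
     (\<alpha> = 1/3 \<longrightarrow>
        (\<forall>\<delta>>0. \<exists>C. \<exists>h\<^sub>0>0. \<exists>\<beta>\<^sub>0>0. \<forall>\<epsilon>>0. \<forall>h\<in>{0<..<h\<^sub>0}.
           \<delta> \<le> \<bar>ln \<epsilon>\<bar> \<and> beta \<alpha> \<epsilon> h > \<beta>\<^sub>0 \<longrightarrow>
           \<bar>approx_drag \<alpha> r\<^sub>0 \<epsilon> h - 9 * pi * \<bar>ln h\<bar> / (2 * \<epsilon> ^ 3)\<bar> \<le> C * (\<bar>ln \<epsilon>\<bar> / \<epsilon> ^ 3))) \<and>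
     (\<alpha> < 1/3 \<longrightarrow>
        (\<forall>\<delta>>0. \<exists>C. \<exists>h\<^sub>0>0. \<exists>\<beta>\<^sub>0>0. \<forall>\<epsilon>>0. \<forall>h\<in>{0<..<h\<^sub>0}.
           \<delta> \<le> \<bar>ln \<epsilon>\<bar> \<and> beta \<alpha> \<epsilon> h > \<beta>\<^sub>0 \<longrightarrow>
           expansion C (approx_drag \<alpha> r\<^sub>0 \<epsilon> h)
             (6 * pi * mu_below \<alpha> / \<epsilon> powr (2 / (1 - \<alpha>)))
             (beta \<alpha> \<epsilon> h powr ((3 * \<alpha> - 1) / (1 + \<alpha>))) \<bar>ln \<epsilon>\<bar>) \<and>
        (\<forall>\<epsilon>\<^sub>1>0. \<exists>C. \<exists>h\<^sub>0>0. \<forall>\<epsilon>\<ge>\<epsilon>\<^sub>1. \<forall>h\<in>{0<..<h\<^sub>0}. \<bar>approx_drag \<alpha> r\<^sub>0 \<epsilon> h\<bar> \<le> C))"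
proof (intro conjI impI, goal_cases)
  case 1
  show ?case using solid_family_lower[OF assms(1-4,6)] by (intro exI[of _ 1]) auto
next
  case 2
  show ?case using part_a[OF assms(1-4,6,5)] by blast
next
  case 3
  show ?case by (rule part_b[OF assms(1-4)])
next
  case 4
  then show ?case using part_c_above[of \<alpha> r\<^sub>0] assms by simp
next
  case 5
  show ?case unfolding 5 using part_c_critical[OF assms(3,4)] by blast
next
  case 6
  then show ?case using part_c_below[of \<alpha> r\<^sub>0] assms by simp
next
  case 7
  then show ?case using part_c_bounded[of \<alpha> r\<^sub>0] assms by simp
qed

end
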